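(* Let $n\ge 1$ and $k>0$, and put $\mu_0=k(n-1)$. For $\mu\in\mathbb C$ let $R_\mu\in\mathcal S'(\mathbb R^n)$ be the type $A_{n-1}$ Riesz distribution (defined in the context). Then: (1) If $R_\mu$ is a complex (Radon) measure, then either $\mathrm{Re}\,\mu>\mu_0=k(n-1)$, or $\mu$ belongs to the finite set $[0,\infty[\,\cap\,\bigl(\{0,k,\ldots,k(n-1)\}-\mathbb N_0\bigr)$. (2) $R_\mu$ is a positive measure if and only if $\mu$ belongs to the generalized Wallach set $W_k=\{0,k,\ldots,k(n-1)\}\cup\,]k(n-1),\infty[$.
   Context: For $x,y\in\mathbb C^n$ write $\langle x,y\rangle=\sum_i x_iy_i$. The Dunkl operators of type $A_{n-1}$ with multiplicity $k$ are $T_i(k)=\frac{\partial}{\partial x_i}+k\sum_{j\ne i}\frac{1}{x_i-x_j}(1-\sigma_{ij})$, $i=1,\dots,n$, where $\sigma_{ij}$ acts on functions by exchanging the coordinates $x_i,x_j$; they commute, and $D(T(k)):=\prod_{i=1}^nT_i(k)$. They act on tempered distributions by $\langle T_i(k)u,\varphi\rangle=-\langle u,T_i(k)\varphi\rangle$. Let $\omega_k(x)=\prod_{1\le i<j\le n}|x_i-x_j|^{2k}$, $D(x)=\prod_{i=1}^n x_i$, $\mathbb R_+=]0,\infty[$, $d_n(k)=\prod_{j=1}^n\frac{\Gamma(1+jk)}{\Gamma(1+k)}$, and $\Gamma_n(\mu;k)=\prod_{j=1}^n\Gamma(\mu-k(j-1))$. For $\mathrm{Re}\,\mu>\mu_0$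 the Riesz measure is $\langle R_\mu,\varphi\rangle=\frac{1}{d_n(k)\Gamma_n(\mu;k)}\int_{\mathbb R_+^n}\varphi(x)D(x)^{\mu-\mu_0-1}\omega_k(x)\,dx$. The map $\mu\mapsto R_\mu$ from $\{\mathrm{Re}\,\mu>\mu_0\}$ to $\mathcal S'(\mathbb R^n)$ extends uniquely to a holomorphic $\mathcal S'(\mathbb R^n)$-valued map on $\mathbb C$ (satisfying $D(T(k))R_\mu=R_{\mu-1}$); $R_\mu$ for general $\mu\in\mathbb C$ denotes this extension. *)

theory Defs
  imports "HOL-Analysis.Analysis"
begin

text \<open>Points of R^n are vectors of type real^'n, with n = CARD('n) (so n >= 1 automatically).\<close>

definition pdiff :: "'n::finite \<Rightarrow> (real^'n \<Rightarrow> complex) \<Rightarrow> real^'n \<Rightarrow> complex" where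
  "pdiff i f x = vector_derivative (\<lambda>t. f (x + t *\<^sub>R axis i 1)) (at 0)"

fun pdiffs :: "'n::finite list \<Rightarrow> (real^'n \<Rightarrow> complex) \<Rightarrow> real^'n \<Rightarrow> complex" where
  "pdiffs [] f = f"
| "pdiffs (i # is) f = pdiff i (pdiffs is f)"

definition smooth_fun :: "(real^'n::finite \<Rightarrow> complex) \<Rightarrow> bool" where
  "smooth_fun f \<longleftrightarrow>
     (\<forall>is. continuous_on UNIV (pdiffs is f) \<and>
           (\<forall>i x. (\<lambda>t. pdiffs is f (x + t *\<^sub>R axis i 1)) differentiable (at (0::real))))"

definition test_function :: "(real^'n::finite \<Rightarrow> complex) \<Rightarrow> bool" where
  "test_function \<phi> \<longleftrightarrow> smooth_fun \<phi> \<and> (\<exists>K. compact K \<and> (\<forall>x. x \<notin> K \<longrightarrow> \<phi> x = 0))"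

definition mu0 :: "nat \<Rightarrow> real \<Rightarrow> real" where
  "mu0 n k = k * (real n - 1)"

definition omega_k :: "real \<Rightarrow> real^'n::finite \<Rightarrow> real" where
  "omega_k k x = (\<Prod>i\<in>UNIV. \<Prod>j\<in>UNIV - {i}. \<bar>x $ i - x $ j\<bar> powr k)"
  \<comment> \<open>= product over i<j of |x_i - x_j|^(2k)\<close>

definition Dprod :: "real^'n::finite \<Rightarrow> real" where
  "Dprod x = (\<Prod>i\<in>UNIV. x $ i)"

definition d_n :: "nat \<Rightarrow> real \<Rightarrow> real" where
  "d_n n k = (\<Prod>j=1..n. Gamma (1 + real j * k) / Gamma (1 + k))"

definition Gamma_n :: "nat \<Rightarrow> complex \<Rightarrow> real \<Rightarrow> complex" where
  "Gamma_n n \<mu> k = (\<Prod>j=1..n. Gamma (\<mu> - complex_of_real (k * (real j - 1))))"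

definition positive_orthant :: "(real^'n::finite) set" where
  "positive_orthant = {x. \<forall>i. 0 < x $ i}"

definition riesz_integral :: "real \<Rightarrow> complex \<Rightarrow> (real^'n::finite \<Rightarrow> complex) \<Rightarrow> complex" where
  "riesz_integral k \<mu> \<phi> =
     (1 / (complex_of_real (d_n CARD('n) k) * Gamma_n CARD('n) \<mu> k)) *
     (LINT x:positive_orthant|lborel.
        \<phi> x * complex_of_real (Dprod x) powr (\<mu> - complex_of_real (mu0 CARD('n) k) - 1)
            * complex_of_real (omega_k k x))"

definition riesz :: "real \<Rightarrow> complex \<Rightarrow> (real^'n::finite \<Rightarrow> complex) \<Rightarrow> complex" where
  "riesz k \<mu> \<phi> =
     (THE g. g holomorphic_on UNIV \<and>
        (\<forall>\<nu>. mu0 CARD('n) k < Re \<nu> \<longrightarrow> g \<nu> = riesz_integral k \<nu> \<phi>)) \<mu>"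

text \<open>A distribution is a complex Radon measure: there is a locally finite Borel measure M
  (the total variation) and a Borel density h with |h| = 1 (polar decomposition) representing it.\<close>
definition is_complex_measure_dist :: "((real^'n::finite \<Rightarrow> complex) \<Rightarrow> complex) \<Rightarrow> bool" where
  "is_complex_measure_dist u \<longleftrightarrow>
     (\<exists>(M :: (real^'n) measure) (h :: real^'n \<Rightarrow> complex).
        sets M = sets borel \<and> (\<forall>K. compact K \<longrightarrow> emeasure M K < \<infinity>) \<and>
        h \<in> borel_measurable M \<and> (\<forall>x. cmod (h x) = 1) \<and>
        (\<forall>\<phi>. test_function \<phi> \<longrightarrow>
            integrable M (\<lambda>x. \<phi> x * h x) \<and> u \<phi> = (\<integral>x. \<phi> x * h x \<partial>M)))"

definition is_positive_measure_dist :: "((real^'n::finite \<Rightarrow> complex) \<Rightarrow> complex) \<Rightarrow> bool" where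
  "is_positive_measure_dist u \<longleftrightarrow>
     (\<exists>M :: (real^'n) measure.
        sets M = sets borel \<and> (\<forall>K. compact K \<longrightarrow> emeasure M K < \<infinity>) \<and>
        (\<forall>\<phi>. test_function \<phi> \<longrightarrow> integrable M \<phi> \<and> u \<phi> = (\<integral>x. \<phi> x \<partial>M)))"

definition exceptional_set :: "nat \<Rightarrow> real \<Rightarrow> real set" where
  "exceptional_set n k = {t. 0 \<le> t \<and> (\<exists>j<n. \<exists>m::nat. t = k * real j - real m)}"

definition wallach_set :: "nat \<Rightarrow> real \<Rightarrow> real set" where
  "wallach_set n k = {k * real j | j. j < n} \<union> {t. k * (real n - 1) < t}"

end

theory Submission
  imports Defs "HOL-Complex_Analysis.Complex_Analysis"
begin

text \<open>Integration by parts shows that the Riesz distribution with parameter \<open>\<mu>\<close> satisfies, for every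
  coordinate \<open>i\<close>, the equation
  \<open>\<mu> R f + R (x_i \<partial>_i f + k \<Sum>\<^bsub>j\<noteq>i\<^esub> x_j (f - f \<circ> \<sigma>_ij) / (x_i - x_j)) = 0\<close>.
  On suitable functions it implies \<open>D(T(k)) R_\<mu> = R_(\<mu>-1)\<close>, which gives the analytic continuation,
  and evaluated on functions of \<open>x_1 + \<dots> + x_n\<close> it gives explicit nonzero values.

  Necessity: a distribution with this homogeneity that is a measure cannot have negative real order,
  and testing against bumps accumulating at the boundary of the orthant excludes every \<open>\<mu>\<close> at which the
  factor \<open>1 / \<Gamma>_n(\<mu>; k)\<close> is nonzero. A positive measure gives nonnegative values to all monomials
  times completely monotone radial functions; these values carry the factors \<open>\<mu> - k j\<close>, whose signs
  exclude the exceptional points outside the Wallach set.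

  Sufficiency: for \<open>\<mu> = k r\<close> with \<open>r < n\<close> the sum over the \<open>r\<close>-dimensional faces of the orthant of a
  product density satisfies the same equation. The equation determines a functional on polynomials times
  radial cut-offs up to a scalar, because there it reduces to an Euler equation on the half line, and
  these functions are dense by Landau kernels. So the Riesz distribution is a positive multiple of that sum.\<close>

text \<open>The functions tested against are smooth and vanish on the part of the closed orthant
  where \<open>p1\<close> is large. The functionals see only the orthant, and the class contains
  cut-offs depending on \<open>p1\<close> alone, which for n >= 2 have no compact support.

  Every derivative and difference quotient in the equation is preceded by a coordinate. This
  suppresses boundary terms in the integration by parts and preserves the degree of polynomials, so
  that uniqueness becomes an induction on the degree.

  The weight |x_i - x_j|^(2k) need not be differentiable for small k. The equation is therefore
  proved for a smoothed weight and large exponents; a limit and analytic continuation give the rest.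
  Difference quotients are written as integrals of derivatives over a segment, which keeps them
  smooth across x_i = x_j.

  Positive values at parameters far from convergence come from iterated primitives of a bump: on
  functions of \<open>p1\<close> the operator D(T(k)) is an n-fold derivative, so replacing a
  cut-off by its n-fold primitive lowers the parameter by one without changing the value.\<close>

section \<open>Smooth functions of one variable\<close>

fun C1 :: "nat \<Rightarrow> (real \<Rightarrow> complex) \<Rightarrow> bool" where
  "C1 0 g \<longleftrightarrow> continuous_on UNIV g"
| "C1 (Suc m) g \<longleftrightarrow> (\<exists>g'. (\<forall>t. (g has_vector_derivative g' t) (at t)) \<and> C1 m g')"

definition smooth1 :: "(real \<Rightarrow> complex) \<Rightarrow> bool" where
  "smooth1 g \<longleftrightarrow> (\<forall>m. C1 m g)"

definition deriv1 :: "(real \<Rightarrow> complex) \<Rightarrow> real \<Rightarrow> complex" where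
  "deriv1 g t = vector_derivative g (at t)"

lemma has_vector_derivative_imp_continuous_on_UNIV:
  "(\<And>t. (g has_vector_derivative g' t) (at t)) \<Longrightarrow> continuous_on UNIV g"
  using has_vector_derivative_continuous continuous_at_imp_continuous_on by metis

lemma C1_continuous: "C1 m g \<Longrightarrow> continuous_on UNIV g"
  by (cases m) (use has_vector_derivative_imp_continuous_on_UNIV in auto)

lemma C1_SucI: "C1 m g' \<Longrightarrow> (\<And>t. (g has_vector_derivative g' t) (at t)) \<Longrightarrow> C1 (Suc m) g"
  unfolding C1.simps by (intro exI[of _ g'] conjI allI)

lemma C1_Suc_imp: "C1 (Suc m) g \<Longrightarrow> C1 m g"
proof (induction m arbitrary: g)
  case 0
  then show ?case using C1_continuous by (metis C1.simps(1))
next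
  case (Suc m)
  then show ?case by (metis C1.simps(2))
qed

lemma smooth1_has_deriv:
  assumes "smooth1 g" shows "(g has_vector_derivative deriv1 g t) (at t)"
proof -
  have "C1 1 g" using assms by (simp add: smooth1_def)
  then obtain g' where "(g has_vector_derivative g' t) (at t)" by auto
  then show ?thesis unfolding deriv1_def using vector_derivative_at by fastforce
qed

lemma smooth1_deriv1: assumes "smooth1 g" shows "smooth1 (deriv1 g)"
  unfolding smooth1_def
proof
  fix m have "C1 (Suc m) g" using assms by (simp add: smooth1_def)
  then obtain g' where g: "\<And>t. (g has_vector_derivative g' t) (at t)" "C1 m g'" by auto
  have "deriv1 g = g'" unfolding deriv1_def using g(1) vector_derivative_at by fastforce
  then show "C1 m (deriv1 g)" using g by simp
qed

lemma smooth1I: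
  assumes "\<And>t. (g has_vector_derivative g' t) (at t)" "smooth1 g'"
  shows "smooth1 g"
  unfolding smooth1_def
proof
  fix m show "C1 m g"
  proof (cases m)
    case 0
    show ?thesis using 0 has_vector_derivative_imp_continuous_on_UNIV[OF assms(1)] by simp
  next
    case (Suc j)
    then show ?thesis using assms by (auto simp: smooth1_def)
  qed
qed

lemma deriv1_eqI: "(\<And>t. (g has_vector_derivative g' t) (at t)) \<Longrightarrow> deriv1 g = g'"
  unfolding deriv1_def using vector_derivative_at by fastforce

lemma smooth1_continuous: "smooth1 g \<Longrightarrow> continuous_on UNIV g"
  using C1_continuous smooth1_def by blast

lemma C1_add: "C1 m f \<Longrightarrow> C1 m g \<Longrightarrow> C1 m (\<lambda>t. f t + g t)"
proof (induction m arbitrary: f g)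
  case 0 then show ?case by (auto intro: continuous_intros)
next
  case (Suc m)
  then obtain f' g' where "\<And>t. (f has_vector_derivative f' t) (at t)" "C1 m f'"
     "\<And>t. (g has_vector_derivative g' t) (at t)" "C1 m g'" by auto
  then show ?case using Suc.IH by (auto intro!: exI[of _ "\<lambda>t. f' t + g' t"] derivative_eq_intros)
qed

lemma C1_mult: "C1 m f \<Longrightarrow> C1 m g \<Longrightarrow> C1 m (\<lambda>t. f t * g t)"
proof (induction m arbitrary: f g)
  case 0 then show ?case by (auto intro: continuous_intros)
next
  case (Suc m)
  then obtain f' g' where *: "\<And>t. (f has_vector_derivative f' t) (at t)" "C1 m f'"
     "\<And>t. (g has_vector_derivative g' t) (at t)" "C1 m g'" by auto
  have "C1 m f" "C1 m g" using Suc.prems C1_Suc_imp by auto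
  then have "C1 m (\<lambda>t. f t * g' t + f' t * g t)" using Suc.IH * C1_add by blast
  moreover have "((\<lambda>t. f t * g t) has_vector_derivative f t * g' t + f' t * g t) (at t)" for t
    using * by (intro has_vector_derivative_mult) auto
  ultimately show ?case by (rule C1_SucI)
qed

lemma C1_const: "C1 m (\<lambda>t. c)"
  by (induction m arbitrary: c) (auto intro!: exI[of _ "\<lambda>t. 0"])

lemma C1_affine: "C1 m g \<Longrightarrow> C1 m (\<lambda>t. g (a * t + b))"
proof (induction m arbitrary: g)
  case 0
  then have "continuous_on UNIV (g \<circ> (\<lambda>t. a * t + b))"
    by (intro continuous_on_compose continuous_intros) (auto intro: continuous_on_subset)
  then show ?case by (simp add: o_def)
next
  case (Suc m)
  then obtain g' where g: "\<And>t. (g has_vector_derivative g' t) (at t)" "C1 m g'" by auto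
  have "((\<lambda>t. g (a * t + b)) has_vector_derivative (of_real a * g' (a * t + b))) (at t)" for t
  proof -
    have "((\<lambda>t. a * t + b) has_vector_derivative a) (at t)"
      by (auto intro!: derivative_eq_intros)
    from vector_diff_chain_at[OF this g(1)] show ?thesis by (simp add: o_def scaleR_conv_of_real)
  qed
  moreover have "C1 m (\<lambda>t. of_real a * g' (a * t + b))" using Suc.IH[OF g(2)] C1_mult C1_const by blast
  ultimately show ?case by (auto intro!: exI[of _ "\<lambda>t. of_real a * g' (a * t + b)"])
qed

lemma smooth1_add: "smooth1 f \<Longrightarrow> smooth1 g \<Longrightarrow> smooth1 (\<lambda>t. f t + g t)"
  and smooth1_mult: "smooth1 f \<Longrightarrow> smooth1 g \<Longrightarrow> smooth1 (\<lambda>t. f t * g t)"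
  and smooth1_const: "smooth1 (\<lambda>t. c)"
  and smooth1_affine: "smooth1 f \<Longrightarrow> smooth1 (\<lambda>t. f (a * t + b))"
  by (auto simp: smooth1_def C1_add C1_mult C1_const C1_affine)

lemma smooth1_diff: "smooth1 f \<Longrightarrow> smooth1 g \<Longrightarrow> smooth1 (\<lambda>t. f t - g t)"
  using smooth1_add[of f "\<lambda>t. -1 * g t"] smooth1_mult[OF smooth1_const[of "-1"], of g] by simp

lemma smooth1_of_real: "smooth1 complex_of_real"
  by (rule smooth1I[where g'="\<lambda>t. 1"]) (auto intro!: derivative_eq_intros smooth1_const)

subsection \<open>Bump functions and iterated antiderivatives\<close>

text \<open>Dividing by powers of t makes the family closed under differentiation, so one induction
  proves smoothness of all members; \<open>m = 0\<close> is the classical flat function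
  exp(-1/t).\<close>

definition flat_fun :: "nat \<Rightarrow> real \<Rightarrow> real" where
  "flat_fun m t = (if t > 0 then exp (- 1 / t) / t ^ m else 0)"

lemma flat_fun_tendsto_0: "(flat_fun m \<longlongrightarrow> 0) (at_right 0)"
proof -
  have "((\<lambda>x::real. x ^ m / exp x) \<longlongrightarrow> 0) at_top" by (rule tendsto_power_div_exp_0)
  then have "((\<lambda>t::real. inverse t ^ m / exp (inverse t)) \<longlongrightarrow> 0) (at_right 0)"
    by (rule filterlim_compose[OF _ filterlim_inverse_at_top_right])
  then show ?thesis
    by (rule Lim_transform_eventually)
      (auto simp: eventually_at_filter flat_fun_def exp_minus field_simps power_divide)
qed

lemma flat_fun_deriv: "(flat_fun m has_real_derivative (flat_fun (m+2) t - real m * flat_fun (m+1) t)) (at t)"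
proof -
  consider "t > 0" | "t = 0" | "t < 0" by linarith
  then show ?thesis
  proof cases
    case 1
    have "((\<lambda>t. exp (- 1 / t) / t ^ m) has_real_derivative
        (exp (-1/t) * (1 / t^2) * t^m - exp (-1/t) * (real m * t ^ (m - 1))) / (t^m * t^m)) (at t)"
      using 1 by (auto intro!: derivative_eq_intros simp: power2_eq_square)
    moreover have "(exp (-1/t) * (1 / t^2) * t^m - exp (-1/t) * (real m * t ^ (m - 1))) / (t^m * t^m)
       = flat_fun (m+2) t - real m * flat_fun (m+1) t"
      using 1 by (cases m) (auto simp: flat_fun_def field_simps power2_eq_square)
    ultimately have "((\<lambda>t. exp (- 1 / t) / t ^ m) has_real_derivative flat_fun (m+2) t - real m * flat_fun (m+1) t) (at t)"
      by simp
    then show ?thesis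
      by (rule has_field_derivative_transform_within_open[where S="{0<..}"]) (use 1 in \<open>auto simp: flat_fun_def\<close>)
  next
    case 2
    \<comment> \<open>At 0 the right difference quotient of \<open>flat_fun m\<close> is
      \<open>flat_fun (Suc m)\<close>, which tends to 0.\<close>
    have R: "((\<lambda>h. flat_fun m h / h) \<longlongrightarrow> 0) (at_right 0)"
      by (rule Lim_transform_eventually[OF flat_fun_tendsto_0[of "Suc m"]])
         (auto simp: eventually_at_filter flat_fun_def field_simps)
    have L: "((\<lambda>h. flat_fun m h / h) \<longlongrightarrow> 0) (at_left 0)"
      by (rule Lim_transform_eventually[OF tendsto_const])
         (auto simp: eventually_at_filter flat_fun_def)
    have "((\<lambda>h. flat_fun m h / h) \<longlongrightarrow> 0) (at 0)" using L R filterlim_split_at by blast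
    then show ?thesis using 2 by (simp add: DERIV_def flat_fun_def)
  next
    case 3
    have "((\<lambda>t. 0) has_real_derivative 0) (at t)" by simp
    then have "(flat_fun m has_real_derivative 0) (at t)"
      by (rule has_field_derivative_transform_within_open[where S="{..<0}"]) (use 3 in \<open>auto simp: flat_fun_def\<close>)
    then show ?thesis using 3 by (simp add: flat_fun_def)
  qed
qed

lemma has_vector_derivative_complex_of_real:
  "(f has_real_derivative d) (at t) \<Longrightarrow> ((\<lambda>t. complex_of_real (f t)) has_vector_derivative complex_of_real d) (at t)"
  by (intro has_vector_derivative_of_real) (simp add: has_real_derivative_iff_has_vector_derivative)

lemma smooth1_flat_fun: "smooth1 (\<lambda>t. complex_of_real (flat_fun j t))"
  unfolding smooth1_def
proof
  fix m show "C1 m (\<lambda>t. complex_of_real (flat_fun j t))"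
  proof (induction m arbitrary: j)
    case 0
    show ?case
      unfolding C1.simps
      by (rule has_vector_derivative_imp_continuous_on_UNIV[OF has_vector_derivative_complex_of_real[OF flat_fun_deriv]])
  next
    case (Suc m)
    have "C1 m (\<lambda>t. complex_of_real (flat_fun (j+2) t) + (- of_nat j) * complex_of_real (flat_fun (j+1) t))"
      by (intro C1_add C1_mult C1_const Suc)
    moreover have "((\<lambda>t. complex_of_real (flat_fun j t)) has_vector_derivative
      complex_of_real (flat_fun (j+2) t) + (- of_nat j) * complex_of_real (flat_fun (j+1) t)) (at t)" for t
      using has_vector_derivative_complex_of_real[OF flat_fun_deriv[of j t]] by simp
    ultimately show ?case by (rule C1_SucI)
  qed
qed

definition bump1 :: "real \<Rightarrow> real \<Rightarrow> real \<Rightarrow> real" where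
  "bump1 l u t = flat_fun 0 (t - l) * flat_fun 0 (u - t)"

lemma flat_fun_nonneg: "flat_fun m t \<ge> 0"
  by (simp add: flat_fun_def)

lemma bump1_pos_iff: "bump1 l u t > 0 \<longleftrightarrow> l < t \<and> t < u"
  by (auto simp: bump1_def flat_fun_def)

lemma bump1_nonneg: "bump1 l u t \<ge> 0"
  by (simp add: bump1_def flat_fun_nonneg)

lemma bump1_eq_0: "t \<le> l \<or> u \<le> t \<Longrightarrow> bump1 l u t = 0"
  by (auto simp: bump1_def flat_fun_def)

lemma smooth1_bump1: "smooth1 (\<lambda>t. complex_of_real (bump1 l u t))"
  unfolding bump1_def of_real_mult
  using smooth1_mult[OF smooth1_affine[OF smooth1_flat_fun[of 0], of 1 "-l"]
         smooth1_affine[OF smooth1_flat_fun[of 0], of "-1" u]]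
  by (simp add: algebra_simps)

text \<open>A primitive normalised at the right end: as \<open>g\<close> vanishes beyond
  \<open>B\<close>, so does its primitive, and antidifferentiation can be repeated without losing
  the bound on the support from the right.\<close>

lemma right_antiderivative:
  fixes g :: "real \<Rightarrow> 'a::banach"
  assumes "continuous_on UNIV g" and g0: "\<And>t. t \<ge> B \<Longrightarrow> g t = 0"
  obtains K where "\<And>t. (K has_vector_derivative g t) (at t)" "\<And>t. t \<ge> B \<Longrightarrow> K t = 0"
proof
  define K where "K t = (if t \<le> B then - integral {t..B} g else 0)" for t
  have int: "g integrable_on {a..b}" for a b
    using assms(1) by (meson continuous_on_subset integrable_continuous_real subset_UNIV)
  fix t
  define a where "a = min t B - 1"
  define b where "b = max t B + 1"
  have "((\<lambda>s. integral {a..s} g) has_vector_derivative g t) (at t within {a..b})"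
    using assms(1) by (intro integral_has_vector_derivative) (auto simp: a_def b_def intro: continuous_on_subset)
  then have 1: "((\<lambda>s. integral {a..s} g - integral {a..B} g) has_vector_derivative g t) (at t within {a..b})"
    by (auto intro!: derivative_eq_intros)
  have "K s = integral {a..s} g - integral {a..B} g" if "s \<in> {a<..<b}" for s
  proof (cases "s \<le> B")
    case True
    have "integral {a..s} g + integral {s..B} g = integral {a..B} g"
      using that True by (intro Henstock_Kurzweil_Integration.integral_combine int) auto
    then show ?thesis using True by (simp add: K_def algebra_simps)
  next
    case False
    have "integral {a..B} g + integral {B..s} g = integral {a..s} g"
      using False by (intro Henstock_Kurzweil_Integration.integral_combine int) (auto simp: a_def)
    moreover have "integral {B..s} g = integral {B..s} (\<lambda>_. 0)"
      by (intro integral_cong) (auto simp: g0)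
    ultimately show ?thesis using False by (simp add: K_def)
  qed note K = this
  have "((\<lambda>s. integral {a..s} g - integral {a..B} g) has_vector_derivative g t) (at t within {a<..<b})"
    using 1 by (rule has_vector_derivative_within_subset) auto
  then have "((\<lambda>s. integral {a..s} g - integral {a..B} g) has_vector_derivative g t) (at t)"
    by (subst (asm) at_within_open) (auto simp: a_def b_def)
  then show "(K has_vector_derivative g t) (at t)"
    by (rule has_vector_derivative_transform_within_open[where S="{a<..<b}"])
       (use K in \<open>auto simp: a_def b_def\<close>)
next
  show "\<And>t. t \<ge> B \<Longrightarrow> (if t \<le> B then - integral {t..B} g else 0) = 0" by auto
qed

lemma smooth1_right_antiderivative:
  assumes "smooth1 g" "\<And>t. t \<ge> B \<Longrightarrow> g t = 0"
  obtains K where "smooth1 K" "\<And>t. t \<ge> B \<Longrightarrow> K t = 0" "deriv1 K = g"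
proof -
  obtain K where K: "\<And>t. (K has_vector_derivative g t) (at t)" "\<And>t. t \<ge> B \<Longrightarrow> K t = 0"
    using right_antiderivative[OF smooth1_continuous[OF assms(1)] assms(2)] by metis
  show ?thesis using that[of K] K smooth1I[OF K(1) assms(1)] deriv1_eqI[OF K(1)] by auto
qed

text \<open>Starting from a bump on ]1,2[, take the primitive of the negative that vanishes beyond
  2, again and again. Each primitive is nonincreasing, hence nonnegative, and the mass of the bump
  makes it strictly positive on all of t < 2.\<close>

lemma completely_monotone_cutoff:
  obtains G :: "nat \<Rightarrow> real \<Rightarrow> real" where
    "\<And>j t. (G (Suc j) has_real_derivative - G j t) (at t)"
    "\<And>j t. G j t \<ge> 0" "\<And>j t. t \<ge> 2 \<Longrightarrow> G j t = 0" "\<And>j t. 1 < t \<Longrightarrow> t < 2 \<Longrightarrow> G j t > 0"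
    "\<And>j t. t < 2 \<Longrightarrow> G (Suc j) t > 0" "\<And>j. smooth1 (\<lambda>t. complex_of_real (G j t))"
proof -
  let ?P = "\<lambda>g::real \<Rightarrow> real. (\<forall>t. g t \<ge> 0) \<and> (\<forall>t\<ge>2. g t = 0) \<and> (\<forall>t. 1 < t \<and> t < 2 \<longrightarrow> g t > 0)
     \<and> smooth1 (\<lambda>t. complex_of_real (g t)) \<and> continuous_on UNIV g"
  let ?Q = "\<lambda>g K. (\<forall>t. (K has_real_derivative - g t) (at t)) \<and> (\<forall>t<2. K t > 0)"
  have ex0: "?P (bump1 1 2)"
  proof -
    have "continuous_on UNIV (\<lambda>t. Re (complex_of_real (bump1 1 2 t)))"
      by (intro continuous_intros smooth1_continuous smooth1_bump1)
    then show ?thesis by (auto simp: bump1_nonneg bump1_eq_0 bump1_pos_iff smooth1_bump1)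
  qed
  have step: "\<exists>K. ?P K \<and> ?Q g K" if g: "?P g" for g
  proof -
    obtain K where K: "\<And>t. (K has_vector_derivative - g t) (at t)" "\<And>t. t \<ge> 2 \<Longrightarrow> K t = 0"
      using right_antiderivative[of "\<lambda>t. - g t" 2] g by (auto intro: continuous_on_minus)
    have K1: "(K has_real_derivative - g t) (at t)" for t
      using K(1) by (simp add: has_real_derivative_iff_has_vector_derivative)
    have mono: "K t \<ge> K s" if "t \<le> s" for s t
      using DERIV_nonpos_imp_nonincreasing[OF that, of K] K1 g
      by (metis neg_le_0_iff_le)
    \<comment> \<open>Between \<open>s\<close> and \<open>r\<close>, two points of ]1,2[ not to the
      left of \<open>t\<close>, the function \<open>g\<close> is positive and \<open>K\<close>
      strictly decreases; from there on it stays above \<open>K 2\<close>, which is 0.\<close>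
    have pos: "K t > 0" if "t < 2" for t
    proof -
      define s where "s = (max t 1 + 2) / 2"
      define r where "r = (s + 2) / 2"
      have s: "t \<le> s" "1 < s" "s < r" "r < 2" "s < 2" using that by (auto simp: s_def r_def max_def)
      have "K r < K s" using DERIV_neg_imp_decreasing[of s r K] K1 g s
        by (metis neg_less_0_iff_less less_le_trans order_le_less_trans)
      moreover have "K 2 \<le> K r" using mono s by simp
      ultimately show ?thesis using mono[OF s(1)] K(2)[of 2] by simp
    qed
    have "smooth1 (\<lambda>t. complex_of_real (K t))"
      by (rule smooth1I[where g'="\<lambda>t. -1 * complex_of_real (g t)"])
         (use has_vector_derivative_complex_of_real[OF K1] g in \<open>auto intro: smooth1_mult[OF smooth1_const[of "-1"], simplified]\<close>)
    moreover have "continuous_on UNIV K"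
      by (rule has_vector_derivative_imp_continuous_on_UNIV[OF K(1)])
    moreover have "K t \<ge> 0" for t using pos[of t] K(2)[of t] by (cases "t < 2") auto
    ultimately show ?thesis using K(2) K1 pos by (intro exI[of _ K]) auto
  qed
  have "\<exists>G. \<forall>j. ?P (G j) \<and> ?Q (G j) (G (Suc j))"
    by (rule dependent_nat_choice) (use ex0 step in blast)+
  then obtain G where G0: "\<And>j. ?P (G j)" and G1: "\<And>j. ?Q (G j) (G (Suc j))"
    by blast
  show ?thesis
  proof (rule that[of G])
    fix j t
    show "(G (Suc j) has_real_derivative - G j t) (at t)" using G1[of j] by simp
    show "t < 2 \<Longrightarrow> G (Suc j) t > 0" using G1[of j] by simp
  qed (use G0 in auto)
qed

subsection \<open>The Euler equation on the half line\<close>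

text \<open>\<open>0 powr 0\<close> evaluates to 0, whereas the weight t^0 must be 1 at the origin
  to be continuous when \<open>l = 0\<close>.\<close>

definition rpow :: "real \<Rightarrow> real \<Rightarrow> real" where
  "rpow l s = (if l = 0 then 1 else s powr l)"

lemma continuous_on_rpow:
  assumes "0 \<le> l" "continuous_on S f" "\<And>x. x \<in> S \<Longrightarrow> 0 \<le> f x"
  shows "continuous_on S (\<lambda>x. rpow l (f x))"
proof (cases "l = 0")
  case False
  then have "continuous_on S (\<lambda>x. f x powr l)"
    using assms by (intro continuous_on_powr') auto
  then show ?thesis using False by (simp add: rpow_def)
qed (simp add: rpow_def)

lemma rpow_plus_1: "0 \<le> l \<Longrightarrow> 0 \<le> s \<Longrightarrow> rpow (l+1) s = s * rpow l s"
  by (cases "s = 0") (auto simp: rpow_def powr_add)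

lemma smooth1_continuous_on_compose:
  "smooth1 F \<Longrightarrow> continuous_on S f \<Longrightarrow> continuous_on S (\<lambda>x. F (f x))"
  using continuous_on_compose2[OF smooth1_continuous] by simp

text \<open>Each derivative in \<open>t\<close> brings out a factor \<open>s\<close>, absorbed by
  raising the exponent; generalising over \<open>l\<close> and \<open>F\<close> turns this into an
  induction on the order of smoothness.\<close>

lemma smooth1_average:
  assumes "smooth1 F" "0 \<le> l"
  shows "smooth1 (\<lambda>t. integral {0..1} (\<lambda>s. complex_of_real (rpow l s) * F (t * s)))" (is "smooth1 (?A l F)")
    and "deriv1 (\<lambda>t. integral {0..1} (\<lambda>s. complex_of_real (rpow l s) * F (t * s)))
       = (\<lambda>t. integral {0..1} (\<lambda>s. complex_of_real (rpow (l+1) s) * deriv1 F (t * s)))"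
proof -
  have vd: "((?A l F) has_vector_derivative ?A (l+1) (deriv1 F) t) (at t)" if F: "smooth1 F" and l: "0 \<le> l" for l F t
  proof -
    have "((\<lambda>t. integral (cbox 0 1) (\<lambda>s. complex_of_real (rpow l s) * F (t * s))) has_vector_derivative
        integral (cbox 0 1) (\<lambda>s. complex_of_real (rpow l s) * (of_real s * deriv1 F (t * s)))) (at t within UNIV)"
    proof (rule leibniz_rule_vector_derivative)
      fix x s :: real assume "s \<in> cbox 0 1"
      have "((\<lambda>t. t * s) has_vector_derivative s) (at x)" by (auto intro!: derivative_eq_intros)
      from vector_diff_chain_at[OF this smooth1_has_deriv[OF F]]
      have "((\<lambda>t. F (t * s)) has_vector_derivative of_real s * deriv1 F (x * s)) (at x)"
        by (simp add: o_def scaleR_conv_of_real)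
      then show "((\<lambda>x. complex_of_real (rpow l s) * F (x * s)) has_vector_derivative
            complex_of_real (rpow l s) * (of_real s * deriv1 F (x * s))) (at x within UNIV)"
        by (auto intro!: derivative_eq_intros)
    next
      fix x :: real
      show "(\<lambda>s. complex_of_real (rpow l s) * F (x * s)) integrable_on cbox 0 1"
        by (intro integrable_continuous continuous_intros continuous_on_rpow l smooth1_continuous_on_compose[OF F]) auto
    next
      show "continuous_on (UNIV \<times> cbox 0 1) (\<lambda>(x, s). complex_of_real (rpow l s) * (of_real s * deriv1 F (x * s)))"
        unfolding split_beta
        by (intro continuous_intros continuous_on_rpow l smooth1_continuous_on_compose[OF smooth1_deriv1[OF F]]) auto
    qed auto
    moreover have *: "complex_of_real (rpow l s) * (of_real s * deriv1 F (t * s)) = complex_of_real (rpow (l+1) s) * deriv1 F (t * s)"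
       if "s \<in> {0..1}" for s t
      using that l by (simp add: rpow_plus_1)
    have "integral (cbox 0 1) (\<lambda>s. complex_of_real (rpow l s) * (of_real s * deriv1 F (t * s))) = ?A (l+1) (deriv1 F) t"
      unfolding cbox_interval by (rule integral_cong[OF *])
    ultimately show ?thesis by simp
  qed
  have "C1 m (?A l F)" for m
    using assms
  proof (induction m arbitrary: l F)
    case 0
    show ?case
      unfolding C1.simps by (rule has_vector_derivative_imp_continuous_on_UNIV[OF vd[OF 0]])
  next
    case (Suc m)
    have "C1 m (?A (l+1) (deriv1 F))" using Suc smooth1_deriv1 by auto
    then show ?case using vd[OF Suc.prems] by (rule C1_SucI)
  qed
  then show "smooth1 (?A l F)" by (simp add: smooth1_def)
  show "deriv1 (?A l F) = ?A (l+1) (deriv1 F)" using vd[OF assms] by (rule deriv1_eqI)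
qed

text \<open>The functional \<open>- \<integral>G'(t) t^l\<close> is \<open>l \<integral>G(t) t^(l-1)\<close> for \<open>l > 0\<close> and \<open>G(0)\<close> for \<open>l = 0\<close>;
  its kernel is the range of the Euler operator. Here \<open>H'\<close> is the solution of \<open>(l+1) H' + t H'' = G'\<close>.\<close>

lemma euler_operator_solvable:
  assumes "0 \<le> l" "0 < B" "smooth1 G" and G0: "\<And>t. t \<ge> B \<Longrightarrow> G t = 0"
    and int0: "integral {0..B} (\<lambda>t. complex_of_real (rpow l t) * deriv1 G t) = 0"
  obtains H where "smooth1 H" "\<And>t. t \<ge> B \<Longrightarrow> H t = 0"
     "\<And>t. G t = of_real l * H t + of_real t * deriv1 H t"
proof -
  let ?g = "deriv1 G"
  \<comment> \<open>For t > 0 this is t^(-l-1) times the integral of s^l G'(s) over [0,t], the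
    regular solution of (l+1) K + t K' = G'; rescaling the variable of integration removes the
    singularity at 0.\<close>
  define K where "K t = integral {0..1} (\<lambda>s. complex_of_real (rpow l s) * ?g (t * s))" for t
  have sg: "smooth1 ?g" using assms smooth1_deriv1 by auto
  have sK: "smooth1 K" and dK: "deriv1 K = (\<lambda>t. integral {0..1} (\<lambda>s. complex_of_real (rpow (l+1) s) * deriv1 ?g (t * s)))"
    using smooth1_average[OF sg \<open>0 \<le> l\<close>] unfolding K_def by auto
  \<comment> \<open>At \<open>t = B\<close> only the right derivative of \<open>G\<close> is seen to
    vanish; by smoothness it is the two-sided one.\<close>
  have g0: "?g t = 0" if "t \<ge> B" for t
  proof -
    have "(G has_vector_derivative ?g t) (at t within {t..})"
      using smooth1_has_deriv[OF assms(3)] by (rule has_vector_derivative_at_within)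
    moreover have "(G has_vector_derivative 0) (at t within {t..})"
      by (rule has_vector_derivative_transform[where f="\<lambda>_. 0"]) (use that G0 in \<open>auto intro: has_vector_derivative_const\<close>)
    moreover have "at t within {t..} \<noteq> bot"
      using trivial_limit_at_right_real[of t] at_le[of "{t<..}" "{t..}" t] Ioi_le_Ico[of t]
      by (metis bot_unique)
    ultimately show ?thesis by (metis vector_derivative_within)
  qed
  \<comment> \<open>Beyond \<open>B\<close> the integral over [0,t] equals the one over [0,B], which
    vanishes by \<open>int0\<close>; scaling [0,t] to [0,1] turns it into \<open>K t\<close> up to a
    nonzero factor.\<close>
  have K0: "K t = 0" if "t \<ge> B" for t
  proof -
    have t: "t > 0" using that assms by simp
    have c: "continuous_on {0..t} (\<lambda>x. complex_of_real (rpow l x) * ?g x)"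
      by (intro continuous_intros continuous_on_rpow assms smooth1_continuous_on_compose[OF sg]) auto
    then have i: "(\<lambda>x. complex_of_real (rpow l x) * ?g x) integrable_on {0..t}"
      using integrable_continuous_real by blast
    have "integral {0..B} (\<lambda>t. complex_of_real (rpow l t) * ?g t) + integral {B..t} (\<lambda>t. complex_of_real (rpow l t) * ?g t)
      = integral {0..t} (\<lambda>t. complex_of_real (rpow l t) * ?g t)"
      using that assms by (intro Henstock_Kurzweil_Integration.integral_combine i) auto
    moreover have "integral {B..t} (\<lambda>t. complex_of_real (rpow l t) * ?g t) = integral {B..t} (\<lambda>_. 0)"
      by (intro integral_cong) (simp add: g0)
    ultimately have "integral {0..t} (\<lambda>t. complex_of_real (rpow l t) * ?g t) = 0" using int0 by simp
    then have "((\<lambda>x. complex_of_real (rpow l x) * ?g x) has_integral 0) (cbox 0 t)"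
      using i by (metis cbox_interval integrable_integral)
    from has_integral_affinity'[OF this, of t 0] t
    have A: "((\<lambda>x. complex_of_real (rpow l (t * x)) * ?g (t * x)) has_integral 0) {0..1}"
      by simp
    have E: "complex_of_real (rpow l (t * x)) = complex_of_real (rpow l t) * complex_of_real (rpow l x)"
        if "x \<in> {0..1}" for x using that t by (auto simp: rpow_def powr_mult)
    have "((\<lambda>x. complex_of_real (rpow l t) * (complex_of_real (rpow l x) * ?g (t * x))) has_integral 0) {0..1}"
      by (rule has_integral_eq[OF _ A]) (simp add: E mult.assoc)
    from has_integral_mult_right[OF this, of "inverse (complex_of_real (rpow l t))"]
    have "((\<lambda>x. complex_of_real (rpow l x) * ?g (t * x)) has_integral 0) {0..1}"
      using t by (simp add: rpow_def mult.assoc[symmetric])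
    then show ?thesis unfolding K_def by (rule integral_unique)
  qed
  obtain H where H: "smooth1 H" "\<And>t. t \<ge> B \<Longrightarrow> H t = 0" "deriv1 H = K"
    using smooth1_right_antiderivative[OF sK K0] by metis
  \<comment> \<open>Integrate the derivative of s^(l+1) G'(t s) with respect to s over [0,1]; the
    boundary term at 0 vanishes since l + 1 > 0.\<close>
  have euler: "?g t = of_real (l+1) * K t + of_real t * deriv1 K t" for t
  proof -
    let ?F = "\<lambda>s. complex_of_real (rpow (l+1) s) * ?g (t * s)"
    have "((\<lambda>s. of_real ((l+1) * rpow l s) * ?g (t * s) + complex_of_real (rpow (l+1) s) * (of_real t * deriv1 ?g (t * s)))
       has_integral (?F 1 - ?F 0)) {0..1}"
    proof (rule fundamental_theorem_of_calculus_interior)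
      show "continuous_on {0..1} ?F"
        using assms by (intro continuous_intros continuous_on_rpow smooth1_continuous_on_compose[OF sg]) auto
      fix s :: real assume s: "s \<in> {0<..<1}"
      have "((\<lambda>x. t * x) has_vector_derivative t) (at s)" by (auto intro!: derivative_eq_intros)
      from vector_diff_chain_at[OF this smooth1_has_deriv[OF sg]]
      have 1: "((\<lambda>x. ?g (t * x)) has_vector_derivative of_real t * deriv1 ?g (t * s)) (at s)"
        by (simp add: o_def scaleR_conv_of_real)
      have "((\<lambda>s. s powr (l+1)) has_real_derivative (l+1) * s powr l) (at s)"
        using s by (auto intro!: derivative_eq_intros)
      then have 2: "((\<lambda>s. complex_of_real (s powr (l+1))) has_vector_derivative of_real ((l+1) * s powr l)) (at s)"
        by (rule has_vector_derivative_complex_of_real)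
      have 3: "rpow (l+1) = (\<lambda>s. s powr (l+1))" "rpow l s = s powr l"
        using assms s by (auto simp: rpow_def fun_eq_iff)
      show "(?F has_vector_derivative of_real ((l+1) * rpow l s) * ?g (t * s) + complex_of_real (rpow (l+1) s) * (of_real t * deriv1 ?g (t * s))) (at s)"
        unfolding 3 using has_vector_derivative_mult[OF 2 1] by (simp add: add.commute)
    qed simp
    moreover have "((\<lambda>s. of_real ((l+1) * rpow l s) * ?g (t * s) + complex_of_real (rpow (l+1) s) * (of_real t * deriv1 ?g (t * s)))
       has_integral (of_real (l+1) * K t + of_real t * deriv1 K t)) {0..1}"
    proof -
      have "((\<lambda>s. of_real (l+1) * (complex_of_real (rpow l s) * ?g (t * s)) + of_real t * (complex_of_real (rpow (l+1) s) * deriv1 ?g (t * s)))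
       has_integral (of_real (l+1) * K t + of_real t * deriv1 K t)) {0..1}"
        unfolding dK unfolding K_def using assms
        by (intro has_integral_add has_integral_mult_right integrable_integral integrable_continuous_real
          continuous_intros continuous_on_rpow smooth1_continuous_on_compose[OF sg]
           smooth1_continuous_on_compose[OF smooth1_deriv1[OF sg]]) auto
      then show ?thesis by (rule has_integral_eq[rotated]) (simp add: algebra_simps)
    qed
    ultimately have "of_real (l+1) * K t + of_real t * deriv1 K t = ?F 1 - ?F 0" by (intro has_integral_unique)
    moreover have "?F 1 - ?F 0 = ?g t" using assms by (simp add: rpow_def)
    ultimately show ?thesis by simp
  qed
  have "G t = of_real l * H t + of_real t * deriv1 H t" for t
  proof -
    \<comment> \<open>The primitive \<open>H\<close> of \<open>K\<close> solves the undifferentiated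
      equation up to a constant, and this constant is 0 because everything vanishes at
      \<open>B\<close>.\<close>
    define D where "D t = G t - (of_real l * H t + of_real t * K t)" for t
    have "(D has_vector_derivative ?g t - (of_real l * K t + (of_real t * deriv1 K t + K t))) (at t)" for t
    proof -
      have "((\<lambda>t. complex_of_real t) has_vector_derivative 1) (at t)" by (auto intro!: derivative_eq_intros)
      from has_vector_derivative_mult[OF this smooth1_has_deriv[OF sK]]
      have 1: "((\<lambda>t. of_real t * K t) has_vector_derivative of_real t * deriv1 K t + K t) (at t)" by simp
      show ?thesis unfolding D_def
        using smooth1_has_deriv[OF assms(3), of t] smooth1_has_deriv[OF H(1), of t, unfolded H(3)] 1
        by (intro has_vector_derivative_diff has_vector_derivative_add has_vector_derivative_mult_right)
    qed
    moreover have "?g t - (of_real l * K t + (of_real t * deriv1 K t + K t)) = 0" for t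
      using euler[of t] by (simp add: algebra_simps)
    ultimately have "(D has_derivative (\<lambda>h. 0)) (at t within UNIV)" for t
      unfolding has_vector_derivative_def by (simp only: scaleR_zero_right)
    then have "\<exists>c. \<forall>t\<in>UNIV. D t = c"
      by (intro has_derivative_zero_constant) auto
    then obtain c where c: "\<And>t. D t = c" by auto
    have "D B = 0" using G0 H(2) K0 by (simp add: D_def)
    then show ?thesis using c[of t] c[of B] H(3) by (simp add: D_def)
  qed
  then show ?thesis using that H by blast
qed

section \<open>Smooth functions of several variables\<close>

definition has_pd :: "'n::finite \<Rightarrow> (real^'n \<Rightarrow> complex) \<Rightarrow> (real^'n \<Rightarrow> complex) \<Rightarrow> bool" where
  "has_pd i f f' \<longleftrightarrow> (\<forall>x. ((\<lambda>t. f (x + t *\<^sub>R axis i 1)) has_vector_derivative f' x) (at 0))"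

primrec Ck :: "nat \<Rightarrow> (real^'n::finite \<Rightarrow> complex) \<Rightarrow> bool" where
  "Ck 0 f \<longleftrightarrow> continuous_on UNIV f"
| "Ck (Suc m) f \<longleftrightarrow> continuous_on UNIV f \<and> (\<forall>i. has_pd i f (pdiff i f) \<and> Ck m (pdiff i f))"

lemma has_pd_pdiff: "has_pd i f f' \<Longrightarrow> pdiff i f = f'"
  unfolding has_pd_def pdiff_def by (intro ext vector_derivative_at) blast

lemma has_pd_at:
  assumes "has_pd i f f'"
  shows "((\<lambda>t. f (x + t *\<^sub>R axis i 1)) has_vector_derivative f' (x + s *\<^sub>R axis i 1)) (at s)"
proof -
  have 1: "((\<lambda>t. t - s) has_vector_derivative 1) (at s)" by (auto intro!: derivative_eq_intros)
  have 2: "((\<lambda>t. f ((x + s *\<^sub>R axis i 1) + t *\<^sub>R axis i 1)) has_vector_derivative f' (x + s *\<^sub>R axis i 1)) (at (s - s))"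
    using assms by (simp add: has_pd_def)
  from vector_diff_chain_at[OF 1 2] show ?thesis
    by (simp add: o_def algebra_simps)
qed

lemma Ck_SucI:
  "continuous_on UNIV f \<Longrightarrow> (\<And>i. has_pd i f (f' i)) \<Longrightarrow> (\<And>i. Ck m (f' i)) \<Longrightarrow> Ck (Suc m) f"
  using has_pd_pdiff by (metis Ck.simps(2))

lemma Ck_Suc_imp: "Ck (Suc m) f \<Longrightarrow> Ck m f"
  by (induction m arbitrary: f) auto

lemma pdiffs_snoc: "pdiffs (is @ [i]) f = pdiffs is (pdiff i f)"
  by (induction "is") auto

text \<open>Closure properties are proved by induction on the order, which \<open>Ck\<close>
  provides. It peels off the innermost derivative while \<open>pdiffs\<close> adds the outermost
  one, hence the list induction from the right in the converse direction.\<close>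

lemma smooth_fun_iff_Ck: "smooth_fun f \<longleftrightarrow> (\<forall>m. Ck m f)"
proof
  assume "smooth_fun f"
  then have "Ck m (pdiffs is f)" for m "is"
  proof (induction m arbitrary: "is")
    case 0
    then show ?case by (simp add: smooth_fun_def)
  next
    case (Suc m)
    have "has_pd i (pdiffs is f) (pdiff i (pdiffs is f))" for i
      using Suc.prems unfolding has_pd_def smooth_fun_def pdiff_def
      using vector_derivative_works by blast
    moreover have "Ck m (pdiff i (pdiffs is f))" for i using Suc.IH[OF Suc.prems, of "i # is"] by simp
    ultimately show ?case using Suc.prems by (simp add: smooth_fun_def)
  qed
  from this[of _ "[]"] show "\<forall>m. Ck m f" by simp
next
  assume C: "\<forall>m. Ck m f"
  have "Ck m (pdiffs is f)" for m "is" using C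
  proof (induction "is" arbitrary: f rule: rev_induct)
    case Nil
    then show ?case by simp
  next
    case (snoc i xs)
    have "\<forall>m. Ck m (pdiff i f)" using snoc.prems by (metis Ck.simps(2))
    then show ?case using snoc.IH by (simp add: pdiffs_snoc)
  qed note * = this
  show "smooth_fun f" unfolding smooth_fun_def
  proof (intro allI conjI)
    fix "is" i and x :: "real^'a"
    show "continuous_on UNIV (pdiffs is f)" using *[of 0] by simp
    have "has_pd i (pdiffs is f) (pdiff i (pdiffs is f))" using *[of "Suc 0" "is"] by simp
    then show "(\<lambda>t. pdiffs is f (x + t *\<^sub>R axis i 1)) differentiable (at 0)"
      unfolding has_pd_def differentiable_def has_vector_derivative_def by blast
  qed
qed

lemma smooth_fun_continuous: "smooth_fun f \<Longrightarrow> continuous_on UNIV f"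
  by (metis smooth_fun_iff_Ck Ck.simps(1))

lemma smooth_fun_has_pd: "smooth_fun f \<Longrightarrow> has_pd i f (pdiff i f)"
  by (metis smooth_fun_iff_Ck Ck.simps(2))

lemma smooth_fun_pdiff: "smooth_fun f \<Longrightarrow> smooth_fun (pdiff i f)"
  by (metis smooth_fun_iff_Ck Ck.simps(2))

subsection \<open>Closure properties\<close>

lemma has_pd_add: "has_pd i f f' \<Longrightarrow> has_pd i g g' \<Longrightarrow> has_pd i (\<lambda>x. f x + g x) (\<lambda>x. f' x + g' x)"
  by (auto simp: has_pd_def intro!: has_vector_derivative_add)

lemma has_pd_mult:
  assumes "has_pd i f f'" "has_pd i g g'"
  shows "has_pd i (\<lambda>x. f x * g x) (\<lambda>x. f x * g' x + f' x * g x)"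
  unfolding has_pd_def
proof
  fix x
  show "((\<lambda>t. f (x + t *\<^sub>R axis i 1) * g (x + t *\<^sub>R axis i 1)) has_vector_derivative f x * g' x + f' x * g x) (at 0)"
    using has_vector_derivative_mult[OF assms(1)[unfolded has_pd_def, rule_format, of x] assms(2)[unfolded has_pd_def, rule_format, of x]]
    by simp
qed

lemma has_pd_const: "has_pd i (\<lambda>x. c) (\<lambda>x. 0)"
  by (simp add: has_pd_def)

lemma Ck_const: "Ck m (\<lambda>x. c)"
proof (induction m arbitrary: c)
  case (Suc m)
  show ?case by (rule Ck_SucI[where f'="\<lambda>i x. 0"]) (simp_all add: has_pd_const Suc)
qed simp

lemma Ck_add: "Ck m f \<Longrightarrow> Ck m g \<Longrightarrow> Ck m (\<lambda>x. f x + g x)"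
proof (induction m arbitrary: f g)
  case (Suc m)
  show ?case
    by (rule Ck_SucI[where f'="\<lambda>i x. pdiff i f x + pdiff i g x"])
       (use Suc in \<open>auto intro: continuous_intros has_pd_add\<close>)
qed (auto intro: continuous_intros)

lemma Ck_mult: "Ck m f \<Longrightarrow> Ck m g \<Longrightarrow> Ck m (\<lambda>x. f x * g x)"
proof (induction m arbitrary: f g)
  case (Suc m)
  have "Ck m f" "Ck m g" using Suc.prems Ck_Suc_imp by auto
  then show ?case
    by (intro Ck_SucI[where f'="\<lambda>i x. f x * pdiff i g x + pdiff i f x * g x"])
       (use Suc in \<open>auto intro: continuous_intros has_pd_mult Ck_add\<close>)
qed (auto intro: continuous_intros)

lemma smooth_fun_const: "smooth_fun (\<lambda>x. c)"
  and smooth_fun_add: "smooth_fun f \<Longrightarrow> smooth_fun g \<Longrightarrow> smooth_fun (\<lambda>x. f x + g x)"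
  and smooth_fun_mult: "smooth_fun f \<Longrightarrow> smooth_fun g \<Longrightarrow> smooth_fun (\<lambda>x. f x * g x)"
  by (auto simp: smooth_fun_iff_Ck Ck_const Ck_add Ck_mult)

lemma pdiff_add: "smooth_fun f \<Longrightarrow> smooth_fun g \<Longrightarrow> pdiff i (\<lambda>x. f x + g x) = (\<lambda>x. pdiff i f x + pdiff i g x)"
  and pdiff_mult: "smooth_fun f \<Longrightarrow> smooth_fun g \<Longrightarrow> pdiff i (\<lambda>x. f x * g x) = (\<lambda>x. f x * pdiff i g x + pdiff i f x * g x)"
  and pdiff_const: "pdiff i (\<lambda>x. c) = (\<lambda>x. 0)"
  by (intro has_pd_pdiff has_pd_add has_pd_mult has_pd_const smooth_fun_has_pd; assumption)+

lemma pdiff_cmult: "smooth_fun f \<Longrightarrow> pdiff i (\<lambda>x. c * f x) = (\<lambda>x. c * pdiff i f x)"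
  using pdiff_mult[OF smooth_fun_const[of c], of f i] by (simp add: pdiff_const)

lemma smooth_fun_uminus: "smooth_fun f \<Longrightarrow> smooth_fun (\<lambda>x. - f x)"
  using smooth_fun_mult[OF smooth_fun_const[of "-1"], of f] by simp

lemma smooth_fun_diff: "smooth_fun f \<Longrightarrow> smooth_fun g \<Longrightarrow> smooth_fun (\<lambda>x. f x - g x)"
  using smooth_fun_add[OF _ smooth_fun_uminus, of f g] by simp

lemma smooth_fun_sum: "(\<And>a. a \<in> A \<Longrightarrow> smooth_fun (f a)) \<Longrightarrow> smooth_fun (\<lambda>x. \<Sum>a\<in>A. f a x)"
  by (induction A rule: infinite_finite_induct) (auto intro: smooth_fun_const smooth_fun_add)

lemma smooth_fun_prod: "(\<And>a. a \<in> A \<Longrightarrow> smooth_fun (f a)) \<Longrightarrow> smooth_fun (\<lambda>x. \<Prod>a\<in>A. f a x)"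
  by (induction A rule: infinite_finite_induct) (auto intro: smooth_fun_const smooth_fun_mult)

text \<open>One computation serves both later uses: constant coefficients give functions of
  \<open>p1\<close>, an indicator gives functions of one coordinate.\<close>

lemma has_pd_linear:
  assumes "smooth1 H"
  shows "has_pd i (\<lambda>x. H (\<Sum>l\<in>UNIV. c l * x $ l)) (\<lambda>x. of_real (c i) * deriv1 H (\<Sum>l\<in>UNIV. c l * x $ l))"
  unfolding has_pd_def
proof
  fix x :: "real^'a"
  have eq: "(\<Sum>l\<in>UNIV. c l * (x + t *\<^sub>R axis i 1) $ l) = (\<Sum>l\<in>UNIV. c l * x $ l) + t * c i" for t
  proof -
    have "(\<Sum>l\<in>UNIV. c l * (x + t *\<^sub>R axis i 1) $ l) = (\<Sum>l\<in>UNIV. c l * x $ l + (if l = i then t * c l else 0))"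
      by (intro sum.cong) (auto simp: axis_def algebra_simps)
    then show ?thesis by (simp add: sum.distrib)
  qed
  have 1: "((\<lambda>t. (\<Sum>l\<in>UNIV. c l * x $ l) + t * c i) has_vector_derivative c i) (at 0)"
    by (auto intro!: derivative_eq_intros)
  from vector_diff_chain_at[OF 1 smooth1_has_deriv[OF assms]]
  show "((\<lambda>t. H (\<Sum>l\<in>UNIV. c l * (x + t *\<^sub>R axis i 1) $ l)) has_vector_derivative
          complex_of_real (c i) * deriv1 H (\<Sum>l\<in>UNIV. c l * x $ l)) (at 0)"
    by (simp only: eq o_def scaleR_conv_of_real[where 'a=complex] mult_zero_left add_0_right)
qed

lemma smooth_fun_linear:
  assumes "smooth1 H" shows "smooth_fun (\<lambda>x. H (\<Sum>l\<in>UNIV. c l * x $ l))"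
proof -
  have "Ck m (\<lambda>x. H (\<Sum>l\<in>UNIV. c l * x $ l))" for m
    using assms
  proof (induction m arbitrary: H)
    case 0
    then show ?case by (auto intro!: smooth1_continuous_on_compose continuous_intros)
  next
    case (Suc m)
    show ?case
      by (rule Ck_SucI[where f'="\<lambda>i x. of_real (c i) * deriv1 H (\<Sum>l\<in>UNIV. c l * x $ l)"])
         (use Suc has_pd_linear smooth1_deriv1 in \<open>auto intro!: smooth1_continuous_on_compose continuous_intros Ck_mult Ck_const\<close>)
  qed
  then show ?thesis by (simp add: smooth_fun_iff_Ck)
qed

definition p1 :: "real^'n::finite \<Rightarrow> real" where "p1 x = (\<Sum>i\<in>UNIV. x $ i)"

lemma sum_single_coord: "(\<Sum>l\<in>UNIV. (if l = j then 1 else 0) * (x::real^'n::finite) $ l) = x $ j"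
  by (simp add: if_distrib[of "\<lambda>c. c * _"] cong: if_cong)

lemma smooth_fun_p1: "smooth1 H \<Longrightarrow> smooth_fun (\<lambda>x. H (p1 x))"
  and pdiff_p1: "smooth1 H \<Longrightarrow> pdiff i (\<lambda>x. H (p1 x)) = (\<lambda>x. deriv1 H (p1 x))"
  using smooth_fun_linear[of H "\<lambda>_. 1"] has_pd_pdiff[OF has_pd_linear[of H i "\<lambda>_. 1"]] by (simp_all add: p1_def)

lemma smooth_fun_coord1: "smooth1 H \<Longrightarrow> smooth_fun (\<lambda>x. H (x $ j))"
  and pdiff_coord1: "smooth1 H \<Longrightarrow> pdiff i (\<lambda>x. H (x $ j)) = (\<lambda>x. if i = j then deriv1 H (x $ j) else 0)"
  using smooth_fun_linear[of H "\<lambda>l. if l = j then 1 else 0"]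
    has_pd_pdiff[OF has_pd_linear[of H i "\<lambda>l. if l = j then 1 else 0"]]
  by (auto simp: sum_single_coord)

lemma deriv1_of_real: "deriv1 complex_of_real = (\<lambda>t. 1)"
  by (rule deriv1_eqI) (auto intro!: derivative_eq_intros)

lemma smooth_fun_coord: "smooth_fun (\<lambda>x. complex_of_real (x $ j))"
  and pdiff_coord: "pdiff i (\<lambda>x. complex_of_real (x $ j)) = (\<lambda>x. if i = j then 1 else 0)"
  unfolding pdiff_coord1[OF smooth1_of_real] deriv1_of_real
  by (rule smooth_fun_coord1[OF smooth1_of_real] refl)+

subsection \<open>Permutations and dilations of the coordinates\<close>

definition permv :: "('n::finite \<Rightarrow> 'n) \<Rightarrow> real^'n \<Rightarrow> real^'n" where
  "permv \<pi> x = (\<chi> l. x $ \<pi> l)"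

abbreviation swapv :: "'n::finite \<Rightarrow> 'n \<Rightarrow> real^'n \<Rightarrow> real^'n" where
  "swapv i j \<equiv> permv (Transposition.transpose i j)"

lemma permv_nth [simp]: "permv \<pi> x $ l = x $ \<pi> l"
  by (simp add: permv_def)

lemma continuous_on_permv [continuous_intros]: "continuous_on S f \<Longrightarrow> continuous_on S (\<lambda>x. permv \<pi> (f x))"
  unfolding permv_def by (intro continuous_intros)

lemma permv_add_axis:
  assumes "bij \<pi>" shows "permv \<pi> (x + t *\<^sub>R axis (\<pi> i) 1) = permv \<pi> x + t *\<^sub>R axis i 1"
  using assms by (auto simp: vec_eq_iff axis_def bij_def inj_eq)

lemma has_pd_permv:
  assumes "bij \<pi>" "has_pd i f f'"
  shows "has_pd (\<pi> i) (\<lambda>x. f (permv \<pi> x)) (\<lambda>x. f' (permv \<pi> x))"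
  using assms by (simp add: has_pd_def permv_add_axis)

lemma has_pd_permv_inv:
  assumes "bij \<pi>" "has_pd (inv \<pi> i) f f'"
  shows "has_pd i (\<lambda>x. f (permv \<pi> x)) (\<lambda>x. f' (permv \<pi> x))"
  using has_pd_permv[OF assms] assms(1) by (simp add: bij_is_surj surj_f_inv_f)

lemma smooth_fun_permv:
  assumes "bij \<pi>" "smooth_fun f" shows "smooth_fun (\<lambda>x. f (permv \<pi> x))"
proof -
  have "Ck m (\<lambda>x. f (permv \<pi> x))" for m
    using assms(2)
  proof (induction m arbitrary: f)
    case 0
    then show ?case using continuous_on_compose2[OF smooth_fun_continuous continuous_on_permv[OF continuous_on_id]] by simp
  next
    case (Suc m)
    show ?case
    proof (rule Ck_SucI[where f'="\<lambda>i x. pdiff (inv \<pi> i) f (permv \<pi> x)"])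
      show "continuous_on UNIV (\<lambda>x. f (permv \<pi> x))"
        using continuous_on_compose2[OF smooth_fun_continuous[OF Suc.prems] continuous_on_permv[OF continuous_on_id]] by simp
      show "has_pd i (\<lambda>x. f (permv \<pi> x)) (\<lambda>x. pdiff (inv \<pi> i) f (permv \<pi> x))" for i
        using Suc.prems by (intro has_pd_permv_inv[OF assms(1)] smooth_fun_has_pd)
      show "Ck m (\<lambda>x. pdiff (inv \<pi> i) f (permv \<pi> x))" for i
        using Suc.prems by (intro Suc.IH smooth_fun_pdiff)
    qed
  qed
  then show ?thesis by (simp add: smooth_fun_iff_Ck)
qed

lemma bij_transpose: "bij (Transposition.transpose i j)"
  by (simp add: bij_def)

lemma pdiff_permv:
  assumes "bij \<pi>" "smooth_fun f"
  shows "pdiff i (\<lambda>x. f (permv \<pi> x)) = (\<lambda>x. pdiff (inv \<pi> i) f (permv \<pi> x))"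
  using assms by (intro has_pd_pdiff has_pd_permv_inv smooth_fun_has_pd)

lemma has_pd_scale:
  assumes "has_pd i f f'" shows "has_pd i (\<lambda>x. f (c *\<^sub>R x)) (\<lambda>x. of_real c * f' (c *\<^sub>R x))"
  unfolding has_pd_def
proof
  fix x
  have 1: "((\<lambda>t. t * c) has_vector_derivative c) (at 0)" by (auto intro!: derivative_eq_intros)
  have 2: "((\<lambda>t. f (c *\<^sub>R x + t *\<^sub>R axis i 1)) has_vector_derivative f' (c *\<^sub>R x)) (at (0 * c))"
    using assms by (simp add: has_pd_def)
  from vector_diff_chain_at[OF 1 2]
  show "((\<lambda>t. f (c *\<^sub>R (x + t *\<^sub>R axis i 1))) has_vector_derivative of_real c * f' (c *\<^sub>R x)) (at 0)"
    by (simp add: o_def scaleR_conv_of_real algebra_simps)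
qed

lemma smooth_fun_scale:
  assumes "smooth_fun f" shows "smooth_fun (\<lambda>x. f (c *\<^sub>R x))"
proof -
  have cont: "continuous_on UNIV (\<lambda>x. f (c *\<^sub>R x))" if "smooth_fun f" for f
    using continuous_on_compose2[OF smooth_fun_continuous[OF that] continuous_on_scaleR[OF continuous_on_const continuous_on_id]] by auto
  have "Ck m (\<lambda>x. f (c *\<^sub>R x))" for m
    using assms
  proof (induction m arbitrary: f)
    case 0
    then show ?case using cont by simp
  next
    case (Suc m)
    show ?case
      using Suc.prems
      by (intro Ck_SucI[where f'="\<lambda>i x. of_real c * pdiff i f (c *\<^sub>R x)"] cont has_pd_scale
           smooth_fun_has_pd Ck_mult Ck_const Suc.IH smooth_fun_pdiff)
  qed
  then show ?thesis by (simp add: smooth_fun_iff_Ck)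
qed

subsection \<open>Divided differences\<close>

text \<open>For distinct i and j this is the segment from the swapped point (t = 0) to
  \<open>x\<close> (t = 1). All its points have the same coordinate sum, and they stay in the
  orthant when \<open>x\<close> is there.\<close>

definition mixv :: "'n::finite \<Rightarrow> 'n \<Rightarrow> real \<Rightarrow> real^'n \<Rightarrow> real^'n" where
  "mixv i j t x = (\<chi> l. if l = i then t * x $ i + (1 - t) * x $ j
                   else if l = j then (1 - t) * x $ i + t * x $ j else x $ l)"

text \<open>The weight \<open>p\<close> is carried along because differentiating in direction i or j
  multiplies it by \<open>t\<close> or \<open>1 - t\<close>; with it, sums of such averages are
  closed under partial derivatives.\<close>

definition mix_avg :: "'n::finite \<Rightarrow> 'n \<Rightarrow> (real \<Rightarrow> real) \<Rightarrow> (real^'n \<Rightarrow> complex) \<Rightarrow> real^'n \<Rightarrow> complex" where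
  "mix_avg i j p f x = integral {0..1} (\<lambda>t. complex_of_real (p t) * f (mixv i j t x))"

lemma continuous_on_if_const:
  "(b \<Longrightarrow> continuous_on S f) \<Longrightarrow> (\<not> b \<Longrightarrow> continuous_on S g) \<Longrightarrow> continuous_on S (\<lambda>x. if b then f x else g x)"
  by (cases b) auto

lemma continuous_on_mixv [continuous_intros]:
  "continuous_on S f \<Longrightarrow> continuous_on S g \<Longrightarrow> continuous_on S (\<lambda>x. mixv i j (f x) (g x))"
  unfolding mixv_def
  by (intro continuous_on_vec_lambda continuous_on_if_const continuous_intros)

text \<open>Along the segment two coordinates move at once. The chain rule needs total
  differentiability in their plane, which follows from both partial derivatives and the continuity
  of one of them.\<close>

lemma has_vector_derivative_two_directions:
  assumes i: "has_pd i f fi" and j: "has_pd j f fj"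
    and c: "continuous_on UNIV fj"
  shows "((\<lambda>s. f (y + (s*a) *\<^sub>R axis i 1 + (s*b) *\<^sub>R axis j 1)) has_vector_derivative
     of_real a * fi (y + (s*a) *\<^sub>R axis i 1 + (s*b) *\<^sub>R axis j 1) + of_real b * fj (y + (s*a) *\<^sub>R axis i 1 + (s*b) *\<^sub>R axis j 1)) (at s)"
proof -
  define Y where "Y = (\<lambda>p q. y + p *\<^sub>R axis i 1 + q *\<^sub>R axis j (1::real))"
  have "((\<lambda>(p, q). f (Y p q)) has_derivative
     (\<lambda>(tp, tq). tp *\<^sub>R fi (Y (s*a) (s*b)) + blinfun_apply (blinfun_scaleR_left (fj (Y (s*a) (s*b)))) tq)) (at (s*a, s*b) within UNIV \<times> UNIV)"
  proof (rule has_derivative_partialsI)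
    have "((\<lambda>p. f ((y + (s*b) *\<^sub>R axis j 1) + p *\<^sub>R axis i 1)) has_vector_derivative fi ((y + (s*b) *\<^sub>R axis j 1) + (s*a) *\<^sub>R axis i 1)) (at (s*a))"
      by (rule has_pd_at[OF i])
    then show "((\<lambda>p. f (Y p (s*b))) has_derivative (\<lambda>tp. tp *\<^sub>R fi (Y (s*a) (s*b)))) (at (s*a) within UNIV)"
      by (simp add: Y_def has_vector_derivative_def algebra_simps)
    show "((\<lambda>q. f (Y p q)) has_derivative blinfun_apply (blinfun_scaleR_left (fj (Y p q)))) (at q within UNIV)" for p q
      using has_pd_at[OF j, of "y + p *\<^sub>R axis i 1" q] by (simp add: Y_def has_vector_derivative_def)
    have "continuous_on UNIV (\<lambda>(p, q). blinfun_scaleR_left (fj (Y p q)))"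
      unfolding split_beta Y_def
      by (intro bounded_linear.continuous_on[OF bounded_linear_blinfun_scaleR_left] continuous_on_compose2[OF c] continuous_intros) auto
    then show "continuous (at (s*a, s*b) within UNIV \<times> UNIV) (\<lambda>(p, q). blinfun_scaleR_left (fj (Y p q)))"
      by (simp add: continuous_on_eq_continuous_at)
  qed auto
  then have 1: "((\<lambda>(p, q). f (Y p q)) has_derivative
     (\<lambda>(tp, tq). tp *\<^sub>R fi (Y (s*a) (s*b)) + tq *\<^sub>R fj (Y (s*a) (s*b)))) (at (s*a, s*b))"
    by simp
  have 2: "((\<lambda>s. (s*a, s*b)) has_derivative (\<lambda>h. (h*a, h*b))) (at s)"
    by (auto intro!: derivative_eq_intros)
  from diff_chain_at[OF 2 1]
  show ?thesis
    unfolding has_vector_derivative_def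
    by (simp add: o_def Y_def scaleR_conv_of_real algebra_simps)
qed

lemma smooth_fun_compose_continuous:
  "smooth_fun f \<Longrightarrow> continuous_on S g \<Longrightarrow> continuous_on S (\<lambda>x. f (g x))"
  using continuous_on_compose2[OF smooth_fun_continuous] by simp

lemma mixv_add_axis:
  assumes "i \<noteq> j"
  shows "mixv i j t (x + s *\<^sub>R axis l 1) = mixv i j t x
     + (s * (if l = i then t else if l = j then 1 - t else 0)) *\<^sub>R axis i 1
     + (s * (if l = j then t else if l = i then 1 - t else 0)) *\<^sub>R axis j 1
     + (s * (if l = i \<or> l = j then 0 else 1)) *\<^sub>R axis l 1"
  using assms by (auto simp: vec_eq_iff mixv_def axis_def algebra_simps)

definition mix_avg_pd :: "'n \<Rightarrow> 'n::finite \<Rightarrow> 'n \<Rightarrow> (real \<Rightarrow> real) \<Rightarrow> (real^'n \<Rightarrow> complex) \<Rightarrow> real^'n \<Rightarrow> complex" where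
  "mix_avg_pd l i j p f =
    (if l = i then \<lambda>x. mix_avg i j (\<lambda>t. p t * t) (pdiff i f) x + mix_avg i j (\<lambda>t. p t * (1 - t)) (pdiff j f) x
     else if l = j then \<lambda>x. mix_avg i j (\<lambda>t. p t * (1 - t)) (pdiff i f) x + mix_avg i j (\<lambda>t. p t * t) (pdiff j f) x
     else mix_avg i j p (pdiff l f))"

lemma mix_avg_integrable:
  "continuous_on {0..1} p \<Longrightarrow> smooth_fun f \<Longrightarrow> (\<lambda>t. complex_of_real (p t) * f (mixv i j t x)) integrable_on {0..1}"
  by (intro integrable_continuous_real continuous_intros smooth_fun_compose_continuous)

lemma continuous_on_mix_avg:
  assumes "continuous_on {0..1} p" "smooth_fun f"
  shows "continuous_on UNIV (mix_avg i j p f)"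
proof -
  have "continuous_on (UNIV \<times> cbox 0 1) (\<lambda>(x, t). complex_of_real (p t) * f (mixv i j t x))"
    unfolding split_beta
    by (intro continuous_intros smooth_fun_compose_continuous[OF assms(2)] continuous_on_compose2[OF assms(1)]) auto
  from integral_continuous_on_param[OF this]
  have "continuous_on UNIV (\<lambda>x. integral (cbox 0 1) (\<lambda>t. complex_of_real (p t) * f (mixv i j t x)))" .
  then show ?thesis by (simp add: mix_avg_def[abs_def])
qed

lemma has_pd_mix_avg:
  assumes "i \<noteq> j" "continuous_on {0..1} p" "smooth_fun f"
  shows "has_pd l (mix_avg i j p f) (mix_avg_pd l i j p f)"
  unfolding has_pd_def
proof
  fix x :: "real^'a"
  define d where "d = (\<lambda>t y. if l = i then of_real t * pdiff i f y + of_real (1 - t) * pdiff j f y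
     else if l = j then of_real (1 - t) * pdiff i f y + of_real t * pdiff j f y else pdiff l f y)"
  have "((\<lambda>s. integral (cbox 0 1) (\<lambda>t. complex_of_real (p t) * f (mixv i j t (x + s *\<^sub>R axis l 1))))
     has_vector_derivative integral (cbox 0 1) (\<lambda>t. complex_of_real (p t) * d t (mixv i j t (x + 0 *\<^sub>R axis l 1)))) (at 0 within UNIV)"
  proof (rule leibniz_rule_vector_derivative)
    fix s t :: real
    note td = has_vector_derivative_two_directions[OF smooth_fun_has_pd smooth_fun_has_pd smooth_fun_continuous[OF smooth_fun_pdiff], OF assms(3) assms(3) assms(3)]
    have "((\<lambda>s. f (mixv i j t (x + s *\<^sub>R axis l 1))) has_vector_derivative d t (mixv i j t (x + s *\<^sub>R axis l 1))) (at s)"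
    proof -
      consider "l = i" | "l = j" "l \<noteq> i" | "l \<noteq> i" "l \<noteq> j" by blast
      then show ?thesis
      proof cases
        case 1 then show ?thesis using td[where i=i and j=j and y="mixv i j t x" and a=t and b="1 - t" and s=s] assms(1) unfolding mixv_add_axis[OF assms(1)] d_def by simp
      next
        case 2 then show ?thesis using td[where i=i and j=j and y="mixv i j t x" and a="1 - t" and b=t and s=s] assms(1) unfolding mixv_add_axis[OF assms(1)] d_def by simp
      next
        case 3 then show ?thesis using has_pd_at[OF smooth_fun_has_pd[OF assms(3)], where i=l and x="mixv i j t x" and s=s] unfolding mixv_add_axis[OF assms(1)] d_def by simp
      qed
    qed
    then show "((\<lambda>s. complex_of_real (p t) * f (mixv i j t (x + s *\<^sub>R axis l 1))) has_vector_derivative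
      complex_of_real (p t) * d t (mixv i j t (x + s *\<^sub>R axis l 1))) (at s within UNIV)"
      by (auto intro!: derivative_eq_intros)
  next
    show "(\<lambda>t. complex_of_real (p t) * f (mixv i j t (x + s *\<^sub>R axis l 1))) integrable_on cbox 0 1" for s
      using mix_avg_integrable[OF assms(2,3)] by simp
    show "continuous_on (UNIV \<times> cbox 0 1) (\<lambda>(s, t). complex_of_real (p t) * d t (mixv i j t (x + s *\<^sub>R axis l 1)))"
      unfolding split_beta d_def
      by (intro continuous_on_if_const continuous_intros smooth_fun_compose_continuous[OF smooth_fun_pdiff[OF assms(3)]]
           continuous_on_compose2[OF assms(2)]) auto
  qed auto
  moreover have "integral (cbox 0 1) (\<lambda>t. complex_of_real (p t) * d t (mixv i j t (x + 0 *\<^sub>R axis l 1))) = mix_avg_pd l i j p f x"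
  proof -
    have i: "(\<lambda>t. complex_of_real (p t * t) * pdiff k f (mixv i j t x)) integrable_on {0..1}"
      "(\<lambda>t. complex_of_real (p t * (1 - t)) * pdiff k f (mixv i j t x)) integrable_on {0..1}" for k
      by (intro mix_avg_integrable smooth_fun_pdiff assms continuous_intros)+
    have a: "integral {0..1} (\<lambda>t. complex_of_real (p t) * (of_real t * pdiff k f (mixv i j t x) + of_real (1 - t) * pdiff m f (mixv i j t x)))
       = integral {0..1} (\<lambda>t. complex_of_real (p t * t) * pdiff k f (mixv i j t x))
       + integral {0..1} (\<lambda>t. complex_of_real (p t * (1 - t)) * pdiff m f (mixv i j t x))" for k m
      by (subst integral_add[OF i(1) i(2), symmetric]) (simp add: algebra_simps)
    have b: "integral {0..1} (\<lambda>t. complex_of_real (p t) * (of_real (1 - t) * pdiff k f (mixv i j t x) + of_real t * pdiff m f (mixv i j t x)))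
       = integral {0..1} (\<lambda>t. complex_of_real (p t * (1 - t)) * pdiff k f (mixv i j t x))
       + integral {0..1} (\<lambda>t. complex_of_real (p t * t) * pdiff m f (mixv i j t x))" for k m
      by (subst integral_add[OF i(2) i(1), symmetric]) (simp add: algebra_simps)
    show ?thesis
    proof (cases "l = i \<or> l = j")
      case True
      then show ?thesis using a[of i j] b[of i j] by (auto simp: mix_avg_pd_def mix_avg_def d_def)
    qed (simp add: mix_avg_pd_def mix_avg_def d_def)
  qed
  ultimately show "((\<lambda>s. mix_avg i j p f (x + s *\<^sub>R axis l 1)) has_vector_derivative mix_avg_pd l i j p f x) (at 0)"
    by (simp add: mix_avg_def)
qed

lemma smooth_fun_mix_avg:
  assumes "i \<noteq> j" "continuous_on {0..1} p" "smooth_fun f"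
  shows "smooth_fun (mix_avg i j p f)"
proof -
  have "Ck m (mix_avg i j p f)" for m
    using assms(2,3)
  proof (induction m arbitrary: p f)
    case 0
    then show ?case using continuous_on_mix_avg by simp
  next
    case (Suc m)
    have "Ck m (mix_avg_pd l i j p f)" for l
      unfolding mix_avg_pd_def using Suc.prems assms(1)
      by (auto intro!: Ck_add Suc.IH smooth_fun_pdiff continuous_intros)
    then show ?case
      using Suc.prems by (intro Ck_SucI[where f'="\<lambda>l. mix_avg_pd l i j p f"] continuous_on_mix_avg has_pd_mix_avg[OF assms(1)])
  qed
  then show ?thesis by (simp add: smooth_fun_iff_Ck)
qed

text \<open>Hadamard's form of the quotient of f - f o \<sigma>_ij by x_i - x_j: the mean of the
  derivative along the segment. It stays smooth on the hyperplane x_i = x_j.\<close>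

definition ddiff :: "'n::finite \<Rightarrow> 'n \<Rightarrow> (real^'n \<Rightarrow> complex) \<Rightarrow> real^'n \<Rightarrow> complex" where
  "ddiff i j f = mix_avg i j (\<lambda>_. 1) (\<lambda>x. pdiff i f x - pdiff j f x)"

lemma smooth_fun_ddiff: "i \<noteq> j \<Longrightarrow> smooth_fun f \<Longrightarrow> smooth_fun (ddiff i j f)"
  unfolding ddiff_def by (intro smooth_fun_mix_avg smooth_fun_diff smooth_fun_pdiff continuous_intros)

lemma ddiff_eq:
  assumes "i \<noteq> j" "smooth_fun f"
  shows "of_real (x $ i - x $ j) * ddiff i j f x = f x - f (swapv i j x)"
proof -
  let ?g = "\<lambda>y. pdiff i f y - pdiff j f y"
  define d where "d = x $ i - x $ j"
  have mix: "mixv i j t x = swapv i j x + (t * d) *\<^sub>R axis i 1 + (t * (- d)) *\<^sub>R axis j 1" for t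
    using assms(1) by (auto simp: vec_eq_iff mixv_def axis_def d_def Transposition.transpose_def algebra_simps)
  have "((\<lambda>t. of_real d * ?g (mixv i j t x)) has_integral (f (mixv i j 1 x) - f (mixv i j 0 x))) {0..1}"
  proof (rule fundamental_theorem_of_calculus)
    fix t :: real
    note td = has_vector_derivative_two_directions[OF smooth_fun_has_pd smooth_fun_has_pd smooth_fun_continuous[OF smooth_fun_pdiff], OF assms(2) assms(2) assms(2)]
    have "((\<lambda>t. f (mixv i j t x)) has_vector_derivative of_real d * ?g (mixv i j t x)) (at t)"
      unfolding mix using td[where i=i and j=j and y="swapv i j x" and a=d and b="- d" and s=t] by (simp add: algebra_simps)
    then show "((\<lambda>t. f (mixv i j t x)) has_vector_derivative of_real d * ?g (mixv i j t x)) (at t within {0..1})"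
      by (rule has_vector_derivative_at_within)
  qed simp
  moreover have "((\<lambda>t. of_real d * ?g (mixv i j t x)) has_integral (of_real d * ddiff i j f x)) {0..1}"
  proof -
    have "(\<lambda>t. complex_of_real 1 * ?g (mixv i j t x)) integrable_on {0..1}"
      using assms by (intro mix_avg_integrable smooth_fun_diff smooth_fun_pdiff continuous_intros)
    then show ?thesis unfolding ddiff_def mix_avg_def
      by (intro has_integral_mult_right) (simp add: has_integral_iff)
  qed
  moreover have "mixv i j 1 x = x" "mixv i j 0 x = swapv i j x"
    using assms(1) by (auto simp: vec_eq_iff mixv_def Transposition.transpose_def)
  ultimately show ?thesis by (auto simp: d_def dest: has_integral_unique)
qed

text \<open>Off the hyperplane x_i = x_j the relation can be divided by x_i - x_j, and points on it
  are limits of such points along axis i. The calculus rules for \<open>ddiff\<close> thus reduce to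
  checking algebraic identities.\<close>

lemma ddiff_unique:
  assumes "i \<noteq> j" "smooth_fun f" "continuous_on UNIV g"
    and eq: "\<And>x. of_real (x $ i - x $ j) * g x = f x - f (swapv i j x)"
  shows "ddiff i j f = g"
proof
  fix x
  let ?h = "\<lambda>s::real. ddiff i j f (x + s *\<^sub>R axis i 1) - g (x + s *\<^sub>R axis i 1)"
  show "ddiff i j f x = g x"
  proof (cases "x $ i = x $ j")
    case False
    then show ?thesis using eq[of x] ddiff_eq[OF assms(1,2), of x] by (metis eq_iff_diff_eq_0 mult_left_cancel of_real_eq_0_iff)
  next
    case True
    have "continuous_on UNIV ?h"
      by (intro continuous_intros smooth_fun_compose_continuous[OF smooth_fun_ddiff[OF assms(1,2)]] continuous_on_compose2[OF assms(3)]) auto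
    then have "(?h \<longlongrightarrow> ?h 0) (at 0)" unfolding continuous_on_def by blast
    moreover have "?h s = 0" if "s \<noteq> 0" for s
    proof -
      let ?y = "x + s *\<^sub>R axis i 1"
      have "?y $ i - ?y $ j \<noteq> 0" using that True assms(1) by (simp add: axis_def)
      then show ?thesis using eq[of ?y] ddiff_eq[OF assms(1,2), of ?y] by (metis eq_iff_diff_eq_0 mult_left_cancel of_real_eq_0_iff)
    qed
    then have "(?h \<longlongrightarrow> 0) (at 0)" by (intro tendsto_eventually) (auto simp: eventually_at_filter)
    ultimately have "?h 0 = 0" using tendsto_unique[OF trivial_limit_at] by blast
    then show ?thesis by simp
  qed
qed

lemma ddiff_add:
  assumes "i \<noteq> j" "smooth_fun f" "smooth_fun g"
  shows "ddiff i j (\<lambda>x. f x + g x) = (\<lambda>x. ddiff i j f x + ddiff i j g x)"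
  using assms ddiff_eq[of i j f] ddiff_eq[of i j g]
  by (intro ddiff_unique smooth_fun_add smooth_fun_continuous smooth_fun_ddiff) (auto simp: algebra_simps)

lemma ddiff_mult:
  assumes "i \<noteq> j" "smooth_fun f" "smooth_fun g"
  shows "ddiff i j (\<lambda>x. f x * g x) = (\<lambda>x. ddiff i j f x * g x + f (swapv i j x) * ddiff i j g x)"
proof (rule ddiff_unique)
  fix x
  have "of_real (x $ i - x $ j) * (ddiff i j f x * g x + f (swapv i j x) * ddiff i j g x)
    = (of_real (x $ i - x $ j) * ddiff i j f x) * g x + f (swapv i j x) * (of_real (x $ i - x $ j) * ddiff i j g x)"
    by (simp add: algebra_simps)
  also have "\<dots> = f x * g x - f (swapv i j x) * g (swapv i j x)"
    unfolding ddiff_eq[OF assms(1,2)] ddiff_eq[OF assms(1,3)] by (simp add: algebra_simps)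
  finally show "of_real (x $ i - x $ j) * (ddiff i j f x * g x + f (swapv i j x) * ddiff i j g x) = \<dots>" .
qed (use assms in \<open>auto intro!: smooth_fun_continuous smooth_fun_add smooth_fun_mult smooth_fun_ddiff smooth_fun_permv bij_transpose\<close>)

lemma ddiff_symmetric:
  assumes "i \<noteq> j" "smooth_fun f" "\<And>x. f (swapv i j x) = f x"
  shows "ddiff i j f = (\<lambda>x. 0)"
  using assms by (intro ddiff_unique) auto

lemma ddiff_const: "i \<noteq> j \<Longrightarrow> ddiff i j (\<lambda>x. c) = (\<lambda>x. 0)"
  by (rule ddiff_symmetric) (auto intro: smooth_fun_const)

lemma ddiff_mult_symmetric:
  assumes "i \<noteq> j" "smooth_fun f" "smooth_fun g" "\<And>x. g (swapv i j x) = g x"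
  shows "ddiff i j (\<lambda>x. f x * g x) = (\<lambda>x. ddiff i j f x * g x)"
  using ddiff_mult[OF assms(1-3)] ddiff_symmetric[OF assms(1,3,4)] by simp

lemma ddiff_permv:
  assumes "i \<noteq> j" "smooth_fun f" "bij \<pi>" "\<pi> i = i" "\<pi> j = j"
  shows "ddiff i j (\<lambda>x. f (permv \<pi> x)) = (\<lambda>x. ddiff i j f (permv \<pi> x))"
proof (rule ddiff_unique)
  fix x
  have "Transposition.transpose i j (\<pi> l) = \<pi> (Transposition.transpose i j l)" for l
    using assms by (metis bij_def inj_eq Transposition.transpose_def)
  then have "permv \<pi> (swapv i j x) = swapv i j (permv \<pi> x)" by (simp add: vec_eq_iff)
  then show "of_real (x $ i - x $ j) * ddiff i j f (permv \<pi> x) = f (permv \<pi> x) - f (permv \<pi> (swapv i j x))"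
    using ddiff_eq[OF assms(1,2), of "permv \<pi> x"] assms by simp
qed (use assms in \<open>auto intro!: smooth_fun_continuous smooth_fun_ddiff smooth_fun_permv\<close>)

lemma p1_mixv [simp]: "i \<noteq> j \<Longrightarrow> p1 (mixv i j t x) = p1 x"
proof -
  assume ij: "i \<noteq> j"
  have "p1 (mixv i j t x) = mixv i j t x $ i + mixv i j t x $ j + (\<Sum>l\<in>UNIV - {i} - {j}. mixv i j t x $ l)"
    unfolding p1_def using ij by (simp add: sum.remove[of UNIV i] sum.remove[of "UNIV - {i}" j])
  also have "\<dots> = x $ i + x $ j + (\<Sum>l\<in>UNIV - {i} - {j}. x $ l)"
    using ij by (auto simp: mixv_def algebra_simps intro!: sum.cong)
  also have "\<dots> = p1 x"
    unfolding p1_def using ij by (simp add: sum.remove[of UNIV i] sum.remove[of "UNIV - {i}" j])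
  finally show ?thesis .
qed

lemma p1_permv [simp]: "bij \<pi> \<Longrightarrow> p1 (permv \<pi> x) = p1 x"
  unfolding p1_def by (simp add: sum.reindex_bij_betw[of \<pi> UNIV UNIV "\<lambda>l. x $ l"])

lemma pdiff_cong_open:
  assumes "open U" "\<And>x. x \<in> U \<Longrightarrow> f x = g x" "x \<in> U"
  shows "pdiff i f x = pdiff i g x"
proof -
  have "\<forall>\<^sub>F t in nhds 0. x + t *\<^sub>R axis i 1 \<in> U"
  proof (rule topological_tendstoD[OF _ assms(1)])
    have "((\<lambda>t. x + t *\<^sub>R axis i 1) \<longlongrightarrow> x + 0 *\<^sub>R axis i 1) (nhds 0)" by (intro tendsto_intros filterlim_ident)
    then show "((\<lambda>t. x + t *\<^sub>R axis i 1) \<longlongrightarrow> x) (nhds 0)" by simp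
  qed (rule assms(3))
  then have "\<forall>\<^sub>F t in nhds 0. f (x + t *\<^sub>R axis i 1) = g (x + t *\<^sub>R axis i 1)"
    by (rule eventually_mono) (rule assms(2))
  then show ?thesis unfolding pdiff_def by (intro vector_derivative_cong_eq) auto
qed

subsection \<open>Integration over \<open>real^'n\<close>\<close>

lemma axis_Basis_image: "(Basis :: (real^'n::finite) set) = (\<lambda>i. axis i 1) ` UNIV"
  by (auto simp: Basis_vec_def)

lemma nn_integral_prod_coords:
  fixes g :: "'n::finite \<Rightarrow> real \<Rightarrow> ennreal"
  assumes [measurable]: "\<And>i. g i \<in> borel_measurable borel"
  shows "(\<integral>\<^sup>+x. (\<Prod>i\<in>UNIV. g i (x $ i)) \<partial>(lborel :: (real^'n) measure)) = (\<Prod>i\<in>UNIV. \<integral>\<^sup>+t. g i t \<partial>lborel)"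
proof -
  have inj: "inj (\<lambda>i::'n. axis i (1::real))" by (auto simp: inj_on_def axis_eq_axis)
  define f where "f b = g (inv (\<lambda>i. axis i 1) b)" for b :: "real^'n"
  have f: "f (axis i 1) = g i" for i unfolding f_def using inv_f_f[OF inj] by simp
  have "(\<integral>\<^sup>+x. (\<Prod>b\<in>Basis. f b (x \<bullet> b)) \<partial>(lborel :: (real^'n) measure)) = (\<Prod>b\<in>Basis. (\<integral>\<^sup>+x. f b x \<partial>lborel))"
    by (rule nn_integral_lborel_prod) (auto simp: f_def)
  then show ?thesis
    unfolding axis_Basis_image by (simp add: prod.reindex[OF inj] f inner_axis)
qed

lemma integrable_prod_coords:
  fixes g :: "'n::finite \<Rightarrow> real \<Rightarrow> real"
  assumes g: "\<And>i. integrable lborel (g i)" and nn: "\<And>i t. 0 \<le> g i t"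
  shows "integrable (lborel :: (real^'n) measure) (\<lambda>x. \<Prod>i\<in>UNIV. g i (x $ i))"
proof (rule integrableI_nonneg)
  have [measurable]: "g i \<in> borel_measurable borel" for i using g[of i] by auto
  show "(\<lambda>x. \<Prod>i\<in>UNIV. g i (x $ i)) \<in> borel_measurable (lborel :: (real^'n) measure)" by measurable
  have "(\<integral>\<^sup>+x. ennreal (\<Prod>i\<in>UNIV. g i (x $ i)) \<partial>(lborel :: (real^'n) measure)) = (\<integral>\<^sup>+x. (\<Prod>i\<in>UNIV. ennreal (g i (x $ i))) \<partial>lborel)"
    by (simp add: prod_ennreal nn)
  also have "\<dots> = (\<Prod>i\<in>UNIV. \<integral>\<^sup>+t. ennreal (g i t) \<partial>lborel)" by (rule nn_integral_prod_coords) simp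
  also have "\<dots> < \<infinity>"
  proof -
    have "(\<integral>\<^sup>+t. ennreal (g i t) \<partial>lborel) = ennreal (\<integral>t. g i t \<partial>lborel)" for i
      by (rule nn_integral_eq_integral[OF g]) (simp add: nn)
    then show ?thesis by (simp add: prod_ennreal integral_nonneg_AE nn)
  qed
  finally show "(\<integral>\<^sup>+x. ennreal (\<Prod>i\<in>UNIV. g i (x $ i)) \<partial>(lborel :: (real^'n) measure)) < \<infinity>" .
qed (simp add: prod_nonneg nn)

lemma borel_measurable_permv [measurable]: "permv \<pi> \<in> borel_measurable borel"
  by (rule borel_measurable_continuous_onI) (intro continuous_intros)

lemma lborel_distr_permv:
  assumes "bij \<pi>"
  shows "distr lborel borel (permv \<pi>) = (lborel :: (real^'n::finite) measure)"
proof (rule lborel_eqI[symmetric])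
  fix l u :: "real^'n" assume le: "\<And>b. b \<in> Basis \<Longrightarrow> l \<bullet> b \<le> u \<bullet> b"
  have le': "l $ i \<le> u $ i" for i using le[of "axis i 1"] by (simp add: inner_axis axis_in_Basis_iff)
  define l' u' where "l' = permv (inv \<pi>) l" and "u' = permv (inv \<pi>) u"
  have inv: "inv \<pi> (\<pi> i) = i" "\<pi> (inv \<pi> i) = i" for i
    using assms by (auto simp: bij_def inv_f_f surj_f_inv_f)
  have "permv \<pi> -` box l u = box l' u'"
    unfolding l'_def u'_def by (auto simp: mem_box_cart) (metis inv)+
  moreover have "emeasure lborel (box l' u') = (\<Prod>b\<in>Basis. (u - l) \<bullet> b)"
  proof -
    have 1: "(\<Prod>b\<in>Basis. (u' - l') \<bullet> b) = (\<Prod>b\<in>Basis. (u - l) \<bullet> b)"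
    proof -
      have inj: "inj (\<lambda>i::'n. axis i (1::real))" by (auto simp: inj_on_def axis_eq_axis)
      have "(\<Prod>i\<in>UNIV. (u' - l') $ i) = (\<Prod>i\<in>UNIV. (u - l) $ i)"
        using prod.reindex_bij_betw[of "inv \<pi>" UNIV UNIV "\<lambda>i. (u - l) $ i"] assms
        by (simp add: l'_def u'_def bij_imp_bij_inv)
      then show ?thesis unfolding axis_Basis_image by (simp add: prod.reindex[OF inj] inner_axis)
    qed
    have "l' \<bullet> b \<le> u' \<bullet> b" if "b \<in> Basis" for b
      using that le' by (auto simp: l'_def u'_def axis_Basis_image inner_axis)
    from emeasure_lborel_box[OF this] show ?thesis unfolding 1 .
  qed
  ultimately show "emeasure (distr lborel borel (permv \<pi>)) (box l u) = (\<Prod>b\<in>Basis. (u - l) \<bullet> b)"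
    by (subst emeasure_distr) auto
qed simp

lemma integral_lborel_permv:
  fixes f :: "real^'n::finite \<Rightarrow> 'b::{banach, second_countable_topology}"
  assumes "bij \<pi>" and [measurable]: "f \<in> borel_measurable borel"
  shows "(\<integral>x. f (permv \<pi> x) \<partial>lborel) = (\<integral>x. f x \<partial>lborel)"
proof -
  have "(\<integral>x. f x \<partial>lborel) = (\<integral>x. f x \<partial>(distr lborel borel (permv \<pi>)))"
    by (simp add: lborel_distr_permv[OF assms(1)])
  also have "\<dots> = (\<integral>x. f (permv \<pi> x) \<partial>lborel)" by (rule integral_distr) auto
  finally show ?thesis by simp
qed

lemma lborel_distr_translate: "distr lborel borel (\<lambda>x. x + c) = (lborel :: 'a::euclidean_space measure)"
  using lborel_distr_plus[of c] by (simp add: add.commute[of _ c])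

lemma integrable_translate:
  fixes f :: "'a::euclidean_space \<Rightarrow> 'b::{banach, second_countable_topology}"
  assumes "integrable lborel f" shows "integrable lborel (\<lambda>x. f (x + c))"
proof -
  have "f \<in> borel_measurable borel" using assms by auto
  then show ?thesis
    using integrable_distr_eq[of "\<lambda>x. x + c" lborel borel f] assms by (simp add: lborel_distr_translate)
qed

lemma integral_translate:
  fixes f :: "'a::euclidean_space \<Rightarrow> 'b::{banach, second_countable_topology}"
  assumes "integrable lborel f" shows "(\<integral>x. f (x + c) \<partial>lborel) = (\<integral>x. f x \<partial>lborel)"
proof -
  have "f \<in> borel_measurable borel" using assms by auto
  then show ?thesis
    using integral_distr[of "\<lambda>x. x + c" lborel borel f] by (simp add: lborel_distr_translate)
qed

text \<open>Averaging F' over the translates by s e_i with 0 <= s <= 1 does not change its integral.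
  By Fubini the average integrates to the integral of F(x + e_i) - F(x), which is 0 by translation
  invariance; integrability replaces any decay at infinity.\<close>

lemma integral_partial_derivative_eq_0:
  fixes F F' :: "real^'n::finite \<Rightarrow> complex"
  assumes pd: "has_pd i F F'" and cont: "\<And>x. continuous_on UNIV (\<lambda>t. F' (x + t *\<^sub>R axis i 1))"
    and intF: "integrable lborel F" and intF': "integrable lborel F'"
  shows "(\<integral>x. F' x \<partial>lborel) = 0"
proof -
  let ?e = "axis i 1 :: real^'n"
  note trI = integrable_translate integral_translate
  have [measurable]: "F' \<in> borel_measurable borel" using intF' by auto
  let ?G = "\<lambda>(s::real, x). indicator {0..1} s *\<^sub>R F' (x + s *\<^sub>R ?e)"
  have int: "integrable (lborel \<Otimes>\<^sub>M lborel) ?G"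
  proof (rule lborel_pair.Fubini_integrable)
    show "?G \<in> borel_measurable (lborel \<Otimes>\<^sub>M lborel)" by measurable
    have "(\<integral>x. norm (?G (s, x)) \<partial>lborel) = indicator {0..1} s * (\<integral>x. norm (F' x) \<partial>lborel)" for s
      using trI(2)[OF integrable_norm[OF intF'], of "s *\<^sub>R ?e"] by simp
    moreover have "integrable lborel (\<lambda>s. indicator {0..1::real} s * (\<integral>x. norm (F' x) \<partial>lborel))" by simp
    ultimately show "integrable lborel (\<lambda>s. \<integral>x. norm (?G (s, x)) \<partial>lborel)" by presburger
    show "AE s in lborel. integrable lborel (\<lambda>x. ?G (s, x))"
      using trI(1)[OF intF'] by auto
  qed
  have "(\<integral>x. (\<integral>s. ?G (s, x) \<partial>lborel) \<partial>lborel) = (\<integral>s. (\<integral>x. ?G (s, x) \<partial>lborel) \<partial>lborel)"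
    using lborel_pair.Fubini_integral[of "\<lambda>s x. ?G (s, x)"] int by simp
  also have "\<dots> = (\<integral>x. F' x \<partial>lborel)"
    using trI(2)[OF intF'] by simp
  finally have 1: "(\<integral>x. (\<integral>s. ?G (s, x) \<partial>lborel) \<partial>lborel) = (\<integral>x. F' x \<partial>lborel)" .
  have "(\<integral>s. ?G (s, x) \<partial>lborel) = F (x + ?e) - F x" for x
  proof -
    have "(\<integral>s. indicator {0..1} s *\<^sub>R F' (x + s *\<^sub>R ?e) \<partial>lborel) = F (x + 1 *\<^sub>R ?e) - F (x + 0 *\<^sub>R ?e)"
      by (rule integral_FTC_Icc)
         (auto intro: has_vector_derivative_at_within has_pd_at[OF pd] continuous_on_subset[OF cont])
    then show ?thesis by simp
  qed
  then have "(\<integral>x. F' x \<partial>lborel) = (\<integral>x. F (x + ?e) - F x \<partial>lborel)" using 1 by simp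
  also have "\<dots> = 0" using trI[OF intF] intF by simp
  finally show ?thesis .
qed

subsection \<open>Holomorphic dependence of integrals on a parameter\<close>

text \<open>Dominated convergence for the difference quotients. Cauchy's inequality on discs of
  radius r / 2 turns the majorant of \<open>f\<close> into the bound 2 G / r for its derivative,
  hence for the quotients.\<close>

lemma holomorphic_on_integral:
  fixes f :: "complex \<Rightarrow> 'a \<Rightarrow> complex"
  assumes U: "open U" and meas: "\<And>z. z \<in> U \<Longrightarrow> f z \<in> borel_measurable M"
    and hol: "\<And>x. x \<in> space M \<Longrightarrow> (\<lambda>z. f z x) holomorphic_on U"
    and dom: "\<And>z. z \<in> U \<Longrightarrow> \<exists>r>0. \<exists>G. integrable M G \<and> cball z r \<subseteq> U \<and> (\<forall>w\<in>cball z r. \<forall>x\<in>space M. norm (f w x) \<le> G x)"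
  shows "(\<lambda>z. \<integral>x. f z x \<partial>M) holomorphic_on U"
  unfolding holomorphic_on_def
proof
  fix z assume z: "z \<in> U"
  obtain r G where r: "r > 0" and G: "integrable M G" and rU: "cball z r \<subseteq> U"
    and derivs_bounded: "\<And>w x. w \<in> cball z r \<Longrightarrow> x \<in> space M \<Longrightarrow> norm (f w x) \<le> G x"
    using dom[OF z] by blast
  have int: "integrable M (f w)" if "w \<in> cball z r" for w
  proof (rule Bochner_Integration.integrable_bound[OF G])
    show "f w \<in> borel_measurable M" using that rU meas by blast
    show "AE x in M. norm (f w x) \<le> norm (G x)"
      using derivs_bounded[OF that] by (intro AE_I2) (simp add: order_trans[OF _ abs_ge_self])
  qed
  define d where "d x = deriv (\<lambda>z. f z x) z" for x
  define q where "q w x = (f w x - f z x) / (w - z)" for w x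
  have hol': "(\<lambda>z. f z x) holomorphic_on cball z r" if "x \<in> space M" for x
    using hol[OF that] rU holomorphic_on_subset by blast
  have der: "((\<lambda>z. f z x) has_field_derivative deriv (\<lambda>z. f z x) w) (at w)" if "x \<in> space M" "w \<in> cball z r" for x w
    using hol[OF that(1)] U rU that(2) holomorphic_derivI by blast
  have qbd: "norm (q w x) \<le> 2 * G x / r" if w: "w \<in> cball z (r/2)" "w \<noteq> z" and x: "x \<in> space M" for w x
  proof -
    have "norm (f w x - f z x) \<le> (2 * G x / r) * norm (w - z)"
    proof (rule field_differentiable_bound[of "cball z (r/2)" "\<lambda>z. f z x" "\<lambda>w. deriv (\<lambda>z. f z x) w"])
      fix v assume v: "v \<in> cball z (r/2)"
      have sub: "cball v (r/2) \<subseteq> cball z r"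
      proof
        fix y assume "y \<in> cball v (r/2)"
        then show "y \<in> cball z r" using v dist_triangle[of z y v] by (simp add: dist_commute)
      qed
      show "((\<lambda>z. f z x) has_field_derivative deriv (\<lambda>z. f z x) v) (at v within cball z (r/2))"
      proof (rule has_field_derivative_at_within, rule der[OF x])
        show "v \<in> cball z r" using v r by simp
      qed
      have "norm ((deriv ^^ 1) (\<lambda>z. f z x) v) \<le> fact 1 * G x / (r/2) ^ 1"
      proof (rule Cauchy_inequality)
        show "(\<lambda>z. f z x) holomorphic_on ball v (r/2)"
          using hol'[OF x] sub holomorphic_on_subset ball_subset_cball by blast
        show "continuous_on (cball v (r/2)) (\<lambda>z. f z x)"
          using hol'[OF x] sub holomorphic_on_imp_continuous_on continuous_on_subset by blast
        show "0 < r/2" using r by simp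
        fix y assume "norm (v - y) = r/2"
        then have "y \<in> cball z r" using sub by (auto simp: dist_norm)
        then show "norm (f y x) \<le> G x" using derivs_bounded x by blast
      qed
      then show "norm (deriv (\<lambda>z. f z x) v) \<le> 2 * G x / r" by (simp add: mult.commute)
    qed (use w r in auto)
    then show ?thesis using w by (simp add: q_def norm_divide divide_le_eq)
  qed
  have "((\<lambda>w. ((\<integral>x. f w x \<partial>M) - (\<integral>x. f z x \<partial>M)) / (w - z)) \<longlongrightarrow> (\<integral>x. d x \<partial>M)) (at z)"
    unfolding tendsto_at_iff_sequentially comp_def
  proof (intro allI impI)
    fix X :: "nat \<Rightarrow> complex" assume X: "\<forall>i. X i \<in> UNIV - {z}" and Xz: "X \<longlonglongrightarrow> z"
    have "\<forall>\<^sub>F i in sequentially. dist (X i) z < r/2" using Xz r by (intro tendstoD) auto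
    then obtain N where N: "\<And>i. i \<ge> N \<Longrightarrow> dist (X i) z < r/2" by (auto simp: eventually_sequentially)
    define Y where "Y i = X (i + N)" for i
    have Y: "Y i \<in> cball z (r/2)" "Y i \<noteq> z" for i using X N[of "i+N"] by (auto simp: Y_def dist_commute)
    have Y': "Y i \<in> cball z r" for i using Y(1)[of i] r by auto
    have Yz: "Y \<longlonglongrightarrow> z" unfolding Y_def using Xz by (rule LIMSEQ_ignore_initial_segment)
    have lim: "(\<lambda>i. q (Y i) x) \<longlonglongrightarrow> d x" if x: "x \<in> space M" for x
    proof -
      have "((\<lambda>w. q w x) \<longlongrightarrow> d x) (at z)"
        using der[OF x, of z] r unfolding d_def q_def has_field_derivative_iff by simp
      then show ?thesis using Y(2) Yz unfolding tendsto_at_iff_sequentially comp_def by blast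
    qed
    have qm: "q (Y i) \<in> borel_measurable M" for i
      unfolding q_def using meas[of "Y i"] meas[OF z] Y'[of i] rU by (intro borel_measurable_divide borel_measurable_diff) auto
    have "(\<lambda>i. \<integral>x. q (Y i) x \<partial>M) \<longlonglongrightarrow> (\<integral>x. d x \<partial>M)"
    proof (rule integral_dominated_convergence[where w="\<lambda>x. 2 * G x / r"])
      show "d \<in> borel_measurable M" using lim qm by (rule borel_measurable_LIMSEQ_metric[rotated])
      show "integrable M (\<lambda>x. 2 * G x / r)" using G by simp
      show "AE x in M. (\<lambda>i. q (Y i) x) \<longlonglongrightarrow> d x" using lim by simp
      show "\<And>i. AE x in M. norm (q (Y i) x) \<le> 2 * G x / r" using qbd Y by simp
    qed (rule qm)
    moreover have "(\<integral>x. q (Y i) x \<partial>M) = ((\<integral>x. f (Y i) x \<partial>M) - (\<integral>x. f z x \<partial>M)) / (Y i - z)" for i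
      unfolding q_def using int[OF Y'[of i]] int[of z] r by simp
    ultimately have "(\<lambda>i. ((\<integral>x. f (X (i + N)) x \<partial>M) - (\<integral>x. f z x \<partial>M)) / (X (i + N) - z)) \<longlonglongrightarrow> (\<integral>x. d x \<partial>M)"
      by (simp add: Y_def)
    then show "(\<lambda>i. ((\<integral>x. f (X i) x \<partial>M) - (\<integral>x. f z x \<partial>M)) / (X i - z)) \<longlonglongrightarrow> (\<integral>x. d x \<partial>M)"
      by (rule LIMSEQ_offset)
  qed
  then have "((\<lambda>w. \<integral>x. f w x \<partial>M) has_field_derivative (\<integral>x. d x \<partial>M)) (at z)"
    by (simp add: has_field_derivative_iff)
  then show "(\<lambda>z. \<integral>x. f z x \<partial>M) field_differentiable at z within U"
    by (meson field_differentiable_at_within field_differentiable_def)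
qed

subsection \<open>Functions supported in a bounded part of the orthant\<close>

text \<open>Only points of the closed orthant count, since the functionals do not see the others;
  functions of \<open>p1\<close> with support bounded from the right qualify.\<close>

definition vanishes_beyond :: "real \<Rightarrow> (real^'n::finite \<Rightarrow> complex) \<Rightarrow> bool" where
  "vanishes_beyond B f \<longleftrightarrow> (\<forall>x. (\<forall>i. 0 \<le> x $ i) \<and> B \<le> p1 x \<longrightarrow> f x = 0)"

definition orthant_test :: "(real^'n::finite \<Rightarrow> complex) \<Rightarrow> bool" where
  "orthant_test f \<longleftrightarrow> smooth_fun f \<and> (\<exists>B. vanishes_beyond B f)"

definition simplex_set :: "real \<Rightarrow> (real^'n::finite) set" where
  "simplex_set B = {x. (\<forall>i. 0 \<le> x $ i) \<and> p1 x \<le> B}"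

lemma coord_le_p1: "(\<And>i. 0 \<le> x $ i) \<Longrightarrow> x $ i \<le> p1 x"
  unfolding p1_def by (rule member_le_sum) auto

lemma continuous_on_p1 [continuous_intros]: "continuous_on S f \<Longrightarrow> continuous_on S (\<lambda>x. p1 (f x))"
  unfolding p1_def by (intro continuous_intros)

lemma compact_simplex_set: "compact (simplex_set B)"
proof -
  have "closed (simplex_set B)"
    unfolding simplex_set_def
    by (intro closed_Collect_conj closed_Collect_all closed_Collect_le continuous_intros)
  moreover have "bounded (simplex_set B :: (real^'a) set)"
  proof (rule bounded_subset[OF bounded_cbox[of 0 "\<chi> i. B"]])
    show "simplex_set B \<subseteq> cbox (0::real^'a) (\<chi> i. B)"
    proof
      fix x :: "real^'a" assume x: "x \<in> simplex_set B"
      then have "x $ i \<le> B" for i using coord_le_p1[of x i] by (simp add: simplex_set_def)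
      with x show "x \<in> cbox 0 (\<chi> i. B)" by (simp add: simplex_set_def mem_box_cart)
    qed
  qed
  ultimately show ?thesis by (simp add: compact_eq_bounded_closed)
qed

lemma bounded_on_simplex:
  assumes "continuous_on UNIV (f :: real^'n::finite \<Rightarrow> complex)"
  obtains C where "0 \<le> C" "\<And>x. x \<in> simplex_set B \<Longrightarrow> norm (f x) \<le> C"
proof -
  have "compact (f ` simplex_set B)"
    using assms compact_simplex_set by (intro compact_continuous_image) (auto intro: continuous_on_subset)
  then obtain C where "\<And>y. y \<in> f ` simplex_set B \<Longrightarrow> norm y \<le> C" using compact_imp_bounded bounded_iff by metis
  then show ?thesis using that[of "max 0 C"] by fastforce
qed

lemma vanishes_beyond_mono: "vanishes_beyond B f \<Longrightarrow> B \<le> C \<Longrightarrow> vanishes_beyond C f"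
  unfolding vanishes_beyond_def by force

lemma vanishes_beyond_add: "vanishes_beyond B f \<Longrightarrow> vanishes_beyond B g \<Longrightarrow> vanishes_beyond B (\<lambda>x. f x + g x)"
  and vanishes_beyond_mult: "vanishes_beyond B f \<Longrightarrow> vanishes_beyond B (\<lambda>x. h x * f x)"
  and vanishes_beyond_mult': "vanishes_beyond B f \<Longrightarrow> vanishes_beyond B (\<lambda>x. f x * h x)"
  and vanishes_beyond_permv: "bij \<pi> \<Longrightarrow> vanishes_beyond B f \<Longrightarrow> vanishes_beyond B (\<lambda>x. f (permv \<pi> x))"
  by (auto simp: vanishes_beyond_def)

lemma orthant_test_smooth: "orthant_test f \<Longrightarrow> smooth_fun f"
  by (simp add: orthant_test_def)

lemma orthant_test_add: "orthant_test f \<Longrightarrow> orthant_test g \<Longrightarrow> orthant_test (\<lambda>x. f x + g x)"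
  unfolding orthant_test_def
  by (metis smooth_fun_add vanishes_beyond_add vanishes_beyond_mono max.cobounded1 max.cobounded2)

lemma orthant_test_mult: "smooth_fun h \<Longrightarrow> orthant_test f \<Longrightarrow> orthant_test (\<lambda>x. h x * f x)"
  unfolding orthant_test_def using smooth_fun_mult[of h f] vanishes_beyond_mult[of _ f h] by blast

lemma orthant_test_cmult: "orthant_test f \<Longrightarrow> orthant_test (\<lambda>x. c * f x)"
  by (intro orthant_test_mult smooth_fun_const)

lemma orthant_test_0: "orthant_test (\<lambda>x. 0)"
  unfolding orthant_test_def by (auto simp: smooth_fun_const vanishes_beyond_def)

lemma orthant_test_sum: "(\<And>a. a \<in> A \<Longrightarrow> orthant_test (f a)) \<Longrightarrow> orthant_test (\<lambda>x. \<Sum>a\<in>A. f a x)"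
  by (induction A rule: infinite_finite_induct) (auto intro: orthant_test_0 orthant_test_add)

lemma orthant_test_permv: "bij \<pi> \<Longrightarrow> orthant_test f \<Longrightarrow> orthant_test (\<lambda>x. f (permv \<pi> x))"
  unfolding orthant_test_def using smooth_fun_permv[of \<pi> f] vanishes_beyond_permv[of \<pi> _ f] by blast

text \<open>From a point of the region one can move in the positive axis direction without leaving
  it, so the right derivative is 0, and by smoothness it is the full one.\<close>

lemma vanishes_beyond_pdiff:
  assumes "smooth_fun f" "vanishes_beyond B f" shows "vanishes_beyond B (pdiff i f)"
  unfolding vanishes_beyond_def
proof (intro allI impI)
  fix x :: "real^'a" assume x: "(\<forall>i. 0 \<le> x $ i) \<and> B \<le> p1 x"
  have p: "p1 (x + t *\<^sub>R axis i 1) = p1 x + t" for t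
  proof -
    have "p1 (x + t *\<^sub>R axis i 1) = (\<Sum>l\<in>UNIV. x $ l + (if l = i then t else 0))"
      unfolding p1_def by (intro sum.cong) (auto simp: axis_def)
    then show ?thesis by (simp add: sum.distrib p1_def)
  qed
  have "((\<lambda>t. f (x + t *\<^sub>R axis i 1)) has_vector_derivative pdiff i f x) (at 0)"
    using smooth_fun_has_pd[OF assms(1)] by (simp add: has_pd_def)
  then have 1: "((\<lambda>t. f (x + t *\<^sub>R axis i 1)) has_vector_derivative pdiff i f x) (at 0 within {0..})"
    by (rule has_vector_derivative_at_within)
  have 2: "((\<lambda>t. f (x + t *\<^sub>R axis i 1)) has_vector_derivative 0) (at 0 within {0..})"
  proof (rule has_vector_derivative_transform[where f="\<lambda>_. 0"])
    fix t :: real assume "t \<in> {0..}"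
    then show "f (x + t *\<^sub>R axis i 1) = 0"
      using assms(2) x p[of t] by (auto simp: vanishes_beyond_def axis_def)
  qed auto
  have "at (0::real) within {0..} \<noteq> bot"
    using trivial_limit_at_right_real[of 0] at_le[of "{0<..}" "{0..}" 0] Ioi_le_Ico[of 0]
    by (metis bot_unique)
  from vector_derivative_within[OF this 1] vector_derivative_within[OF this 2]
  show "pdiff i f x = 0" by simp
qed

text \<open>The segment that defines \<open>ddiff\<close> keeps the coordinates nonnegative and
  \<open>p1\<close> constant, so the averaged derivatives vanish all along it.\<close>

lemma vanishes_beyond_ddiff:
  assumes "i \<noteq> j" "smooth_fun f" "vanishes_beyond B f" shows "vanishes_beyond B (ddiff i j f)"
  unfolding vanishes_beyond_def
proof (intro allI impI)
  fix x :: "real^'a" assume x: "(\<forall>i. 0 \<le> x $ i) \<and> B \<le> p1 x"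
  have "complex_of_real 1 * (pdiff i f (mixv i j t x) - pdiff j f (mixv i j t x)) = 0" if "t \<in> {0..1}" for t
  proof -
    have "\<forall>l. 0 \<le> mixv i j t x $ l" using that x by (auto simp: mixv_def)
    then show ?thesis
      using vanishes_beyond_pdiff[OF assms(2,3)] x assms(1) unfolding vanishes_beyond_def by simp
  qed
  then have "ddiff i j f x = integral {0..1} (\<lambda>t::real. 0)"
    unfolding ddiff_def mix_avg_def by (intro integral_cong)
  then show "ddiff i j f x = 0" by simp
qed

lemma orthant_test_pdiff: "orthant_test f \<Longrightarrow> orthant_test (pdiff i f)"
  unfolding orthant_test_def using smooth_fun_pdiff[of f i] vanishes_beyond_pdiff[of f _ i] by blast

lemma orthant_test_ddiff: "i \<noteq> j \<Longrightarrow> orthant_test f \<Longrightarrow> orthant_test (ddiff i j f)"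
  unfolding orthant_test_def using smooth_fun_ddiff[of i j f] vanishes_beyond_ddiff[of i j f] by blast

lemma test_function_imp_orthant_test:
  assumes "test_function f" shows "orthant_test f"
proof -
  obtain K where K: "compact K" "\<And>x. x \<notin> K \<Longrightarrow> f x = 0" and s: "smooth_fun f"
    using assms by (auto simp: test_function_def)
  have "compact (p1 ` K)"
    by (intro compact_continuous_image K continuous_intros)
  then obtain C where C: "\<And>x. x \<in> K \<Longrightarrow> norm (p1 x) \<le> C"
    using compact_imp_bounded bounded_iff by (metis imageI)
  have "vanishes_beyond (C + 1) f" unfolding vanishes_beyond_def using K C by force
  then show ?thesis using s by (auto simp: orthant_test_def)
qed

subsection \<open>Power weights on the faces of the orthant\<close>

definition face :: "'n::finite set \<Rightarrow> real^'n \<Rightarrow> real^'n" where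
  "face A x = (\<chi> i. if i \<in> A then x $ i else 0)"

text \<open>The coordinates outside \<open>A\<close> are dummy variables of total mass one, so that all faces can be
  integrated over with the Lebesgue measure of the full space.\<close>

definition face_weight :: "'n::finite set \<Rightarrow> complex \<Rightarrow> real^'n \<Rightarrow> complex" where
  "face_weight A b x = complex_of_real (\<Prod>i\<in>A. x $ i) powr (b - 1) * complex_of_real (\<Prod>i\<in>-A. indicator {..1} (x $ i))"

definition gint :: "'n::finite set \<Rightarrow> complex \<Rightarrow> (real^'n \<Rightarrow> complex) \<Rightarrow> complex" where
  "gint A b f = (LINT x:positive_orthant|lborel. f (face A x) * face_weight A b x)"

lemma face_nth [simp]: "face A x $ i = (if i \<in> A then x $ i else 0)"
  by (simp add: face_def)

lemma face_UNIV [simp]: "face UNIV x = x"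
  by (simp add: vec_eq_iff)

lemma continuous_on_face [continuous_intros]: "continuous_on S f \<Longrightarrow> continuous_on S (\<lambda>x. face A (f x))"
  unfolding face_def by (intro continuous_on_vec_lambda continuous_on_if_const continuous_intros)

lemma open_positive_orthant: "open (positive_orthant :: (real^'n::finite) set)"
proof -
  have eq: "positive_orthant = (\<Inter>i\<in>UNIV. {x :: real^'n. 0 < x $ i})" by (auto simp: positive_orthant_def)
  show ?thesis unfolding eq by (intro open_INT finite ballI open_Collect_less continuous_intros)
qed

lemma positive_orthant_borel [measurable]: "positive_orthant \<in> sets (borel :: (real^'n::finite) measure)"
  by (rule borel_open[OF open_positive_orthant])

lemma borel_measurable_face [measurable]: "face A \<in> borel_measurable borel"
  by (rule borel_measurable_continuous_onI) (intro continuous_intros)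

lemma borel_measurable_face_weight [measurable]: "face_weight A b \<in> borel_measurable borel"
  unfolding face_weight_def by measurable

text \<open>The singular power dominates for small \<open>t\<close>; the added 1 takes care of large
  \<open>t\<close> and of the dummy coordinates of a face.\<close>

definition pdom :: "real \<Rightarrow> real \<Rightarrow> real \<Rightarrow> real" where
  "pdom d R t = indicator {0<..R} t * (t powr (d - 1) + 1)"

lemma pdom_nonneg: "0 \<le> pdom d R t"
  by (simp add: pdom_def)

lemma pdom_ge_1: "0 < t \<Longrightarrow> t \<le> R \<Longrightarrow> 1 \<le> pdom d R t"
  by (simp add: pdom_def)

lemma integrable_pdom:
  assumes "0 < d" "0 \<le> R" shows "integrable lborel (pdom d R)"
proof -
  have "(\<lambda>t. t powr (d - 1)) absolutely_integrable_on {0<..R}"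
    using integrable_on_powr_from_0'[of "d - 1" R] assms
    by (intro nonnegative_absolutely_integrable_1) auto
  then have "set_integrable lborel {0<..R} (\<lambda>t. t powr (d - 1))"
    unfolding set_integrable_def by (subst integrable_completion[symmetric]) auto
  moreover have "set_integrable lborel {0<..R} (\<lambda>t. 1::real)"
    unfolding set_integrable_def using assms by (auto simp: integrable_indicator_iff)
  ultimately have "set_integrable lborel {0<..R} (\<lambda>t. t powr (d - 1) + 1)"
    by (rule set_integral_add)
  then show ?thesis unfolding set_integrable_def pdom_def[abs_def] by simp
qed

lemma powr_le_pdom:
  assumes "0 < t" "t \<le> R" "1 \<le> R" "d \<le> c" "c \<le> T" "0 \<le> T"
  shows "t powr (c - 1) \<le> R powr T * pdom d R t"
proof (cases "t \<le> 1")
  case True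
  have "t powr (c - 1) \<le> t powr (d - 1)" using assms True by (intro powr_mono') auto
  also have "\<dots> \<le> pdom d R t" using assms by (simp add: pdom_def)
  also have "\<dots> \<le> R powr T * pdom d R t"
    using ge_one_powr_ge_zero[of R T] assms mult_right_mono[of 1 "R powr T" "pdom d R t"] pdom_nonneg by simp
  finally show ?thesis .
next
  case False
  have "t powr (c - 1) \<le> t powr T" using assms False by (intro powr_mono) auto
  also have "\<dots> \<le> R powr T" using assms by (intro powr_mono2) auto
  also have "\<dots> \<le> R powr T * pdom d R t" using pdom_ge_1[of t R d] assms by simp
  finally show ?thesis .
qed

lemma prod_powr_real: "(\<And>i. i \<in> A \<Longrightarrow> 0 \<le> (f i :: real)) \<Longrightarrow> (\<Prod>i\<in>A. f i) powr c = (\<Prod>i\<in>A. f i powr c)" if "finite A"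
  using that by (induction A) (auto simp: powr_mult prod_nonneg)

lemma face_weight_bound:
  fixes x :: "real^'n::finite"
  assumes x: "x \<in> positive_orthant" and R: "\<And>i. i \<in> A \<Longrightarrow> x $ i \<le> R" "1 \<le> R"
    and b: "d \<le> Re b" "Re b \<le> T" "0 \<le> T"
  shows "norm (face_weight A b x) \<le> (\<Prod>i\<in>(UNIV::'n set). R powr T) * (\<Prod>i\<in>UNIV. pdom d R (x $ i))"
proof (cases "\<exists>i\<in>-A. x $ i > 1")
  case True
  then have "\<exists>i\<in>-A. indicator {..1} (x $ i) = (0::real)" by (auto simp: indicator_def not_le)
  then have "(\<Prod>i\<in>-A. indicator {..1} (x $ i)) = (0::real)" by (intro prod_zero) auto
  then have "face_weight A b x = 0" by (simp only: face_weight_def of_real_0 mult_zero_right)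
  then show ?thesis by (simp add: prod_nonneg pdom_nonneg)
next
  case False
  have pos: "0 < x $ i" for i using x by (simp add: positive_orthant_def)
  have D: "0 < (\<Prod>i\<in>A. x $ i)" by (simp add: prod_pos pos)
  have RT: "1 \<le> R powr T" using ge_one_powr_ge_zero R b by simp
  have "norm (face_weight A b x) = (\<Prod>i\<in>A. x $ i) powr (Re b - 1) * (\<Prod>i\<in>-A. indicator {..1} (x $ i))"
    using D unfolding face_weight_def norm_mult norm_of_real
    by (subst norm_powr_real_powr) (auto simp: abs_of_nonneg prod_nonneg simp del: of_real_prod)
  also have "(\<Prod>i\<in>A. x $ i) powr (Re b - 1) = (\<Prod>i\<in>A. x $ i powr (Re b - 1))"
    by (intro prod_powr_real) (auto intro: less_imp_le pos)
  also have "\<dots> * (\<Prod>i\<in>-A. indicator {..1} (x $ i)) \<le>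
     (\<Prod>i\<in>A. R powr T * pdom d R (x $ i)) * (\<Prod>i\<in>-A. R powr T * pdom d R (x $ i))"
  proof (rule mult_mono)
    show "(\<Prod>i\<in>A. x $ i powr (Re b - 1)) \<le> (\<Prod>i\<in>A. R powr T * pdom d R (x $ i))"
      using powr_le_pdom pos R b by (intro prod_mono) auto
    show "(\<Prod>i\<in>-A. indicator {..1} (x $ i)) \<le> (\<Prod>i\<in>-A. R powr T * pdom d R (x $ i))"
    proof (rule prod_mono)
      fix i assume "i \<in> -A"
      then have "1 \<le> pdom d R (x $ i)" using pdom_ge_1[of "x $ i" R d] pos False R by force
      then show "0 \<le> indicat_real {..1} (x $ i) \<and> indicat_real {..1} (x $ i) \<le> R powr T * pdom d R (x $ i)"
        using RT mult_mono[of 1 "R powr T" 1 "pdom d R (x $ i)"] by (auto simp: indicator_def)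
    qed
  qed (auto intro!: prod_nonneg mult_nonneg_nonneg pdom_nonneg)
  also have "\<dots> = (\<Prod>i\<in>UNIV. R powr T * pdom d R (x $ i))"
    using prod.union_disjoint[of A "-A" "\<lambda>i. R powr T * pdom d R (x $ i)"] by (simp add: Compl_partition)
  finally show ?thesis by (simp add: prod.distrib)
qed

text \<open>One integrable majorant for a whole strip of exponents and for all functions with the
  same bound on the simplex: integrability, norm estimates, limits and holomorphy all rest on
  it.\<close>

lemma gint_dominated:
  assumes "0 < d"
  obtains G :: "real^'n::finite \<Rightarrow> real" where "integrable lborel G" "\<And>x. 0 \<le> G x"
    "\<And>b f S x. \<lbrakk>d \<le> Re b; Re b \<le> T; vanishes_beyond B f; \<And>y. y \<in> simplex_set B \<Longrightarrow> norm (f y) \<le> S; 0 \<le> S; x \<in> positive_orthant\<rbrakk>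
       \<Longrightarrow> norm (f (face A x) * face_weight A b x) \<le> S * G x"
proof -
  define R where "R = max 1 B"
  define T' where "T' = max 0 T"
  define G where "G x = (\<Prod>i\<in>(UNIV::'n set). R powr T') * (\<Prod>i\<in>UNIV. pdom d R (x $ i))" for x :: "real^'n"
  have int: "integrable lborel G"
    unfolding G_def using integrable_prod_coords[of "\<lambda>_. pdom d R"] integrable_pdom[OF assms, of R] pdom_nonneg
    by (intro integrable_mult_right) (auto simp: R_def)
  have nn: "0 \<le> G x" for x by (simp add: G_def prod_nonneg pdom_nonneg)
  show ?thesis
  proof (rule that[OF int nn])
    fix b S and f :: "real^'n \<Rightarrow> complex" and x :: "real^'n"
    assume b: "d \<le> Re b" "Re b \<le> T" and f: "vanishes_beyond B f" "\<And>y. y \<in> simplex_set B \<Longrightarrow> norm (f y) \<le> S"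
      and S: "0 \<le> S" and x: "x \<in> positive_orthant"
    have pos: "0 < x $ i" for i using x by (simp add: positive_orthant_def)
    have fn: "0 \<le> face A x $ i" for i using pos[of i] by simp
    show "norm (f (face A x) * face_weight A b x) \<le> S * G x"
    proof (cases "B \<le> p1 (face A x)")
      case True
      then have "f (face A x) = 0" using f(1) fn unfolding vanishes_beyond_def by blast
      then show ?thesis using S nn by simp
    next
      case False
      then have s: "face A x \<in> simplex_set B" using fn by (simp add: simplex_set_def)
      have "x $ i \<le> R" if "i \<in> A" for i
        using coord_le_p1[of "face A x" i, OF fn] that False by (simp add: R_def)
      then have "norm (face_weight A b x) \<le> G x"
        unfolding G_def using b by (intro face_weight_bound[OF x]) (auto simp: R_def T'_def)
      then show ?thesis using f(2)[OF s] S by (simp add: norm_mult mult_mono)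
    qed
  qed
qed

lemma gint_integrable:
  assumes "0 < Re b" "continuous_on UNIV f" "vanishes_beyond B f"
  shows "set_integrable lborel positive_orthant (\<lambda>x. f (face A x) * face_weight A b (x::real^'n::finite))"
proof -
  obtain G :: "real^'n \<Rightarrow> real" where G: "integrable lborel G" "\<And>x. 0 \<le> G x"
    "\<And>b' f S x. \<lbrakk>Re b \<le> Re b'; Re b' \<le> Re b; vanishes_beyond B f; \<And>y. y \<in> simplex_set B \<Longrightarrow> norm (f y) \<le> S; 0 \<le> S; x \<in> positive_orthant\<rbrakk>
       \<Longrightarrow> norm (f (face A x) * face_weight A b' x) \<le> S * G x"
    using gint_dominated[OF assms(1), of "Re b" B A] by metis
  obtain S where S: "0 \<le> S" "\<And>x. x \<in> simplex_set B \<Longrightarrow> norm (f x) \<le> S" using bounded_on_simplex[OF assms(2)] by metis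
  have [measurable]: "f \<in> borel_measurable borel" using assms(2) by (rule borel_measurable_continuous_onI)
  show ?thesis unfolding set_integrable_def
  proof (rule Bochner_Integration.integrable_bound)
    show "integrable lborel (\<lambda>x. S * G x)" using G(1) by simp
    show "(\<lambda>x. indicator positive_orthant x *\<^sub>R (f (face A x) * face_weight A b x)) \<in> borel_measurable lborel" by measurable
    show "AE x in lborel. norm (indicat_real positive_orthant x *\<^sub>R (f (face A x) * face_weight A b x)) \<le> norm (S * G x)"
      using G(2) G(3)[OF order_refl order_refl assms(3) S(2) S(1)] S(1) by (auto simp: indicator_def)
  qed
qed

lemma gint_bound:
  assumes "0 < Re b"
  obtains C where "0 \<le> C"
    "\<And>f S. \<lbrakk>continuous_on UNIV f; vanishes_beyond B f; \<And>y. y \<in> simplex_set B \<Longrightarrow> norm (f y) \<le> S; 0 \<le> S\<rbrakk>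
       \<Longrightarrow> norm (gint (A::'n::finite set) b f) \<le> S * C"
proof -
  obtain G :: "real^'n \<Rightarrow> real" where G: "integrable lborel G" "\<And>x. 0 \<le> G x"
    "\<And>b' f S x. \<lbrakk>Re b \<le> Re b'; Re b' \<le> Re b; vanishes_beyond B f; \<And>y. y \<in> simplex_set B \<Longrightarrow> norm (f y) \<le> S; 0 \<le> S; x \<in> positive_orthant\<rbrakk>
       \<Longrightarrow> norm (f (face A x) * face_weight A b' x) \<le> S * G x"
    using gint_dominated[OF assms(1), of "Re b" B A] by metis
  show ?thesis
  proof (rule that[of "\<integral>x. G x \<partial>lborel"])
    show "0 \<le> (\<integral>x. G x \<partial>lborel)" using G(2) by simp
    fix f :: "real^'n \<Rightarrow> complex" and S assume f: "continuous_on UNIV f" "vanishes_beyond B f" "\<And>y. y \<in> simplex_set B \<Longrightarrow> norm (f y) \<le> S" "0 \<le> S"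
    have "norm (\<integral>x. indicat_real positive_orthant x *\<^sub>R (f (face A x) * face_weight A b x) \<partial>lborel) \<le> (\<integral>x. S * G x \<partial>lborel)"
    proof (rule Bochner_Integration.integral_norm_bound_integral)
      show "integrable lborel (\<lambda>x. indicat_real positive_orthant x *\<^sub>R (f (face A x) * face_weight A b x))"
        using gint_integrable[OF assms f(1,2)] by (simp add: set_integrable_def)
      show "integrable lborel (\<lambda>x. S * G x)" using G(1) by simp
      show "norm (indicat_real positive_orthant x *\<^sub>R (f (face A x) * face_weight A b x)) \<le> S * G x" for x
        using G(2) G(3)[OF order_refl order_refl f(2,3,4)] f(4) by (auto simp: indicator_def)
    qed
    then show "norm (gint A b f) \<le> S * (\<integral>x. G x \<partial>lborel)"
      by (simp add: gint_def set_lebesgue_integral_def)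
  qed
qed

lemma gint_tendsto:
  assumes b: "0 < Re b" and f: "\<And>n. continuous_on UNIV (f n)" "\<And>n. vanishes_beyond B (f n)"
      "\<And>n y. y \<in> simplex_set B \<Longrightarrow> norm (f n y) \<le> S" "0 \<le> S"
    and g: "continuous_on UNIV g" "vanishes_beyond B g" "\<And>y. y \<in> simplex_set B \<Longrightarrow> (\<lambda>n. f n y) \<longlonglongrightarrow> g y"
  shows "(\<lambda>n. gint A b (f n)) \<longlonglongrightarrow> gint A b (g :: real^'n::finite \<Rightarrow> complex)"
proof -
  obtain G :: "real^'n \<Rightarrow> real" where G: "integrable lborel G" "\<And>x. 0 \<le> G x"
    "\<And>b' f S x. \<lbrakk>Re b \<le> Re b'; Re b' \<le> Re b; vanishes_beyond B f; \<And>y. y \<in> simplex_set B \<Longrightarrow> norm (f y) \<le> S; 0 \<le> S; x \<in> positive_orthant\<rbrakk>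
       \<Longrightarrow> norm (f (face A x) * face_weight A b' x) \<le> S * G x"
    using gint_dominated[OF assms(1), of "Re b" B A] by metis
  have [measurable]: "f n \<in> borel_measurable borel" for n using f(1) by (rule borel_measurable_continuous_onI)
  have [measurable]: "g \<in> borel_measurable borel" using g(1) by (rule borel_measurable_continuous_onI)
  show ?thesis unfolding gint_def set_lebesgue_integral_def
  proof (rule integral_dominated_convergence[where w="\<lambda>x. S * G x"])
    show "AE x in lborel. (\<lambda>n. indicat_real positive_orthant x *\<^sub>R (f n (face A x) * face_weight A b x))
        \<longlonglongrightarrow> indicat_real positive_orthant x *\<^sub>R (g (face A x) * face_weight A b x)"
    proof (rule AE_I2)
      fix x :: "real^'n"
      show "(\<lambda>n. indicat_real positive_orthant x *\<^sub>R (f n (face A x) * face_weight A b x))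
        \<longlonglongrightarrow> indicat_real positive_orthant x *\<^sub>R (g (face A x) * face_weight A b x)"
      proof (cases "x \<in> positive_orthant")
        case True
        then have fn: "\<forall>i. 0 \<le> face A x $ i" by (auto simp: positive_orthant_def less_imp_le)
        have "(\<lambda>n. f n (face A x)) \<longlonglongrightarrow> g (face A x)"
        proof (cases "B \<le> p1 (face A x)")
          case True
          then show ?thesis using fn f(2) g(2) by (simp add: vanishes_beyond_def)
        next
          case False
          then show ?thesis using fn g(3) by (simp add: simplex_set_def)
        qed
        then show ?thesis by (intro tendsto_intros)
      qed simp
    qed
    show "AE x in lborel. norm (indicat_real positive_orthant x *\<^sub>R (f n (face A x) * face_weight A b x)) \<le> S * G x" for n
      using G(2) G(3)[OF order_refl order_refl f(2) f(3) f(4)] f(4) by (auto simp: indicator_def)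
    show "integrable lborel (\<lambda>x. S * G x)" using G(1) by simp
  qed measurable
qed

lemma gint_add:
  assumes "0 < Re b" "continuous_on UNIV f" "vanishes_beyond B f" "continuous_on UNIV g" "vanishes_beyond C g"
  shows "gint A b (\<lambda>x. f x + g x) = gint A b f + gint A b g"
  unfolding gint_def
  using set_integral_add(2)[OF gint_integrable[OF assms(1-3)] gint_integrable[OF assms(1,4,5)]] by (simp add: algebra_simps)

lemma gint_cmult: "gint A b (\<lambda>x. c * f x) = c * gint A b f"
  unfolding gint_def by (simp add: mult.assoc)

lemma gint_sum:
  assumes "0 < Re b" "finite J" "\<And>j. j \<in> J \<Longrightarrow> continuous_on UNIV (f j) \<and> vanishes_beyond B (f j)"
  shows "gint A b (\<lambda>x. \<Sum>j\<in>J. f j x) = (\<Sum>j\<in>J. gint A b (f j))"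
  using assms(2,3)
proof (induction J)
  case empty
  show ?case by (simp add: gint_def)
next
  case (insert a J)
  have "vanishes_beyond B (\<lambda>x. \<Sum>j\<in>J. f j x)" using insert.prems by (auto simp: vanishes_beyond_def)
  then show ?case using insert assms(1)
    by (simp add: gint_add[where B=B and C=B] continuous_on_sum)
qed

lemma gint_cong:
  assumes "\<And>x. x \<in> positive_orthant \<Longrightarrow> f (face A x) = g (face A x)" shows "gint A b f = gint A b g"
  unfolding gint_def by (rule set_lebesgue_integral_cong) (use assms in auto)

lemma holomorphic_gint:
  assumes f: "continuous_on UNIV f" "vanishes_beyond B f"
  shows "(\<lambda>b. gint A b (f :: real^'n::finite \<Rightarrow> complex)) holomorphic_on {b. 0 < Re b}"
  unfolding gint_def set_lebesgue_integral_def
proof (rule holomorphic_on_integral)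
  have [measurable]: "f \<in> borel_measurable borel" using f(1) by (rule borel_measurable_continuous_onI)
  show "(\<lambda>x. indicat_real positive_orthant x *\<^sub>R (f (face A x) * face_weight A b x)) \<in> borel_measurable lborel" for b
    by measurable
  show "open {b. 0 < Re b}" by (rule open_halfspace_Re_gt)
  show "(\<lambda>b. indicat_real positive_orthant x *\<^sub>R (f (face A x) * face_weight A b x)) holomorphic_on {b. 0 < Re b}" for x
  proof (cases "x \<in> positive_orthant")
    case True
    then have "complex_of_real (\<Prod>i\<in>A. x $ i) \<noteq> 0" by (auto simp: positive_orthant_def less_le)
    then show ?thesis unfolding face_weight_def powr_def scaleR_conv_of_real
      by (auto intro!: holomorphic_intros)
  qed simp
  fix z assume "z \<in> {b. 0 < Re b}"
  then have z: "0 < Re z" by simp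
  obtain S where S: "0 \<le> S" "\<And>x. x \<in> simplex_set B \<Longrightarrow> norm (f x) \<le> S" using bounded_on_simplex[OF f(1)] by metis
  obtain G :: "real^'n \<Rightarrow> real" where G: "integrable lborel G" "\<And>x. 0 \<le> G x"
    "\<And>b f S x. \<lbrakk>Re z / 2 \<le> Re b; Re b \<le> 2 * Re z; vanishes_beyond B f; \<And>y. y \<in> simplex_set B \<Longrightarrow> norm (f y) \<le> S; 0 \<le> S; x \<in> positive_orthant\<rbrakk>
       \<Longrightarrow> norm (f (face A x) * face_weight A b x) \<le> S * G x"
    using gint_dominated[of "Re z / 2" "2 * Re z" B A] z by (metis half_gt_zero)
  \<comment> \<open>A disc of radius Re z / 2 stays in the strip for which the majorant was
    chosen.\<close>
  have near: "Re z / 2 \<le> Re w \<and> Re w \<le> 2 * Re z" if "w \<in> cball z (Re z / 2)" for w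
  proof -
    have "\<bar>Re (z - w)\<bar> \<le> Re z / 2" using that abs_Re_le_cmod[of "z - w"] by (simp add: dist_norm)
    then have "\<bar>Re z - Re w\<bar> \<le> Re z / 2" by simp
    then have "Re z - Re w \<le> Re z / 2" "Re w - Re z \<le> Re z / 2" by linarith+
    then show ?thesis using z by argo
  qed
  show "\<exists>r>0. \<exists>G. integrable lborel G \<and> cball z r \<subseteq> {b. 0 < Re b} \<and>
     (\<forall>w\<in>cball z r. \<forall>x\<in>space lborel. norm (indicat_real positive_orthant x *\<^sub>R (f (face A x) * face_weight A w x)) \<le> G x)"
  proof (intro exI[of _ "Re z / 2"] exI[of _ "\<lambda>x. S * G x"] conjI ballI)
    show "cball z (Re z / 2) \<subseteq> {b. 0 < Re b}" using near z by fastforce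
    fix w x assume "w \<in> cball z (Re z / 2)"
    then show "norm (indicat_real positive_orthant x *\<^sub>R (f (face A x) * face_weight A w x)) \<le> S * G x"
      using near G(2)[of x] G(3)[of w f S x] f(2) S by (auto simp: indicator_def)
  qed (use z G(1) in auto)
qed

lemma gint_permv:
  assumes "bij \<pi>" "continuous_on UNIV f"
  shows "gint A b (\<lambda>x. f (permv \<pi> x)) = gint (\<pi> -` A) b (f :: real^'n::finite \<Rightarrow> complex)"
proof -
  have [measurable]: "f \<in> borel_measurable borel" using assms(2) by (rule borel_measurable_continuous_onI)
  have bb: "bij_betw \<pi> (\<pi> -` S) S" for S using assms(1) by (auto simp: bij_betw_def bij_def inj_on_def surj_image_vimage_eq)
  let ?h = "\<lambda>x. indicat_real positive_orthant x *\<^sub>R (f (face (\<pi> -` A) x) * face_weight (\<pi> -` A) b x)"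
  have 1: "permv \<pi> (face A x) = face (\<pi> -` A) (permv \<pi> x)" for x by (simp add: vec_eq_iff)
  have 2: "face_weight A b x = face_weight (\<pi> -` A) b (permv \<pi> x)" for x :: "real^'n"
    unfolding face_weight_def vimage_Compl[symmetric]
    using prod.reindex_bij_betw[OF bb[of A], of "\<lambda>i. x $ i"] prod.reindex_bij_betw[OF bb[of "-A"], of "\<lambda>i. indicat_real {..1} (x $ i)"]
    by simp
  have 3: "indicat_real positive_orthant (permv \<pi> x) = indicat_real positive_orthant x" for x :: "real^'n"
    using assms(1) by (auto simp: positive_orthant_def indicator_def) (metis bij_pointE)
  have "gint A b (\<lambda>x. f (permv \<pi> x)) = (\<integral>x. ?h (permv \<pi> x) \<partial>lborel)"
    unfolding gint_def set_lebesgue_integral_def 1 2 3 ..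
  also have "\<dots> = (\<integral>x. ?h x \<partial>lborel)"
    by (rule integral_lborel_permv[OF assms(1)]) measurable
  finally show ?thesis unfolding gint_def set_lebesgue_integral_def .
qed

subsection \<open>Integration by parts on a face\<close>

text \<open>Extended by 0 to t <= 0, the power is differentiable on the whole line once Re b > 1, so
  that the boundary of the orthant produces no separate terms.\<close>

definition ppow :: "complex \<Rightarrow> real \<Rightarrow> complex" where
  "ppow b t = (if 0 < t then complex_of_real t powr b else 0)"

lemma ppow_has_deriv:
  assumes "1 < Re b"
  shows "(ppow b has_vector_derivative b * ppow (b - 1) t) (at t)"
proof -
  consider "t > 0" | "t = 0" | "t < 0" by linarith
  then show ?thesis
  proof cases
    case 1
    have d1: "((\<lambda>t. complex_of_real t) has_vector_derivative 1) (at t)" by (auto intro!: derivative_eq_intros)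
    have "((\<lambda>z. z powr b) has_field_derivative (b * complex_of_real t powr (b - 1))) (at (complex_of_real t))"
      using \<open>t > 0\<close> by (intro has_field_derivative_powr) (simp add: complex_nonpos_Reals_iff)
    from field_vector_diff_chain_at[OF d1 this]
    have "((\<lambda>t. complex_of_real t powr b) has_vector_derivative b * ppow (b - 1) t) (at t)"
      using \<open>t > 0\<close> by (simp add: o_def ppow_def)
    then show ?thesis
      by (rule has_vector_derivative_transform_within_open[where S="{0<..}"]) (use \<open>t > 0\<close> in \<open>auto simp: ppow_def\<close>)
  next
    case 2
    \<comment> \<open>At the origin the difference quotient has size at most |h|^(Re b - 1), which
      tends to 0 because Re b > 1.\<close>
    have "((\<lambda>h. norm (ppow b h) / \<bar>h\<bar>) \<longlongrightarrow> 0) (at 0)"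
    proof (rule tendsto_sandwich[OF _ _ tendsto_const])
      show "\<forall>\<^sub>F h in at 0. norm (ppow b h) / \<bar>h\<bar> \<le> \<bar>h\<bar> powr (Re b - 1)"
      proof (rule always_eventually, rule allI)
        fix h :: real
        show "norm (ppow b h) / \<bar>h\<bar> \<le> \<bar>h\<bar> powr (Re b - 1)"
        proof (cases "0 < h")
          case True
          then show ?thesis by (simp add: ppow_def norm_powr_real_powr powr_diff)
        next
          case False
          then have "ppow b h = 0" by (simp add: ppow_def)
          then show ?thesis by (metis div_0 norm_zero powr_ge_zero)
        qed
      qed
      have "((\<lambda>h::real. \<bar>h\<bar> powr (Re b - 1)) \<longlongrightarrow> 0 powr (Re b - 1)) (at 0)"
        using assms by (intro tendsto_powr') (auto intro!: tendsto_eq_intros)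
      then show "((\<lambda>h::real. \<bar>h\<bar> powr (Re b - 1)) \<longlongrightarrow> 0) (at 0)" by simp
    qed auto
    then have "(ppow b has_derivative (\<lambda>h. h *\<^sub>R 0)) (at 0)"
      by (simp add: has_derivative_at ppow_def)
    then show ?thesis using 2 by (simp add: has_vector_derivative_def ppow_def)
  next
    case 3
    have "((\<lambda>t. 0) has_vector_derivative b * ppow (b - 1) t) (at t)" using 3 by (simp add: ppow_def)
    then show ?thesis
      by (rule has_vector_derivative_transform_within_open[where S="{..<0}"]) (use 3 in \<open>auto simp: ppow_def\<close>)
  qed
qed

lemma continuous_on_ppow:
  assumes "0 < Re b" shows "continuous_on S (ppow b)"
proof -
  have "1 < Re (b + 1)" using assms by simp
  have "isCont (ppow b) t" for t
  proof (cases "t = 0")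
    case True
    have "((\<lambda>h. ppow b h) \<longlongrightarrow> 0) (at 0)"
    proof (rule Lim_null_comparison)
      show "\<forall>\<^sub>F h in at 0. norm (ppow b h) \<le> \<bar>h\<bar> powr (Re b)"
        by (auto simp: eventually_at_filter ppow_def norm_powr_real_powr)
      have "((\<lambda>h::real. \<bar>h\<bar> powr (Re b)) \<longlongrightarrow> 0 powr (Re b)) (at 0)"
        using assms by (intro tendsto_powr') (auto intro!: tendsto_eq_intros)
      then show "((\<lambda>h::real. \<bar>h\<bar> powr (Re b)) \<longlongrightarrow> 0) (at 0)" by simp
    qed
    moreover have "ppow b 0 = 0" by (simp add: ppow_def)
    ultimately show ?thesis using True by (simp add: isCont_def)
  next
    case False
    have "isCont (\<lambda>t. complex_of_real t powr b) t" if "t > 0"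
      using that by (intro continuous_intros) (auto simp: complex_nonpos_Reals_iff)
    moreover have "\<forall>\<^sub>F s in nhds t. ppow b s = complex_of_real s powr b" if "t > 0"
      using eventually_nhds_in_open[of "{0<..}" t] that by (auto simp: ppow_def elim: eventually_mono)
    moreover have "\<forall>\<^sub>F s in nhds t. ppow b s = 0" if "t < 0"
      using eventually_nhds_in_open[of "{..<0}" t] that by (auto simp: ppow_def elim: eventually_mono)
    ultimately show ?thesis using False isCont_cong[of "ppow b" "\<lambda>t. complex_of_real t powr b" t] isCont_cong[of "ppow b" "\<lambda>t. 0" t]
      by (cases "t > 0") auto
  qed
  then show ?thesis by (simp add: continuous_at_imp_continuous_on)
qed

lemma face_add_axis: "i \<in> A \<Longrightarrow> face A (x + t *\<^sub>R axis i 1) = face A x + t *\<^sub>R axis i 1"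
  by (auto simp: vec_eq_iff axis_def)

text \<open>The derivative in direction \<open>i\<close> of x_i^b times f times the remaining
  factors integrates to 0. The power b is one more than the exponent of the weight, which leaves the
  factor x_i in front of f'.\<close>

lemma gint_by_parts:
  fixes f f' :: "real^'n::finite \<Rightarrow> complex"
  assumes i: "i \<in> A" and b: "1 < Re b" and pd: "has_pd i f f'"
    and f: "continuous_on UNIV f" "vanishes_beyond B f"
    and f': "continuous_on UNIV f'" "vanishes_beyond B f'"
  shows "gint A b (\<lambda>x. b * f x + of_real (x $ i) * f' x) = 0"
proof -
  have b0: "0 < Re b" using b by simp
  \<comment> \<open>Positivity of the other coordinates does not change along axis \<open>i\<close>;
    crossing x_i = 0 is harmless thanks to \<open>ppow\<close>.\<close>
  define P where "P x = (\<forall>l. l \<noteq> i \<longrightarrow> 0 < x $ l)" for x :: "real^'n"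
  define W where "W x = complex_of_real (\<Prod>l\<in>A - {i}. x $ l) powr (b - 1) * complex_of_real (\<Prod>l\<in>-A. indicator {..1} (x $ l))" for x :: "real^'n"
  define F where "F x = (if P x then ppow b (x $ i) * f (face A x) * W x else 0)" for x
  define F' where "F' x = (if P x then (b * ppow (b - 1) (x $ i) * f (face A x) + ppow b (x $ i) * f' (face A x)) * W x else 0)" for x
  have P: "P (x + t *\<^sub>R axis i 1) = P x" for x t by (auto simp: P_def axis_def)
  have W: "W (x + t *\<^sub>R axis i 1) = W x" for x t
    unfolding W_def using i
    by (intro arg_cong2[where f="(*)"] arg_cong2[where f="(powr)"] arg_cong[where f=complex_of_real] prod.cong refl) (auto simp: axis_def)
  have "has_pd i F F'" unfolding has_pd_def
  proof
    fix x
    show "((\<lambda>t. F (x + t *\<^sub>R axis i 1)) has_vector_derivative F' x) (at 0)"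
    proof (cases "P x")
      case False
      then show ?thesis by (simp add: F_def F'_def P)
    next
      case True
      have 1: "((\<lambda>t. x $ i + t) has_vector_derivative 1) (at 0)" by (auto intro!: derivative_eq_intros)
      have "((\<lambda>t. ppow b (x $ i + t)) has_vector_derivative b * ppow (b - 1) (x $ i)) (at 0)"
        using vector_diff_chain_at[OF 1, of "ppow b" "b * ppow (b - 1) (x $ i)"] ppow_has_deriv[OF b, of "x $ i"] by (simp add: o_def)
      moreover have "((\<lambda>t. f (face A x + t *\<^sub>R axis i 1)) has_vector_derivative f' (face A x)) (at 0)"
        using pd by (simp add: has_pd_def)
      ultimately have "((\<lambda>t. ppow b (x $ i + t) * f (face A x + t *\<^sub>R axis i 1)) has_vector_derivative
         ppow b (x $ i + 0) * f' (face A x) + b * ppow (b - 1) (x $ i) * f (face A x + 0 *\<^sub>R axis i 1)) (at 0)"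
        by (rule has_vector_derivative_mult)
      then have "((\<lambda>t. ppow b (x $ i + t) * f (face A x + t *\<^sub>R axis i 1) * W x) has_vector_derivative
         (ppow b (x $ i + 0) * f' (face A x) + b * ppow (b - 1) (x $ i) * f (face A x + 0 *\<^sub>R axis i 1)) * W x) (at 0)"
        by (rule has_vector_derivative_mult_left)
      then show ?thesis using True by (simp add: F_def F'_def P W face_add_axis[OF i] add.commute)
    qed
  qed
  moreover have "continuous_on UNIV (\<lambda>t. F' (x + t *\<^sub>R axis i 1))" for x
  proof (cases "P x")
    case False
    then show ?thesis by (simp add: F'_def P)
  next
    case True
    have "continuous_on UNIV (\<lambda>t. (b * ppow (b - 1) (x $ i + t) * f (face A x + t *\<^sub>R axis i 1) + ppow b (x $ i + t) * f' (face A x + t *\<^sub>R axis i 1)) * W x)"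
      using b by (intro continuous_intros continuous_on_compose2[OF continuous_on_ppow, of _ UNIV]
          continuous_on_compose2[OF f(1)] continuous_on_compose2[OF f'(1)]) auto
    then show ?thesis using True by (simp add: F'_def P W face_add_axis[OF i])
  qed
  moreover have weight: "complex_of_real (x $ i) * face_weight A b x = ppow b (x $ i) * W x" "face_weight A b x = ppow (b - 1) (x $ i) * W x"
    if "x \<in> positive_orthant" for x :: "real^'n"
  proof -
    have pos: "0 < x $ l" for l using that by (simp add: positive_orthant_def)
    have "0 < (\<Prod>l\<in>A - {i}. x $ l)" using pos by (simp add: prod_pos)
    then have *: "complex_of_real (\<Prod>l\<in>A. x $ l) powr (b - 1) = complex_of_real (x $ i) powr (b - 1) * complex_of_real (\<Prod>l\<in>A - {i}. x $ l) powr (b - 1)"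
      using pos[of i] i by (subst prod.remove[of A i]) (auto simp: powr_times_real_left simp del: of_real_prod)
    show 2: "face_weight A b x = ppow (b - 1) (x $ i) * W x"
      unfolding face_weight_def * W_def ppow_def using pos[of i] by simp
    have "complex_of_real (x $ i) * complex_of_real (x $ i) powr (b - 1) = complex_of_real (x $ i) powr b"
      using pos[of i] by (simp add: powr_diff)
    then have "complex_of_real (x $ i) * ppow (b - 1) (x $ i) = ppow b (x $ i)" using pos[of i] by (simp add: ppow_def)
    then show "complex_of_real (x $ i) * face_weight A b x = ppow b (x $ i) * W x" unfolding 2 by (simp add: mult.assoc[symmetric])
  qed
  have out: "x \<notin> positive_orthant \<Longrightarrow> F x = 0 \<and> F' x = 0" for x
  proof -
    assume "x \<notin> positive_orthant"
    then have "\<not> P x \<or> x $ i \<le> 0" by (auto simp: P_def positive_orthant_def not_less)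
    then show ?thesis by (auto simp: F_def F'_def ppow_def)
  qed
  have FF: "F x = indicat_real positive_orthant x *\<^sub>R ((\<lambda>y. of_real (y $ i) * f y) (face A x) * face_weight A b x)" for x
  proof (cases "x \<in> positive_orthant")
    case True
    have "(of_real (x $ i) * f (face A x)) * face_weight A b x = f (face A x) * (of_real (x $ i) * face_weight A b x)" by simp
    also have "\<dots> = F x" using True unfolding weight(1)[OF True] by (simp add: F_def P_def positive_orthant_def)
    finally show ?thesis using True i by simp
  qed (use out in simp)
  have FF': "F' x = indicat_real positive_orthant x *\<^sub>R ((\<lambda>y. b * f y + of_real (y $ i) * f' y) (face A x) * face_weight A b x)" for x
  proof (cases "x \<in> positive_orthant")
    case True
    have "(b * f (face A x) + of_real (x $ i) * f' (face A x)) * face_weight A b x = b * f (face A x) * face_weight A b x + f' (face A x) * (of_real (x $ i) * face_weight A b x)" by (simp add: algebra_simps)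
    also have "\<dots> = F' x" using True unfolding weight(1)[OF True] unfolding weight(2)[OF True] by (simp add: F'_def P_def positive_orthant_def algebra_simps)
    finally show ?thesis using True i by simp
  qed (use out in simp)
  have cx: "continuous_on UNIV (\<lambda>y::real^'n. complex_of_real (y $ i))" by (intro continuous_intros)
  have "integrable lborel F" unfolding FF
    using gint_integrable[OF b0 continuous_on_mult[OF cx f(1)] vanishes_beyond_mult[OF f(2)], where A=A]
    unfolding set_integrable_def .
  moreover have "integrable lborel F'" unfolding FF'
    using gint_integrable[OF b0 continuous_on_add[OF continuous_on_mult[OF continuous_on_const f(1)] continuous_on_mult[OF cx f'(1)]]
        vanishes_beyond_add[OF vanishes_beyond_mult[OF f(2)] vanishes_beyond_mult[OF f'(2)]], where A=A]
    unfolding set_integrable_def .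
  ultimately have "(\<integral>x. F' x \<partial>lborel) = 0" by (intro integral_partial_derivative_eq_0)
  then show ?thesis unfolding FF' gint_def set_lebesgue_integral_def by simp
qed

subsection \<open>The regularised Vandermonde weight\<close>

text \<open>Both orders of a pair occur, each with exponent k/2 on the square, so for e = 0 and
  \<open>A = UNIV\<close> this is the product of |x_i - x_j|^(2k) over i < j. A positive
  \<open>e\<close> keeps all bases positive and the weight differentiable.\<close>

definition vand :: "'n::finite set \<Rightarrow> real \<Rightarrow> real \<Rightarrow> real^'n \<Rightarrow> real" where
  "vand A k e x = (\<Prod>l\<in>A. \<Prod>m\<in>A - {l}. ((x $ l - x $ m)\<^sup>2 + e) powr (k / 2))"

lemma continuous_on_vand:
  assumes "0 < k" "0 \<le> e" shows "continuous_on S (vand A k e)"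
  unfolding vand_def using assms
  by (intro continuous_on_prod continuous_on_powr' continuous_intros) auto

lemma vand_nonneg: "0 \<le> vand A k e x"
  unfolding vand_def by (intro prod_nonneg) auto

lemma vand_mono: "0 \<le> k \<Longrightarrow> 0 \<le> e \<Longrightarrow> e \<le> e' \<Longrightarrow> vand A k e x \<le> vand A k e' x"
  unfolding vand_def by (intro prod_mono conjI powr_mono2 prod_nonneg) auto

lemma vand_tendsto:
  assumes "0 < k" shows "(\<lambda>n. vand A k (1 / real (Suc n)) x) \<longlonglongrightarrow> vand A k 0 x"
  unfolding vand_def
proof (intro tendsto_prod)
  fix l m assume "l \<in> A" "m \<in> A - {l}"
  have "(\<lambda>n. (x $ l - x $ m)\<^sup>2 + 1 / real (Suc n)) \<longlonglongrightarrow> (x $ l - x $ m)\<^sup>2 + 0"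
    by (intro tendsto_intros LIMSEQ_Suc[OF lim_1_over_n])
  then show "(\<lambda>n. ((x $ l - x $ m)\<^sup>2 + 1 / real (Suc n)) powr (k / 2)) \<longlonglongrightarrow> ((x $ l - x $ m)\<^sup>2 + 0) powr (k / 2)"
    using assms by (intro tendsto_powr') auto
qed

lemma vand_eq_0: "i \<in> A \<Longrightarrow> j \<in> A \<Longrightarrow> i \<noteq> j \<Longrightarrow> x $ i = x $ j \<Longrightarrow> vand A k 0 x = 0"
  unfolding vand_def
proof (rule prod_zero)
  assume *: "i \<in> A" "j \<in> A" "i \<noteq> j" "x $ i = x $ j"
  have "(\<Prod>m\<in>A - {i}. ((x $ i - x $ m)\<^sup>2 + 0) powr (k / 2)) = 0"
    by (rule prod_zero) (use * in \<open>auto intro!: bexI[of _ j]\<close>)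
  then show "\<exists>l\<in>A. (\<Prod>m\<in>A - {l}. ((x $ l - x $ m)\<^sup>2 + 0) powr (k / 2)) = 0" using * by blast
qed simp

lemma vand_permv:
  assumes "bij \<pi>" shows "vand A k e (permv \<pi> x) = vand (\<pi> ` A) k e x"
proof -
  have inj: "inj_on \<pi> S" for S using assms by (auto simp: bij_def inj_on_def)
  have "vand (\<pi> ` A) k e x = (\<Prod>l\<in>A. \<Prod>m\<in>\<pi> ` A - {\<pi> l}. ((x $ \<pi> l - x $ m)\<^sup>2 + e) powr (k / 2))"
    unfolding vand_def by (simp add: prod.reindex[OF inj])
  also have "\<dots> = (\<Prod>l\<in>A. \<Prod>m\<in>\<pi> ` (A - {l}). ((x $ \<pi> l - x $ m)\<^sup>2 + e) powr (k / 2))"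
    using assms by (intro prod.cong refl) (auto simp: bij_def inj_eq)
  finally show ?thesis unfolding vand_def by (simp add: prod.reindex[OF inj])
qed

lemma vand_face: "vand A k e (face A x) = vand A k e x"
  unfolding vand_def by (intro prod.cong) auto

text \<open>All factors with coordinate \<open>i\<close> are collected in one exponential, so the
  logarithmic derivative in direction \<open>i\<close> is a plain sum over the other
  coordinates.\<close>

lemma vand_remove:
  assumes "i \<in> A" "0 < e"
  shows "vand A k e x = vand (A - {i}) k e x * exp (k * (\<Sum>j\<in>A - {i}. ln ((x $ i - x $ j)\<^sup>2 + e)))"
proof -
  let ?g = "\<lambda>l m. ((x $ l - x $ m)\<^sup>2 + e) powr (k / 2)"
  have pos: "0 < (x $ l - x $ m)\<^sup>2 + e" for l m using assms(2) by (simp add: add_nonneg_pos)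
  have "vand A k e x = (\<Prod>m\<in>A - {i}. ?g i m) * (\<Prod>l\<in>A - {i}. \<Prod>m\<in>A - {l}. ?g l m)"
    unfolding vand_def using assms by (simp add: prod.remove[of A i])
  also have "(\<Prod>l\<in>A - {i}. \<Prod>m\<in>A - {l}. ?g l m) = (\<Prod>l\<in>A - {i}. ?g l i * (\<Prod>m\<in>A - {i} - {l}. ?g l m))"
  proof (rule prod.cong)
    fix l assume l: "l \<in> A - {i}"
    have "A - {l} - {i} = A - {i} - {l}" by auto
    then show "(\<Prod>m\<in>A - {l}. ?g l m) = ?g l i * (\<Prod>m\<in>A - {i} - {l}. ?g l m)"
      using l assms by (subst prod.remove[of "A - {l}" i]) auto
  qed simp
  also have "(\<Prod>m\<in>A - {i}. ?g i m) * \<dots> = (\<Prod>m\<in>A - {i}. ?g i m * ?g m i) * vand (A - {i}) k e x"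
    by (simp add: prod.distrib vand_def mult.assoc)
  also have "(\<Prod>m\<in>A - {i}. ?g i m * ?g m i) = (\<Prod>m\<in>A - {i}. exp (k * ln ((x $ i - x $ m)\<^sup>2 + e)))"
  proof (rule prod.cong)
    fix m
    have "?g m i = ?g i m" by (simp add: power2_commute)
    then have "?g i m * ?g m i = ?g i m * ?g i m" by simp
    also have "\<dots> = ((x $ i - x $ m)\<^sup>2 + e) powr (k / 2 + k / 2)" by (simp only: powr_add)
    also have "\<dots> = exp (k * ln ((x $ i - x $ m)\<^sup>2 + e))"
      using pos[of i m] by (simp add: powr_def)
    finally show "?g i m * ?g m i = exp (k * ln ((x $ i - x $ m)\<^sup>2 + e))" .
  qed simp
  finally show ?thesis by (simp add: exp_sum[symmetric] sum_distrib_left mult.commute)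
qed

lemma has_pd_vand:
  assumes "i \<in> A" "0 < e"
  shows "has_pd i (\<lambda>x. complex_of_real (vand A k e x))
     (\<lambda>x. complex_of_real (vand A k e x * (\<Sum>j\<in>A - {i}. 2 * k * (x $ i - x $ j) / ((x $ i - x $ j)\<^sup>2 + e))))"
  unfolding has_pd_def
proof
  fix x
  let ?L = "\<lambda>t. \<Sum>j\<in>A - {i}. ln ((x $ i + t - x $ j)\<^sup>2 + e)"
  let ?y = "\<lambda>t. x + t *\<^sub>R axis i 1"
  have pos: "0 < u\<^sup>2 + e" for u :: real using assms(2) by (simp add: add_nonneg_pos)
  have eq: "vand A k e (?y t) = vand (A - {i}) k e x * exp (k * ?L t)" for t
  proof -
    have "vand (A - {i}) k e (?y t) = vand (A - {i}) k e x"
      unfolding vand_def by (intro prod.cong) (auto simp: axis_def)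
    moreover have "(\<Sum>j\<in>A - {i}. ln ((?y t $ i - ?y t $ j)\<^sup>2 + e)) = ?L t"
      by (intro sum.cong) (auto simp: axis_def)
    ultimately show ?thesis unfolding vand_remove[OF assms, of k "?y t"] by simp
  qed
  have "((\<lambda>t. vand (A - {i}) k e x * exp (k * ?L t)) has_real_derivative
     vand (A - {i}) k e x * (exp (k * ?L 0) * (k * (\<Sum>j\<in>A - {i}. 2 * (x $ i - x $ j) / ((x $ i - x $ j)\<^sup>2 + e))))) (at 0)"
    using pos by (auto intro!: derivative_eq_intros sum.cong)
  moreover have "vand (A - {i}) k e x * (exp (k * ?L 0) * (k * (\<Sum>j\<in>A - {i}. 2 * (x $ i - x $ j) / ((x $ i - x $ j)\<^sup>2 + e))))
      = vand A k e x * (\<Sum>j\<in>A - {i}. 2 * k * (x $ i - x $ j) / ((x $ i - x $ j)\<^sup>2 + e))"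
    unfolding vand_remove[OF assms, of k x] by (simp add: sum_distrib_left mult_ac)
  ultimately have "((\<lambda>t. vand A k e (?y t)) has_real_derivative
     vand A k e x * (\<Sum>j\<in>A - {i}. 2 * k * (x $ i - x $ j) / ((x $ i - x $ j)\<^sup>2 + e))) (at 0)"
    unfolding eq by simp
  then show "((\<lambda>t. complex_of_real (vand A k e (?y t))) has_vector_derivative
     complex_of_real (vand A k e x * (\<Sum>j\<in>A - {i}. 2 * k * (x $ i - x $ j) / ((x $ i - x $ j)\<^sup>2 + e)))) (at 0)"
    by (rule has_vector_derivative_complex_of_real)
qed

lemma vand_symmetric: "i \<in> A \<Longrightarrow> j \<in> A \<Longrightarrow> vand A k e (swapv i j x) = vand A k e x"
  by (simp add: vand_permv bij_transpose)

lemma swap_vimage: "i \<in> A \<Longrightarrow> j \<in> A \<Longrightarrow> Transposition.transpose i j -` A = A"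
  by (auto simp: Transposition.transpose_def split: if_splits)

lemma continuous_on_of_real_vand: "0 < k \<Longrightarrow> 0 \<le> e \<Longrightarrow> continuous_on S (\<lambda>x. complex_of_real (vand A k e x))"
  by (intro continuous_intros continuous_on_vand)

lemma vanishes_beyond_sum:
  fixes f :: "'b \<Rightarrow> real^'n::finite \<Rightarrow> complex"
  assumes "\<And>j. j \<in> J \<Longrightarrow> vanishes_beyond B (f j)"
  shows "vanishes_beyond B (\<lambda>x. \<Sum>j\<in>J. f j x)"
  unfolding vanishes_beyond_def
proof (intro allI impI sum.neutral ballI)
  fix x :: "real^'n" and j assume x: "(\<forall>i. 0 \<le> x $ i) \<and> B \<le> p1 x" and j: "j \<in> J"
  then show "f j x = 0" using assms[OF j] unfolding vanishes_beyond_def by blast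
qed

lemma continuous_on_compose_permv:
  assumes "continuous_on UNIV g" shows "continuous_on UNIV (\<lambda>x. g (permv \<pi> x))"
  using continuous_on_compose2[OF assms continuous_on_permv[OF continuous_on_id]] by simp

text \<open>Integration by parts for f times the smoothed weight adds, for each j, x_i f times an
  expression odd in x_i - x_j. Averaging with the swap of i and j replaces x_i f by half of x_i f -
  x_j (f o swap), and this difference is (x_i - x_j) (f + x_j \<open>ddiff i j f\<close>).\<close>

lemma master_regularised:
  fixes f :: "real^'n::finite \<Rightarrow> complex"
  assumes i: "i \<in> A" and k: "0 < k" and b: "1 < Re b" and e: "0 < e"
    and f: "smooth_fun f" "vanishes_beyond B f"
  shows "gint A b (\<lambda>x. (b * f x + of_real (x $ i) * pdiff i f x
       + (\<Sum>j\<in>A - {i}. of_real k * (f x + of_real (x $ j) * ddiff i j f x) * of_real ((x $ i - x $ j)\<^sup>2 / ((x $ i - x $ j)\<^sup>2 + e))))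
       * of_real (vand A k e x)) = 0"
proof -
  have b0: "0 < Re b" using b by simp
  let ?E = "\<lambda>x. complex_of_real (vand A k e x)"
  let ?c = "\<lambda>j x. complex_of_real (2 * k * (x $ i - x $ j) / ((x $ i - x $ j)\<^sup>2 + e))"
  have pos: "u\<^sup>2 + e \<noteq> 0" for u :: real using e by (metis add_nonneg_pos less_irrefl zero_le_power2)
  have cE: "continuous_on UNIV ?E" using k e by (intro continuous_on_of_real_vand) auto
  have cc: "continuous_on UNIV (?c j)" for j using pos by (intro continuous_intros) auto
  have cx: "continuous_on UNIV (\<lambda>x::real^'n. complex_of_real (x $ j))" for j by (intro continuous_intros)
  note cf = smooth_fun_continuous[OF f(1)] smooth_fun_continuous[OF smooth_fun_pdiff[OF f(1)]]
  have vp: "vanishes_beyond B (pdiff i f)" by (rule vanishes_beyond_pdiff[OF f])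
  have pd: "has_pd i (\<lambda>x. f x * ?E x) (\<lambda>x. f x * (?E x * (\<Sum>j\<in>A - {i}. ?c j x)) + pdiff i f x * ?E x)"
    using has_pd_mult[OF smooth_fun_has_pd[OF f(1)] has_pd_vand[OF i e, of k]] by simp
  have "gint A b (\<lambda>x. b * (f x * ?E x) + of_real (x $ i) * (f x * (?E x * (\<Sum>j\<in>A - {i}. ?c j x)) + pdiff i f x * ?E x)) = 0"
    by (rule gint_by_parts[OF i b pd, where B=B])
       (intro continuous_intros cE cc cf vanishes_beyond_add vanishes_beyond_mult' f vp)+
  also have "(\<lambda>x. b * (f x * ?E x) + of_real (x $ i) * (f x * (?E x * (\<Sum>j\<in>A - {i}. ?c j x)) + pdiff i f x * ?E x))
    = (\<lambda>x. (b * f x + of_real (x $ i) * pdiff i f x) * ?E x + (\<Sum>j\<in>A - {i}. of_real (x $ i) * f x * ?E x * ?c j x))"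
    by (intro ext) (simp add: algebra_simps sum_distrib_left)
  also have "gint A b \<dots> = gint A b (\<lambda>x. (b * f x + of_real (x $ i) * pdiff i f x) * ?E x) + (\<Sum>j\<in>A - {i}. gint A b (\<lambda>x. of_real (x $ i) * f x * ?E x * ?c j x))"
  proof -
    have s: "gint A b (\<lambda>x. \<Sum>j\<in>A - {i}. of_real (x $ i) * f x * ?E x * ?c j x) = (\<Sum>j\<in>A - {i}. gint A b (\<lambda>x. of_real (x $ i) * f x * ?E x * ?c j x))"
      by (rule gint_sum[OF b0, where B=B], simp,
          intro conjI continuous_on_mult cE cc cf cx vanishes_beyond_mult' vanishes_beyond_mult f)
    have "vanishes_beyond B (\<lambda>x. \<Sum>j\<in>A - {i}. of_real (x $ i) * f x * ?E x * ?c j x)"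
      using f(2) by (simp add: vanishes_beyond_def)
    then have "gint A b (\<lambda>x. (b * f x + of_real (x $ i) * pdiff i f x) * ?E x + (\<Sum>j\<in>A - {i}. of_real (x $ i) * f x * ?E x * ?c j x))
      = gint A b (\<lambda>x. (b * f x + of_real (x $ i) * pdiff i f x) * ?E x) + gint A b (\<lambda>x. \<Sum>j\<in>A - {i}. of_real (x $ i) * f x * ?E x * ?c j x)"
      by (intro gint_add[OF b0, where B=B and C=B] continuous_on_sum continuous_on_add continuous_on_mult continuous_on_const cE cc cf cx
            vanishes_beyond_mult' vanishes_beyond_add vanishes_beyond_mult[OF f(2)] vanishes_beyond_mult[OF vp])
    then show ?thesis unfolding s .
  qed
  also have "(\<Sum>j\<in>A - {i}. gint A b (\<lambda>x. of_real (x $ i) * f x * ?E x * ?c j x))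
     = (\<Sum>j\<in>A - {i}. gint A b (\<lambda>x. of_real k * (f x + of_real (x $ j) * ddiff i j f x) * of_real ((x $ i - x $ j)\<^sup>2 / ((x $ i - x $ j)\<^sup>2 + e)) * ?E x))"
  proof (rule sum.cong)
    fix j assume "j \<in> A - {i}"
    then have j: "j \<in> A" "i \<noteq> j" by auto
    let ?g = "\<lambda>x. of_real (x $ i) * f x * ?E x * ?c j x"
    have cg: "continuous_on UNIV ?g" by (intro continuous_on_mult cE cc cf cx)
    have vg: "vanishes_beyond B ?g" by (intro vanishes_beyond_mult' vanishes_beyond_mult f)
    have cgs: "continuous_on UNIV (\<lambda>x. ?g (swapv i j x))"
      by (rule continuous_on_compose_permv[OF cg])
    \<comment> \<open>The measure on the face is invariant under exchanging two coordinates of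
      \<open>A\<close>, so the integral may be replaced by its mean with the swapped copy.\<close>
    have "gint A b (\<lambda>x. ?g (swapv i j x)) = gint A b ?g"
      using gint_permv[OF bij_transpose[of i j] cg, where A=A and b=b, unfolded swap_vimage[OF i j(1)]] .
    then have "gint A b ?g = 1/2 * (gint A b ?g + gint A b (\<lambda>x. ?g (swapv i j x)))" by simp
    also have "\<dots> = 1/2 * gint A b (\<lambda>x. ?g x + ?g (swapv i j x))"
      by (subst gint_add[OF b0 cg vg cgs vanishes_beyond_permv[OF bij_transpose vg]]) simp
    also have "\<dots> = gint A b (\<lambda>x. 1/2 * (?g x + ?g (swapv i j x)))" by (rule gint_cmult[symmetric])
    also have "(\<lambda>x. 1/2 * (?g x + ?g (swapv i j x))) = (\<lambda>x. of_real k * (f x + of_real (x $ j) * ddiff i j f x) * of_real ((x $ i - x $ j)\<^sup>2 / ((x $ i - x $ j)\<^sup>2 + e)) * ?E x)"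
    proof
      fix x :: "real^'n"
      define u where "u = x $ i - x $ j"
      have "x $ j - x $ i = - (x $ i - x $ j)" by simp
      then have "2 * k * (x $ j - x $ i) / ((x $ j - x $ i)\<^sup>2 + e) = - (2 * k * (x $ i - x $ j) / ((x $ i - x $ j)\<^sup>2 + e))"
        by (simp only: power2_minus mult_minus_right minus_divide_left)
      then have anti: "?c j (swapv i j x) = - ?c j x"
        by (simp only: permv_nth transpose_apply_first transpose_apply_second of_real_minus)
      have fs: "f (swapv i j x) = f x - of_real u * ddiff i j f x"
        unfolding u_def using ddiff_eq[OF j(2) f(1), of x] by simp
      have "1/2 * (?g x + ?g (swapv i j x)) = 1/2 * (of_real (x $ i) * f x - of_real (x $ j) * f (swapv i j x)) * ?E x * ?c j x"
        unfolding anti vand_symmetric[OF i j(1)] by (simp add: algebra_simps)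
      also have "of_real (x $ i) * f x - of_real (x $ j) * f (swapv i j x) = of_real u * (f x + of_real (x $ j) * ddiff i j f x)"
        unfolding fs by (simp add: u_def algebra_simps)
      also have "1/2 * (of_real u * (f x + of_real (x $ j) * ddiff i j f x)) * ?E x * ?c j x
         = (f x + of_real (x $ j) * ddiff i j f x) * ?E x * (1/2 * of_real u * ?c j x)" by (simp add: mult_ac)
      also have "1/2 * of_real u * ?c j x = of_real k * of_real (u\<^sup>2 / (u\<^sup>2 + e))"
        unfolding u_def[symmetric] by (simp add: power2_eq_square)
      finally show "1/2 * (?g x + ?g (swapv i j x)) = of_real k * (f x + of_real (x $ j) * ddiff i j f x) * of_real ((x $ i - x $ j)\<^sup>2 / ((x $ i - x $ j)\<^sup>2 + e)) * ?E x"
        unfolding u_def by (simp add: mult_ac)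
    qed
    finally show "gint A b ?g = gint A b (\<lambda>x. of_real k * (f x + of_real (x $ j) * ddiff i j f x) * of_real ((x $ i - x $ j)\<^sup>2 / ((x $ i - x $ j)\<^sup>2 + e)) * ?E x)" .
  qed simp
  also have "gint A b (\<lambda>x. (b * f x + of_real (x $ i) * pdiff i f x) * ?E x) + \<dots> =
     gint A b (\<lambda>x. (b * f x + of_real (x $ i) * pdiff i f x) * ?E x + (\<Sum>j\<in>A - {i}. of_real k * (f x + of_real (x $ j) * ddiff i j f x) * of_real ((x $ i - x $ j)\<^sup>2 / ((x $ i - x $ j)\<^sup>2 + e)) * ?E x))"
  proof -
    let ?h = "\<lambda>j x. of_real k * (f x + of_real (x $ j) * ddiff i j f x) * of_real ((x $ i - x $ j)\<^sup>2 / ((x $ i - x $ j)\<^sup>2 + e)) * ?E x"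
    have ch: "continuous_on UNIV (?h j) \<and> vanishes_beyond B (?h j)" if "j \<in> A - {i}" for j
    proof
      have ij: "i \<noteq> j" using that by auto
      have "continuous_on UNIV (\<lambda>x. complex_of_real ((x $ i - x $ j)\<^sup>2 / ((x $ i - x $ j)\<^sup>2 + e)))"
        using pos by (intro continuous_intros) auto
      then show "continuous_on UNIV (?h j)"
        by (intro continuous_on_mult continuous_on_add continuous_on_const cE cf cx smooth_fun_continuous[OF smooth_fun_ddiff[OF ij f(1)]])
      show "vanishes_beyond B (?h j)"
        by (intro vanishes_beyond_mult' vanishes_beyond_mult vanishes_beyond_add f vanishes_beyond_ddiff[OF ij f])
    qed
    have "vanishes_beyond B (\<lambda>x. \<Sum>j\<in>A - {i}. ?h j x)"
      using ch by (intro vanishes_beyond_sum) auto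
    moreover have "continuous_on UNIV (\<lambda>x. \<Sum>j\<in>A - {i}. ?h j x)"
      using ch by (intro continuous_on_sum) auto
    ultimately have "gint A b (\<lambda>x. (b * f x + of_real (x $ i) * pdiff i f x) * ?E x + (\<Sum>j\<in>A - {i}. ?h j x))
      = gint A b (\<lambda>x. (b * f x + of_real (x $ i) * pdiff i f x) * ?E x) + gint A b (\<lambda>x. \<Sum>j\<in>A - {i}. ?h j x)"
      by (intro gint_add[OF b0, where B=B and C=B] continuous_on_add continuous_on_mult continuous_on_const cE cf cx
            vanishes_beyond_mult' vanishes_beyond_add vanishes_beyond_mult[OF f(2)] vanishes_beyond_mult[OF vp])
    moreover have "gint A b (\<lambda>x. \<Sum>j\<in>A - {i}. ?h j x) = (\<Sum>j\<in>A - {i}. gint A b (?h j))"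
      by (rule gint_sum[OF b0 _ ch]) simp
    ultimately show ?thesis by (simp only:)
  qed
  finally show ?thesis by (simp add: distrib_right sum_distrib_right)
qed

text \<open>Let e tend to 0. Off the diagonal x_i = x_j the quotients tend to 1; on it the
  Vandermonde weight itself vanishes in the limit, so convergence is pointwise everywhere.\<close>

lemma master_large:
  fixes f :: "real^'n::finite \<Rightarrow> complex"
  assumes i: "i \<in> A" and k: "0 < k" and b: "1 < Re b"
    and f: "smooth_fun f" "vanishes_beyond B f"
  shows "gint A b (\<lambda>x. (b * f x + of_real (x $ i) * pdiff i f x
       + (\<Sum>j\<in>A - {i}. of_real k * (f x + of_real (x $ j) * ddiff i j f x))) * of_real (vand A k 0 x)) = 0"
proof -
  have b0: "0 < Re b" using b by simp
  let ?u = "\<lambda>x::real^'n. b * f x + of_real (x $ i) * pdiff i f x"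
  let ?v = "\<lambda>j x. of_real k * (f x + of_real (x $ j) * ddiff i j f x)"
  let ?q = "\<lambda>e j x. complex_of_real ((x $ i - x $ j)\<^sup>2 / ((x $ i - x $ j)\<^sup>2 + e))"
  let ?fe = "\<lambda>e x. (?u x + (\<Sum>j\<in>A - {i}. ?v j x * ?q e j x)) * of_real (vand A k e x)"
  let ?g = "\<lambda>x. (?u x + (\<Sum>j\<in>A - {i}. ?v j x)) * of_real (vand A k 0 x)"
  \<comment> \<open>A bound for all e <= 1: the quotients are at most 1, and the weight increases
    with \<open>e\<close>.\<close>
  define H where "H x = complex_of_real ((norm (?u x) + (\<Sum>j\<in>A - {i}. norm (?v j x))) * vand A k 1 x)" for x
  have cx: "continuous_on UNIV (\<lambda>x::real^'n. complex_of_real (x $ j))" for j by (intro continuous_intros)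
  note cf = smooth_fun_continuous[OF f(1)] smooth_fun_continuous[OF smooth_fun_pdiff[OF f(1)]]
  have cu: "continuous_on UNIV ?u" by (intro continuous_on_add continuous_on_mult continuous_on_const cf cx)
  have cv: "continuous_on UNIV (?v j)" if "j \<in> A - {i}" for j
    using that by (intro continuous_on_add continuous_on_mult continuous_on_const cf cx smooth_fun_continuous[OF smooth_fun_ddiff] f) auto
  have vu: "vanishes_beyond B ?u" by (intro vanishes_beyond_add vanishes_beyond_mult f vanishes_beyond_pdiff)
  have vv: "vanishes_beyond B (?v j)" if "j \<in> A - {i}" for j
    using that by (intro vanishes_beyond_add vanishes_beyond_mult f vanishes_beyond_ddiff) auto
  have vs: "vanishes_beyond B (\<lambda>x. \<Sum>j\<in>A - {i}. ?v j x * r j x)" for r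
    by (intro vanishes_beyond_sum vanishes_beyond_mult' vv)
  have "continuous_on UNIV H" unfolding H_def
    using k by (intro continuous_on_of_real continuous_on_mult continuous_on_add continuous_on_norm cu continuous_on_sum cv continuous_on_vand) auto
  then obtain S where S: "0 \<le> S" "\<And>x. x \<in> simplex_set B \<Longrightarrow> norm (H x) \<le> S" using bounded_on_simplex by metis
  have q1: "norm (?q e j x) \<le> 1" if "0 < e" for e j x
    using that by (simp add: norm_divide divide_le_eq add_nonneg_pos del: of_real_divide of_real_power of_real_add) 
  have derivs_bounded: "norm (?fe e x) \<le> norm (H x)" if "0 < e" "e \<le> 1" for e x
  proof -
    have "norm (?u x + (\<Sum>j\<in>A - {i}. ?v j x * ?q e j x)) \<le> norm (?u x) + (\<Sum>j\<in>A - {i}. norm (?v j x))"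
    proof (rule order_trans[OF norm_triangle_ineq add_left_mono])
      have "norm (\<Sum>j\<in>A - {i}. ?v j x * ?q e j x) \<le> (\<Sum>j\<in>A - {i}. norm (?v j x * ?q e j x))" by (rule norm_sum)
      also have "\<dots> \<le> (\<Sum>j\<in>A - {i}. norm (?v j x))"
      proof (rule sum_mono)
        fix j
        show "norm (?v j x * ?q e j x) \<le> norm (?v j x)"
          unfolding norm_mult[of "?v j x"] by (rule mult_left_le[OF q1[OF that(1)] norm_ge_zero])
      qed
      finally show "norm (\<Sum>j\<in>A - {i}. ?v j x * ?q e j x) \<le> (\<Sum>j\<in>A - {i}. norm (?v j x))" .
    qed
    moreover have "vand A k e x \<le> vand A k 1 x" using that k by (intro vand_mono) auto
    ultimately have "norm (?u x + (\<Sum>j\<in>A - {i}. ?v j x * ?q e j x)) * vand A k e x \<le> (norm (?u x) + (\<Sum>j\<in>A - {i}. norm (?v j x))) * vand A k 1 x"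
      by (intro mult_mono) (auto intro!: add_nonneg_nonneg sum_nonneg simp: vand_nonneg)
    moreover have "0 \<le> (norm (?u x) + (\<Sum>j\<in>A - {i}. norm (?v j x))) * vand A k 1 x"
      by (intro mult_nonneg_nonneg add_nonneg_nonneg sum_nonneg vand_nonneg) auto
    ultimately show ?thesis unfolding H_def norm_mult norm_of_real by (simp only: abs_of_nonneg vand_nonneg)
  qed
  have "(\<lambda>n. gint A b (?fe (1 / real (Suc n)))) \<longlonglongrightarrow> gint A b ?g"
  proof (rule gint_tendsto[OF b0, where B=B and S=S])
    fix n
    let ?e = "1 / real (Suc n)"
    have e: "0 < ?e" "?e \<le> 1" by auto
    have pos: "u\<^sup>2 + ?e \<noteq> 0" for u :: real using e(1) by (metis add_nonneg_pos less_irrefl zero_le_power2)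
    have cq: "continuous_on UNIV (?q ?e j)" for j
      by (intro continuous_intros) (use pos in auto)
    show "continuous_on UNIV (?fe ?e)" using k e
      by (intro continuous_on_mult continuous_on_add cu continuous_on_sum cv cq continuous_on_of_real_vand) auto
    show "vanishes_beyond B (?fe ?e)" by (intro vanishes_beyond_mult' vanishes_beyond_add vu vs)
    show "norm (?fe ?e y) \<le> S" if "y \<in> simplex_set B" for y
      using derivs_bounded[OF e, of y] S(2)[OF that] by linarith
  next
    show "continuous_on UNIV ?g" using k
      by (intro continuous_on_mult continuous_on_add cu continuous_on_sum cv continuous_on_of_real_vand) auto
    show "vanishes_beyond B ?g" using vs[of "\<lambda>_ _. 1"] by (intro vanishes_beyond_mult' vanishes_beyond_add vu) simp
    fix x :: "real^'n"
    have vt: "(\<lambda>n. complex_of_real (vand A k (1 / real (Suc n)) x)) \<longlonglongrightarrow> complex_of_real (vand A k 0 x)"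
      by (intro tendsto_of_real vand_tendsto k)
    show "(\<lambda>n. ?fe (1 / real (Suc n)) x) \<longlonglongrightarrow> ?g x"
      unfolding distrib_right sum_distrib_right
    proof (intro tendsto_add tendsto_sum tendsto_mult[OF tendsto_const vt])
      fix j assume j: "j \<in> A - {i}"
      show "(\<lambda>n. ?v j x * ?q (1 / real (Suc n)) j x * of_real (vand A k (1 / real (Suc n)) x)) \<longlonglongrightarrow> ?v j x * of_real (vand A k 0 x)"
      proof (cases "x $ i = x $ j")
        case True
        have "vand A k 0 x = 0" using vand_eq_0[OF i _ _ True] j by blast
        then show ?thesis using True by simp
      next
        case False
        have "(\<lambda>n. (x $ i - x $ j)\<^sup>2 / ((x $ i - x $ j)\<^sup>2 + 1 / real (Suc n))) \<longlonglongrightarrow> (x $ i - x $ j)\<^sup>2 / ((x $ i - x $ j)\<^sup>2 + 0)"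
          using False by (intro tendsto_intros LIMSEQ_Suc[OF lim_1_over_n]) auto
        then have "(\<lambda>n. ?q (1 / real (Suc n)) j x) \<longlonglongrightarrow> of_real ((x $ i - x $ j)\<^sup>2 / ((x $ i - x $ j)\<^sup>2 + 0))"
          by (rule tendsto_of_real)
        then have "(\<lambda>n. ?q (1 / real (Suc n)) j x) \<longlonglongrightarrow> 1" using False by simp
        from tendsto_mult[OF tendsto_mult[OF tendsto_const this] vt] show ?thesis by simp
      qed
    qed
  qed (rule S(1))
  moreover have "(\<lambda>n. gint A b (?fe (1 / real (Suc n)))) = (\<lambda>n. 0)"
    by (rule ext, rule master_regularised[OF i k b _ f]) simp
  ultimately have "(\<lambda>n::nat. 0) \<longlonglongrightarrow> gint A b ?g" by (simp only:)
  then show ?thesis by (rule LIMSEQ_unique[OF _ tendsto_const])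
qed

section \<open>Integrals with the Vandermonde weight\<close>

definition fint :: "'n::finite set \<Rightarrow> real \<Rightarrow> complex \<Rightarrow> (real^'n \<Rightarrow> complex) \<Rightarrow> complex" where
  "fint A k b f = gint A b (\<lambda>x. f x * of_real (vand A k 0 x))"

lemma fint_add:
  assumes "0 < k" "0 < Re b" "orthant_test f" "orthant_test g"
  shows "fint A k b (\<lambda>x. f x + g x) = fint A k b f + fint A k b g"
proof -
  obtain B C where "vanishes_beyond B f" "vanishes_beyond C g" using assms by (auto simp: orthant_test_def)
  then show ?thesis unfolding fint_def distrib_right using assms
    by (intro gint_add continuous_on_mult continuous_on_of_real_vand vanishes_beyond_mult' smooth_fun_continuous orthant_test_smooth) auto
qed

lemma fint_cmult: "fint A k b (\<lambda>x. c * f x) = c * fint A k b f"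
  unfolding fint_def by (simp add: gint_cmult mult.assoc)

lemma fint_cong: "(\<And>x. x \<in> positive_orthant \<Longrightarrow> f (face A x) = g (face A x)) \<Longrightarrow> fint A k b f = fint A k b g"
  unfolding fint_def by (intro gint_cong) simp

lemma holomorphic_fint:
  assumes "0 < k" "orthant_test f" shows "(\<lambda>b. fint A k b f) holomorphic_on {b. 0 < Re b}"
proof -
  obtain B where "vanishes_beyond B f" using assms by (auto simp: orthant_test_def)
  then show ?thesis unfolding fint_def using assms
    by (intro holomorphic_gint[where B=B] continuous_on_mult continuous_on_of_real_vand vanishes_beyond_mult' smooth_fun_continuous orthant_test_smooth) auto
qed

lemma fint_permv:
  assumes "0 < k" "bij \<pi>" "orthant_test f"
  shows "fint A k b (\<lambda>x. f (permv \<pi> x)) = fint (\<pi> -` A) k b f"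
proof -
  have "continuous_on UNIV (\<lambda>x. f x * complex_of_real (vand (\<pi> -` A) k 0 x))"
    using assms by (intro continuous_on_mult continuous_on_of_real_vand smooth_fun_continuous orthant_test_smooth) auto
  from gint_permv[OF assms(2) this, where A=A and b=b] show ?thesis
    using assms(2) by (simp add: fint_def vand_permv bij_is_surj surj_image_vimage_eq)
qed

text \<open>The terms k f from the card A - 1 other coordinates join the factor b. The left side is
  holomorphic for Re b > 0 and vanishes for Re b > 1, hence throughout.\<close>

lemma fint_master:
  assumes i: "i \<in> A" and k: "0 < k" and b: "0 < Re b" and f: "orthant_test f"
  shows "(b + of_real k * (of_nat (card A) - 1)) * fint A k b f
     + fint A k b (\<lambda>x. of_real (x $ i) * pdiff i f x + (\<Sum>j\<in>A - {i}. of_real k * of_real (x $ j) * ddiff i j f x)) = 0"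
proof -
  let ?r = "\<lambda>x. of_real (x $ i) * pdiff i f x + (\<Sum>j\<in>A - {i}. of_real k * of_real (x $ j) * ddiff i j f x)"
  obtain B where B: "vanishes_beyond B f" using f by (auto simp: orthant_test_def)
  have sf: "smooth_fun f" using f by (rule orthant_test_smooth)
  have r: "orthant_test ?r" using f
    by (intro orthant_test_add orthant_test_sum orthant_test_mult orthant_test_pdiff orthant_test_ddiff smooth_fun_mult smooth_fun_const smooth_fun_coord) auto
  define h where "h b = (b + of_real k * (of_nat (card A) - 1)) * fint A k b f + fint A k b ?r" for b
  have hol: "h holomorphic_on {b. 0 < Re b}" unfolding h_def
    using holomorphic_fint[OF k f] holomorphic_fint[OF k r] by (intro holomorphic_intros)
  have h0: "h b = 0" if b: "1 < Re b" for b
  proof -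
    have "real (card (A - {i})) = real (card A) - 1"
      using card_Diff_singleton[OF i] card_gt_0_iff[of A] i by (auto simp: of_nat_diff)
    then have c: "complex_of_nat (card (A - {i})) = of_nat (card A) - 1"
      by (metis of_real_1 of_real_diff of_real_of_nat_eq)
    have "h b = fint A k b (\<lambda>x. (b + of_real k * (of_nat (card A) - 1)) * f x + ?r x)"
      unfolding h_def using b by (subst fint_add[OF k _ orthant_test_cmult[OF f] r]) (auto simp: fint_cmult)
    also have "(\<lambda>x. (b + of_real k * (of_nat (card A) - 1)) * f x + ?r x) = (\<lambda>x. b * f x + of_real (x $ i) * pdiff i f x
       + (\<Sum>j\<in>A - {i}. of_real k * (f x + of_real (x $ j) * ddiff i j f x)))"
      by (intro ext) (simp add: sum.distrib distrib_left c[symmetric] algebra_simps)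
    finally show ?thesis unfolding fint_def using master_large[OF i k b sf B] by simp
  qed
  have "h b = 0"
    using b
    by (intro analytic_continuation_open[of "{b. 1 < Re b}" "{b. 0 < Re b}" h "\<lambda>_. 0" b] hol)
       (auto simp: h0 open_halfspace_Re_gt intro!: convex_connected convex_halfspace_Re_gt exI[of _ 2])
  then show ?thesis by (simp add: h_def)
qed

subsection \<open>Functionals satisfying the master equation\<close>

text \<open>Common to the Riesz integrals, their continuation, the face functionals and linear
  combinations of these at one parameter; the evaluation of monomials and the uniqueness argument
  are carried out at this level.\<close>

definition master_functional :: "real \<Rightarrow> complex \<Rightarrow> ((real^'n::finite \<Rightarrow> complex) \<Rightarrow> complex) \<Rightarrow> bool" where
  "master_functional k \<mu> R \<longleftrightarrow>
     (\<forall>f g. orthant_test f \<longrightarrow> orthant_test g \<longrightarrow> R (\<lambda>x. f x + g x) = R f + R g) \<and>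
     (\<forall>c f. orthant_test f \<longrightarrow> R (\<lambda>x. c * f x) = c * R f) \<and>
     (\<forall>i f. orthant_test f \<longrightarrow> \<mu> * R f + R (\<lambda>x. of_real (x $ i) * pdiff i f x
         + (\<Sum>j\<in>UNIV - {i}. of_real k * of_real (x $ j) * ddiff i j f x)) = 0)"

lemma master_functional_add: "master_functional k \<mu> R \<Longrightarrow> orthant_test f \<Longrightarrow> orthant_test g \<Longrightarrow> R (\<lambda>x. f x + g x) = R f + R g"
  and master_functional_cmult: "master_functional k \<mu> R \<Longrightarrow> orthant_test f \<Longrightarrow> R (\<lambda>x. c * f x) = c * R f"
  and master_functional_eq: "master_functional k \<mu> R \<Longrightarrow> orthant_test f \<Longrightarrow> \<mu> * R f + R (\<lambda>x. of_real (x $ i) * pdiff i f x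
         + (\<Sum>j\<in>UNIV - {i}. of_real k * of_real (x $ j) * ddiff i j f x)) = 0"
  by (auto simp: master_functional_def)

section \<open>Squarefree monomials under the master equation\<close>

definition mon :: "'n::finite set \<Rightarrow> real^'n \<Rightarrow> complex" where
  "mon B x = (\<Prod>l\<in>B. complex_of_real (x $ l))"

text \<open>On functions symmetric in the coordinates outside \<open>B\<close>, with
  \<open>i\<close> among them, the terms of the Dunkl operator with j outside \<open>B\<close>
  vanish; there this is the full operator T_i(k).\<close>

definition dunkl_step :: "real \<Rightarrow> 'n::finite \<Rightarrow> 'n set \<Rightarrow> (real^'n \<Rightarrow> complex) \<Rightarrow> real^'n \<Rightarrow> complex" where
  "dunkl_step k i B f x = pdiff i f x + (\<Sum>j\<in>B. of_real k * ddiff i j f x)"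

lemma smooth_fun_mon: "smooth_fun (mon B)"
  unfolding mon_def[abs_def] by (intro smooth_fun_prod smooth_fun_coord)

lemma mon_empty [simp]: "mon {} = (\<lambda>x. 1)"
  by (simp add: mon_def fun_eq_iff)

lemma mon_insert: "i \<notin> B \<Longrightarrow> mon (insert i B) x = complex_of_real (x $ i) * mon B x"
  by (simp add: mon_def)

lemma mon_swapv: "i \<notin> B \<Longrightarrow> j \<notin> B \<Longrightarrow> mon B (swapv i j x) = mon B x"
  unfolding mon_def by (intro prod.cong) (auto simp: Transposition.transpose_def)

lemma pdiff_mon:
  assumes "i \<notin> B" shows "pdiff i (mon B) = (\<lambda>x. 0)"
proof (rule has_pd_pdiff)
  have "mon B (x + t *\<^sub>R axis i 1) = mon B x" for x :: "real^'a" and t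
    unfolding mon_def using assms by (intro prod.cong) (auto simp: axis_def)
  then show "has_pd i (mon B) (\<lambda>x. 0)" by (simp add: has_pd_def)
qed

lemma orthant_test_dunkl_step: "i \<notin> B \<Longrightarrow> orthant_test f \<Longrightarrow> orthant_test (dunkl_step k i B f)"
  unfolding dunkl_step_def[abs_def]
  by (intro orthant_test_add orthant_test_pdiff orthant_test_sum orthant_test_cmult orthant_test_ddiff) auto

lemma ddiff_coord: "i \<noteq> j \<Longrightarrow> ddiff i j (\<lambda>x. complex_of_real (x $ j)) = (\<lambda>x. -1)"
  by (rule ddiff_unique) (auto intro: smooth_fun_coord)

text \<open>Apply the equation in direction \<open>i\<close> to the product. Coordinates outside
  \<open>B\<close> contribute nothing to the difference terms, by symmetry. Each j in
  \<open>B\<close> contributes -k times the original product, which lowers \<mu> by k, and a term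
  whose monomial has gained the factor x_i.\<close>

lemma aomoto_relation:
  assumes R: "master_functional k \<mu> R" and i: "i \<notin> B" and f: "orthant_test f"
    and sym: "\<And>j x. j \<notin> B \<Longrightarrow> f (swapv i j x) = f x"
  shows "(\<mu> - of_real k * of_nat (card B)) * R (\<lambda>x. mon B x * f x)
     = - R (\<lambda>x. mon (insert i B) x * dunkl_step k i B f x)"
proof -
  let ?g = "\<lambda>x. mon B x * f x"
  have sf: "smooth_fun f" using f by (rule orthant_test_smooth)
  have g: "orthant_test ?g" by (intro orthant_test_mult smooth_fun_mon f)
  have step: "orthant_test (\<lambda>x. mon (insert i B) x * dunkl_step k i B f x)"
    by (intro orthant_test_mult smooth_fun_mon orthant_test_dunkl_step i f)
  have pd: "pdiff i ?g x = mon B x * pdiff i f x" for x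
    using pdiff_mult[OF smooth_fun_mon sf] pdiff_mon[OF i] by simp
  have d0: "ddiff i j ?g x = 0" if "j \<notin> B" "j \<noteq> i" for j x
  proof -
    have "?g (swapv i j y) = ?g y" for y using mon_swapv[OF i that(1)] sym[OF that(1)] by simp
    then have "ddiff i j ?g = (\<lambda>x. 0)"
      using that by (intro ddiff_symmetric smooth_fun_mult smooth_fun_mon sf) auto
    then show ?thesis by simp
  qed
  \<comment> \<open>Split off the factor x_j, whose divided difference is -1; the remaining monomial
    is symmetric in i and j.\<close>
  have d1: "of_real (x $ j) * ddiff i j ?g x = mon (insert i B) x * ddiff i j f x - ?g x" if j: "j \<in> B" for j x
  proof -
    have ij: "i \<noteq> j" using i j by auto
    let ?h = "\<lambda>x. f x * mon (B - {j}) x"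
    have mB: "mon B x = of_real (x $ j) * mon (B - {j}) x" for x
      using mon_insert[of j "B - {j}" x] j by (simp add: insert_absorb)
    have sh: "smooth_fun ?h" by (intro smooth_fun_mult sf smooth_fun_mon)
    have "?g = (\<lambda>x. of_real (x $ j) * ?h x)" using mB by (simp add: fun_eq_iff)
    then have "ddiff i j ?g x = - ?h x + of_real (x $ i) * ddiff i j ?h x"
      using ddiff_mult[OF ij smooth_fun_coord sh, of j] ddiff_coord[OF ij] by simp
    also have "ddiff i j ?h x = ddiff i j f x * mon (B - {j}) x"
      using ddiff_mult_symmetric[OF ij sf smooth_fun_mon, of "B - {j}"] mon_swapv[of i "B - {j}" j] i by simp
    finally have e: "ddiff i j ?g x = - ?h x + of_real (x $ i) * (ddiff i j f x * mon (B - {j}) x)" .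
    show ?thesis unfolding e by (simp add: mB mon_insert[OF i] algebra_simps)
  qed
  have eq: "of_real (x $ i) * pdiff i ?g x + (\<Sum>j\<in>UNIV - {i}. of_real k * of_real (x $ j) * ddiff i j ?g x)
    = mon (insert i B) x * dunkl_step k i B f x + (- (of_real k * of_nat (card B))) * ?g x" for x
  proof -
    have "(\<Sum>j\<in>UNIV - {i}. of_real k * of_real (x $ j) * ddiff i j ?g x) = (\<Sum>j\<in>B. of_real k * of_real (x $ j) * ddiff i j ?g x)"
      using i d0 by (intro sum.mono_neutral_right) auto
    also have "\<dots> = (\<Sum>j\<in>B. of_real k * (mon (insert i B) x * ddiff i j f x - ?g x))"
      using d1 by (intro sum.cong) (simp_all add: mult.assoc)
    finally show ?thesis unfolding pd
      using mon_insert[OF i, of x]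
      by (simp add: dunkl_step_def sum_subtractf sum_distrib_left algebra_simps)
  qed
  have "\<mu> * R ?g + R (\<lambda>x. mon (insert i B) x * dunkl_step k i B f x + (- (of_real k * of_nat (card B))) * ?g x) = 0"
    using R g unfolding master_functional_def eq[symmetric] by blast
  moreover have "R (\<lambda>x. mon (insert i B) x * dunkl_step k i B f x + (- (of_real k * of_nat (card B))) * ?g x)
     = R (\<lambda>x. mon (insert i B) x * dunkl_step k i B f x) + (- (of_real k * of_nat (card B))) * R ?g"
    by (simp only: master_functional_add[OF R step orthant_test_cmult[OF g]] master_functional_cmult[OF R g])
  ultimately show ?thesis by (simp add: algebra_simps add_eq_0_iff2)
qed

fun dunkl_chain :: "real \<Rightarrow> 'n::finite list \<Rightarrow> 'n set \<Rightarrow> (real^'n \<Rightarrow> complex) \<Rightarrow> real^'n \<Rightarrow> complex" where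
  "dunkl_chain k [] B f = f"
| "dunkl_chain k (i # is) B f = dunkl_chain k is (insert i B) (dunkl_step k i B f)"

definition sym_outside :: "'n::finite set \<Rightarrow> (real^'n \<Rightarrow> complex) \<Rightarrow> bool" where
  "sym_outside B f \<longleftrightarrow> (\<forall>i j x. i \<notin> B \<longrightarrow> j \<notin> B \<longrightarrow> f (swapv i j x) = f x)"

lemma sym_outside_dunkl_step:
  assumes "i \<notin> B" "orthant_test f" "sym_outside B f"
  shows "sym_outside (insert i B) (dunkl_step k i B f)"
  unfolding sym_outside_def
proof (intro allI impI)
  fix j l x assume jl: "j \<notin> insert i B" "l \<notin> insert i B"
  let ?\<pi> = "Transposition.transpose j l"
  have sf: "smooth_fun f" using assms(2) by (rule orthant_test_smooth)
  have f: "(\<lambda>x. f (permv ?\<pi> x)) = f" using assms(3) jl by (auto simp: sym_outside_def)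
  have fix': "?\<pi> m = m" if "m \<in> insert i B" for m using that jl by (auto simp: Transposition.transpose_def)
  have inv: "inv ?\<pi> i = i" by (rule inv_f_eq) (use fix' in auto)
  have "pdiff i f = (\<lambda>x. pdiff i f (permv ?\<pi> x))"
    using pdiff_permv[OF bij_transpose[of j l] sf, of i] unfolding f inv .
  from fun_cong[OF this, of x] have 1: "pdiff i f (permv ?\<pi> x) = pdiff i f x" by (rule sym)
  have 2: "ddiff i m f (permv ?\<pi> x) = ddiff i m f x" if "m \<in> B" for m
    using ddiff_permv[OF _ sf bij_transpose fix' fix', of i m] f that assms(1) by (metis insert_iff)
  show "dunkl_step k i B f (permv ?\<pi> x) = dunkl_step k i B f x"
    unfolding dunkl_step_def using 1 2 by simp
qed

lemma orthant_test_dunkl_chain: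
  "distinct is \<Longrightarrow> set is \<inter> B = {} \<Longrightarrow> orthant_test f \<Longrightarrow> orthant_test (dunkl_chain k is B f)"
  by (induction "is" arbitrary: B f) (auto simp: orthant_test_dunkl_step)

text \<open>Each step contributes the next factor \<mu> - k m and moves one coordinate into the
  monomial. Once the list exhausts all coordinates the monomial is D(x), and multiplication by D(x)
  is a shift of the parameter.\<close>

lemma aomoto_chain:
  assumes R: "master_functional k \<mu> R"
  shows "distinct is \<Longrightarrow> set is \<inter> B = {} \<Longrightarrow> orthant_test f \<Longrightarrow> sym_outside B f \<Longrightarrow>
    (\<Prod>m<length is. \<mu> - of_real k * of_nat (card B + m)) * R (\<lambda>x. mon B x * f x)
     = (-1) ^ length is * R (\<lambda>x. mon (B \<union> set is) x * dunkl_chain k is B f x)"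
proof (induction "is" arbitrary: B f)
  case Nil
  then show ?case by simp
next
  case (Cons i xs)
  have i: "i \<notin> B" using Cons.prems by auto
  have c: "card (insert i B) = Suc (card B)" using i by simp
  have 1: "(\<mu> - of_real k * of_nat (card B)) * R (\<lambda>x. mon B x * f x) = - R (\<lambda>x. mon (insert i B) x * dunkl_step k i B f x)"
    using Cons.prems i by (intro aomoto_relation[OF R]) (auto simp: sym_outside_def)
  have 2: "(\<Prod>m<length xs. \<mu> - of_real k * of_nat (Suc (card B) + m)) * R (\<lambda>x. mon (insert i B) x * dunkl_step k i B f x)
     = (-1) ^ length xs * R (\<lambda>x. mon (insert i B \<union> set xs) x * dunkl_chain k xs (insert i B) (dunkl_step k i B f) x)"
    using Cons.IH[of "insert i B" "dunkl_step k i B f"] Cons.prems i c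
    by (simp add: orthant_test_dunkl_step sym_outside_dunkl_step)
  have "(\<Prod>m<length (i # xs). \<mu> - of_real k * of_nat (card B + m)) * R (\<lambda>x. mon B x * f x)
     = (\<Prod>m<length xs. \<mu> - of_real k * of_nat (Suc (card B) + m)) * ((\<mu> - of_real k * of_nat (card B)) * R (\<lambda>x. mon B x * f x))"
    by (simp add: prod.lessThan_Suc_shift ac_simps del: prod.lessThan_Suc)
  also have "\<dots> = - ((-1) ^ length xs * R (\<lambda>x. mon (insert i B \<union> set xs) x * dunkl_chain k xs (insert i B) (dunkl_step k i B f) x))"
    unfolding 1 using 2 by simp
  finally show ?case by simp
qed

lemma dunkl_step_p1:
  assumes "smooth1 H" "i \<notin> B"
  shows "dunkl_step k i B (\<lambda>x. H (p1 x)) = (\<lambda>x. deriv1 H (p1 x))"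
proof -
  have "ddiff i j (\<lambda>x. H (p1 x)) = (\<lambda>x. 0)" if "j \<in> B" for j
    using that assms by (intro ddiff_symmetric) (auto simp: smooth_fun_p1 bij_transpose)
  then show ?thesis using pdiff_p1[OF assms(1)] by (simp add: dunkl_step_def fun_eq_iff)
qed

lemma dunkl_chain_p1:
  "smooth1 H \<Longrightarrow> distinct is \<Longrightarrow> set is \<inter> B = {} \<Longrightarrow>
     dunkl_chain k is B (\<lambda>x. H (p1 x)) = (\<lambda>x. (deriv1 ^^ length is) H (p1 x))"
proof (induction "is" arbitrary: B H)
  case (Cons i xs)
  then show ?case using Cons.IH[of "deriv1 H" "insert i B"] dunkl_step_p1[of H i B k]
    by (simp add: smooth1_deriv1 funpow_swap1)
qed simp

lemma sym_outside_p1: "sym_outside B (\<lambda>x. H (p1 x))"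
  by (simp add: sym_outside_def bij_transpose)

lemma orthant_test_p1:
  assumes "smooth1 H" "\<And>t. t \<ge> C \<Longrightarrow> H t = 0"
  shows "orthant_test (\<lambda>x. H (p1 x))"
  unfolding orthant_test_def vanishes_beyond_def using assms smooth_fun_p1 by auto

subsection \<open>The Riesz integral\<close>

text \<open>The normalising factor 1 / (d_n \<Gamma>_n), written with the entire function
  \<open>rGamma\<close> so that it is holomorphic everywhere and its zeros can be read off.\<close>

definition rcoef :: "nat \<Rightarrow> real \<Rightarrow> complex \<Rightarrow> complex" where
  "rcoef n k \<mu> = inverse (complex_of_real (d_n n k)) * (\<Prod>j<n. rGamma (\<mu> - of_real k * of_nat j))"

lemma riesz_integral_eq:
  "riesz_integral k \<mu> (f :: real^'n::finite \<Rightarrow> complex)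
     = rcoef CARD('n) k \<mu> * fint UNIV k (\<mu> - of_real (mu0 CARD('n) k)) f"
proof -
  have 1: "omega_k k x = vand UNIV k 0 x" for x :: "real^'n"
  proof -
    have "\<bar>u\<bar> powr k = (u\<^sup>2 + 0) powr (k / 2)" for u :: real
    proof (cases "u = 0")
      case False
      then have "u\<^sup>2 = \<bar>u\<bar> powr 2" by (simp add: powr_numeral)
      then have "(u\<^sup>2 + 0) powr (k / 2) = (\<bar>u\<bar> powr 2) powr (k / 2)" by simp
      also have "\<dots> = \<bar>u\<bar> powr k" by (simp only: powr_powr) simp
      finally show ?thesis by (rule sym)
    qed simp
    then show ?thesis by (simp add: omega_k_def vand_def)
  qed
  have 2: "1 / (complex_of_real (d_n CARD('n) k) * Gamma_n CARD('n) \<mu> k) = rcoef CARD('n) k \<mu>"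
    unfolding rcoef_def Gamma_n_def One_nat_def prod.atLeast1_atMost_eq
    using prod_inversef[of "\<lambda>j. Gamma (\<mu> - of_real k * of_nat j)" "{..<CARD('n)}"]
    by (simp add: rGamma_inverse_Gamma o_def divide_inverse)
  show ?thesis
    unfolding riesz_integral_def 2 fint_def gint_def
    by (simp add: 1 face_weight_def Dprod_def vand_face algebra_simps)
qed

lemma holomorphic_rcoef [holomorphic_intros]: "rcoef n k holomorphic_on S"
  unfolding rcoef_def[abs_def] by (intro holomorphic_intros)

lemma rcoef_plus_1: "rcoef n k \<mu> = (\<Prod>j<n. \<mu> - of_real k * of_nat j) * rcoef n k (\<mu> + 1)"
proof -
  have "rGamma (\<mu> - of_real k * of_nat j) = (\<mu> - of_real k * of_nat j) * rGamma (\<mu> + 1 - of_real k * of_nat j)" for j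
    using rGamma_plus1[of "\<mu> - of_real k * of_nat j"] by (simp add: algebra_simps)
  then show ?thesis unfolding rcoef_def by (simp add: prod.distrib)
qed

lemma riesz_integral_master:
  assumes k: "0 < k" and \<mu>: "mu0 CARD('n) k < Re \<mu>"
  shows "master_functional k \<mu> (riesz_integral k \<mu> :: (real^'n::finite \<Rightarrow> complex) \<Rightarrow> complex)"
proof -
  let ?b = "\<mu> - of_real (mu0 CARD('n) k)"
  have b: "0 < Re ?b" using \<mu> by simp
  have "?b + of_real k * (of_nat (card (UNIV :: 'n set)) - 1) = \<mu>" by (simp add: mu0_def)
  then have "\<mu> * fint UNIV k ?b f + fint UNIV k ?b (\<lambda>x. of_real (x $ i) * pdiff i f x
     + (\<Sum>j\<in>UNIV - {i}. of_real k * of_real (x $ j) * ddiff i j f x)) = 0" if "orthant_test f" for i and f :: "real^'n \<Rightarrow> complex"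
    using fint_master[OF UNIV_I k b that, of i] by simp
  then have "rcoef CARD('n) k \<mu> * (\<mu> * fint UNIV k ?b f + fint UNIV k ?b (\<lambda>x. of_real (x $ i) * pdiff i f x
     + (\<Sum>j\<in>UNIV - {i}. of_real k * of_real (x $ j) * ddiff i j f x))) = 0" if "orthant_test f" for i and f :: "real^'n \<Rightarrow> complex"
    using that by simp
  moreover have add: "fint UNIV k ?b (\<lambda>x. f x + g x) = fint UNIV k ?b f + fint UNIV k ?b g"
    if "orthant_test f" "orthant_test g" for f g :: "real^'n \<Rightarrow> complex"
    by (rule fint_add[OF k b that])
  ultimately show ?thesis unfolding master_functional_def riesz_integral_eq
    using add by (auto simp: fint_cmult algebra_simps)
qed

text \<open>Multiplication by D(x) raises the exponent of the weight by one; the product on the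
  right is the quotient of the two normalising factors.\<close>

lemma riesz_integral_mon:
  assumes k: "0 < k" and \<mu>: "mu0 CARD('n) k < Re \<mu>"
  shows "riesz_integral k \<mu> (\<lambda>x::real^'n::finite. mon UNIV x * f x)
     = (\<Prod>j<CARD('n). \<mu> - of_real k * of_nat j) * riesz_integral k (\<mu> + 1) f"
proof -
  let ?b = "\<mu> - of_real (mu0 CARD('n) k)"
  have "fint UNIV k ?b (\<lambda>x. mon UNIV x * f x) = fint UNIV k (?b + 1) f"
    unfolding fint_def gint_def
  proof (rule set_lebesgue_integral_cong)
    show "positive_orthant \<in> sets (lborel :: (real^'n) measure)" by simp
    have "mon UNIV x * face_weight UNIV ?b x = face_weight UNIV (?b + 1) x" if "x \<in> positive_orthant" for x :: "real^'n"
    proof -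
      have "0 < (\<Prod>i\<in>UNIV. x $ i)" using that by (auto simp: positive_orthant_def intro: prod_pos)
      then have "complex_of_real (\<Prod>i\<in>UNIV. x $ i) * complex_of_real (\<Prod>i\<in>UNIV. x $ i) powr (?b - 1) = complex_of_real (\<Prod>i\<in>UNIV. x $ i) powr ?b"
        by (simp add: powr_diff del: of_real_prod)
      then show ?thesis by (simp add: mon_def face_weight_def)
    qed
    then have "f x * complex_of_real (vand UNIV k 0 x) * (mon UNIV x * face_weight UNIV ?b x) =
       f x * complex_of_real (vand UNIV k 0 x) * face_weight UNIV (?b + 1) x" if "x \<in> positive_orthant" for x
      using that by metis
    then show "\<forall>x. x \<in> positive_orthant \<longrightarrow> mon UNIV (face UNIV x) * f (face UNIV x) * complex_of_real (vand UNIV k 0 (face UNIV x)) * face_weight UNIV ?b x =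
       f (face UNIV x) * complex_of_real (vand UNIV k 0 (face UNIV x)) * face_weight UNIV (?b + 1) x"
      by (simp only: face_UNIV mult_ac) simp
  qed
  moreover have "?b + 1 = \<mu> + 1 - of_real (mu0 CARD('n) k)" by simp
  ultimately show ?thesis unfolding riesz_integral_eq rcoef_plus_1[of _ _ \<mu>] by simp
qed

lemma holomorphic_riesz_integral:
  assumes "0 < k" "orthant_test f"
  shows "(\<lambda>\<mu>. riesz_integral k \<mu> (f :: real^'n::finite \<Rightarrow> complex)) holomorphic_on {\<mu>. mu0 CARD('n) k < Re \<mu>}"
proof -
  have "((\<lambda>b. fint UNIV k b f) \<circ> (\<lambda>\<mu>. \<mu> - of_real (mu0 CARD('n) k))) holomorphic_on {\<mu>. mu0 CARD('n) k < Re \<mu>}"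
    by (rule holomorphic_on_compose_gen[OF _ holomorphic_fint[OF assms]]) (auto intro!: holomorphic_intros)
  then show ?thesis unfolding riesz_integral_eq o_def by (intro holomorphic_intros)
qed

lemma riesz_integral_permv:
  assumes "0 < k" "bij \<pi>" "orthant_test f"
  shows "riesz_integral k \<mu> (\<lambda>x. f (permv \<pi> x)) = riesz_integral k \<mu> f"
  unfolding riesz_integral_eq using fint_permv[OF assms, where A=UNIV] by simp

lemma riesz_integral_cong:
  "(\<And>x. x \<in> positive_orthant \<Longrightarrow> f x = g x) \<Longrightarrow> riesz_integral k \<mu> f = riesz_integral k \<mu> g"
  unfolding riesz_integral_eq using fint_cong[where A=UNIV and f=f and g=g] by simp

section \<open>Symmetrization and the shift of the parameter by one\<close>

definition symmetrize :: "(real^'n::finite \<Rightarrow> complex) \<Rightarrow> real^'n \<Rightarrow> complex" where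
  "symmetrize f x = (1 / of_nat (card {\<pi>::'n \<Rightarrow> 'n. bij \<pi>})) * (\<Sum>\<pi>\<in>{\<pi>. bij \<pi>}. f (permv \<pi> x))"

lemma orthant_test_symmetrize: "orthant_test f \<Longrightarrow> orthant_test (symmetrize f)"
  unfolding symmetrize_def[abs_def] by (intro orthant_test_cmult orthant_test_sum orthant_test_permv) auto

lemma sym_outside_symmetrize: "sym_outside {} (symmetrize f)"
  unfolding sym_outside_def
proof (intro allI impI)
  fix i j :: 'a and x
  let ?t = "Transposition.transpose i j"
  have "(\<Sum>\<pi>\<in>{\<pi>. bij \<pi>}. f (permv \<pi> (permv ?t x))) = (\<Sum>\<pi>\<in>{\<pi>. bij \<pi>}. f (permv (?t \<circ> \<pi>) x))"
    by (intro sum.cong arg_cong[where f=f]) (auto simp: vec_eq_iff)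
  also have "\<dots> = (\<Sum>\<pi>\<in>{\<pi>. bij \<pi>}. f (permv \<pi> x))"
    by (rule sum.reindex_bij_witness[of _ "\<lambda>\<pi>. ?t \<circ> \<pi>" "\<lambda>\<pi>. ?t \<circ> \<pi>"])
       (auto simp: o_assoc[symmetric] bij_comp bij_transpose fun_eq_iff)
  finally show "symmetrize f (permv ?t x) = symmetrize f x" by (simp add: symmetrize_def)
qed

lemma symmetrize_symmetric: "(\<And>\<pi> x. bij \<pi> \<Longrightarrow> f (permv \<pi> x) = f x) \<Longrightarrow> symmetrize (f :: real^'n::finite \<Rightarrow> complex) = f"
proof -
  assume *: "\<And>\<pi> x. bij \<pi> \<Longrightarrow> f (permv \<pi> x) = f x"
  have "card {\<pi>::'n \<Rightarrow> 'n. bij \<pi>} \<noteq> 0" by (auto intro: bij_id)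
  then show ?thesis using * by (simp add: symmetrize_def fun_eq_iff)
qed

lemma master_functional_sum:
  assumes R: "master_functional k \<mu> R" and "finite J" "\<And>a. a \<in> J \<Longrightarrow> orthant_test (f a)"
  shows "R (\<lambda>x. \<Sum>a\<in>J. f a x) = (\<Sum>a\<in>J. R (f a))"
  using assms(2,3)
proof (induction J)
  case empty
  have "R (\<lambda>x. 0 * 0) = 0 * R (\<lambda>x. 0)" using R orthant_test_0 unfolding master_functional_def by blast
  then show ?case by simp
next
  case (insert a J)
  then have "R (\<lambda>x. f a x + (\<Sum>a\<in>J. f a x)) = R (f a) + R (\<lambda>x. \<Sum>a\<in>J. f a x)"
    using R orthant_test_sum[of J f] unfolding master_functional_def by blast
  then show ?case using insert by simp
qed

lemma riesz_integral_symmetrize: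
  assumes k: "0 < k" and \<mu>: "mu0 CARD('n) k < Re \<mu>" and f: "orthant_test f"
  shows "riesz_integral k \<mu> (symmetrize f) = riesz_integral k \<mu> (f :: real^'n::finite \<Rightarrow> complex)"
proof -
  note R = riesz_integral_master[OF k \<mu>]
  define N where "N = card {\<pi>::'n \<Rightarrow> 'n. bij \<pi>}"
  have N: "N \<noteq> 0" unfolding N_def by (auto intro: bij_id)
  have "riesz_integral k \<mu> (symmetrize f) = (1 / of_nat N) * riesz_integral k \<mu> (\<lambda>x. \<Sum>\<pi>\<in>{\<pi>. bij \<pi>}. f (permv \<pi> x))"
    unfolding symmetrize_def[abs_def] N_def using R orthant_test_sum[of "{\<pi>. bij \<pi>}" "\<lambda>\<pi> x. f (permv \<pi> x)"] orthant_test_permv f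
    unfolding master_functional_def by blast
  also have "riesz_integral k \<mu> (\<lambda>x. \<Sum>\<pi>\<in>{\<pi>. bij \<pi>}. f (permv \<pi> x)) = (\<Sum>\<pi>\<in>{\<pi>::'n \<Rightarrow> 'n. bij \<pi>}. riesz_integral k \<mu> f)"
    using riesz_integral_permv[OF k _ f] f
    by (subst master_functional_sum[OF R]) (auto intro: orthant_test_permv)
  also have "\<dots> = of_nat N * riesz_integral k \<mu> f" by (simp add: N_def)
  finally show ?thesis using N by simp
qed

definition coord_list :: "'n::finite list" where
  "coord_list = (SOME is. distinct is \<and> set is = UNIV)"

lemma coord_list: "distinct (coord_list :: 'n::finite list)" "set (coord_list :: 'n list) = UNIV"
  using someI_ex[of "\<lambda>is::'n list. distinct is \<and> set is = UNIV"] finite_distinct_list[of "UNIV :: 'n set"]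
  unfolding coord_list_def by auto

lemma length_coord_list [simp]: "length (coord_list :: 'n::finite list) = CARD('n)"
  using distinct_card[OF coord_list(1)] coord_list(2) by metis

text \<open>On symmetric functions this is the product of all Dunkl operators, up to a symmetrization that
  does not affect invariant functionals; taking the chain avoids their commutativity.\<close>

definition dunkl_prod :: "real \<Rightarrow> (real^'n::finite \<Rightarrow> complex) \<Rightarrow> real^'n \<Rightarrow> complex" where
  "dunkl_prod k f = dunkl_chain k coord_list {} (symmetrize f)"

lemma orthant_test_dunkl_prod: "orthant_test f \<Longrightarrow> orthant_test (dunkl_prod k f)"
  unfolding dunkl_prod_def
  by (intro orthant_test_dunkl_chain orthant_test_symmetrize) (auto simp: coord_list)

lemma prod_nonzero_right:
  assumes "0 < k" "mu0 n k < Re \<mu>" shows "(\<Prod>j<n. \<mu> - of_real k * of_nat j) \<noteq> 0"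
proof -
  have "\<mu> - of_real k * of_nat j \<noteq> 0" if "j < n" for j
  proof
    assume "\<mu> - of_real k * of_nat j = 0"
    then have "\<mu> = of_real (k * real j)" by simp
    moreover have "k * real j \<le> k * (real n - 1)" using that assms by (intro mult_left_mono) auto
    ultimately show False using assms by (simp add: mu0_def)
  qed
  then show ?thesis by simp
qed

text \<open>The dual form of D(T(k)) R_(\<mu>+1) = R_\<mu>, with one sign per operator. Both the
  chain relation and the multiplication by D(x) carry the product of the factors \<mu> - k j; it is
  nonzero in the domain of convergence and cancels.\<close>

lemma riesz_integral_dunkl_prod:
  assumes k: "0 < k" and \<mu>: "mu0 CARD('n) k < Re \<mu>" and f: "orthant_test f"
  shows "riesz_integral k \<mu> (f :: real^'n::finite \<Rightarrow> complex) = (-1) ^ CARD('n) * riesz_integral k (\<mu> + 1) (dunkl_prod k f)"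
proof -
  have "(\<Prod>m<CARD('n). \<mu> - of_real k * of_nat m) * riesz_integral k \<mu> f
    = (-1) ^ CARD('n) * riesz_integral k \<mu> (\<lambda>x. mon UNIV x * dunkl_prod k f x)"
    using aomoto_chain[OF riesz_integral_master[OF k \<mu>] coord_list(1) _ orthant_test_symmetrize[OF f] sym_outside_symmetrize]
      riesz_integral_symmetrize[OF k \<mu> f]
    by (simp add: dunkl_prod_def coord_list(2))
  also have "\<dots> = (\<Prod>m<CARD('n). \<mu> - of_real k * of_nat m) * ((-1) ^ CARD('n) * riesz_integral k (\<mu> + 1) (dunkl_prod k f))"
    unfolding riesz_integral_mon[OF k \<mu>] by (simp add: mult_ac)
  finally show ?thesis using prod_nonzero_right[OF k \<mu>] by simp
qed

subsection \<open>The Riesz distributions\<close>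

lemma entire_unique:
  assumes "f holomorphic_on UNIV" "g holomorphic_on UNIV" "\<And>\<nu>. c < Re \<nu> \<Longrightarrow> f \<nu> = g \<nu>"
  shows "f \<mu> = g \<mu>"
proof (rule analytic_continuation_open[of "{\<nu>. c < Re \<nu>}" UNIV f g])
  have "of_real (c + 1) \<in> {\<nu>. c < Re \<nu>}" by simp
  then show "{\<nu>. c < Re \<nu>} \<noteq> {}" by blast
qed (use assms open_halfspace_Re_gt in auto)

lemma orthant_test_dunkl_prod_pow: "orthant_test f \<Longrightarrow> orthant_test ((dunkl_prod k ^^ N) f)"
  by (induction N) (auto intro: orthant_test_dunkl_prod)

text \<open>Sign and \<open>N\<close>-fold operator compensate a shift of the parameter by
  \<open>N\<close>, so that the integral converges for Re \<mu> > mu0 - N.\<close>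

definition riesz_shift :: "real \<Rightarrow> nat \<Rightarrow> (real^'n::finite \<Rightarrow> complex) \<Rightarrow> complex \<Rightarrow> complex" where
  "riesz_shift k N f \<mu> = (-1) ^ (CARD('n) * N) * riesz_integral k (\<mu> + of_nat N) ((dunkl_prod k ^^ N) f)"

lemma riesz_shift_le:
  assumes k: "0 < k" and f: "orthant_test (f :: real^'n::finite \<Rightarrow> complex)"
    and "mu0 CARD('n) k < Re \<mu> + real N" "N \<le> M"
  shows "riesz_shift k M f \<mu> = riesz_shift k N f \<mu>"
  using assms(4)
proof (induction M rule: dec_induct)
  case (step M)
  have "riesz_shift k (Suc M) f \<mu> = riesz_shift k M f \<mu>"
    unfolding riesz_shift_def
    using step assms(3)
    by (subst riesz_integral_dunkl_prod[OF k _ orthant_test_dunkl_prod_pow[OF f], of _ M])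
       (auto simp: power_add algebra_simps)
  then show ?case using step by simp
qed simp

lemma riesz_shift_eq:
  assumes k: "0 < k" and f: "orthant_test (f :: real^'n::finite \<Rightarrow> complex)"
    and "mu0 CARD('n) k < Re \<mu> + real N" "mu0 CARD('n) k < Re \<mu> + real M"
  shows "riesz_shift k M f \<mu> = riesz_shift k N f \<mu>"
proof (cases "N \<le> M")
  case True
  then show ?thesis by (intro riesz_shift_le[OF k f assms(3)])
next
  case False
  then show ?thesis using riesz_shift_le[OF k f assms(4), of N] by simp
qed

text \<open>The formulas for different \<open>N\<close> agree wherever both converge, so they glue
  to an entire function.\<close>

lemma riesz_extension_exists:
  assumes k: "0 < k" and f: "orthant_test (f :: real^'n::finite \<Rightarrow> complex)"
  obtains g where "g holomorphic_on UNIV"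
    "\<And>\<mu> N. mu0 CARD('n) k < Re \<mu> + real N \<Longrightarrow> g \<mu> = riesz_shift k N f \<mu>"
proof
  define N where "N \<mu> = nat (\<lceil>mu0 CARD('n) k - Re \<mu>\<rceil> + 1)" for \<mu> :: complex
  define g where "g \<mu> = riesz_shift k (N \<mu>) f \<mu>" for \<mu>
  have N: "mu0 CARD('n) k < Re \<mu> + real (N \<mu>)" for \<mu> unfolding N_def by linarith
  show eq: "g \<mu> = riesz_shift k M f \<mu>" if "mu0 CARD('n) k < Re \<mu> + real M" for \<mu> M
    unfolding g_def by (rule riesz_shift_eq[OF k f that N])
  have hol: "riesz_shift k M f holomorphic_on {\<mu>. mu0 CARD('n) k - real M < Re \<mu>}" for M
  proof -
    have "((\<lambda>\<mu>. riesz_integral k \<mu> ((dunkl_prod k ^^ M) f)) \<circ> (\<lambda>\<mu>. \<mu> + of_nat M)) holomorphic_on {\<mu>. mu0 CARD('n) k - real M < Re \<mu>}"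
      by (rule holomorphic_on_compose_gen[OF _ holomorphic_riesz_integral[OF k orthant_test_dunkl_prod_pow[OF f]]])
         (auto intro!: holomorphic_intros)
    then show ?thesis unfolding riesz_shift_def[abs_def] o_def by (intro holomorphic_intros)
  qed
  show "g holomorphic_on UNIV"
    unfolding holomorphic_on_def
  proof
    fix z :: complex
    \<comment> \<open>On this half-plane the fixed shift \<open>N z\<close> is valid for all points,
      although \<open>g\<close> chooses its shift point by point.\<close>
    let ?S = "{\<mu>. mu0 CARD('n) k - real (N z) < Re \<mu>}"
    have "g holomorphic_on ?S"
    proof (rule holomorphic_transform[OF hol])
      fix w assume "w \<in> ?S"
      then have "mu0 CARD('n) k < Re w + real (N z)" by (simp add: algebra_simps)
      from eq[OF this] show "riesz_shift k (N z) f w = g w" by (rule sym)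
    qed
    moreover have "open ?S" "z \<in> ?S" using N[of z] by (auto simp: open_halfspace_Re_gt)
    ultimately show "g field_differentiable at z within UNIV"
      using holomorphic_on_imp_differentiable_at by blast
  qed
qed

lemma
  assumes k: "0 < k" and f: "orthant_test (f :: real^'n::finite \<Rightarrow> complex)"
  shows holomorphic_riesz: "(\<lambda>\<mu>. riesz k \<mu> f) holomorphic_on UNIV"
    and riesz_eq_shift: "mu0 CARD('n) k < Re \<mu> + real N \<Longrightarrow> riesz k \<mu> f = riesz_shift k N f \<mu>"
proof -
  obtain g where g: "g holomorphic_on UNIV"
    "\<And>\<mu> N. mu0 CARD('n) k < Re \<mu> + real N \<Longrightarrow> g \<mu> = riesz_shift k N f \<mu>"
    using riesz_extension_exists[OF k f] by metis
  have g0: "g \<nu> = riesz_integral k \<nu> f" if "mu0 CARD('n) k < Re \<nu>" for \<nu>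
    using g(2)[of \<nu> 0] that by (simp add: riesz_shift_def)
  have "(THE g. g holomorphic_on UNIV \<and> (\<forall>\<nu>. mu0 CARD('n) k < Re \<nu> \<longrightarrow> g \<nu> = riesz_integral k \<nu> f)) = g"
  proof (rule the_equality)
    fix h assume h: "h holomorphic_on UNIV \<and> (\<forall>\<nu>. mu0 CARD('n) k < Re \<nu> \<longrightarrow> h \<nu> = riesz_integral k \<nu> f)"
    have "h \<nu> = g \<nu>" for \<nu>
    proof (rule entire_unique[of h g "mu0 CARD('n) k"])
      show "h \<nu> = g \<nu>" if "mu0 CARD('n) k < Re \<nu>" for \<nu>
        using h g0[OF that] that by simp
    qed (use h g(1) in auto)
    then show "h = g" by auto
  qed (use g g0 in auto)
  then have r: "riesz k \<mu> f = g \<mu>" for \<mu> by (simp add: riesz_def)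
  show "(\<lambda>\<mu>. riesz k \<mu> f) holomorphic_on UNIV" using g(1) r by (simp add: fun_eq_iff)
  show "mu0 CARD('n) k < Re \<mu> + real N \<Longrightarrow> riesz k \<mu> f = riesz_shift k N f \<mu>" using g(2) r by simp
qed

lemma riesz_eq_integral:
  assumes "0 < k" "orthant_test (f :: real^'n::finite \<Rightarrow> complex)" "mu0 CARD('n) k < Re \<mu>"
  shows "riesz k \<mu> f = riesz_integral k \<mu> f"
  using riesz_eq_shift[OF assms(1,2), of \<mu> 0] assms(3) by (simp add: riesz_shift_def)

text \<open>The definite description refers to the function only through its integrals, and these
  see only the open orthant.\<close>

lemma riesz_cong:
  assumes "\<And>x. x \<in> positive_orthant \<Longrightarrow> f x = g x" shows "riesz k \<mu> f = riesz k \<mu> g"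
  unfolding riesz_def using riesz_integral_cong[of f g k] assms by simp

text \<open>Transfer principle: by the identity theorem, a formula with an entire right-hand side
  has to be checked only for the convergent integrals.\<close>

lemma riesz_identity:
  assumes k: "0 < k" and "f holomorphic_on UNIV" and "orthant_test (g :: real^'n::finite \<Rightarrow> complex)"
    and "\<And>\<nu>. mu0 CARD('n) k < Re \<nu> \<Longrightarrow> riesz_integral k \<nu> g = f \<nu>"
  shows "riesz k \<mu> g = f \<mu>"
proof (rule entire_unique[of "\<lambda>\<mu>. riesz k \<mu> g" f "mu0 CARD('n) k"])
  show "riesz k \<nu> g = f \<nu>" if "mu0 CARD('n) k < Re \<nu>" for \<nu>
    using riesz_eq_integral[OF k assms(3) that] assms(4)[OF that] by simp
qed (rule holomorphic_riesz[OF k assms(3)], rule assms(2))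

lemma holomorphic_riesz_plus_1:
  assumes "0 < k" "orthant_test f" shows "(\<lambda>\<mu>. riesz k (\<mu> + 1) f) holomorphic_on UNIV"
proof -
  have "(\<lambda>\<mu>::complex. \<mu> + 1) holomorphic_on UNIV" by (intro holomorphic_intros)
  from holomorphic_on_compose_gen[OF this holomorphic_riesz[OF assms]] show ?thesis by (simp add: o_def)
qed

lemma riesz_master_functional:
  assumes k: "0 < k" shows "master_functional k \<mu> (riesz k \<mu> :: (real^'n::finite \<Rightarrow> complex) \<Rightarrow> complex)"
  unfolding master_functional_def
proof (intro conjI allI impI)
  note M = riesz_integral_master[OF k, where 'n='n]
  note hr = holomorphic_riesz[OF k]
  fix f g :: "real^'n \<Rightarrow> complex" assume f: "orthant_test f"
  show "riesz k \<mu> (\<lambda>x. f x + g x) = riesz k \<mu> f + riesz k \<mu> g" if g: "orthant_test g"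
    using master_functional_add[OF M f g] riesz_eq_integral[OF k f] riesz_eq_integral[OF k g] f g
    by (intro riesz_identity[OF k] holomorphic_intros hr orthant_test_add) auto
  show "riesz k \<mu> (\<lambda>x. c * f x) = c * riesz k \<mu> f" for c
    using master_functional_cmult[OF M f] riesz_eq_integral[OF k f] f
    by (intro riesz_identity[OF k] holomorphic_intros hr orthant_test_cmult) auto
  fix i
  let ?g = "\<lambda>x. of_real (x $ i) * pdiff i f x + (\<Sum>j\<in>UNIV - {i}. of_real k * of_real (x $ j) * ddiff i j f x)"
  have g: "orthant_test ?g" using f
    by (intro orthant_test_add orthant_test_sum orthant_test_mult orthant_test_pdiff orthant_test_ddiff smooth_fun_mult smooth_fun_const smooth_fun_coord) auto
  have "riesz k \<mu> ?g = - (\<mu> * riesz k \<mu> f)"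
  proof (rule riesz_identity[OF k _ g])
    show "(\<lambda>\<mu>. - (\<mu> * riesz k \<mu> f)) holomorphic_on UNIV" by (intro holomorphic_intros hr f)
    fix \<nu> assume \<nu>: "mu0 CARD('n) k < Re \<nu>"
    show "riesz_integral k \<nu> ?g = - (\<nu> * riesz k \<nu> f)"
      using master_functional_eq[OF M[OF \<nu>] f, of i] riesz_eq_integral[OF k f \<nu>] by (simp add: add_eq_0_iff)
  qed
  then show "\<mu> * riesz k \<mu> f + riesz k \<mu> ?g = 0" by simp
qed

lemma riesz_mon:
  assumes k: "0 < k" and f: "orthant_test f"
  shows "riesz k \<mu> (\<lambda>x::real^'n::finite. mon UNIV x * f x)
     = (\<Prod>j<CARD('n). \<mu> - of_real k * of_nat j) * riesz k (\<mu> + 1) f"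
proof (rule riesz_identity[OF k])
  show "(\<lambda>\<mu>. (\<Prod>j<CARD('n). \<mu> - of_real k * of_nat j) * riesz k (\<mu> + 1) f) holomorphic_on UNIV"
    by (intro holomorphic_intros holomorphic_riesz_plus_1 k f)
  show "orthant_test (\<lambda>x. mon UNIV x * f x)" by (intro orthant_test_mult smooth_fun_mon f)
  fix \<nu> assume "mu0 CARD('n) k < Re \<nu>"
  then show "riesz_integral k \<nu> (\<lambda>x. mon UNIV x * f x) = (\<Prod>j<CARD('n). \<nu> - of_real k * of_nat j) * riesz k (\<nu> + 1) f"
    using riesz_integral_mon[OF k] riesz_eq_integral[OF k f, of "\<nu> + 1"] by simp
qed

lemma riesz_dunkl_prod:
  assumes k: "0 < k" and f: "orthant_test (f :: real^'n::finite \<Rightarrow> complex)"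
  shows "riesz k \<mu> f = (-1) ^ CARD('n) * riesz k (\<mu> + 1) (dunkl_prod k f)"
proof (rule riesz_identity[OF k _ f])
  show "(\<lambda>\<mu>. (-1) ^ CARD('n) * riesz k (\<mu> + 1) (dunkl_prod k f)) holomorphic_on UNIV"
    by (intro holomorphic_intros holomorphic_riesz_plus_1 k orthant_test_dunkl_prod f)
  fix \<nu> assume "mu0 CARD('n) k < Re \<nu>"
  then show "riesz_integral k \<nu> f = (-1) ^ CARD('n) * riesz k (\<nu> + 1) (dunkl_prod k f)"
    using riesz_integral_dunkl_prod[OF k _ f] riesz_eq_integral[OF k orthant_test_dunkl_prod[OF f], of "\<nu> + 1"] by simp
qed

lemma dunkl_prod_p1:
  "smooth1 H \<Longrightarrow> dunkl_prod k (\<lambda>x::real^'n::finite. H (p1 x)) = (\<lambda>x. (deriv1 ^^ CARD('n)) H (p1 x))"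
  unfolding dunkl_prod_def
  by (subst symmetrize_symmetric) (simp_all add: dunkl_chain_p1 coord_list)

subsection \<open>Positivity on radial cut-offs\<close>

text \<open>Each member is minus the derivative of the next: a sequence of smooth substitutes, with
  support bounded from the right, for the completely monotone function exp(-t).\<close>

definition cm_seq :: "(nat \<Rightarrow> real \<Rightarrow> real) \<Rightarrow> bool" where
  "cm_seq G \<longleftrightarrow> (\<forall>j t. (G (Suc j) has_real_derivative - G j t) (at t)) \<and>
    (\<forall>j t. G j t \<ge> 0) \<and> (\<forall>j t. t \<ge> 2 \<longrightarrow> G j t = 0) \<and>
    (\<forall>j t. t < 2 \<longrightarrow> G (Suc j) t > 0) \<and> (\<forall>j. smooth1 (\<lambda>t. complex_of_real (G j t)))"

lemma cm_seq_exists: "\<exists>G. cm_seq G"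
proof -
  obtain G :: "nat \<Rightarrow> real \<Rightarrow> real" where
    "\<And>j t. (G (Suc j) has_real_derivative - G j t) (at t)"
    "\<And>j t. G j t \<ge> 0" "\<And>j t. t \<ge> 2 \<Longrightarrow> G j t = 0" "\<And>j t. 1 < t \<Longrightarrow> t < 2 \<Longrightarrow> G j t > 0"
    "\<And>j t. t < 2 \<Longrightarrow> G (Suc j) t > 0" "\<And>j. smooth1 (\<lambda>t. complex_of_real (G j t))"
    using completely_monotone_cutoff by blast
  then show ?thesis by (auto simp: cm_seq_def intro!: exI[of _ G])
qed

lemma cm_seq_deriv1:
  assumes "cm_seq G"
  shows "(deriv1 ^^ m) (\<lambda>t. complex_of_real (G (j + m) t)) = (\<lambda>t. (-1) ^ m * complex_of_real (G j t))"
proof (induction m arbitrary: j)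
  case (Suc m)
  have sm: "smooth1 (\<lambda>t. complex_of_real (G i t))" for i using assms by (simp add: cm_seq_def)
  have "(G (Suc j) has_real_derivative - G j t) (at t)" for t using assms by (simp add: cm_seq_def)
  from has_vector_derivative_complex_of_real[OF this]
  have d: "((\<lambda>t. complex_of_real (G (Suc j) t)) has_vector_derivative - complex_of_real (G j t)) (at t)" for t by simp
  have "(deriv1 ^^ Suc m) (\<lambda>t. complex_of_real (G (j + Suc m) t)) = deriv1 ((deriv1 ^^ m) (\<lambda>t. complex_of_real (G (Suc j + m) t)))"
    by simp
  also have "\<dots> = deriv1 (\<lambda>t. (-1) ^ m * complex_of_real (G (Suc j) t))" unfolding Suc ..
  also have "\<dots> = (\<lambda>t. (-1) ^ m * (- complex_of_real (G j t)))"
    by (rule deriv1_eqI) (intro has_vector_derivative_mult_right d)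
  finally show ?case by simp
qed simp

lemma orthant_test_cm:
  assumes "cm_seq G" shows "orthant_test (\<lambda>x::real^'n::finite. complex_of_real (G j (p1 x)))"
  using assms by (intro orthant_test_p1[where H="\<lambda>t. complex_of_real (G j t)" and C=2]) (auto simp: cm_seq_def)

text \<open>On functions of \<open>p1\<close> the operator D(T(k)) acts as the n-fold derivative,
  here (-1)^n times the member n places earlier; this sign cancels the one in the shift
  relation.\<close>

lemma riesz_cm_shift:
  assumes k: "0 < k" and G: "cm_seq G"
  shows "riesz k \<mu> (\<lambda>x::real^'n::finite. complex_of_real (G (j + CARD('n) * N) (p1 x)))
      = riesz k (\<mu> + of_nat N) (\<lambda>x::real^'n. complex_of_real (G j (p1 x)))"
proof (induction N arbitrary: \<mu>)
  case (Suc N)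
  let ?H = "\<lambda>t. complex_of_real (G (j + CARD('n) * N + CARD('n)) t)"
  have s: "smooth1 ?H" using G by (simp add: cm_seq_def)
  have "dunkl_prod k (\<lambda>x::real^'n. ?H (p1 x)) = (\<lambda>x. (-1) ^ CARD('n) * complex_of_real (G (j + CARD('n) * N) (p1 x)))"
    using dunkl_prod_p1[OF s, where 'n='n] cm_seq_deriv1[OF G, of "CARD('n)" "j + CARD('n) * N"] by simp
  moreover have "riesz k \<mu> (\<lambda>x::real^'n. ?H (p1 x)) = (-1) ^ CARD('n) * riesz k (\<mu> + 1) (dunkl_prod k (\<lambda>x::real^'n. ?H (p1 x)))"
    by (rule riesz_dunkl_prod[OF k orthant_test_cm[OF G]])
  moreover have "riesz k (\<mu> + 1) (\<lambda>x::real^'n. (-1) ^ CARD('n) * complex_of_real (G (j + CARD('n) * N) (p1 x)))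
     = (-1) ^ CARD('n) * riesz k (\<mu> + 1) (\<lambda>x::real^'n. complex_of_real (G (j + CARD('n) * N) (p1 x)))"
    by (rule master_functional_cmult[OF riesz_master_functional[OF k] orthant_test_cm[OF G]])
  ultimately have "riesz k \<mu> (\<lambda>x::real^'n. ?H (p1 x)) = (-1) ^ CARD('n) * ((-1) ^ CARD('n) * riesz k (\<mu> + 1) (\<lambda>x::real^'n. complex_of_real (G (j + CARD('n) * N) (p1 x))))"
    by (simp only:)
  then have "riesz k \<mu> (\<lambda>x::real^'n. ?H (p1 x)) = riesz k (\<mu> + 1) (\<lambda>x::real^'n. complex_of_real (G (j + CARD('n) * N) (p1 x)))"
    by (simp add: mult.assoc[symmetric] flip: power_add mult_2)
  then show ?case using Suc[of "\<mu> + 1"] by (simp add: algebra_simps)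
qed simp

text \<open>Evaluates squarefree monomials through purely radial values: the chain starts with the
  empty monomial and differentiates the radial factor once per coordinate. The signs of the factors
  \<mu> - k i decide about positivity later.\<close>

lemma master_functional_mon_cm:
  fixes B :: "'n::finite set"
  assumes R: "master_functional k \<mu> R" and G: "cm_seq G"
  shows "R (\<lambda>x. mon B x * complex_of_real (G j (p1 x)))
      = (\<Prod>i<card B. \<mu> - of_real k * of_nat i) * R (\<lambda>x. complex_of_real (G (j + card B) (p1 x)))"
proof -
  obtain xs where xs: "distinct xs" "set xs = B" using finite_distinct_list[of B] by auto
  have len: "length xs = card B" using xs distinct_card by metis
  let ?H = "\<lambda>t. complex_of_real (G (j + card B) t)"
  have s: "smooth1 ?H" using G by (simp add: cm_seq_def)
  have chain: "dunkl_chain k xs {} (\<lambda>x. ?H (p1 x)) = (\<lambda>x. (-1) ^ card B * complex_of_real (G j (p1 x)))"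
    using dunkl_chain_p1[OF s xs(1), of "{}" k] cm_seq_deriv1[OF G, of "card B" j] len by simp
  have "(\<Prod>m<card B. \<mu> - of_real k * of_nat m) * R (\<lambda>x. ?H (p1 x))
     = (-1) ^ card B * R (\<lambda>x. mon B x * ((-1) ^ card B * complex_of_real (G j (p1 x))))"
    using aomoto_chain[OF R xs(1) _ orthant_test_cm[OF G] sym_outside_p1, of "{}" "j + card B"] chain xs(2) len by simp
  also have "R (\<lambda>x. mon B x * ((-1) ^ card B * complex_of_real (G j (p1 x)))) = R (\<lambda>x. (-1) ^ card B * (mon B x * complex_of_real (G j (p1 x))))"
    by (simp add: mult_ac)
  also have "\<dots> = (-1) ^ card B * R (\<lambda>x. mon B x * complex_of_real (G j (p1 x)))"
    by (intro master_functional_cmult[OF R] orthant_test_mult smooth_fun_mon orthant_test_cm G)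
  finally show ?thesis by (simp add: mult.assoc[symmetric] flip: power_add mult_2)
qed

text \<open>Distinct coordinates make the Vandermonde weight positive; the size bounds keep the
  point where the cut-off is positive and inside the dummy intervals. With c = n + 1, the
  coordinates (h + 1) / c^2 are at most 1 / c, so every partial sum stays below 1.\<close>

lemma scattered_point:
  obtains z :: "real^'n::finite" where "\<And>l. 0 < z $ l" "\<And>l. z $ l < 1" "\<And>l m. l \<noteq> m \<Longrightarrow> z $ l \<noteq> z $ m"
    "\<And>A. p1 (face A z) < 2"
proof -
  obtain h :: "'n \<Rightarrow> nat" where h: "bij_betw h UNIV {0..<CARD('n)}"
    using ex_bij_betw_finite_nat[of "UNIV :: 'n set"] by auto
  define c where "c = real (CARD('n) + 1)"
  define z :: "real^'n" where "z = (\<chi> l. (real (h l) + 1) / c\<^sup>2)"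
  have c: "1 < c" by (simp add: c_def)
  have hl: "real (h l) + 1 \<le> c - 1" for l
  proof -
    have "h l \<in> {0..<CARD('n)}" using h by (auto simp: bij_betw_def)
    then show ?thesis by (simp add: c_def)
  qed
  have z0: "0 < z $ l" for l using c by (simp add: z_def)
  have zl: "z $ l \<le> 1 / c" for l
  proof -
    have "(real (h l) + 1) / c\<^sup>2 \<le> c / c\<^sup>2" using hl[of l] c by (intro divide_right_mono) auto
    then show ?thesis using c by (simp add: z_def power2_eq_square)
  qed
  have z1: "z $ l < 1" for l using zl[of l] c by (meson divide_less_eq_1_pos less_trans order_le_less_trans zero_less_one)
  have "p1 (face A z) < 2" for A
  proof -
    have "p1 (face A z) \<le> (\<Sum>l\<in>(UNIV::'n set). 1 / c)"
      unfolding p1_def using zl c by (intro sum_mono) auto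
    also have "\<dots> < 2" using c by (simp add: c_def divide_simps)
    finally show ?thesis .
  qed
  moreover have "z $ l \<noteq> z $ m" if "l \<noteq> m" for l m
    using that h c by (auto simp: z_def bij_betw_def inj_on_def)
  ultimately show ?thesis using that z0 z1 by blast
qed

text \<open>The integrand is nonnegative, and strictly positive on an open neighbourhood of a point
  with small distinct coordinates. The index \<open>Suc j\<close> guarantees a cut-off that is
  positive on all of t < 2.\<close>

lemma fint_cm_pos:
  assumes k: "0 < k" and b: "0 < b" and G: "cm_seq G"
  obtains r where "0 < r" "fint (A::'n::finite set) k (of_real b) (\<lambda>x. complex_of_real (G (Suc j) (p1 x))) = complex_of_real r"
proof -
  let ?g = "G (Suc j)"
  define F where "F x = indicator positive_orthant x *\<^sub>R
     (?g (p1 (face A x)) * vand A k 0 x * ((\<Prod>i\<in>A. x $ i) powr (b - 1) * (\<Prod>i\<in>-A. indicator {..1} (x $ i))))" for x :: "real^'n"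
  have contg: "continuous_on S ?g" for S
    using smooth1_continuous[of "\<lambda>t. complex_of_real (?g t)"] G continuous_on_Re[of UNIV "\<lambda>t. complex_of_real (?g t)"]
    by (auto simp: cm_seq_def intro: continuous_on_subset)
  have eq: "indicat_real positive_orthant x *\<^sub>R (complex_of_real (?g (p1 (face A x))) * complex_of_real (vand A k 0 (face A x)) * face_weight A (of_real b) x)
     = complex_of_real (F x)" for x
  proof (cases "x \<in> positive_orthant")
    case True
    then have "0 < (\<Prod>i\<in>A. x $ i)" by (auto simp: positive_orthant_def intro: prod_pos)
    then have "complex_of_real (\<Prod>i\<in>A. x $ i) powr (of_real b - 1) = complex_of_real ((\<Prod>i\<in>A. x $ i) powr (b - 1))"
      by (subst powr_of_real[symmetric]) auto
    then show ?thesis using True by (simp add: F_def face_weight_def vand_face mult_ac del: of_real_prod)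
  qed (simp add: F_def)
  have ot: "orthant_test (\<lambda>x::real^'n. complex_of_real (?g (p1 x)))" by (rule orthant_test_cm[OF G])
  obtain B where B: "vanishes_beyond B (\<lambda>x::real^'n. complex_of_real (?g (p1 x)))" using ot by (auto simp: orthant_test_def)
  have c: "continuous_on UNIV (\<lambda>x. complex_of_real (?g (p1 x)) * complex_of_real (vand A k 0 x))"
    using k by (intro continuous_on_mult continuous_on_of_real_vand smooth_fun_continuous[OF orthant_test_smooth[OF ot]]) auto
  have int: "integrable lborel (\<lambda>x. complex_of_real (F x))"
    using gint_integrable[OF _ c vanishes_beyond_mult'[OF B], of "of_real b" A] b
    unfolding set_integrable_def eq by simp
  have intF: "integrable lborel F" using int by (simp add: complex_of_real_integrable_eq)
  have nn: "0 \<le> F x" for x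
    using G by (auto simp: F_def indicator_def cm_seq_def vand_nonneg intro!: mult_nonneg_nonneg prod_nonneg)
  have val: "fint A k (of_real b) (\<lambda>x. complex_of_real (?g (p1 x))) = complex_of_real (\<integral>x. F x \<partial>lborel)"
    unfolding fint_def gint_def set_lebesgue_integral_def eq by (rule integral_complex_of_real)
  obtain z :: "real^'n" where z: "\<And>l. 0 < z $ l" "\<And>l. z $ l < 1" "\<And>l m. l \<noteq> m \<Longrightarrow> z $ l \<noteq> z $ m" "\<And>A. p1 (face A z) < 2"
    using scattered_point[where 'n='n] by metis
  define U where "U = positive_orthant \<inter> {x. 0 < ?g (p1 (face A x)) * vand A k 0 x} \<inter> (\<Inter>l\<in>-A. {x::real^'n. x $ l < 1})"
  have "open U" unfolding U_def using k
    by (intro open_Int open_positive_orthant open_INT ballI open_Collect_less continuous_intros continuous_on_vand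
         continuous_on_compose2[OF contg[of UNIV]]) auto
  moreover have "z \<in> U"
  proof -
    have "0 < vand A k 0 z" unfolding vand_def using z(3) by (intro prod_pos) auto
    moreover have "0 < ?g (p1 (face A z))" using G z(4) by (simp add: cm_seq_def)
    ultimately show ?thesis using z by (simp add: U_def positive_orthant_def)
  qed
  ultimately have "\<not> negligible U" using open_not_negligible by blast
  have FU: "F x > 0" if "x \<in> U" for x
  proof -
    have "0 < (\<Prod>i\<in>A. x $ i)" using that by (auto simp: U_def positive_orthant_def intro: prod_pos)
    moreover have "(\<Prod>i\<in>-A. indicat_real {..1} (x $ i)) = 1" using that by (intro prod.neutral) (force simp: U_def)
    moreover have "0 < (\<Prod>i\<in>A. x $ i) powr (b - 1)" using \<open>0 < (\<Prod>i\<in>A. x $ i)\<close>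
      by (metis less_irrefl powr_gt_zero)
    ultimately show ?thesis using that mult_pos_pos by (simp add: F_def U_def)
  qed
  have "(\<integral>x. F x \<partial>lborel) \<noteq> 0"
  proof
    assume "(\<integral>x. F x \<partial>lborel) = 0"
    then have "AE x in lborel. F x = 0"
      using integral_nonneg_eq_0_iff_AE[OF intF] nn by auto
    then have "AE x in lborel. x \<notin> U" using FU by (force elim: eventually_mono)
    then have "AE x in lebesgue. x \<notin> U" by (rule AE_completion)
    then have "negligible U" using \<open>open U\<close> by (simp add: negligible_iff_null_sets AE_iff_null_sets lmeasurable_open)
    then show False using \<open>\<not> negligible U\<close> by simp
  qed
  moreover have "0 \<le> (\<integral>x. F x \<partial>lborel)" using nn by simp
  ultimately have "0 < (\<integral>x. F x \<partial>lborel)" by simp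
  from that[OF this val] show ?thesis .
qed

lemma rcoef_pos:
  assumes k: "0 < k" and \<mu>: "mu0 n k < \<mu>"
  obtains r where "0 < r" "rcoef n k (of_real \<mu>) = complex_of_real r"
proof
  let ?r = "inverse (d_n n k) * (\<Prod>j<n. rGamma (\<mu> - k * real j))"
  have "rGamma (complex_of_real \<mu> - of_real k * of_nat j) = of_real (rGamma (\<mu> - k * real j))" for j
    using rGamma_complex_of_real[of "\<mu> - k * real j"] by simp
  then show "rcoef n k (of_real \<mu>) = complex_of_real ?r" by (simp add: rcoef_def)
  have "0 < rGamma (\<mu> - k * real j)" if "j < n" for j
  proof -
    have "k * real j \<le> k * (real n - 1)" using that k by (intro mult_left_mono) auto
    then show ?thesis using \<mu> by (simp add: rGamma_inverse_Gamma mu0_def)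
  qed
  moreover have "0 < d_n n k" unfolding d_n_def using k by (intro prod_pos) (auto intro!: divide_pos_pos Gamma_real_pos add_pos_nonneg)
  ultimately show "0 < ?r" by (intro mult_pos_pos prod_pos) auto
qed

text \<open>Lowering the index by n N moves the parameter to \<mu> + N, where the value is a
  convergent integral with a positive normalising factor. One further index is reserved for strict
  positivity.\<close>

lemma riesz_cm_pos:
  assumes k: "0 < k" and G: "cm_seq G"
  obtains J where "\<And>j. J \<le> j \<Longrightarrow> \<exists>r>0. riesz k (complex_of_real \<mu>) (\<lambda>x::real^'n::finite. complex_of_real (G j (p1 x))) = complex_of_real r"
proof -
  define N where "N = nat (\<lceil>mu0 CARD('n) k - \<mu>\<rceil> + 1)"
  have N: "mu0 CARD('n) k < \<mu> + real N" unfolding N_def by linarith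
  show ?thesis
  proof (rule that[of "Suc (CARD('n) * N)"])
    fix j assume "Suc (CARD('n) * N) \<le> j"
    then obtain i where i: "j = Suc i + CARD('n) * N" by (metis add.commute add_Suc le_iff_add)
    obtain r where r: "0 < r" "rcoef CARD('n) k (of_real (\<mu> + real N)) = complex_of_real r"
      using rcoef_pos[OF k N] by blast
    obtain s where s: "0 < s" "fint (UNIV::'n set) k (of_real (\<mu> + real N - mu0 CARD('n) k)) (\<lambda>x. complex_of_real (G (Suc i) (p1 x))) = complex_of_real s"
      using fint_cm_pos[OF k _ G, of "\<mu> + real N - mu0 CARD('n) k" "UNIV::'n set" i] N by auto
    have "riesz k (complex_of_real \<mu>) (\<lambda>x::real^'n. complex_of_real (G j (p1 x)))
      = riesz_integral k (of_real (\<mu> + real N)) (\<lambda>x::real^'n. complex_of_real (G (Suc i) (p1 x)))"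
      unfolding i riesz_cm_shift[OF k G] using N riesz_eq_integral[OF k orthant_test_cm[OF G], where 'n='n] by simp
    also have "\<dots> = complex_of_real (r * s)" unfolding riesz_integral_eq using r s by simp
    finally show "\<exists>r>0. riesz k (complex_of_real \<mu>) (\<lambda>x::real^'n. complex_of_real (G j (p1 x))) = complex_of_real r"
      using r s by (intro exI[of _ "r * s"]) simp
  qed
qed

subsection \<open>Homogeneity\<close>

lemma integral_lborel_scale:
  fixes f :: "real^'n::finite \<Rightarrow> complex"
  assumes c: "0 < c" and [measurable]: "f \<in> borel_measurable borel"
  shows "(\<integral>x. f x \<partial>lborel) = of_real (c ^ CARD('n)) * (\<integral>x. f (c *\<^sub>R x) \<partial>lborel)"
proof -
  have "(lborel :: (real^'n) measure) = density (distr lborel borel (\<lambda>x. 0 + c *\<^sub>R x)) (\<lambda>_. ennreal (\<bar>c\<bar> ^ DIM(real^'n)))"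
    using c by (intro lborel_affine) simp
  then have "(\<integral>x. f x \<partial>lborel) = (\<integral>x. f x \<partial>(density (distr lborel borel (\<lambda>x::real^'n. 0 + c *\<^sub>R x)) (\<lambda>_. ennreal (\<bar>c\<bar> ^ DIM(real^'n)))))"
    by simp
  also have "\<dots> = (\<integral>x. (\<bar>c\<bar> ^ DIM(real^'n)) *\<^sub>R f x \<partial>(distr lborel borel (\<lambda>x::real^'n. 0 + c *\<^sub>R x)))"
    by (rule integral_density) auto
  also have "\<dots> = (\<integral>x. (\<bar>c\<bar> ^ DIM(real^'n)) *\<^sub>R f (0 + c *\<^sub>R x) \<partial>lborel)"
    by (rule integral_distr) auto
  finally show ?thesis using c by (simp add: scaleR_conv_of_real)
qed

text \<open>Degrees add up: n from the Jacobian, n (b - 1) from the power weight and k n (n - 1)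
  from the Vandermonde weight. At b = \<mu> - mu0 the total is n \<mu>.\<close>

lemma fint_scale:
  fixes f :: "real^'n::finite \<Rightarrow> complex"
  assumes k: "0 < k" and c: "0 < c" and f: "orthant_test f"
  shows "fint UNIV k b f = of_real c powr (of_nat CARD('n) * (b + of_real (k * (real CARD('n) - 1)))) * fint UNIV k b (\<lambda>x. f (c *\<^sub>R x))"
proof -
  let ?n = "CARD('n)"
  let ?h = "\<lambda>x. indicat_real positive_orthant x *\<^sub>R (f (face UNIV x) * complex_of_real (vand UNIV k 0 (face UNIV x)) * face_weight UNIV b x)"
  have [measurable]: "f \<in> borel_measurable borel"
    by (rule borel_measurable_continuous_onI[OF smooth_fun_continuous[OF orthant_test_smooth[OF f]]])
  have "(\<lambda>x. complex_of_real (vand UNIV k 0 (face UNIV x))) \<in> borel_measurable (borel :: (real^'n) measure)"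
    unfolding face_UNIV by (rule borel_measurable_continuous_onI[OF continuous_on_of_real_vand]) (use k in auto)
  then have hm: "?h \<in> borel_measurable borel"
    by (intro borel_measurable_scaleR borel_measurable_times borel_measurable_indicator positive_orthant_borel
      borel_measurable_face_weight measurable_compose[OF borel_measurable_face]) auto
  let ?s = "of_real c powr (of_nat ?n * of_real (k * (real ?n - 1))) * of_real c powr (of_nat ?n * (b - 1))"
  have v: "vand UNIV k 0 (c *\<^sub>R x) = c powr (real ?n * (k * (real ?n - 1))) * vand UNIV k 0 x" for x :: "real^'n"
  proof -
    have "((c *\<^sub>R x) $ l - (c *\<^sub>R x) $ m)\<^sup>2 = c\<^sup>2 * (x $ l - x $ m)\<^sup>2" for l m
      by (simp add: power2_eq_square algebra_simps)
    then have 1: "(((c *\<^sub>R x) $ l - (c *\<^sub>R x) $ m)\<^sup>2 + 0) powr (k / 2) = c powr k * ((x $ l - x $ m)\<^sup>2 + 0) powr (k / 2)" for l m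
      using c by (simp add: powr_mult powr_powr flip: powr_numeral)
    have "(\<Prod>l\<in>(UNIV::'n set). \<Prod>m\<in>UNIV - {l}. c powr k) = c powr (real ?n * (k * (real ?n - 1)))"
    proof -
      have "(\<Prod>l\<in>(UNIV::'n set). \<Prod>m\<in>UNIV - {l}. c powr k) = ((c powr k) ^ (?n - 1)) ^ ?n" by (simp add: card_Diff_singleton)
      also have "\<dots> = c powr (real ?n * (k * (real ?n - 1)))"
        using c by (simp add: powr_powr of_nat_diff Suc_leI mult_ac flip: powr_realpow)
      finally show ?thesis .
    qed
    then show ?thesis unfolding vand_def 1 by (simp add: prod.distrib)
  qed
  have w: "face_weight UNIV b (c *\<^sub>R x) = of_real c powr (of_nat ?n * (b - 1)) * face_weight UNIV b x" if "x \<in> positive_orthant" for x :: "real^'n"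
  proof -
    have "0 < (\<Prod>i\<in>UNIV. x $ i)" using that by (auto simp: positive_orthant_def intro: prod_pos)
    then have "complex_of_real (c ^ ?n * (\<Prod>i\<in>UNIV. x $ i)) powr (b - 1) = complex_of_real (c ^ ?n) powr (b - 1) * complex_of_real (\<Prod>i\<in>UNIV. x $ i) powr (b - 1)"
      unfolding of_real_mult using c by (intro powr_times_real) (auto simp del: of_real_prod of_real_power)
    moreover have "complex_of_real (c ^ ?n) powr (b - 1) = of_real c powr (of_nat ?n * (b - 1))"
    proof -
      have "complex_of_real (c ^ ?n) powr (b - 1) = exp ((b - 1) * (of_nat ?n * of_real (ln c)))"
        using c by (simp add: powr_def ln_realpow Ln_of_real flip: of_real_power)
      also have "\<dots> = of_real c powr (of_nat ?n * (b - 1))" using c by (simp add: powr_def Ln_of_real mult_ac)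
      finally show ?thesis .
    qed
    ultimately show ?thesis by (simp add: face_weight_def prod.distrib del: of_real_prod of_real_power of_real_mult)
  qed
  have h: "?h (c *\<^sub>R x) = ?s * (indicat_real positive_orthant x *\<^sub>R (f (c *\<^sub>R face UNIV x) * complex_of_real (vand UNIV k 0 (face UNIV x)) * face_weight UNIV b x))" for x
  proof (cases "x \<in> positive_orthant")
    case True
    then have "c *\<^sub>R x \<in> positive_orthant" using c by (simp add: positive_orthant_def)
    moreover have "complex_of_real (c powr (real ?n * (k * (real ?n - 1)))) = of_real c powr (of_nat ?n * of_real (k * (real ?n - 1)))"
      using c by (subst powr_of_real[symmetric]) auto
    ultimately show ?thesis using True w[OF True] v[of x] by (simp add: mult_ac)
  next
    case False
    then have "c *\<^sub>R x \<notin> positive_orthant" using c by (auto simp: positive_orthant_def zero_less_mult_iff)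
    then show ?thesis using False by simp
  qed
  have "fint UNIV k b f = of_real (c ^ ?n) * (\<integral>x. ?h (c *\<^sub>R x) \<partial>lborel)"
    unfolding fint_def gint_def set_lebesgue_integral_def
    by (rule integral_lborel_scale[OF c hm])
  also have "\<dots> = of_real (c ^ ?n) * (?s * fint UNIV k b (\<lambda>x. f (c *\<^sub>R x)))"
    unfolding h fint_def gint_def set_lebesgue_integral_def by (subst integral_mult_right_zero) (rule refl)
  also have "of_real (c ^ ?n) * (?s * fint UNIV k b (\<lambda>x. f (c *\<^sub>R x))) = (of_real (c ^ ?n) * ?s) * fint UNIV k b (\<lambda>x. f (c *\<^sub>R x))"
    by (simp add: mult.assoc)
  also have "of_real (c ^ ?n) * ?s = of_real c powr (of_nat ?n * (b + of_real (k * (real ?n - 1))))"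
  proof -
    have "complex_of_real (c ^ ?n) = of_real c powr (of_nat ?n)" using c by (simp add: powr_nat')
    then show ?thesis by (simp add: powr_add[symmetric] algebra_simps)
  qed
  finally show ?thesis .
qed

lemma orthant_test_scale:
  assumes "0 < c" "orthant_test f" shows "orthant_test (\<lambda>x. f (c *\<^sub>R x))"
proof -
  obtain B where B: "vanishes_beyond B f" and s: "smooth_fun f" using assms by (auto simp: orthant_test_def)
  have "p1 (c *\<^sub>R x) = c * p1 x" for x :: "real^'a" by (simp add: p1_def sum_distrib_left)
  then have "vanishes_beyond (B / c) (\<lambda>x. f (c *\<^sub>R x))"
    using B assms(1) by (simp add: vanishes_beyond_def field_simps)
  then show ?thesis using smooth_fun_scale[OF s] by (auto simp: orthant_test_def)
qed

lemma riesz_scale: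
  fixes f :: "real^'n::finite \<Rightarrow> complex"
  assumes k: "0 < k" and c: "0 < c" and f: "orthant_test f"
  shows "riesz k \<mu> (\<lambda>x. f (c *\<^sub>R x)) = of_real c powr (- (of_nat CARD('n) * \<mu>)) * riesz k \<mu> f"
proof (rule riesz_identity[OF k _ orthant_test_scale[OF c f]])
  show "(\<lambda>\<mu>. of_real c powr (- (of_nat CARD('n) * \<mu>)) * riesz k \<mu> f) holomorphic_on UNIV"
    using c by (intro holomorphic_intros holomorphic_riesz[OF k f]) auto
  fix \<nu> assume \<nu>: "mu0 CARD('n) k < Re \<nu>"
  let ?b = "\<nu> - of_real (mu0 CARD('n) k)"
  have "?b + of_real (k * (real CARD('n) - 1)) = \<nu>" by (simp add: mu0_def)
  then have "fint UNIV k ?b f = of_real c powr (of_nat CARD('n) * \<nu>) * fint UNIV k ?b (\<lambda>x. f (c *\<^sub>R x))"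
    using fint_scale[OF k c f, of ?b] by simp
  moreover have "of_real c powr (- (of_nat CARD('n) * \<nu>)) * of_real c powr (of_nat CARD('n) * \<nu>) = 1"
    using c by (simp add: powr_minus)
  moreover have "P * (r * (Q * X)) = (P * Q) * (r * X)" for P Q r X :: complex by simp
  ultimately show "riesz_integral k \<nu> (\<lambda>x. f (c *\<^sub>R x)) = of_real c powr (- (of_nat CARD('n) * \<nu>)) * riesz k \<nu> f"
    unfolding riesz_eq_integral[OF k f \<nu>] riesz_integral_eq by (simp only: mult_1)
qed

subsection \<open>Test functions\<close>

text \<open>A measure has order zero: on a fixed compact set the sup norm controls the value. The
  necessity argument for complex measures uses nothing but this estimate.\<close>

lemma complex_measure_dist_bound:
  assumes "is_complex_measure_dist u" "compact K"
  shows "\<exists>C\<ge>0. \<forall>\<phi> S. test_function \<phi> \<longrightarrow> (\<forall>x. x \<notin> K \<longrightarrow> \<phi> x = 0) \<longrightarrow> (\<forall>x. norm (\<phi> x) \<le> S) \<longrightarrow> norm (u \<phi>) \<le> C * S"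
proof -
  obtain M h where M: "sets M = sets borel" "\<And>K. compact K \<Longrightarrow> emeasure M K < \<infinity>" "\<And>x. cmod (h x) = 1"
    "\<And>\<phi>. test_function \<phi> \<Longrightarrow> integrable M (\<lambda>x. \<phi> x * h x) \<and> u \<phi> = (\<integral>x. \<phi> x * h x \<partial>M)"
    using assms(1) unfolding is_complex_measure_dist_def by blast
  have K: "K \<in> sets M" using assms(2) by (simp add: M(1) borel_compact)
  show ?thesis
  proof (intro exI[of _ "measure M K"] conjI allI impI)
    fix \<phi> S assume \<phi>: "test_function \<phi>" "\<forall>x. x \<notin> K \<longrightarrow> \<phi> x = 0" "\<forall>x. norm (\<phi> x) \<le> S"
    have "norm (\<integral>x. \<phi> x * h x \<partial>M) \<le> (\<integral>x. S * indicator K x \<partial>M)"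
    proof (rule Bochner_Integration.integral_norm_bound_integral)
      show "integrable M (\<lambda>x. \<phi> x * h x)" using M(4)[OF \<phi>(1)] by simp
      show "integrable M (\<lambda>x. S * indicat_real K x)"
        using K M(2)[OF assms(2)] by (intro integrable_mult_right) (simp add: integrable_indicator_iff)
      show "norm (\<phi> x * h x) \<le> S * indicat_real K x" for x
        using \<phi>(2,3) M(3)[of x] by (auto simp: norm_mult indicator_def)
    qed
    also have "\<dots> = measure M K * S" using K sets.sets_into_space[OF K] by (simp add: Int_absorb2)
    finally show "norm (u \<phi>) \<le> measure M K * S" using M(4)[OF \<phi>(1)] by simp
  qed simp
qed

lemma smooth_step:
  obtains \<eta> :: "real \<Rightarrow> real" where "smooth1 (\<lambda>t. complex_of_real (\<eta> t))" "\<And>t. 0 \<le> t \<Longrightarrow> \<eta> t = 1"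
    "\<And>t. t \<le> -1 \<Longrightarrow> \<eta> t = 0" "\<And>t. 0 \<le> \<eta> t" "\<And>t. \<eta> t \<le> 1"
proof -
  have cont: "continuous_on UNIV (bump1 (-1) 0)"
    using continuous_on_Re[OF smooth1_continuous[OF smooth1_bump1[of "-1" 0]]] by simp
  obtain K where K: "\<And>t. (K has_vector_derivative bump1 (-1) 0 t) (at t)" "\<And>t. 0 \<le> t \<Longrightarrow> K t = 0"
    using right_antiderivative[OF cont, of 0] by (metis bump1_eq_0)
  have Kd: "(K has_real_derivative bump1 (-1) 0 t) (at t)" for t
    using K(1) by (simp add: has_real_derivative_iff_has_vector_derivative)
  have mono: "K s \<le> K t" if "s \<le> t" for s t
    by (rule DERIV_nonneg_imp_nondecreasing[OF that]) (use Kd bump1_nonneg in blast)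
  have const: "K t = K (-1)" if "t \<le> -1" for t
  proof -
    have "K (-1) \<le> K t"
    proof (rule DERIV_nonpos_imp_nonincreasing[OF that, of K])
      fix x :: real assume "x \<le> -1"
      then have "bump1 (-1) 0 x = 0" by (simp add: bump1_eq_0)
      then show "\<exists>y. (K has_real_derivative y) (at x) \<and> y \<le> 0" using Kd[of x] by auto
    qed
    then show ?thesis using mono[OF that] by simp
  qed
  have "K (-3/4) < K (-1/4)"
  proof (rule DERIV_pos_imp_increasing[of "-3/4" "-1/4" K])
    fix x :: real assume "-3/4 \<le> x" "x \<le> -1/4"
    then have "0 < bump1 (-1) 0 x" by (simp add: bump1_pos_iff)
    then show "\<exists>y. (K has_real_derivative y) (at x) \<and> 0 < y" using Kd[of x] by auto
  qed simp
  moreover have "K (-1) \<le> K (-3/4)" "K (-1/4) \<le> K 0" by (intro mono; simp)+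
  ultimately have neg: "K (-1) < 0" using K(2)[of 0] by simp
  \<comment> \<open>\<open>K\<close> rises from \<open>K (-1)\<close>, which is negative, to 0 and
    is constant to the left of -1; this fixes the normalisation.\<close>
  define \<eta> where "\<eta> t = 1 - K t / K (-1)" for t
  show ?thesis
  proof (rule that[of \<eta>])
    have "smooth1 (\<lambda>t. complex_of_real (K t))"
      by (rule smooth1I[OF has_vector_derivative_complex_of_real[OF Kd] smooth1_bump1])
    then have "smooth1 (\<lambda>t. 1 - complex_of_real (1 / K (-1)) * complex_of_real (K t))"
      by (intro smooth1_diff smooth1_mult smooth1_const)
    then show "smooth1 (\<lambda>t. complex_of_real (\<eta> t))" by (simp add: \<eta>_def)
    show "\<eta> t = 1" if "0 \<le> t" for t using K(2)[OF that] by (simp add: \<eta>_def)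
    show "\<eta> t = 0" if "t \<le> -1" for t using const[OF that] neg by (simp add: \<eta>_def)
    have bounds: "K (-1) \<le> K t \<and> K t \<le> 0" for t
    proof
      show "K (-1) \<le> K t"
      proof (cases "t \<le> -1")
        case True
        then show ?thesis using const[OF True] by simp
      next
        case False
        then show ?thesis using mono[of "-1" t] by simp
      qed
      show "K t \<le> 0"
      proof (cases "t \<le> 0")
        case True
        then show ?thesis using mono[OF True] K(2)[of 0] by simp
      next
        case False
        then show ?thesis using K(2)[of t] by simp
      qed
    qed
    show "0 \<le> \<eta> t" for t using bounds[of t] neg by (simp add: \<eta>_def divide_simps)
    show "\<eta> t \<le> 1" for t using bounds[of t] neg by (simp add: \<eta>_def divide_simps zero_le_divide_iff)
  qed
qed

text \<open>Functions that vanish for large \<open>p1\<close> may have unbounded support;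
  multiplying by \<open>ct\<close> makes them test functions and leaves them unchanged on the closed
  orthant.\<close>

definition is_cutoff :: "(real^'n::finite \<Rightarrow> real) \<Rightarrow> bool" where
  "is_cutoff ct \<longleftrightarrow>
    (\<forall>f C. smooth_fun f \<longrightarrow> (\<forall>x. C \<le> p1 x \<longrightarrow> f x = 0) \<longrightarrow> test_function (\<lambda>x. f x * complex_of_real (ct x))) \<and>
    (\<forall>x::real^'n. (\<forall>i. 0 \<le> x $ i) \<longrightarrow> ct x = 1) \<and> (\<forall>x. 0 \<le> ct x \<and> ct x \<le> 1)"

lemma orthant_cutoff: "\<exists>ct :: real^'n::finite \<Rightarrow> real. is_cutoff ct"
proof -
  obtain \<eta> :: "real \<Rightarrow> real" where \<eta>: "smooth1 (\<lambda>t. complex_of_real (\<eta> t))" "\<And>t. 0 \<le> t \<Longrightarrow> \<eta> t = 1"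
    "\<And>t. t \<le> -1 \<Longrightarrow> \<eta> t = 0" "\<And>t. 0 \<le> \<eta> t" "\<And>t. \<eta> t \<le> 1"
    using smooth_step by metis
  define ct where "ct x = (\<Prod>i\<in>UNIV. \<eta> (x $ i))" for x :: "real^'n"
  have sc: "smooth_fun (\<lambda>x. complex_of_real (ct x))"
    unfolding ct_def of_real_prod using smooth_fun_coord1[OF \<eta>(1)] by (intro smooth_fun_prod)
  have "test_function (\<lambda>x. f x * complex_of_real (ct x))"
    if f: "smooth_fun f" "\<And>x. C \<le> p1 x \<Longrightarrow> f x = 0" for f :: "real^'n \<Rightarrow> complex" and C
  proof -
    \<comment> \<open>When all coordinates are at least -1, one coordinate above C + n pushes the
      sum beyond C; this explains the box.\<close>
    have "f x * complex_of_real (ct x) = 0" if x: "x \<notin> cbox (\<chi> i. -1) (\<chi> i. C + real CARD('n))" for x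
    proof (cases "\<exists>i. x $ i \<le> -1")
      case True
      then have "ct x = 0" unfolding ct_def using \<eta>(3) by (intro prod_zero) auto
      then show ?thesis by simp
    next
      case False
      then have ge: "-1 \<le> x $ i" for i by (simp add: not_le less_imp_le)
      then obtain i where i: "C + real CARD('n) < x $ i" using x by (auto simp: mem_box_cart not_le)
      have "p1 x = x $ i + (\<Sum>j\<in>UNIV - {i}. x $ j)" unfolding p1_def by (simp add: sum.remove[of UNIV i])
      moreover have "(\<Sum>j\<in>UNIV - {i}. -1) \<le> (\<Sum>j\<in>UNIV - {i}. x $ j)" using ge by (intro sum_mono)
      moreover have "(\<Sum>j\<in>UNIV - {i}. -1) \<ge> - real CARD('n)" by (simp add: card_Diff_singleton)
      ultimately have "C \<le> p1 x" using i by linarith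
      then show ?thesis using f(2) by simp
    qed
    then show "test_function (\<lambda>x. f x * complex_of_real (ct x))"
      unfolding test_function_def using smooth_fun_mult[OF f(1) sc] compact_cbox by blast
  qed
  moreover have "0 \<le> ct x \<and> ct x \<le> 1" for x by (auto simp: ct_def \<eta> intro!: prod_nonneg prod_le_1)
  moreover have "(\<forall>i. 0 \<le> x $ i) \<longrightarrow> ct x = 1" for x by (auto simp: ct_def \<eta>)
  ultimately have "is_cutoff ct" unfolding is_cutoff_def by blast
  then show ?thesis by blast
qed

text \<open>A negative order of homogeneity is incompatible with local boundedness at the origin.\<close>

lemma complex_measure_imp_nonneg:
  assumes k: "0 < k" and u: "is_complex_measure_dist (riesz k (complex_of_real \<mu>) :: (real^'n::finite \<Rightarrow> complex) \<Rightarrow> complex)"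
  shows "0 \<le> \<mu>"
proof (rule ccontr)
  assume neg: "\<not> 0 \<le> \<mu>"
  obtain G where G: "cm_seq G" using cm_seq_exists by blast
  obtain J where J: "\<And>j. J \<le> j \<Longrightarrow> \<exists>r>0. riesz k (complex_of_real \<mu>) (\<lambda>x::real^'n. complex_of_real (G j (p1 x))) = complex_of_real r"
    using riesz_cm_pos[OF k G, where 'n='n] by metis
  obtain r where r: "0 < r" "riesz k (complex_of_real \<mu>) (\<lambda>x::real^'n. complex_of_real (G J (p1 x))) = complex_of_real r"
    using J[of J] by auto
  obtain ct :: "real^'n \<Rightarrow> real" where ct:
    "\<And>f C. \<lbrakk>smooth_fun f; \<And>x. C \<le> p1 x \<Longrightarrow> f x = 0\<rbrakk> \<Longrightarrow> test_function (\<lambda>x. f x * complex_of_real (ct x))"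
    "\<And>x. (\<And>i. 0 \<le> x $ i) \<Longrightarrow> ct x = 1" "\<And>x. 0 \<le> ct x" "\<And>x. ct x \<le> 1"
    using orthant_cutoff[where 'n='n] unfolding is_cutoff_def by blast
  define \<phi> where "\<phi> x = complex_of_real (G J (p1 x)) * complex_of_real (ct x)" for x
  have t: "test_function \<phi>" unfolding \<phi>_def
    by (rule ct(1)[where C=2]) (use G orthant_test_smooth[OF orthant_test_cm[OF G]] in \<open>auto simp: cm_seq_def\<close>)
  have rphi: "riesz k (complex_of_real \<mu>) \<phi> = complex_of_real r"
    unfolding r(2)[symmetric] by (rule riesz_cong) (simp add: \<phi>_def ct(2) positive_orthant_def less_imp_le)
  obtain K where K: "compact K" "\<And>x. x \<notin> K \<Longrightarrow> \<phi> x = 0" and s: "smooth_fun \<phi>" using t by (auto simp: test_function_def)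
  obtain R where "\<forall>x\<in>K. norm x \<le> R" using compact_imp_bounded[OF K(1)] unfolding bounded_iff by blast
  then have R: "K \<subseteq> cball 0 R" by auto
  have "compact (\<phi> ` cball 0 R)"
    by (intro compact_continuous_image continuous_on_subset[OF smooth_fun_continuous[OF s]]) auto
  then obtain S where S: "\<And>y. y \<in> \<phi> ` cball 0 R \<Longrightarrow> norm y \<le> S" using compact_imp_bounded bounded_iff by metis
  have S': "norm (\<phi> x) \<le> max 0 S" for x
    using S[of "\<phi> x"] K(2)[of x] R by (cases "x \<in> K") (auto simp: le_max_iff_disj)
  obtain C where C: "0 \<le> C" "\<And>(\<phi> :: real^'n \<Rightarrow> complex) S. \<lbrakk>test_function \<phi>; \<And>x. x \<notin> cball 0 R \<Longrightarrow> \<phi> x = 0; \<And>x. norm (\<phi> x) \<le> S\<rbrakk> \<Longrightarrow> norm (riesz k (complex_of_real \<mu>) \<phi>) \<le> C * S"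
    using complex_measure_dist_bound[OF u compact_cball[of 0 R]] by blast
  \<comment> \<open>Replacing \<phi> by its dilate with c >= 1 keeps the support in the same ball
    and the same sup norm, while the value is multiplied by c^(-n \<mu>), which is unbounded in c
    for negative \<mu>.\<close>
  have bound: "c powr (- (real CARD('n) * \<mu>)) * r \<le> C * max 0 S" if c: "1 \<le> c" for c
  proof -
    have z: "\<phi> (c *\<^sub>R x) = 0" if "x \<notin> cball 0 R" for x
    proof (rule K(2), rule notI)
      assume "c *\<^sub>R x \<in> K"
      then have "c * norm x \<le> R" using R c by auto
      moreover have "norm x \<le> c * norm x" using c mult_right_mono[of 1 c "norm x"] by simp
      ultimately show False using that by simp
    qed
    have "test_function (\<lambda>x. \<phi> (c *\<^sub>R x))"
      unfolding test_function_def using smooth_fun_scale[OF s] z compact_cball by blast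
    from C(2)[OF this z S'] have "norm (riesz k (complex_of_real \<mu>) (\<lambda>x. \<phi> (c *\<^sub>R x))) \<le> C * max 0 S" .
    moreover have "riesz k (complex_of_real \<mu>) (\<lambda>x. \<phi> (c *\<^sub>R x)) = complex_of_real (c powr (- (real CARD('n) * \<mu>)) * r)"
      using riesz_scale[OF k _ test_function_imp_orthant_test[OF t], of c "complex_of_real \<mu>"] c rphi
        powr_of_real[of c "- (real CARD('n) * \<mu>)"] by simp
    ultimately show ?thesis using c r(1) by (simp del: of_real_mult)
  qed
  define a where "a = - (real CARD('n) * \<mu>)"
  have a: "0 < a" using neg by (simp add: a_def mult_pos_neg)
  \<comment> \<open>Chosen so that X r exceeds the bound by 1.\<close>
  define X where "X = (C * max 0 S + 1) / r"
  have X: "0 < X" using C(1) r(1) by (simp add: X_def add_nonneg_pos)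
  define c where "c = max 1 (X powr (1 / a))"
  have "X = (X powr (1 / a)) powr a" using X a by (simp add: powr_powr)
  also have "\<dots> \<le> c powr a" using a by (intro powr_mono2) (auto simp: c_def)
  finally have "X * r \<le> c powr a * r" using r by simp
  moreover have "c powr a * r \<le> C * max 0 S" using bound[of c] by (simp add: c_def a_def)
  ultimately show False using r(1) by (simp add: X_def)
qed

subsection \<open>Test functions in the open orthant\<close>

text \<open>If \<open>B\<close> vanishes near 0, this is smooth for every complex exponent. The
  exponent can then be lowered at will, which amounts to dividing by powers of the
  coordinate.\<close>

definition pw :: "(real \<Rightarrow> complex) \<Rightarrow> complex \<Rightarrow> real \<Rightarrow> complex" where
  "pw B z t = (if 0 < t then B t * complex_of_real t powr z else 0)"

lemma deriv1_eq_0: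
  assumes "smooth1 B" "\<And>t. t < l \<Longrightarrow> B t = 0" "t < l"
  shows "deriv1 B t = 0"
proof -
  have "((\<lambda>_. 0) has_vector_derivative 0) (at t)" by simp
  then have "(B has_vector_derivative 0) (at t)"
    by (rule has_vector_derivative_transform_within_open[where S="{..<l}"]) (use assms in auto)
  then show ?thesis unfolding deriv1_def by (rule vector_derivative_at)
qed

lemma pw_has_deriv:
  assumes "smooth1 B" "\<And>t. t < l \<Longrightarrow> B t = 0" "0 < l"
  shows "(pw B z has_vector_derivative pw (deriv1 B) z t + z * pw B (z - 1) t) (at t)"
proof (cases "0 < t")
  case True
  have d1: "((\<lambda>t. complex_of_real t) has_vector_derivative 1) (at t)" by (auto intro!: derivative_eq_intros)
  have "((\<lambda>w. w powr z) has_field_derivative (z * complex_of_real t powr (z - 1))) (at (complex_of_real t))"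
    using True by (intro has_field_derivative_powr) (simp add: complex_nonpos_Reals_iff)
  from field_vector_diff_chain_at[OF d1 this]
  have "((\<lambda>t. complex_of_real t powr z) has_vector_derivative (z * complex_of_real t powr (z - 1))) (at t)"
    by (simp add: o_def)
  from has_vector_derivative_mult[OF smooth1_has_deriv[OF assms(1)] this]
  have "((\<lambda>t. B t * complex_of_real t powr z) has_vector_derivative pw (deriv1 B) z t + z * pw B (z - 1) t) (at t)"
    using True by (simp add: pw_def algebra_simps)
  then show ?thesis
    by (rule has_vector_derivative_transform_within_open[where S="{0<..}"]) (use True in \<open>auto simp: pw_def\<close>)
next
  case False
  have "((\<lambda>_. 0) has_vector_derivative pw (deriv1 B) z t + z * pw B (z - 1) t) (at t)"
    using False by (simp add: pw_def)
  then show ?thesis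
    by (rule has_vector_derivative_transform_within_open[where S="{..<l}"]) (use False assms in \<open>auto simp: pw_def\<close>)
qed

lemma smooth1_pw:
  assumes "smooth1 B" "\<And>t. t < l \<Longrightarrow> B t = 0" "0 < l"
  shows "smooth1 (pw B z)"
proof -
  have "C1 m (pw B z)" for m
    using assms(1,2)
  proof (induction m arbitrary: B z)
    case 0
    show ?case unfolding C1.simps
      by (rule has_vector_derivative_imp_continuous_on_UNIV[OF pw_has_deriv[OF 0(1,2) assms(3)]])
  next
    case (Suc m)
    have "C1 m (pw (deriv1 B) z)"
      using Suc.prems by (intro Suc.IH smooth1_deriv1 deriv1_eq_0[OF Suc.prems])
    moreover have "C1 m (pw B (z - 1))" using Suc by blast
    ultimately have "C1 m (\<lambda>t. pw (deriv1 B) z t + z * pw B (z - 1) t)"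
      by (intro C1_add C1_mult C1_const)
    then show ?case by (rule C1_SucI) (rule pw_has_deriv[OF Suc.prems assms(3)])
  qed
  then show ?thesis by (simp add: smooth1_def)
qed

definition pw_prod :: "('n::finite \<Rightarrow> real \<Rightarrow> real) \<Rightarrow> complex \<Rightarrow> real^'n \<Rightarrow> complex" where
  "pw_prod q z x = (\<Prod>i\<in>UNIV. pw (\<lambda>t. complex_of_real (q i t)) z (x $ i))"

definition bump_family :: "('n::finite \<Rightarrow> real \<Rightarrow> real) \<Rightarrow> bool" where
  "bump_family q \<longleftrightarrow> (\<forall>i. smooth1 (\<lambda>t. complex_of_real (q i t)) \<and> (\<forall>t. 0 \<le> q i t \<and> q i t \<le> 1)
     \<and> (\<exists>l>0. \<forall>t<l. q i t = 0) \<and> (\<exists>u. \<forall>t\<ge>u. q i t = 0))"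

lemma smooth_fun_pw_prod:
  assumes "bump_family q" shows "smooth_fun (pw_prod q z)"
proof -
  have "smooth1 (pw (\<lambda>t. complex_of_real (q i t)) z)" for i
  proof -
    obtain l where "0 < l" "\<And>t. t < l \<Longrightarrow> q i t = 0" using assms unfolding bump_family_def by blast
    then show ?thesis using assms by (intro smooth1_pw[of _ l]) (auto simp: bump_family_def)
  qed
  then show ?thesis unfolding pw_prod_def[abs_def] by (intro smooth_fun_prod smooth_fun_coord1)
qed

lemma pw_prod_outside:
  assumes "bump_family q" "\<And>i t. u \<le> t \<Longrightarrow> q i t = 0" "x \<notin> cbox 0 (\<chi> i. u)"
  shows "pw_prod q z x = 0"
proof -
  obtain i where "x $ i < 0 \<or> u < x $ i" using assms(3) by (auto simp: mem_box_cart not_le)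
  then have "pw (\<lambda>t. complex_of_real (q i t)) z (x $ i) = 0" using assms(2)[of "x $ i" i] by (auto simp: pw_def)
  then show ?thesis unfolding pw_prod_def by (intro prod_zero) auto
qed

lemma test_function_pw_prod:
  assumes "bump_family q" shows "test_function (pw_prod q z)"
proof -
  obtain U where U: "\<And>i t. U i \<le> t \<Longrightarrow> q i t = 0" using assms unfolding bump_family_def by metis
  have "pw_prod q z x = 0" if "x \<notin> cbox 0 (\<chi> i. Max (range U))" for x
  proof (rule pw_prod_outside[OF assms _ that])
    show "q i t = 0" if "Max (range U) \<le> t" for i t
      using U[of i t] Max_ge[of "range U" "U i"] that by simp
  qed
  then show ?thesis using smooth_fun_pw_prod[OF assms] compact_cbox unfolding test_function_def by blast
qed

lemma pw_prod_mon:
  "x \<in> positive_orthant \<Longrightarrow> pw_prod q z x = mon UNIV x * pw_prod q (z - 1) x"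
  unfolding pw_prod_def mon_def prod.distrib[symmetric]
  by (intro prod.cong) (auto simp: pw_def positive_orthant_def powr_diff less_imp_neq[symmetric])

text \<open>Dividing by powers of the coordinates moves the parameter into the domain of convergence.\<close>

lemma riesz_pw_prod:
  assumes k: "0 < k" and q: "bump_family (q :: 'n::finite \<Rightarrow> real \<Rightarrow> real)"
  shows "mu0 CARD('n) k < Re \<mu> + real N \<Longrightarrow>
    riesz k \<mu> (pw_prod q z) = rcoef CARD('n) k \<mu> * fint UNIV k (\<mu> + of_nat N - of_real (mu0 CARD('n) k)) (pw_prod q (z - of_nat N))"
proof (induction N arbitrary: \<mu> z)
  case 0
  then show ?case
    using riesz_eq_integral[OF k test_function_imp_orthant_test[OF test_function_pw_prod[OF q]]] riesz_integral_eq by simp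
next
  case (Suc N)
  have "riesz k \<mu> (pw_prod q z) = riesz k \<mu> (\<lambda>x. mon UNIV x * pw_prod q (z - 1) x)"
    by (rule riesz_cong) (rule pw_prod_mon)
  also have "\<dots> = (\<Prod>j<CARD('n). \<mu> - of_real k * of_nat j) * riesz k (\<mu> + 1) (pw_prod q (z - 1))"
    by (rule riesz_mon[OF k test_function_imp_orthant_test[OF test_function_pw_prod[OF q]]])
  also have "riesz k (\<mu> + 1) (pw_prod q (z - 1)) = rcoef CARD('n) k (\<mu> + 1) *
     fint UNIV k ((\<mu> + 1) + of_nat N - of_real (mu0 CARD('n) k)) (pw_prod q ((z - 1) - of_nat N))"
    using Suc.prems by (intro Suc.IH) simp
  finally show ?case unfolding rcoef_plus_1[of _ _ \<mu>] by (simp add: algebra_simps)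
qed

lemma prod_of_real_powr:
  assumes "finite I" "\<And>i. i \<in> I \<Longrightarrow> 0 \<le> f i"
  shows "complex_of_real (\<Prod>i\<in>I. f i) powr z = (\<Prod>i\<in>I. complex_of_real (f i) powr z)"
  using assms
proof (induction I rule: finite_induct)
  case (insert i I)
  then show ?case by (simp add: powr_times_real_left del: of_real_prod)
qed simp

definition bump_density :: "real \<Rightarrow> real \<Rightarrow> ('n::finite \<Rightarrow> real \<Rightarrow> real) \<Rightarrow> real^'n \<Rightarrow> real" where
  "bump_density k \<beta> q x = indicator positive_orthant x * (\<Prod>i\<in>UNIV. q i (x $ i) * (x $ i) powr (\<beta> - 1)) * vand UNIV k 0 x"

text \<open>The exponent -i Im \<mu> cancels the oscillation of the weight and leaves a real
  nonnegative density with exponent \<beta> - 1. The integral converges for every \<mu> because the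
  bumps stay away from the coordinate hyperplanes.\<close>

lemma riesz_pw_prod_value:
  fixes \<mu> :: complex
  assumes k: "0 < k" and q: "bump_family (q :: 'n::finite \<Rightarrow> real \<Rightarrow> real)"
  defines "\<beta> \<equiv> Re \<mu> - mu0 CARD('n) k"
  shows "integrable lborel (bump_density k \<beta> q)"
    and "riesz k \<mu> (pw_prod q (- \<i> * of_real (Im \<mu>))) = rcoef CARD('n) k \<mu> * complex_of_real (\<integral>x. bump_density k \<beta> q x \<partial>lborel)"
proof -
  define N where "N = nat (\<lceil>mu0 CARD('n) k - Re \<mu>\<rceil> + 1)"
  have N: "mu0 CARD('n) k < Re \<mu> + real N" unfolding N_def by linarith
  let ?z = "- \<i> * of_real (Im \<mu>)"
  let ?b = "\<mu> + of_nat N - of_real (mu0 CARD('n) k)"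
  have b: "0 < Re ?b" using N by simp
  have ot: "orthant_test (pw_prod q (?z - of_nat N))"
    by (rule test_function_imp_orthant_test[OF test_function_pw_prod[OF q]])
  have z: "?z - of_nat N + (?b - 1) = complex_of_real (\<beta> - 1)"
    by (simp add: \<beta>_def complex_eq_iff)
  have eq: "indicat_real positive_orthant x *\<^sub>R (pw_prod q (?z - of_nat N) (face UNIV x) * complex_of_real (vand UNIV k 0 (face UNIV x)) * face_weight UNIV ?b x)
     = complex_of_real (bump_density k \<beta> q x)" for x
  proof (cases "x \<in> positive_orthant")
    case True
    then have pos: "0 < x $ i" for i by (simp add: positive_orthant_def)
    have "pw_prod q (?z - of_nat N) x * complex_of_real (\<Prod>i\<in>UNIV. x $ i) powr (?b - 1)
      = (\<Prod>i\<in>UNIV. pw (\<lambda>t. complex_of_real (q i t)) (?z - of_nat N) (x $ i) * complex_of_real (x $ i) powr (?b - 1))"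
      using pos by (subst prod_of_real_powr) (auto simp: pw_prod_def prod.distrib less_imp_le)
    also have "\<dots> = (\<Prod>i\<in>UNIV. complex_of_real (q i (x $ i) * (x $ i) powr (\<beta> - 1)))"
    proof (rule prod.cong)
      fix i
      have "pw (\<lambda>t. complex_of_real (q i t)) (?z - of_nat N) (x $ i) * complex_of_real (x $ i) powr (?b - 1)
        = complex_of_real (q i (x $ i)) * (complex_of_real (x $ i) powr (?z - of_nat N) * complex_of_real (x $ i) powr (?b - 1))"
        using pos[of i] by (simp add: pw_def)
      also have "complex_of_real (x $ i) powr (?z - of_nat N) * complex_of_real (x $ i) powr (?b - 1) = complex_of_real (x $ i) powr (complex_of_real (\<beta> - 1))"
        unfolding powr_add[symmetric] z ..
      also have "\<dots> = complex_of_real ((x $ i) powr (\<beta> - 1))" using pos[of i] by (subst powr_of_real) auto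
      finally show "pw (\<lambda>t. complex_of_real (q i t)) (?z - of_nat N) (x $ i) * complex_of_real (x $ i) powr (?b - 1) = complex_of_real (q i (x $ i) * (x $ i) powr (\<beta> - 1))"
        by (simp only: of_real_mult)
    qed simp
    finally have "pw_prod q (?z - of_nat N) x * complex_of_real (\<Prod>i\<in>UNIV. x $ i) powr (?b - 1) = complex_of_real (\<Prod>i\<in>UNIV. q i (x $ i) * (x $ i) powr (\<beta> - 1))"
      by (simp only: of_real_prod)
    moreover have "indicat_real positive_orthant x *\<^sub>R (pw_prod q (?z - of_nat N) (face UNIV x) * complex_of_real (vand UNIV k 0 (face UNIV x)) * face_weight UNIV ?b x)
       = (pw_prod q (?z - of_nat N) x * complex_of_real (\<Prod>i\<in>UNIV. x $ i) powr (?b - 1)) * complex_of_real (vand UNIV k 0 x)"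
      using True by (simp add: face_weight_def mult_ac del: of_real_prod)
    ultimately show ?thesis using True by (simp add: bump_density_def del: of_real_prod)
  qed (simp add: bump_density_def)
  obtain B where B: "vanishes_beyond B (pw_prod q (?z - of_nat N))" using ot by (auto simp: orthant_test_def)
  have c: "continuous_on UNIV (\<lambda>x. pw_prod q (?z - of_nat N) x * complex_of_real (vand UNIV k 0 x))"
    using k by (intro continuous_on_mult continuous_on_of_real_vand smooth_fun_continuous[OF orthant_test_smooth[OF ot]]) auto
  have "integrable lborel (\<lambda>x. complex_of_real (bump_density k \<beta> q x))"
    using gint_integrable[OF b c vanishes_beyond_mult'[OF B], where A=UNIV]
    unfolding set_integrable_def eq .
  then show "integrable lborel (bump_density k \<beta> q)" by (simp add: complex_of_real_integrable_eq)
  have "fint UNIV k ?b (pw_prod q (?z - of_nat N)) = complex_of_real (\<integral>x. bump_density k \<beta> q x \<partial>lborel)"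
    unfolding fint_def gint_def set_lebesgue_integral_def eq by (rule integral_complex_of_real)
  then show "riesz k \<mu> (pw_prod q ?z) = rcoef CARD('n) k \<mu> * complex_of_real (\<integral>x. bump_density k \<beta> q x \<partial>lborel)"
    using riesz_pw_prod[OF k q N, of ?z] by simp
qed

subsection \<open>Bumps accumulating at the boundary\<close>

text \<open>Coordinate \<open>i0\<close> sits in a dyadic interval that approaches 0 and stays below
  2; the others sit in fixed intervals beyond 3. For injective \<open>h\<close> different
  coordinates are at least 1 apart, so the Vandermonde weight is at least 1.\<close>

definition dyadic_bump :: "('n \<Rightarrow> nat) \<Rightarrow> 'n \<Rightarrow> nat \<Rightarrow> 'n \<Rightarrow> real \<Rightarrow> real" where
  "dyadic_bump h i0 m i t = (if i = i0 then bump1 1 2 (2 ^ m * t) else bump1 (2 * real (h i) + 3) (2 * real (h i) + 4) t)"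

lemma bump1_le_1: "bump1 l u t \<le> 1"
proof -
  have "flat_fun 0 s \<le> 1" for s by (simp add: flat_fun_def)
  then show ?thesis unfolding bump1_def by (intro mult_le_one flat_fun_nonneg)
qed

lemma bump_family_dyadic: "bump_family (dyadic_bump h i0 m :: 'n::finite \<Rightarrow> real \<Rightarrow> real)"
  unfolding bump_family_def
proof (intro allI conjI)
  fix i :: 'n and t :: real
  show "smooth1 (\<lambda>t. complex_of_real (dyadic_bump h i0 m i t))"
    using smooth1_affine[OF smooth1_bump1[of 1 2], of "2 ^ m" 0] smooth1_bump1
    by (cases "i = i0") (simp_all add: dyadic_bump_def)
  show "0 \<le> dyadic_bump h i0 m i t" "dyadic_bump h i0 m i t \<le> 1" by (auto simp: dyadic_bump_def bump1_nonneg bump1_le_1)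
  show "\<exists>l>0. \<forall>t<l. dyadic_bump h i0 m i t = 0"
  proof (intro exI[of _ "1 / 2 ^ m"] conjI allI impI)
    fix t :: real assume t: "t < 1 / 2 ^ m"
    then have "2 ^ m * t \<le> 1" by (simp add: field_simps)
    moreover have "t \<le> 1" using t one_le_power[of "2::real" m] by (smt (verit) divide_le_eq_1)
    ultimately show "dyadic_bump h i0 m i t = 0" by (auto simp: dyadic_bump_def intro!: bump1_eq_0)
  qed simp
  show "\<exists>u. \<forall>t\<ge>u. dyadic_bump h i0 m i t = 0"
  proof (intro exI[of _ "2 * real (h i) + 4"] allI impI)
    fix t :: real assume t: "2 * real (h i) + 4 \<le> t"
    then have "1 * t \<le> 2 ^ m * t" by (intro mult_right_mono) auto
    then have "2 \<le> 2 ^ m * t" using t by linarith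
    then show "dyadic_bump h i0 m i t = 0" using t by (cases "i = i0") (simp_all add: dyadic_bump_def bump1_eq_0)
  qed
qed

lemma dyadic_bump_pos:
  assumes "0 < dyadic_bump h i0 m i t"
  shows "i = i0 \<Longrightarrow> t < 2" "i \<noteq> i0 \<Longrightarrow> 2 * real (h i) + 3 < t \<and> t < 2 * real (h i) + 4"
proof -
  assume "i = i0"
  then have *: "1 < 2 ^ m * t" "2 ^ m * t < 2" using assms by (auto simp: dyadic_bump_def bump1_pos_iff)
  then have "0 < t" by (smt (verit) zero_less_mult_iff zero_less_power)
  then have "1 * t \<le> 2 ^ m * t" by (intro mult_right_mono) auto
  then show "t < 2" using * by simp
qed (use assms in \<open>auto simp: dyadic_bump_def bump1_pos_iff\<close>)

lemma vand_ge_1_dyadic: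
  fixes x :: "real^'n::finite"
  assumes "0 < k" "inj h" "\<And>i. 0 < dyadic_bump h i0 m i (x $ i)"
  shows "1 \<le> vand UNIV k 0 x"
proof -
  have d: "1 \<le> (x $ l - x $ r)\<^sup>2" if "l \<noteq> r" for l r
  proof -
    note b = dyadic_bump_pos[OF assms(3)]
    consider "l = i0" | "r = i0" | "l \<noteq> i0" "r \<noteq> i0" by blast
    then have "1 \<le> \<bar>x $ l - x $ r\<bar>"
    proof cases
      case 1
      then show ?thesis using b(1)[of l] b(2)[of r] that by auto
    next
      case 2
      then show ?thesis using b(1)[of r] b(2)[of l] that by auto
    next
      case 3
      have "h l \<noteq> h r" using assms(2) that by (auto simp: inj_def)
      then have "real (h l) + 1 \<le> real (h r) \<or> real (h r) + 1 \<le> real (h l)" by linarith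
      then show ?thesis using b(2)[of l] b(2)[of r] 3 by linarith
    qed
    then show ?thesis using power_mono[of 1 "\<bar>x $ l - x $ r\<bar>" 2] by simp
  qed
  show ?thesis unfolding vand_def using d assms(1)
    by (intro prod_ge_1 ge_one_powr_ge_zero) auto
qed

text \<open>Rescaling the moving bump to unit size multiplies its integral against t^(\<beta>-1) by
  2^(-m \<beta>), which is at least 1 for \<beta> <= 0: the contributions do not decay at the
  boundary. The other coordinates do not depend on \<open>m\<close>, and the Vandermonde weight is
  bounded below by 1.\<close>

lemma dyadic_bump_lower_bound:
  fixes h :: "'n::finite \<Rightarrow> nat"
  assumes k: "0 < k" and \<beta>: "\<beta> \<le> 0" and h: "inj h"
    and int: "\<And>m. integrable lborel (bump_density k \<beta> (dyadic_bump h i0 m))"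
  shows "\<exists>p>0. \<forall>m. p \<le> (\<integral>x. bump_density k \<beta> (dyadic_bump h i0 m) x \<partial>lborel)"
proof -
  define q where "q m i t = ennreal (indicator {0<..} t * dyadic_bump h i0 m i t * t powr (\<beta> - 1))" for m and i :: 'n and t :: real
  define Q where "Q m i = (\<integral>\<^sup>+t. q m i t \<partial>lborel)" for m i
  have dm: "dyadic_bump h i0 m i \<in> borel_measurable borel" for m i
  proof -
    have "continuous_on UNIV (\<lambda>t. complex_of_real (dyadic_bump h i0 m i t))"
      using bump_family_dyadic[of h i0 m] by (intro smooth1_continuous) (simp add: bump_family_def)
    from continuous_on_Re[OF this] show ?thesis by (intro borel_measurable_continuous_onI) simp
  qed
  have d0: "0 \<le> dyadic_bump h i0 m i t" for m i t using bump_family_dyadic[of h i0 m] by (simp add: bump_family_def)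
  have qm: "q m i \<in> borel_measurable borel" for m i unfolding q_def using dm[of m i] by measurable
  have low: "(\<Prod>i\<in>UNIV. Q m i) \<le> ennreal (\<integral>x. bump_density k \<beta> (dyadic_bump h i0 m) x \<partial>lborel)" for m
  proof -
    have nn: "0 \<le> bump_density k \<beta> (dyadic_bump h i0 m) x" for x
      unfolding bump_density_def by (intro mult_nonneg_nonneg prod_nonneg vand_nonneg) (auto simp: d0)
    have "(\<Prod>i\<in>UNIV. Q m i) = (\<integral>\<^sup>+x. (\<Prod>i\<in>UNIV. q m i (x $ i)) \<partial>(lborel :: (real^'n) measure))"
      unfolding Q_def by (rule nn_integral_prod_coords[symmetric]) (rule qm)
    also have "\<dots> \<le> (\<integral>\<^sup>+x. ennreal (bump_density k \<beta> (dyadic_bump h i0 m) x) \<partial>lborel)"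
    proof (rule nn_integral_mono)
      fix x :: "real^'n"
      have pr: "(\<Prod>i\<in>UNIV. q m i (x $ i)) = ennreal (\<Prod>i\<in>UNIV. indicator {0<..} (x $ i) * dyadic_bump h i0 m i (x $ i) * (x $ i) powr (\<beta> - 1))"
        unfolding q_def by (rule prod_ennreal) (simp add: d0)
      show "(\<Prod>i\<in>UNIV. q m i (x $ i)) \<le> ennreal (bump_density k \<beta> (dyadic_bump h i0 m) x)"
      proof (cases "\<forall>i. 0 < x $ i \<and> 0 < dyadic_bump h i0 m i (x $ i)")
        case True
        then have "x \<in> positive_orthant" by (simp add: positive_orthant_def)
        moreover have "1 \<le> vand UNIV k 0 x" using True by (intro vand_ge_1_dyadic[OF k h]) auto
        then have "(\<Prod>i\<in>UNIV. dyadic_bump h i0 m i (x $ i) * (x $ i) powr (\<beta> - 1)) * 1 \<le> (\<Prod>i\<in>UNIV. dyadic_bump h i0 m i (x $ i) * (x $ i) powr (\<beta> - 1)) * vand UNIV k 0 x"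
          by (intro mult_left_mono prod_nonneg) (auto simp: d0)
        ultimately show ?thesis unfolding pr bump_density_def using True by (intro ennreal_leI) simp
      next
        case False
        then obtain i where "\<not> (0 < x $ i \<and> 0 < dyadic_bump h i0 m i (x $ i))" by blast
        then have "indicator {0<..} (x $ i) * dyadic_bump h i0 m i (x $ i) * (x $ i) powr (\<beta> - 1) = 0"
          using d0[of m i "x $ i"] by (auto simp: indicator_def)
        then have "(\<Prod>i\<in>UNIV. indicator {0<..} (x $ i) * dyadic_bump h i0 m i (x $ i) * (x $ i) powr (\<beta> - 1)) = 0"
          by (intro prod_zero) auto
        then show ?thesis unfolding pr by (simp only: ennreal_0 zero_le)
      qed
    qed
    also have "\<dots> = ennreal (\<integral>x. bump_density k \<beta> (dyadic_bump h i0 m) x \<partial>lborel)"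
      by (rule nn_integral_eq_integral[OF int]) (simp add: nn)
    finally show ?thesis .
  qed
  have mono: "Q 0 i \<le> Q m i" for m i
  proof (cases "i = i0")
    case False
    then show ?thesis by (simp add: Q_def q_def dyadic_bump_def)
  next
    case True
    define c :: real where "c = 1 / 2 ^ m"
    have c: "0 < c" "c \<le> 1" by (auto simp: c_def)
    have "Q m i = ennreal \<bar>c\<bar> * (\<integral>\<^sup>+t. q m i (0 + c * t) \<partial>lborel)"
      unfolding Q_def using c by (intro nn_integral_real_affine qm) auto
    also have "\<dots> = (\<integral>\<^sup>+t. ennreal c * q m i (c * t) \<partial>lborel)"
      using c qm[of m i] by (subst nn_integral_cmult) auto
    also have "\<dots> \<ge> Q 0 i" unfolding Q_def
    proof (rule nn_integral_mono)
      fix t :: real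
      show "q 0 i t \<le> ennreal c * q m i (c * t)"
      proof (cases "0 < t")
        case False
        then show ?thesis by (simp add: q_def)
      next
        case t: True
        have "c * (c * t) powr (\<beta> - 1) = c powr \<beta> * t powr (\<beta> - 1)"
          using c t by (simp add: powr_mult powr_diff)
        moreover have "1 \<le> c powr \<beta>" using powr_mono'[OF \<beta>, of c] c by simp
        ultimately have "t powr (\<beta> - 1) \<le> c * (c * t) powr (\<beta> - 1)" by (simp add: mult_le_cancel_right1)
        then have "bump1 1 2 t * t powr (\<beta> - 1) \<le> bump1 1 2 t * (c * (c * t) powr (\<beta> - 1))"
          by (intro mult_left_mono bump1_nonneg)
        moreover have "q m i (c * t) = ennreal (bump1 1 2 (2 ^ m * (c * t)) * (c * t) powr (\<beta> - 1))"
          using True t c by (simp add: q_def dyadic_bump_def)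
        moreover have e: "2 ^ m * (c * t) = t" by (simp add: c_def)
        ultimately have "q m i (c * t) = ennreal (bump1 1 2 t * (c * t) powr (\<beta> - 1))"
          by (simp only: e)
        then have "ennreal c * q m i (c * t) = ennreal (bump1 1 2 t * (c * (c * t) powr (\<beta> - 1)))"
          using c by (simp add: ennreal_mult'[symmetric] mult.left_commute)
        moreover note \<open>bump1 1 2 t * t powr (\<beta> - 1) \<le> _\<close>
        moreover have "q 0 i t = ennreal (bump1 1 2 t * t powr (\<beta> - 1))"
          using True t by (simp add: q_def dyadic_bump_def)
        ultimately show ?thesis by (simp only: ennreal_leI)
      qed
    qed
    finally show ?thesis .
  qed
  have Qpos: "Q 0 i \<noteq> 0" for i
  proof
    assume "Q 0 i = 0"
    then have "AE t in lborel. q 0 i t = 0" unfolding Q_def using qm[of 0 i] by (simp add: nn_integral_0_iff_AE)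
    moreover obtain a b :: real where ab: "0 < a" "a < b" "\<And>t. a < t \<Longrightarrow> t < b \<Longrightarrow> 0 < dyadic_bump h i0 0 i t"
    proof (cases "i = i0")
      case True
      then show ?thesis using that[of 1 2] by (auto simp: dyadic_bump_def bump1_pos_iff)
    next
      case False
      then show ?thesis using that[of "2 * real (h i) + 3" "2 * real (h i) + 4"] by (auto simp: dyadic_bump_def bump1_pos_iff)
    qed
    have qp: "0 < q 0 i t" if "a < t" "t < b" for t
      using ab(1) ab(3)[OF that] that by (simp add: q_def)
    have "t \<notin> {a<..<b}" if "q 0 i t = 0" for t using qp[of t] that by auto
    ultimately have "AE t in lborel. t \<notin> {a<..<b}" by (auto elim!: eventually_mono)
    then have "{a<..<b} \<in> null_sets lborel" by (subst AE_iff_null_sets) auto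
    then show False using ab(2) by (simp add: null_sets_def)
  qed
  define P where "P = (\<Prod>i\<in>UNIV. Q 0 i)"
  have P: "P \<le> ennreal (\<integral>x. bump_density k \<beta> (dyadic_bump h i0 m) x \<partial>lborel)" for m
  proof -
    have "(\<Prod>i\<in>I. Q 0 i) \<le> (\<Prod>i\<in>I. Q m i)" for I
      by (induction I rule: infinite_finite_induct) (auto intro: mult_mono mono)
    then show ?thesis unfolding P_def using low[of m] order_trans by blast
  qed
  have "P \<noteq> 0" unfolding P_def using Qpos by simp
  moreover have "P < \<infinity>" using P[of 0] by (rule le_less_trans) simp
  ultimately have p: "0 < enn2real P" "P = ennreal (enn2real P)" by (auto simp: enn2real_positive_iff zero_less_iff_neq_zero)
  have "enn2real P \<le> (\<integral>x. bump_density k \<beta> (dyadic_bump h i0 m) x \<partial>lborel)" for m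
  proof -
    have nn: "0 \<le> (\<integral>x. bump_density k \<beta> (dyadic_bump h i0 m) x \<partial>lborel)"
      unfolding bump_density_def by (intro integral_nonneg_AE AE_I2 mult_nonneg_nonneg prod_nonneg vand_nonneg) (auto simp: d0)
    have "ennreal (enn2real P) \<le> ennreal (\<integral>x. bump_density k \<beta> (dyadic_bump h i0 m) x \<partial>lborel)" using P[of m] p(2) by simp
    then show ?thesis using nn by (simp add: ennreal_le_iff)
  qed
  then show ?thesis using p(1) by blast
qed

lemma norm_pw_le: "z = - \<i> * of_real s \<Longrightarrow> norm (pw (\<lambda>t. complex_of_real (q' t)) z t) \<le> \<bar>q' t\<bar>"
  by (simp add: pw_def norm_mult norm_powr_real_powr)

text \<open>The supports of the summands are disjoint dyadic intervals, and a single bump is at most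
  1.\<close>

lemma sum_dyadic_bump_le_1: "(\<Sum>m<N. bump1 1 2 (2 ^ m * t)) \<le> 1"
proof (cases "\<exists>m<N. 0 < bump1 1 2 (2 ^ m * t)")
  case False
  then have "bump1 1 2 (2 ^ m * t) = 0" if "m < N" for m
    using that bump1_nonneg[of 1 2 "2 ^ m * t"] by (metis less_eq_real_def)
  then show ?thesis by simp
next
  case True
  then obtain m where m: "m < N" "1 < 2 ^ m * t" "2 ^ m * t < 2" by (auto simp: bump1_pos_iff)
  have t: "0 < t" using m(2) by (smt (verit) zero_less_mult_iff zero_less_power)
  have "bump1 1 2 (2 ^ j * t) = 0" if "j \<noteq> m" for j
  proof (cases "j < m")
    case True
    then have "(2::real) ^ Suc j \<le> 2 ^ m" by (intro power_increasing) auto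
    then have "2 ^ Suc j * t \<le> 2 ^ m * t" using t by (intro mult_right_mono) auto
    then show ?thesis using m by (intro bump1_eq_0) auto
  next
    case False
    then have "(2::real) ^ Suc m \<le> 2 ^ j" using that by (intro power_increasing) auto
    then have "2 ^ Suc m * t \<le> 2 ^ j * t" using t by (intro mult_right_mono) auto
    then show ?thesis using m by (intro bump1_eq_0) auto
  qed
  then have "(\<Sum>m<N. bump1 1 2 (2 ^ m * t)) = bump1 1 2 (2 ^ m * t)"
    using m(1) by (subst sum.remove[of _ m]) auto
  then show ?thesis using bump1_le_1 by simp
qed

text \<open>With a nonzero coefficient the sums of the first N dyadic bumps, bounded by 1 and
  supported in one compact set, would have values growing linearly in N.\<close>

lemma complex_measure_imp_rcoef_0:
  assumes k: "0 < k" and u: "is_complex_measure_dist (riesz k \<mu> :: (real^'n::finite \<Rightarrow> complex) \<Rightarrow> complex)"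
    and \<mu>: "Re \<mu> \<le> mu0 CARD('n) k"
  shows "rcoef CARD('n) k \<mu> = 0"
proof (rule ccontr)
  assume rc: "rcoef CARD('n) k \<mu> \<noteq> 0"
  obtain h :: "'n \<Rightarrow> nat" where "bij_betw h UNIV {0..<CARD('n)}"
    using ex_bij_betw_finite_nat[of "UNIV :: 'n set"] by auto
  then have h: "inj h" by (simp add: bij_betw_def)
  \<comment> \<open>An arbitrary coordinate.\<close>
  define i0 :: 'n where "i0 = undefined"
  define z where "z = - \<i> * complex_of_real (Im \<mu>)"
  define q where "q = dyadic_bump h i0"
  have bq: "bump_family (q m)" for m unfolding q_def by (rule bump_family_dyadic)
  define \<beta> where "\<beta> = Re \<mu> - mu0 CARD('n) k"
  note val = riesz_pw_prod_value[OF k bq, of \<mu>, folded \<beta>_def z_def]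
  obtain p where p: "0 < p" "\<And>m. p \<le> (\<integral>x. bump_density k \<beta> (q m) x \<partial>lborel)"
    using dyadic_bump_lower_bound[OF k _ h, of \<beta> i0] val(1) \<mu> unfolding q_def \<beta>_def by auto
  define U where "U = Max (range (\<lambda>i. 2 * real (h i) + 4))"
  have U: "2 * real (h i) + 4 \<le> U" for i unfolding U_def by (intro Max_ge) auto
  define K where "K = cbox (0::real^'n) (\<chi> i. U)"
  have out: "pw_prod (q m) z x = 0" if "x \<notin> K" for m x
  proof (rule pw_prod_outside[OF bq _ that[unfolded K_def]])
    fix i t assume t: "U \<le> t"
    have "0 \<le> t" using t U[of i] by linarith
    then have "1 * t \<le> 2 ^ m * t" by (intro mult_right_mono) auto
    moreover have "4 \<le> t" using t U[of i] by linarith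
    ultimately have "2 \<le> 2 ^ m * t" by linarith
    then show "q m i t = 0" using t U[of i] by (cases "i = i0") (simp_all add: q_def dyadic_bump_def bump1_eq_0)
  qed
  obtain C where C: "\<And>(\<phi> :: real^'n \<Rightarrow> complex) S. \<lbrakk>test_function \<phi>; \<And>x. x \<notin> K \<Longrightarrow> \<phi> x = 0; \<And>x. norm (\<phi> x) \<le> S\<rbrakk> \<Longrightarrow> norm (riesz k \<mu> \<phi>) \<le> C * S"
    using complex_measure_dist_bound[OF u, of K] unfolding K_def by (metis compact_cbox)
  have bound: "norm (rcoef CARD('n) k \<mu>) * (real N * p) \<le> C" for N
  proof -
    let ?\<phi> = "\<lambda>x. \<Sum>m<N. pw_prod (q m) z x"
    have "test_function ?\<phi>"
      unfolding test_function_def using out compact_cbox[of "0::real^'n"] smooth_fun_pw_prod[OF bq] K_def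
      by (intro conjI smooth_fun_sum exI[of _ K]) auto
    moreover have "?\<phi> x = 0" if "x \<notin> K" for x using out[OF that] by simp
    moreover have "norm (?\<phi> x) \<le> 1" for x
    proof -
      have "norm (pw_prod (q m) z x) \<le> bump1 1 2 (2 ^ m * x $ i0)" for m
      proof -
        have nn: "0 \<le> q m i t \<and> q m i t \<le> 1" for i t using bq[of m] by (simp add: bump_family_def)
        have "norm (pw_prod (q m) z x) = (\<Prod>i\<in>UNIV. norm (pw (\<lambda>t. complex_of_real (q m i t)) z (x $ i)))"
          by (simp add: pw_prod_def prod_norm)
        also have "\<dots> \<le> (\<Prod>i\<in>UNIV. q m i (x $ i))"
        proof (rule prod_mono)
          fix i
          show "0 \<le> norm (pw (\<lambda>t. complex_of_real (q m i t)) z (x $ i)) \<and> norm (pw (\<lambda>t. complex_of_real (q m i t)) z (x $ i)) \<le> q m i (x $ i)"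
            using norm_pw_le[OF z_def, of "q m i" "x $ i"] nn[of i "x $ i"] by simp
        qed
        also have "\<dots> = q m i0 (x $ i0) * (\<Prod>i\<in>UNIV - {i0}. q m i (x $ i))" by (simp add: prod.remove[of UNIV i0])
        also have "\<dots> \<le> q m i0 (x $ i0) * 1" using nn by (intro mult_left_mono prod_le_1) auto
        finally show ?thesis by (simp add: q_def dyadic_bump_def)
      qed
      then have "norm (?\<phi> x) \<le> (\<Sum>m<N. bump1 1 2 (2 ^ m * x $ i0))" by (intro sum_norm_le) auto
      then show ?thesis using sum_dyadic_bump_le_1 order_trans by blast
    qed
    ultimately have "norm (riesz k \<mu> ?\<phi>) \<le> C * 1" by (rule C)
    moreover have "riesz k \<mu> ?\<phi> = rcoef CARD('n) k \<mu> * complex_of_real (\<Sum>m<N. \<integral>x. bump_density k \<beta> (q m) x \<partial>lborel)"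
      using master_functional_sum[OF riesz_master_functional[OF k, of \<mu>], of "{..<N}" "\<lambda>m. pw_prod (q m) z"]
        test_function_imp_orthant_test[OF test_function_pw_prod[OF bq]] val(2)
      by (simp add: sum_distrib_left)
    moreover have "real N * p \<le> (\<Sum>m<N. \<integral>x. bump_density k \<beta> (q m) x \<partial>lborel)"
      using sum_mono[of "{..<N}" "\<lambda>_. p" "\<lambda>m. \<integral>x. bump_density k \<beta> (q m) x \<partial>lborel"] p(2) by simp
    moreover have "0 \<le> real N * p" using p(1) by simp
    ultimately have "norm (rcoef CARD('n) k \<mu>) * (\<Sum>m<N. \<integral>x. bump_density k \<beta> (q m) x \<partial>lborel) \<le> C"
      by (simp add: norm_mult del: of_real_sum)
    then show ?thesis using mult_left_mono[OF \<open>real N * p \<le> _\<close>, of "norm (rcoef CARD('n) k \<mu>)"] by simp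
  qed
  define w where "w = norm (rcoef CARD('n) k \<mu>) * p"
  have w: "0 < w" using rc p(1) by (simp add: w_def)
  obtain N where "C / w < real N" using reals_Archimedean2 by blast
  then have "C < real N * w" using w by (simp add: field_simps)
  then show False using bound[of N] by (simp add: w_def mult_ac)
qed

text \<open>Zeros of the coefficient are poles of the Gamma factors, that is \<mu> = k j - m. Such a
  \<mu> is real, and homogeneity has already excluded negative values.\<close>

lemma complex_measure_imp_exceptional:
  assumes k: "0 < k" and u: "is_complex_measure_dist (riesz k \<mu> :: (real^'n::finite \<Rightarrow> complex) \<Rightarrow> complex)"
  shows "mu0 CARD('n) k < Re \<mu> \<or> \<mu> \<in> complex_of_real ` exceptional_set CARD('n) k"
proof (cases "mu0 CARD('n) k < Re \<mu>")
  case False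
  then have "rcoef CARD('n) k \<mu> = 0" using complex_measure_imp_rcoef_0[OF k u] by simp
  moreover have "0 < d_n CARD('n) k" unfolding d_n_def using k by (intro prod_pos) (auto intro!: divide_pos_pos Gamma_real_pos add_pos_nonneg)
  ultimately have "(\<Prod>j<CARD('n). rGamma (\<mu> - of_real k * of_nat j)) = 0" by (simp add: rcoef_def)
  then obtain j where j: "j < CARD('n)" "rGamma (\<mu> - of_real k * of_nat j) = 0" by auto
  then obtain m where "\<mu> - of_real k * of_nat j = - of_nat m" by (auto simp: rGamma_eq_zero_iff elim!: nonpos_Ints_cases')
  then have \<mu>: "\<mu> = complex_of_real (k * real j - real m)" by (simp add: algebra_simps)
  then have "0 \<le> k * real j - real m" using complex_measure_imp_nonneg[OF k, of "k * real j - real m"] u by simp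
  then have "k * real j - real m \<in> exceptional_set CARD('n) k" using j(1) by (auto simp: exceptional_set_def)
  then show ?thesis using \<mu> by blast
qed simp

subsection \<open>Positive Riesz distributions have a Wallach index\<close>

lemma positive_imp_complex_measure:
  assumes "is_positive_measure_dist u" shows "is_complex_measure_dist u"
proof -
  obtain M where M: "sets M = sets borel" "\<And>K. compact K \<Longrightarrow> emeasure M K < \<infinity>"
    "\<And>\<phi>. test_function \<phi> \<Longrightarrow> integrable M \<phi> \<and> u \<phi> = (\<integral>x. \<phi> x \<partial>M)"
    using assms unfolding is_positive_measure_dist_def by blast
  show ?thesis unfolding is_complex_measure_dist_def
    by (intro exI[of _ M] exI[of _ "\<lambda>_. 1"]) (use M in auto)
qed

text \<open>Vanishing on test functions that are 0 on the open orthant becomes a statement about the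
  measure: nonnegative test functions that are positive exactly at the points of an open cube with
  x_i < 0 have integral 0, and countably many of them exhaust the complement.\<close>

lemma positive_dist_supported_on_orthant:
  fixes u :: "(real^'n::finite \<Rightarrow> complex) \<Rightarrow> complex" and M :: "(real^'n) measure"
  assumes M: "sets M = sets borel"
    "\<And>\<phi>. test_function \<phi> \<Longrightarrow> integrable M \<phi> \<and> u \<phi> = (\<integral>x. \<phi> x \<partial>M)"
    and u: "\<And>\<phi>. test_function \<phi> \<Longrightarrow> (\<And>x. x \<in> positive_orthant \<Longrightarrow> \<phi> x = 0) \<Longrightarrow> u \<phi> = 0"
  shows "AE x in M. \<forall>i. 0 \<le> x $ i"
proof -
  define \<phi> where "\<phi> R i x = complex_of_real (flat_fun 0 (- (x $ i))) * (\<Prod>j\<in>UNIV. complex_of_real (bump1 (- R) R (x $ j)))" for R :: real and i :: 'n and x :: "real^'n"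
  define \<psi> where "\<psi> R i x = flat_fun 0 (- (x $ i)) * (\<Prod>j\<in>UNIV. bump1 (- R) R (x $ j))" for R :: real and i :: 'n and x :: "real^'n"
  have \<phi>: "\<phi> R i x = complex_of_real (\<psi> R i x)" for R i x by (simp add: \<phi>_def \<psi>_def)
  have "AE x in M. \<psi> (real N) i x = 0" for N i
  proof -
    let ?R = "real N"
    have "smooth1 (\<lambda>t. complex_of_real (flat_fun 0 (- t)))" using smooth1_affine[OF smooth1_flat_fun[of 0], of "-1" 0] by simp
    then have "smooth_fun (\<phi> ?R i)" unfolding \<phi>_def[abs_def]
      by (intro smooth_fun_mult smooth_fun_prod smooth_fun_coord1 smooth1_bump1)
    moreover have "\<phi> ?R i x = 0" if "x \<notin> cbox (\<chi> i. - ?R) (\<chi> i. ?R)" for x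
    proof -
      have "\<exists>j. x $ j < - ?R \<or> ?R < x $ j" using that by (auto simp: mem_box_cart not_le)
      then obtain j where "x $ j < - ?R \<or> ?R < x $ j" by blast
      then have "bump1 (- ?R) ?R (x $ j) = 0" by (intro bump1_eq_0) auto
      then have "(\<Prod>j\<in>UNIV. bump1 (- ?R) ?R (x $ j)) = 0" by (intro prod_zero) auto
      then show ?thesis by (simp only: \<phi> \<psi>_def mult_zero_right of_real_0)
    qed
    ultimately have t: "test_function (\<phi> ?R i)" unfolding test_function_def using compact_cbox by blast
    have "u (\<phi> ?R i) = 0"
    proof (rule u[OF t])
      fix x :: "real^'n" assume "x \<in> positive_orthant"
      then have "0 < x $ i" by (simp add: positive_orthant_def)
      then show "\<phi> ?R i x = 0" by (simp add: \<phi>_def flat_fun_def)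
    qed
    then have "(\<integral>x. complex_of_real (\<psi> ?R i x) \<partial>M) = 0" "integrable M (\<lambda>x. complex_of_real (\<psi> ?R i x))"
      using M(2)[OF t] by (simp_all add: \<phi>[abs_def])
    then have "(\<integral>x. \<psi> ?R i x \<partial>M) = 0" "integrable M (\<psi> ?R i)"
      by (simp_all add: complex_of_real_integrable_eq)
    moreover have "0 \<le> \<psi> ?R i x" for x
      unfolding \<psi>_def by (intro mult_nonneg_nonneg prod_nonneg flat_fun_nonneg) (auto simp: bump1_nonneg)
    ultimately show ?thesis using integral_nonneg_eq_0_iff_AE[of M "\<psi> ?R i"] by auto
  qed
  then have "AE x in M. \<forall>N i. \<psi> (real N) i x = 0" by (simp add: AE_all_countable)
  then show ?thesis
  proof (rule eventually_mono)
    fix x :: "real^'n" assume x: "\<forall>N i. \<psi> (real N) i x = 0"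
    show "\<forall>i. 0 \<le> x $ i"
    proof (rule ccontr)
      assume "\<not> (\<forall>i. 0 \<le> x $ i)"
      then obtain i where i: "x $ i < 0" by (auto simp: not_le)
      obtain N :: nat where N: "Max (range (\<lambda>j. \<bar>x $ j\<bar>)) < real N" using reals_Archimedean2 by blast
      have "\<bar>x $ j\<bar> < real N" for j using N Max_ge[of "range (\<lambda>j. \<bar>x $ j\<bar>)" "\<bar>x $ j\<bar>"] by simp
      then have "- real N < x $ j \<and> x $ j < real N" for j using abs_less_iff[of "x $ j" "real N"] by (simp add: minus_less_iff)
      then have "0 < bump1 (- real N) (real N) (x $ j)" for j by (simp add: bump1_pos_iff)
      then have "0 < (\<Prod>j\<in>UNIV. bump1 (- real N) (real N) (x $ j))" by (intro prod_pos) auto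
      moreover have "0 < flat_fun 0 (- (x $ i))" using i by (simp add: flat_fun_def)
      ultimately have "0 < \<psi> (real N) i x" unfolding \<psi>_def by (rule mult_pos_pos[rotated])
      then show False using x by simp
    qed
  qed
qed

lemma riesz_eq_0:
  fixes \<phi> :: "real^'n::finite \<Rightarrow> complex"
  assumes *: "\<And>x. x \<in> positive_orthant \<Longrightarrow> \<phi> x = 0" and k: "0 < k"
  shows "riesz k \<mu> \<phi> = 0"
proof -
  have "riesz k \<mu> \<phi> = riesz k \<mu> (\<lambda>x::real^'n. 0 * 0)" by (rule riesz_cong) (simp add: *)
  also have "\<dots> = 0 * riesz k \<mu> (\<lambda>x::real^'n. 0)"
    by (rule master_functional_cmult[OF riesz_master_functional[OF k] orthant_test_0])
  finally show ?thesis by simp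
qed

text \<open>The representing measure lives on the closed orthant, where the monomial, the radial
  factor and the cut-off are all nonnegative.\<close>

lemma positive_riesz_mon_nonneg:
  assumes k: "0 < k" and G: "cm_seq G"
    and u: "is_positive_measure_dist (riesz k \<mu> :: (real^'n::finite \<Rightarrow> complex) \<Rightarrow> complex)"
  shows "\<exists>r\<ge>0. riesz k \<mu> (\<lambda>x::real^'n. mon B x * complex_of_real (G j (p1 x))) = complex_of_real r"
proof -
  obtain M where M: "sets M = sets borel"
    "\<And>\<phi>. test_function \<phi> \<Longrightarrow> integrable M \<phi> \<and> riesz k \<mu> \<phi> = (\<integral>x. \<phi> x \<partial>(M :: (real^'n) measure))"
    using u unfolding is_positive_measure_dist_def by blast
  have ae: "AE x in M. \<forall>i. 0 \<le> x $ i"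
    by (rule positive_dist_supported_on_orthant[OF M]) (auto intro: riesz_eq_0[OF _ k])
  obtain ct :: "real^'n \<Rightarrow> real" where ct:
    "\<And>f C. \<lbrakk>smooth_fun f; \<And>x. C \<le> p1 x \<Longrightarrow> f x = 0\<rbrakk> \<Longrightarrow> test_function (\<lambda>x. f x * complex_of_real (ct x))"
    "\<And>x. (\<And>i. 0 \<le> x $ i) \<Longrightarrow> ct x = 1" "\<And>x. 0 \<le> ct x" "\<And>x. ct x \<le> 1"
    using orthant_cutoff[where 'n='n] unfolding is_cutoff_def by blast
  define g where "g x = (\<Prod>l\<in>B. x $ l) * G j (p1 x) * ct x" for x :: "real^'n"
  let ?f = "\<lambda>x::real^'n. mon B x * complex_of_real (G j (p1 x))"
  have gf: "?f x * complex_of_real (ct x) = complex_of_real (g x)" for x by (simp add: g_def mon_def)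
  have t: "test_function (\<lambda>x. ?f x * complex_of_real (ct x))"
    by (rule ct(1)[where C=2])
       (use G in \<open>auto simp: cm_seq_def intro!: smooth_fun_mult smooth_fun_mon smooth_fun_p1[where H="\<lambda>t. complex_of_real (G j t)"]\<close>)
  have "riesz k \<mu> ?f = riesz k \<mu> (\<lambda>x. ?f x * complex_of_real (ct x))"
    by (rule riesz_cong) (simp add: ct(2) positive_orthant_def less_imp_le)
  also have "\<dots> = (\<integral>x. complex_of_real (g x) \<partial>M)" using M(2)[OF t] by (simp add: gf)
  also have "\<dots> = complex_of_real (\<integral>x. g x \<partial>M)" by (rule integral_complex_of_real)
  finally have "riesz k \<mu> ?f = complex_of_real (\<integral>x. g x \<partial>M)" .
  moreover have "0 \<le> (\<integral>x. g x \<partial>M)"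
  proof (rule integral_nonneg_AE, rule eventually_mono[OF ae])
    fix x :: "real^'n" assume "\<forall>i. 0 \<le> x $ i"
    then show "0 \<le> g x" unfolding g_def using G ct(3) by (intro mult_nonneg_nonneg prod_nonneg) (auto simp: cm_seq_def)
  qed
  ultimately show ?thesis by blast
qed

text \<open>In R(x_i G_0) = \<mu> R(G_1) both values of R are real, so \<mu> is real unless R(G_1) =
  0. In that case the positive measure would vanish where p1 < 2 in the orthant, and after a
  dilation on the support of a bump whose value is nonzero.\<close>

lemma positive_riesz_real:
  assumes k: "0 < k" and \<mu>: "mu0 CARD('n) k < Re \<mu>"
    and u: "is_positive_measure_dist (riesz k \<mu> :: (real^'n::finite \<Rightarrow> complex) \<Rightarrow> complex)"
  shows "Im \<mu> = 0"
proof -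
  obtain G where G: "cm_seq G" using cm_seq_exists by blast
  let ?R = "riesz k \<mu> :: (real^'n \<Rightarrow> complex) \<Rightarrow> complex"
  note MF = riesz_master_functional[OF k, of \<mu>, where 'n='n]
  have main: "?R (\<lambda>x. complex_of_real (G (Suc 0) (p1 x))) \<noteq> 0"
  proof
    assume R0: "?R (\<lambda>x. complex_of_real (G (Suc 0) (p1 x))) = 0"
    obtain M where M: "sets M = sets borel"
      "\<And>\<phi>. test_function \<phi> \<Longrightarrow> integrable M \<phi> \<and> ?R \<phi> = (\<integral>x. \<phi> x \<partial>(M :: (real^'n) measure))"
      using u unfolding is_positive_measure_dist_def by blast
    obtain ct :: "real^'n \<Rightarrow> real" where ct:
      "\<And>f C. \<lbrakk>smooth_fun f; \<And>x. C \<le> p1 x \<Longrightarrow> f x = 0\<rbrakk> \<Longrightarrow> test_function (\<lambda>x. f x * complex_of_real (ct x))"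
      "\<And>x. (\<And>i. 0 \<le> x $ i) \<Longrightarrow> ct x = 1" "\<And>x. 0 \<le> ct x" "\<And>x. ct x \<le> 1"
      using orthant_cutoff[where 'n='n] unfolding is_cutoff_def by blast
    obtain h :: "'n \<Rightarrow> nat" where "bij_betw h UNIV {0..<CARD('n)}"
      using ex_bij_betw_finite_nat[of "UNIV :: 'n set"] by auto
    then have h: "inj h" by (simp add: bij_betw_def)
    \<comment> \<open>Intervals at mutual distance at least 1 keep the coordinates distinct on the
      support, so the density is positive there.\<close>
    define q where "q i t = bump1 (2 * real (h i) + 3) (2 * real (h i) + 4) t" for i t
    define z where "z = - \<i> * complex_of_real (Im \<mu>)"
    have bq: "bump_family q" unfolding bump_family_def
    proof (intro allI conjI)
      fix i t
      show "smooth1 (\<lambda>t. complex_of_real (q i t))" by (simp add: q_def smooth1_bump1)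
      show "0 \<le> q i t" "q i t \<le> 1" by (simp_all add: q_def bump1_nonneg bump1_le_1)
      show "\<exists>l>0. \<forall>t<l. q i t = 0" by (rule exI[of _ 3]) (auto simp: q_def intro!: bump1_eq_0)
      show "\<exists>u. \<forall>t\<ge>u. q i t = 0" by (rule exI[of _ "2 * real (h i) + 4"]) (auto simp: q_def intro!: bump1_eq_0)
    qed
    define \<beta> where "\<beta> = Re \<mu> - mu0 CARD('n) k"
    note val = riesz_pw_prod_value[OF k bq, of \<mu>, folded \<beta>_def z_def]
    have dpos: "0 \<le> bump_density k \<beta> q x" for x
      unfolding bump_density_def q_def by (intro mult_nonneg_nonneg prod_nonneg vand_nonneg) (auto simp: bump1_nonneg)
    have "(\<integral>x. bump_density k \<beta> q x \<partial>lborel) \<noteq> 0"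
    proof
      assume "(\<integral>x. bump_density k \<beta> q x \<partial>lborel) = 0"
      then have ae: "AE x in lborel. bump_density k \<beta> q x = 0"
        using integral_nonneg_eq_0_iff_AE[OF val(1)] dpos by auto
      define U where "U = box (\<chi> i. 2 * real (h i) + 3) (\<chi> i. 2 * real (h i) + 4)"
      have U: "0 < bump_density k \<beta> q x" if "x \<in> U" for x
      proof -
        have x: "2 * real (h i) + 3 < x $ i \<and> x $ i < 2 * real (h i) + 4" for i using that by (auto simp: U_def mem_box_cart)
        have xp: "0 < x $ i" for i using x[of i] by linarith
        have ne: "x $ l \<noteq> x $ m" if "l \<noteq> m" for l m
        proof -
          have "h l \<noteq> h m" using h that by (auto simp: inj_def)
          then have "real (h l) + 1 \<le> real (h m) \<or> real (h m) + 1 \<le> real (h l)" by linarith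
          then show ?thesis using x[of l] x[of m] by linarith
        qed
        have "0 < vand UNIV k 0 x" unfolding vand_def using ne by (intro prod_pos) auto
        moreover have "0 < (\<Prod>i\<in>UNIV. q i (x $ i) * x $ i powr (\<beta> - 1))"
          using x xp by (intro prod_pos ballI mult_pos_pos) (auto simp: q_def bump1_pos_iff less_imp_neq[symmetric])
        ultimately show ?thesis using xp by (simp add: bump_density_def positive_orthant_def)
      qed
      have "x \<notin> U" if "bump_density k \<beta> q x = 0" for x using U[of x] that by auto
      then have "AE x in lborel. x \<notin> U" using ae by (auto elim!: eventually_mono)
      then have "U \<in> null_sets lborel" by (subst AE_iff_null_sets) (auto simp: U_def)
      then have "negligible U" by (simp add: negligible_iff_null_sets null_sets_completionI)
      moreover have "open U" "(\<chi> i. 2 * real (h i) + 7/2) \<in> U" by (auto simp: U_def mem_box_cart)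
      ultimately show False using open_not_negligible[of U] by auto
    qed
    moreover have "rcoef CARD('n) k \<mu> \<noteq> 0"
    proof -
      have "rGamma (\<mu> - of_real k * of_nat j) \<noteq> 0" if "j < CARD('n)" for j
      proof
        assume "rGamma (\<mu> - of_real k * of_nat j) = 0"
        then obtain m where "\<mu> - of_real k * of_nat j = - of_nat m" by (auto simp: rGamma_eq_zero_iff elim!: nonpos_Ints_cases')
        then have "\<mu> = complex_of_real (k * real j - real m)" by (simp add: algebra_simps)
        moreover have "k * real j \<le> k * (real CARD('n) - 1)" using that k by (intro mult_left_mono) auto
        ultimately show False using \<mu> by (simp add: mu0_def)
      qed
      moreover have "0 < d_n CARD('n) k" unfolding d_n_def using k by (intro prod_pos) (auto intro!: divide_pos_pos Gamma_real_pos add_pos_nonneg)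
      ultimately show ?thesis by (simp add: rcoef_def)
    qed
    ultimately have ne: "?R (pw_prod q z) \<noteq> 0" using val(2) by simp
    \<comment> \<open>On the support of the bump p1 is at most U - 1, so the dilation by 1 / U
      brings it into p1 < 2, where the radial cut-off is positive.\<close>
    define U where "U = real CARD('n) * (2 * Max (range (\<lambda>i. real (h i))) + 4) + 1"
    have Mx: "real (h i) \<le> Max (range (\<lambda>i. real (h i)))" for i by (intro Max_ge) auto
    have U0: "0 < U"
    proof -
      have "0 \<le> Max (range (\<lambda>i. real (h i)))" using Mx[of undefined] by (meson of_nat_0_le_iff order_trans)
      then show ?thesis by (simp add: U_def add_nonneg_pos)
    qed
    define c where "c = 1 / U"
    have c: "0 < c" using U0 by (simp add: c_def)
    define H where "H x = G (Suc 0) (p1 (c *\<^sub>R x))" for x :: "real^'n"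
    have Hs: "smooth_fun (\<lambda>x. complex_of_real (H x))" unfolding H_def
      using smooth_fun_scale[OF orthant_test_smooth[OF orthant_test_cm[OF G, of "Suc 0"]], of c] .
    have pc: "p1 (c *\<^sub>R x) = c * p1 x" for x :: "real^'n" by (simp add: p1_def sum_distrib_left)
    have Hv: "complex_of_real (H x) = 0" if "2 / c \<le> p1 x" for x
      using that c G by (simp add: H_def pc cm_seq_def field_simps)
    have tH: "test_function (\<lambda>x. complex_of_real (H x) * complex_of_real (ct x))" by (rule ct(1)[OF Hs Hv])
    have "?R (\<lambda>x. complex_of_real (H x) * complex_of_real (ct x)) = ?R (\<lambda>x. complex_of_real (H x))"
      by (rule riesz_cong) (simp add: ct(2) positive_orthant_def less_imp_le)
    also have "\<dots> = 0"
      unfolding H_def riesz_scale[OF k c orthant_test_cm[OF G]] R0 by simp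
    finally have "(\<integral>x. complex_of_real (H x * ct x) \<partial>M) = 0" "integrable M (\<lambda>x. complex_of_real (H x * ct x))"
      using M(2)[OF tH] by simp_all
    then have "(\<integral>x. H x * ct x \<partial>M) = 0" "integrable M (\<lambda>x. H x * ct x)"
      by (simp_all add: complex_of_real_integrable_eq del: of_real_mult)
    moreover have "0 \<le> H x * ct x" for x using G ct(3) by (simp add: H_def cm_seq_def)
    ultimately have ae: "AE x in M. H x * ct x = 0" using integral_nonneg_eq_0_iff_AE[of M "\<lambda>x. H x * ct x"] by auto
    have "pw_prod q z x = 0" if "H x * ct x = 0" for x
    proof (rule ccontr)
      assume nz: "pw_prod q z x \<noteq> 0"
      have x: "0 < x $ i \<and> x $ i < 2 * real (h i) + 4" for i
      proof -
        have "pw (\<lambda>t. complex_of_real (q i t)) z (x $ i) \<noteq> 0" using nz by (auto simp: pw_prod_def)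
        then have "0 < x $ i" "q i (x $ i) \<noteq> 0" by (auto simp: pw_def split: if_splits)
        then show ?thesis using bump1_eq_0[of "x $ i"] by (force simp: q_def not_le)
      qed
      then have "ct x = 1" by (intro ct(2)) (simp add: less_imp_le)
      moreover have "p1 x < 2 * U"
      proof -
        have "x $ i \<le> 2 * Max (range (\<lambda>i. real (h i))) + 4" for i using x[of i] Mx[of i] by linarith
        then have "p1 x \<le> (\<Sum>i\<in>(UNIV::'n set). 2 * Max (range (\<lambda>i. real (h i))) + 4)" unfolding p1_def by (intro sum_mono)
        then have "p1 x \<le> U - 1" by (simp add: U_def)
        then show ?thesis using U0 by linarith
      qed
      then have "p1 (c *\<^sub>R x) < 2" unfolding pc using U0 by (simp add: c_def field_simps)
      then have "0 < H x" using G by (simp add: H_def cm_seq_def)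
      ultimately show False using that by simp
    qed
    then have "AE x in M. pw_prod q z x = 0" using ae by (auto elim!: eventually_mono)
    then have "(\<integral>x. pw_prod q z x \<partial>M) = 0" by (rule integral_eq_zero_AE)
    then show False using ne M(2)[OF test_function_pw_prod[OF bq]] by simp
  qed
  obtain i :: 'n where True by blast
  obtain r where r: "?R (\<lambda>x. mon {i} x * complex_of_real (G 0 (p1 x))) = complex_of_real r"
    using positive_riesz_mon_nonneg[OF k G u, of "{i}" 0] by auto
  obtain s where s: "?R (\<lambda>x. complex_of_real (G (Suc 0) (p1 x))) = complex_of_real s"
    using positive_riesz_mon_nonneg[OF k G u, of "{}" "Suc 0"] by auto
  have "complex_of_real r = \<mu> * complex_of_real s"
    using master_functional_mon_cm[OF MF G, of "{i}" 0] r s by simp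
  moreover have "s \<noteq> 0" using main s by auto
  ultimately have "\<mu> = complex_of_real (r / s)" by (simp add: field_simps)
  then show ?thesis by simp
qed

text \<open>An exceptional value outside the Wallach set lies strictly between k (j - 1) and k j. A
  squarefree monomial of degree j + 1 then has positive factors \<mu> - k i for i < j and the single
  negative factor \<mu> - k j, against the nonnegativity of its value.\<close>

lemma positive_imp_wallach:
  assumes k: "0 < k" and u: "is_positive_measure_dist (riesz k \<mu> :: (real^'n::finite \<Rightarrow> complex) \<Rightarrow> complex)"
  shows "\<mu> \<in> complex_of_real ` wallach_set CARD('n) k"
proof (cases "mu0 CARD('n) k < Re \<mu>")
  case True
  then have "\<mu> = complex_of_real (Re \<mu>)" using positive_riesz_real[OF k True u] by (simp add: complex_eq_iff)
  moreover have "Re \<mu> \<in> wallach_set CARD('n) k" using True by (simp add: wallach_set_def mu0_def)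
  ultimately show ?thesis by blast
next
  case False
  obtain t where t: "\<mu> = complex_of_real t" "t \<in> exceptional_set CARD('n) k"
    using complex_measure_imp_exceptional[OF k positive_imp_complex_measure[OF u]] False by blast
  have t0: "0 \<le> t" using t(2) by (simp add: exceptional_set_def)
  have tn: "t \<le> k * (real CARD('n) - 1)" using False t(1) by (simp add: mu0_def)
  show ?thesis
  proof (rule ccontr)
    assume "\<not> ?thesis"
    then have nw: "t \<noteq> k * real j" if "j < CARD('n)" for j
      using that t(1) by (auto simp: wallach_set_def)
    \<comment> \<open>The least j with t <= k j; it is below n since t <= k (n - 1), so a monomial
      of degree j + 1 exists.\<close>
    define j where "j = nat \<lceil>t / k\<rceil>"
    have c: "real j = real_of_int \<lceil>t / k\<rceil>" using k t0 by (simp add: j_def)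
    have "t / k \<le> real j" unfolding c by (rule le_of_int_ceiling)
    then have j1: "t \<le> k * real j" using k by (simp add: field_simps)
    have "real j - 1 < t / k" unfolding c using ceiling_correct[of "t / k"] by linarith
    then have j2: "k * (real j - 1) < t" using k by (simp add: field_simps)
    have jn: "j < CARD('n)"
    proof (rule ccontr)
      assume "\<not> j < CARD('n)"
      then have "k * (real CARD('n) - 1) \<le> k * (real j - 1)" using k by (intro mult_left_mono) auto
      then show False using j2 tn by linarith
    qed
    have jt: "t < k * real j" using j1 nw[OF jn] by simp
    obtain G where G: "cm_seq G" using cm_seq_exists by blast
    obtain J where J: "\<And>j. J \<le> j \<Longrightarrow> \<exists>r>0. riesz k (complex_of_real t) (\<lambda>x::real^'n. complex_of_real (G j (p1 x))) = complex_of_real r"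
      using riesz_cm_pos[OF k G, where 'n='n and \<mu>=t] by metis
    obtain B :: "'n set" where B: "card B = Suc j" using jn obtain_subset_with_card_n[of "Suc j" "UNIV :: 'n set"] by auto
    obtain r where r: "0 < r" "riesz k \<mu> (\<lambda>x::real^'n. complex_of_real (G (J + Suc j) (p1 x))) = complex_of_real r"
      using J[of "J + Suc j"] t(1) by auto
    obtain s where s: "0 \<le> s" "riesz k \<mu> (\<lambda>x::real^'n. mon B x * complex_of_real (G J (p1 x))) = complex_of_real s"
      using positive_riesz_mon_nonneg[OF k G u, of B J] by auto
    have "complex_of_real s = complex_of_real ((\<Prod>i<Suc j. t - k * real i) * r)"
      using master_functional_mon_cm[OF riesz_master_functional[OF k] G, of \<mu> B J] r s B t(1) by simp
    then have "s = (\<Prod>i<Suc j. t - k * real i) * r" by (simp only: of_real_eq_iff)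
    moreover have "(\<Prod>i<Suc j. t - k * real i) < 0"
    proof -
      have "0 < (\<Prod>i<j. t - k * real i)"
      proof (intro prod_pos ballI)
        fix i assume "i \<in> {..<j}"
        then have "k * real i \<le> k * (real j - 1)" using k by (intro mult_left_mono) auto
        then show "0 < t - k * real i" using j2 by linarith
      qed
      then show ?thesis using jt by (simp add: mult_pos_neg)
    qed
    ultimately have "s < 0" using mult_neg_pos[OF _ r(1)] by metis
    then show False using s(1) by simp
  qed
qed

subsection \<open>Measures on the faces\<close>

definition face_density :: "'n::finite set \<Rightarrow> real \<Rightarrow> real \<Rightarrow> real^'n \<Rightarrow> real" where
  "face_density A k b x = indicator positive_orthant x *
     ((\<Prod>i\<in>A. x $ i) powr (b - 1) * (\<Prod>i\<in>-A. indicator {..1} (x $ i)) * vand A k 0 x)"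

lemma face_density_nonneg: "0 \<le> face_density A k b x"
  by (auto simp: face_density_def indicator_def vand_nonneg intro!: mult_nonneg_nonneg prod_nonneg)

lemma of_real_face_density:
  "complex_of_real (face_density A k b x) = indicat_real positive_orthant x *\<^sub>R (complex_of_real (vand A k 0 x) * face_weight A (of_real b) x)"
proof (cases "x \<in> positive_orthant")
  case True
  then have "0 < (\<Prod>i\<in>A. x $ i)" by (auto simp: positive_orthant_def intro: prod_pos)
  then have "complex_of_real (\<Prod>i\<in>A. x $ i) powr (of_real b - 1) = complex_of_real ((\<Prod>i\<in>A. x $ i) powr (b - 1))"
    by (subst powr_of_real[symmetric]) auto
  then show ?thesis using True by (simp add: face_density_def face_weight_def mult_ac del: of_real_prod)
qed (simp add: face_density_def)

lemma face_density_measurable: "0 < k \<Longrightarrow> face_density A k b \<in> borel_measurable borel"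
proof -
  assume k: "0 < k"
  have [measurable]: "vand A k 0 \<in> borel_measurable borel"
    by (rule borel_measurable_continuous_onI[OF continuous_on_vand]) (use k in auto)
  show ?thesis unfolding face_density_def[abs_def] by measurable
qed

lemma fint_eq_face_density:
  "fint A k (of_real b) f = (\<integral>x. face_density A k b x *\<^sub>R f (face A x) \<partial>lborel)"
  unfolding fint_def gint_def set_lebesgue_integral_def
  by (intro Bochner_Integration.integral_cong refl)
     (simp add: of_real_face_density scaleR_conv_of_real vand_face mult_ac)

lemma face_density_integrable:
  fixes f :: "real^'n::finite \<Rightarrow> complex"
  assumes k: "0 < k" and b: "0 < b" and [measurable]: "f \<in> borel_measurable borel"
    and v: "vanishes_beyond B f" and S: "\<And>y. y \<in> simplex_set B \<Longrightarrow> norm (f y) \<le> S"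
  shows "integrable lborel (\<lambda>x. face_density A k b x *\<^sub>R f (face A x))"
proof -
  obtain T where T: "0 \<le> T" "\<And>y. y \<in> simplex_set B \<Longrightarrow> norm (complex_of_real (vand A k 0 y)) \<le> T"
    using bounded_on_simplex[OF continuous_on_of_real_vand[OF k order_refl], of B] by metis
  let ?f = "\<lambda>y. f y * complex_of_real (vand A k 0 y)"
  obtain G :: "real^'n \<Rightarrow> real" where G: "integrable lborel G" "\<And>x. 0 \<le> G x"
    "\<And>b' f S x. \<lbrakk>b \<le> Re b'; Re b' \<le> b; vanishes_beyond B f; \<And>y. y \<in> simplex_set B \<Longrightarrow> norm (f y) \<le> S; 0 \<le> S; x \<in> positive_orthant\<rbrakk>
       \<Longrightarrow> norm (f (face A x) * face_weight A b' x) \<le> S * G x"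
    using gint_dominated[OF b, of b B A] by metis
  have fd[measurable]: "face_density A k b \<in> borel_measurable borel" by (rule face_density_measurable[OF k])
  have eq: "face_density A k b x *\<^sub>R f (face A x) = indicat_real positive_orthant x *\<^sub>R (?f (face A x) * face_weight A (of_real b) x)" for x
    by (simp add: of_real_face_density scaleR_conv_of_real vand_face mult_ac)
  show ?thesis
  proof (rule Bochner_Integration.integrable_bound)
    show "integrable lborel (\<lambda>x. (max 0 S * T) * G x)" using G(1) by simp
    show "(\<lambda>x. face_density A k b x *\<^sub>R f (face A x)) \<in> borel_measurable lborel" by measurable
    have "norm (face_density A k b x *\<^sub>R f (face A x)) \<le> (max 0 S * T) * G x" for x
    proof (cases "x \<in> positive_orthant")
      case True
      have "norm (?f y) \<le> max 0 S * T" if "y \<in> simplex_set B" for y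
      proof -
        have "norm (f y) \<le> max 0 S" using S[OF that] by simp
        then show ?thesis unfolding norm_mult by (rule mult_mono[OF _ T(2)[OF that]]) simp_all
      qed
      moreover have "0 \<le> max 0 S * T" using T(1) by simp
      ultimately have "norm (?f (face A x) * face_weight A (of_real b) x) \<le> (max 0 S * T) * G x"
        by (intro G(3)[OF _ _ vanishes_beyond_mult'[OF v] _ _ True]) simp_all
      then show ?thesis using True unfolding eq by simp
    qed (use G(2) T(1) in \<open>simp add: eq\<close>)
    then show "AE x in lborel. norm (face_density A k b x *\<^sub>R f (face A x)) \<le> norm ((max 0 S * T) * G x)"
      using G(2) T(1) by simp
  qed
qed

text \<open>The image measures of several faces are summed in one construction: faces are indexed by
  a counting measure, the density is placed on the product with Lebesgue measure, and the face map
  pushes it forward.\<close>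

lemma finite_sum_of_faces_positive:
  fixes u :: "(real^'n::finite \<Rightarrow> complex) \<Rightarrow> complex"
  assumes k: "0 < k" and b: "0 < b" and c: "0 \<le> c"
    and u: "\<And>\<phi>. test_function \<phi> \<Longrightarrow> u \<phi> = complex_of_real c * (\<Sum>A\<in>\<A>. fint A k (of_real b) \<phi>)"
  shows "is_positive_measure_dist u"
proof -
  let ?P = "count_space \<A> \<Otimes>\<^sub>M (lborel :: (real^'n) measure)"
  let ?d = "\<lambda>(A, x). c * face_density A k b x"
  let ?F = "\<lambda>(A::'n set, x). face A x"
  interpret C: sigma_finite_measure "count_space \<A>" by (rule sigma_finite_measure_count_space_finite) simp
  interpret P: pair_sigma_finite "count_space \<A>" "lborel :: (real^'n) measure" ..
  have md: "?d \<in> borel_measurable ?P"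
    by (rule measurable_pair_measure_countable1) (auto intro!: countable_finite borel_measurable_times face_density_measurable k)
  have mF: "?F \<in> measurable ?P borel"
    by (rule measurable_pair_measure_countable1) (auto intro!: countable_finite)
  define M where "M = distr (density ?P (\<lambda>z. ennreal (?d z))) borel ?F"
  have int: "integrable M f \<and> (\<integral>x. f x \<partial>M) = complex_of_real c * (\<Sum>A\<in>\<A>. \<integral>x. face_density A k b x *\<^sub>R f (face A x) \<partial>lborel)"
    if fm: "f \<in> borel_measurable borel" and v: "vanishes_beyond B f" and S: "\<And>y. y \<in> simplex_set B \<Longrightarrow> norm (f y) \<le> S"
    for f :: "real^'n \<Rightarrow> complex" and B S
  proof -
    let ?h = "\<lambda>z. ?d z *\<^sub>R f (?F z)"
    have fF: "(\<lambda>z. f (?F z)) \<in> borel_measurable ?P" using measurable_compose[OF mF fm] by simp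
    have i1: "integrable lborel (\<lambda>x. c *\<^sub>R (face_density A k b x *\<^sub>R f (face A x)))" for A
      by (intro integrable_scaleR_right face_density_integrable[OF k b fm v S])
    have h: "integrable ?P ?h"
    proof (rule P.Fubini_integrable)
      show "?h \<in> borel_measurable ?P" using md fF by (rule borel_measurable_scaleR)
      show "integrable (count_space \<A>) (\<lambda>A. \<integral>x. norm (?h (A, x)) \<partial>lborel)"
        by (rule integrable_count_space) simp
      show "AE A in count_space \<A>. integrable lborel (\<lambda>x. ?h (A, x))" using i1 by simp
    qed
    have "integrable M f"
      unfolding M_def using h md mF fm fF c
      by (subst integrable_distr_eq) (auto simp: integrable_density face_density_nonneg split_beta)
    moreover have "(\<integral>x. f x \<partial>M) = (\<integral>z. ?h z \<partial>?P)"
      unfolding M_def using md mF fm fF c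
      by (subst integral_distr) (auto simp: integral_density face_density_nonneg split_beta)
    moreover have "(\<integral>z. ?h z \<partial>?P) = (\<integral>A. (\<integral>x. ?h (A, x) \<partial>lborel) \<partial>count_space \<A>)"
      by (subst P.integral_fst'[OF h]) (rule refl)
    moreover have "\<dots> = (\<Sum>A\<in>\<A>. \<integral>x. ?h (A, x) \<partial>lborel)" by (rule lebesgue_integral_count_space_finite) simp
    moreover have "(\<integral>x. ?h (A, x) \<partial>lborel) = complex_of_real c * (\<integral>x. face_density A k b x *\<^sub>R f (face A x) \<partial>lborel)" for A
    proof -
      have "(\<integral>x. ?h (A, x) \<partial>lborel) = (\<integral>x. c *\<^sub>R (face_density A k b x *\<^sub>R f (face A x)) \<partial>lborel)" by simp
      also have "\<dots> = c *\<^sub>R (\<integral>x. face_density A k b x *\<^sub>R f (face A x) \<partial>lborel)" by (rule integral_scaleR_right)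
      finally show ?thesis by (simp add: scaleR_conv_of_real)
    qed
    ultimately show ?thesis by (simp add: sum_distrib_left)
  qed
  show ?thesis unfolding is_positive_measure_dist_def
  proof (intro exI[of _ M] conjI allI impI)
    show "sets M = sets borel" by (simp add: M_def)
  next
    fix K :: "(real^'n) set" assume K: "compact K"
    have "compact (p1 ` K)" by (intro compact_continuous_image K continuous_intros)
    then obtain B where B: "\<And>x. x \<in> K \<Longrightarrow> norm (p1 x) \<le> B" using compact_imp_bounded bounded_iff by (metis imageI)
    have Kb: "K \<in> sets borel" by (rule borel_compact[OF K])
    \<comment> \<open>Local finiteness comes from the same integral formula, applied to the bounded
      indicator of \<open>K\<close>.\<close>
    let ?f = "\<lambda>x. complex_of_real (indicator K x)"
    have "vanishes_beyond (B + 1) ?f" unfolding vanishes_beyond_def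
    proof (intro allI impI)
      fix x :: "real^'n" assume "(\<forall>i. 0 \<le> x $ i) \<and> B + 1 \<le> p1 x"
      then have "x \<notin> K" using B[of x] by auto
      then show "?f x = 0" by simp
    qed
    then have "integrable M ?f"
      using int[of ?f "B + 1" 1] Kb by (auto simp: indicator_def)
    then have "integrable M (indicat_real K)" by (simp add: complex_of_real_integrable_eq)
    moreover have "K \<in> sets M" using Kb by (simp add: M_def)
    ultimately show "emeasure M K < \<infinity>" by (simp add: integrable_indicator_iff M_def)
  next
    fix \<phi> :: "real^'n \<Rightarrow> complex" assume t: "test_function \<phi>"
    have ot: "orthant_test \<phi>" by (rule test_function_imp_orthant_test[OF t])
    obtain B where B: "vanishes_beyond B \<phi>" using ot by (auto simp: orthant_test_def)
    have ct: "continuous_on UNIV \<phi>" by (rule smooth_fun_continuous[OF orthant_test_smooth[OF ot]])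
    obtain S where S: "\<And>x. x \<in> simplex_set B \<Longrightarrow> norm (\<phi> x) \<le> S" using bounded_on_simplex[OF ct] by metis
    have *: "integrable M \<phi> \<and> (\<integral>x. \<phi> x \<partial>M) = complex_of_real c * (\<Sum>A\<in>\<A>. \<integral>x. face_density A k b x *\<^sub>R \<phi> (face A x) \<partial>lborel)"
      by (rule int[OF borel_measurable_continuous_onI[OF ct] B S])
    show "integrable M \<phi>" "u \<phi> = (\<integral>x. \<phi> x \<partial>M)" using * u[OF t] by (simp_all add: fint_eq_face_density)
  qed
qed

subsection \<open>The lower-dimensional Riesz measures\<close>

text \<open>For r = 0 only the empty face remains and the functional is evaluation at the origin, as
  the dummy variables have mass one. The exponent k (n - r + 1) is the one for which the
  contributions of different faces match in the master equation.\<close>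

definition face_functional :: "real \<Rightarrow> nat \<Rightarrow> (real^'n::finite \<Rightarrow> complex) \<Rightarrow> complex" where
  "face_functional k r f = (\<Sum>A | card A = r. fint A k (of_real (k * (real CARD('n) - real r + 1))) f)"

lemma fint_sum:
  assumes "0 < k" "0 < Re b" "finite J" "\<And>j. j \<in> J \<Longrightarrow> orthant_test (f j)"
  shows "fint A k b (\<lambda>x. \<Sum>j\<in>J. f j x) = (\<Sum>j\<in>J. fint A k b (f j))"
  using assms(3,4)
proof (induction J)
  case empty
  show ?case using fint_cmult[of A k b 0 "\<lambda>x. 0"] by simp
next
  case (insert a J)
  then show ?case using assms(1,2) by (simp add: fint_add orthant_test_sum)
qed

text \<open>Exchanging i and j turns a face missing i, with a chosen j in it, into a face containing
  i, with j outside it, and back. Each face containing i is therefore reached n - r times.\<close>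

lemma face_sum_exchange:
  fixes F :: "'n::finite set \<Rightarrow> complex"
  shows "(\<Sum>A | card A = r \<and> i \<notin> A. \<Sum>j\<in>A. F (Transposition.transpose i j -` A))
       = (\<Sum>A | card A = r \<and> i \<in> A. of_nat (CARD('n) - r) * F A)"
proof -
  let ?t = "\<lambda>j. Transposition.transpose i j"
  have card_t: "card (?t j -` A) = card A" for j and A :: "'n set"
    by (rule card_vimage_inj) (auto simp: bij_transpose bij_is_inj bij_is_surj)
  have tt: "?t j -` (?t j -` A) = A" for j and A :: "'n set" by (auto simp: vimage_def)
  have "(\<Sum>A | card A = r \<and> i \<notin> A. \<Sum>j\<in>A. F (?t j -` A)) = (\<Sum>(A, j)\<in>Sigma {A. card A = r \<and> i \<notin> A} (\<lambda>A. A). F (?t j -` A))"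
    by (rule sum.Sigma) auto
  also have "\<dots> = (\<Sum>(A, j)\<in>Sigma {A. card A = r \<and> i \<in> A} (\<lambda>A. - A). F A)"
    by (rule sum.reindex_bij_witness[of _ "\<lambda>(A, j). (?t j -` A, j)" "\<lambda>(A, j). (?t j -` A, j)"])
       (auto simp: tt card_t)
  also have "\<dots> = (\<Sum>A | card A = r \<and> i \<in> A. \<Sum>j\<in>-A. F A)"
    by (rule sum.Sigma[symmetric]) auto
  also have "\<dots> = (\<Sum>A | card A = r \<and> i \<in> A. of_nat (CARD('n) - r) * F A)"
    by (intro sum.cong refl) (auto simp: Compl_eq_Diff_UNIV card_Diff_subset of_nat_diff)
  finally show ?thesis .
qed

text \<open>On a face containing \<open>i\<close> the integrated equation yields the factor -k n. On
  a face missing \<open>i\<close> the derivative term drops out and x_j \<open>ddiff i j f\<close>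
  is f o swap - f, which gives -k r and k times the exchanged faces. As these cover each face
  containing \<open>i\<close> n - r times, the balance -k n + k (n - r) = -k r is the same for both
  kinds.\<close>

lemma face_functional_master:
  assumes k: "0 < k" and r: "r < CARD('n)"
  shows "master_functional k (of_real (k * real r)) (face_functional k r :: (real^'n::finite \<Rightarrow> complex) \<Rightarrow> complex)"
  unfolding master_functional_def
proof (intro conjI allI impI)
  let ?b = "of_real (k * (real CARD('n) - real r + 1)) :: complex"
  have b: "0 < Re ?b" using k r by simp
  fix f :: "real^'n \<Rightarrow> complex" assume f: "orthant_test f"
  show "face_functional k r (\<lambda>x. f x + g x) = face_functional k r f + face_functional k r g" if g: "orthant_test g" for g
    unfolding face_functional_def by (simp only: fint_add[OF k b f g] sum.distrib)
  show "face_functional k r (\<lambda>x. c * f x) = c * face_functional k r f" for c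
    unfolding face_functional_def by (simp add: fint_cmult sum_distrib_left)
  fix i
  let ?g = "\<lambda>x. of_real (x $ i) * pdiff i f x + (\<Sum>j\<in>UNIV - {i}. of_real k * of_real (x $ j) * ddiff i j f x)"
  let ?F = "\<lambda>A. fint A k ?b f"
  have sf: "smooth_fun f" by (rule orthant_test_smooth[OF f])
  have in_face: "fint A k ?b ?g = - (of_real (k * real CARD('n)) * ?F A)" if A: "card A = r" "i \<in> A" for A
  proof -
    have "fint A k ?b ?g = fint A k ?b (\<lambda>x. of_real (x $ i) * pdiff i f x + (\<Sum>j\<in>A - {i}. of_real k * of_real (x $ j) * ddiff i j f x))"
    proof (rule fint_cong)
      fix x :: "real^'n"
      have "(\<Sum>j\<in>UNIV - {i}. of_real k * of_real (face A x $ j) * ddiff i j f (face A x)) = (\<Sum>j\<in>A - {i}. of_real k * of_real (face A x $ j) * ddiff i j f (face A x))"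
        by (intro sum.mono_neutral_right) auto
      then show "?g (face A x) = of_real (face A x $ i) * pdiff i f (face A x) + (\<Sum>j\<in>A - {i}. of_real k * of_real (face A x $ j) * ddiff i j f (face A x))"
        by simp
    qed
    moreover have "?b + of_real k * (of_nat (card A) - 1) = of_real (k * real CARD('n))" using A by (simp add: algebra_simps)
    ultimately show ?thesis using fint_master[OF A(2) k b f] by (simp add: add_eq_0_iff)
  qed
  have out_face: "fint A k ?b ?g = of_real k * (\<Sum>j\<in>A. ?F (Transposition.transpose i j -` A)) - of_real (k * real r) * ?F A"
    if A: "card A = r" "i \<notin> A" for A
  proof -
    have "fint A k ?b ?g = fint A k ?b (\<lambda>x. \<Sum>j\<in>A. of_real k * (f (swapv i j x) + (-1) * f x))"
    proof (rule fint_cong)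
      fix x :: "real^'n"
      let ?y = "face A x"
      have "(\<Sum>j\<in>UNIV - {i}. of_real k * of_real (?y $ j) * ddiff i j f ?y) = (\<Sum>j\<in>A. of_real k * of_real (?y $ j) * ddiff i j f ?y)"
        using A(2) by (intro sum.mono_neutral_right) auto
      also have "\<dots> = (\<Sum>j\<in>A. of_real k * (f (swapv i j ?y) + (-1) * f ?y))"
      proof (rule sum.cong)
        fix j assume j: "j \<in> A"
        then have "i \<noteq> j" using A(2) by auto
        from ddiff_eq[OF this sf, of ?y] have "of_real (?y $ j) * ddiff i j f ?y = f (swapv i j ?y) - f ?y"
          using A(2) by (simp add: algebra_simps)
        then show "of_real k * of_real (?y $ j) * ddiff i j f ?y = of_real k * (f (swapv i j ?y) + (-1) * f ?y)"
          by (simp only: mult.assoc) simp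
      qed simp
      finally show "?g ?y = (\<Sum>j\<in>A. of_real k * (f (swapv i j ?y) + (-1) * f ?y))" using A(2) by simp
    qed
    also have "\<dots> = (\<Sum>j\<in>A. fint A k ?b (\<lambda>x. of_real k * (f (swapv i j x) + (-1) * f x)))"
      by (rule fint_sum[OF k b], simp, intro orthant_test_cmult orthant_test_add orthant_test_permv bij_transpose f)
    also have "\<dots> = (\<Sum>j\<in>A. of_real k * (?F (Transposition.transpose i j -` A) + (-1) * ?F A))"
      by (simp only: fint_cmult fint_add[OF k b orthant_test_permv[OF bij_transpose f] orthant_test_cmult[OF f]]
            fint_permv[OF k bij_transpose f])
    also have "\<dots> = of_real k * (\<Sum>j\<in>A. ?F (Transposition.transpose i j -` A)) - of_real (k * real r) * ?F A"
      using A(1) by (simp add: sum_distrib_left[symmetric] sum_subtractf right_diff_distrib)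
    finally show ?thesis .
  qed
  have split: "(\<Sum>A | card A = r. h A) = (\<Sum>A | card A = r \<and> i \<in> A. h A) + (\<Sum>A | card A = r \<and> i \<notin> A. h A)" for h :: "'n set \<Rightarrow> complex"
  proof -
    have "{A. card A = r} = {A. card A = r \<and> i \<in> A} \<union> {A. card A = r \<and> i \<notin> A}" by auto
    then show ?thesis by (simp add: sum.union_disjoint[symmetric] Int_def conj_commute)
  qed
  have "face_functional k r ?g = (\<Sum>A | card A = r \<and> i \<in> A. fint A k ?b ?g) + (\<Sum>A | card A = r \<and> i \<notin> A. fint A k ?b ?g)"
    unfolding face_functional_def by (rule split)
  also have "(\<Sum>A | card A = r \<and> i \<in> A. fint A k ?b ?g) = (\<Sum>A | card A = r \<and> i \<in> A. - (of_real (k * real CARD('n)) * ?F A))"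
    by (rule sum.cong[OF refl], rule in_face) auto
  also have "(\<Sum>A | card A = r \<and> i \<notin> A. fint A k ?b ?g)
     = (\<Sum>A | card A = r \<and> i \<notin> A. of_real k * (\<Sum>j\<in>A. ?F (Transposition.transpose i j -` A)) - of_real (k * real r) * ?F A)"
    by (rule sum.cong[OF refl], rule out_face) auto
  also have "(\<Sum>A | card A = r \<and> i \<in> A. - (of_real (k * real CARD('n)) * ?F A)) + \<dots> = (\<Sum>A | card A = r \<and> i \<in> A. - (of_real (k * real CARD('n)) * ?F A))
     + (of_real k * (\<Sum>A | card A = r \<and> i \<notin> A. \<Sum>j\<in>A. ?F (Transposition.transpose i j -` A)) - of_real (k * real r) * (\<Sum>A | card A = r \<and> i \<notin> A. ?F A))"
    by (simp only: sum_subtractf sum_distrib_left)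
  also have "\<dots> = - (of_real (k * real r) * ((\<Sum>A | card A = r \<and> i \<in> A. ?F A) + (\<Sum>A | card A = r \<and> i \<notin> A. ?F A)))"
    unfolding face_sum_exchange[where r=r and i=i and F="?F"] sum_negf sum_distrib_left[symmetric]
    using r by (simp add: of_nat_diff algebra_simps)
  finally show "of_real (k * real r) * face_functional k r f + face_functional k r ?g = 0"
    unfolding face_functional_def split[of ?F] by simp
qed

subsection \<open>Uniqueness of solutions of the master equation\<close>

inductive poly_deg_le :: "nat \<Rightarrow> (real^'n::finite \<Rightarrow> complex) \<Rightarrow> bool" where
  poly_deg_le_const: "poly_deg_le d (\<lambda>x. c)"
| poly_deg_le_coord: "poly_deg_le d f \<Longrightarrow> poly_deg_le (Suc d) (\<lambda>x. of_real (x $ i) * f x)"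
| poly_deg_le_add: "poly_deg_le d f \<Longrightarrow> poly_deg_le d g \<Longrightarrow> poly_deg_le d (\<lambda>x. f x + g x)"

lemma smooth_fun_poly_deg_le: "poly_deg_le d f \<Longrightarrow> smooth_fun f"
  by (induction rule: poly_deg_le.induct) (intro smooth_fun_const smooth_fun_add smooth_fun_mult smooth_fun_coord; assumption)+

lemma poly_deg_le_Suc: "poly_deg_le d f \<Longrightarrow> poly_deg_le (Suc d) f"
  by (induction rule: poly_deg_le.induct) (auto intro: poly_deg_le.intros)

lemma poly_deg_le_cmult: "poly_deg_le d f \<Longrightarrow> poly_deg_le d (\<lambda>x. c * f x)"
proof (induction rule: poly_deg_le.induct)
  case (poly_deg_le_coord d f i)
  then show ?case using poly_deg_le.poly_deg_le_coord[of d "\<lambda>x. c * f x" i] by (simp add: mult.left_commute)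
next
  case (poly_deg_le_add d f g)
  then show ?case using poly_deg_le.poly_deg_le_add by (simp add: distrib_left)
qed (rule poly_deg_le.poly_deg_le_const)

lemma poly_deg_le_sum: "(\<And>a. a \<in> A \<Longrightarrow> poly_deg_le d (f a)) \<Longrightarrow> poly_deg_le d (\<lambda>x. \<Sum>a\<in>A. f a x)"
  by (induction A rule: infinite_finite_induct) (auto intro: poly_deg_le.intros)

text \<open>The coordinate in front restores the degree lost by differentiation; this and the
  analogue for \<open>ddiff\<close> make the operator of the master equation preserve the
  degree.\<close>

lemma poly_deg_le_coord_pdiff: "poly_deg_le d f \<Longrightarrow> poly_deg_le d (\<lambda>x. of_real (x $ l) * pdiff i f x)"
proof (induction rule: poly_deg_le.induct)
  case (poly_deg_le_const d c)
  have "has_pd i (\<lambda>x. c) (\<lambda>x. 0)" by (rule has_pd_const)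
  then have "pdiff i (\<lambda>x::real^'a. c) = (\<lambda>x. 0)" by (rule has_pd_pdiff)
  then show ?case by (simp add: poly_deg_le.poly_deg_le_const)
next
  case (poly_deg_le_coord d f j)
  have p: "pdiff i (\<lambda>x. of_real (x $ j) * f x) = (\<lambda>x. (if i = j then 1 else 0) * f x + of_real (x $ j) * pdiff i f x)"
    using pdiff_mult[OF smooth_fun_coord smooth_fun_poly_deg_le[OF poly_deg_le_coord.hyps], of i j] by (simp add: pdiff_coord fun_eq_iff)
  have "poly_deg_le (Suc d) (\<lambda>x. of_real (x $ l) * ((if i = j then 1 else 0) * f x) + of_real (x $ j) * (of_real (x $ l) * pdiff i f x))"
    by (intro poly_deg_le.poly_deg_le_add poly_deg_le.poly_deg_le_coord poly_deg_le_cmult poly_deg_le_coord)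
  then show ?case unfolding p by (simp add: algebra_simps)
next
  case (poly_deg_le_add d f g)
  have "poly_deg_le d (\<lambda>x. of_real (x $ l) * pdiff i f x + of_real (x $ l) * pdiff i g x)"
    by (intro poly_deg_le.poly_deg_le_add poly_deg_le_add.IH)
  then show ?case using pdiff_add[OF smooth_fun_poly_deg_le smooth_fun_poly_deg_le, OF poly_deg_le_add.hyps] by (simp add: distrib_left)
qed

lemma ddiff_coord_cases:
  assumes "i \<noteq> j"
  shows "ddiff i j (\<lambda>x::real^'n::finite. complex_of_real (x $ m)) = (\<lambda>x. if m = i then 1 else if m = j then -1 else 0)"
proof (rule ddiff_unique)
  fix x :: "real^'n"
  show "of_real (x $ i - x $ j) * (if m = i then 1 else if m = j then -1 else 0) = complex_of_real (x $ m) - of_real (swapv i j x $ m)"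
    using assms by (auto simp: Transposition.transpose_def)
qed (use assms in \<open>auto intro: smooth_fun_coord\<close>)

lemma poly_deg_le_coord_ddiff: "poly_deg_le d f \<Longrightarrow> i \<noteq> j \<Longrightarrow> poly_deg_le d (\<lambda>x. of_real (x $ l) * ddiff i j f x)"
proof (induction rule: poly_deg_le.induct)
  case (poly_deg_le_const d c)
  then show ?case using poly_deg_le.poly_deg_le_const[of d 0] by (simp add: ddiff_const)
next
  case (poly_deg_le_coord d f m)
  let ?e = "if m = i then 1 else if m = j then -1 else 0 :: complex"
  have p: "ddiff i j (\<lambda>x. of_real (x $ m) * f x) = (\<lambda>x. ?e * f x + of_real (swapv i j x $ m) * ddiff i j f x)"
    using ddiff_mult[OF poly_deg_le_coord.prems smooth_fun_coord smooth_fun_poly_deg_le[OF poly_deg_le_coord.hyps], of m]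
    unfolding ddiff_coord_cases[OF poly_deg_le_coord.prems] .
  have "poly_deg_le (Suc d) (\<lambda>x. of_real (x $ l) * (?e * f x) + of_real (x $ Transposition.transpose i j m) * (of_real (x $ l) * ddiff i j f x))"
    by (intro poly_deg_le.poly_deg_le_add poly_deg_le.poly_deg_le_coord poly_deg_le_cmult poly_deg_le_coord)
  then show ?case unfolding p by (simp only: permv_nth distrib_left mult_ac)
next
  case (poly_deg_le_add d f g)
  have "poly_deg_le d (\<lambda>x. of_real (x $ l) * ddiff i j f x + of_real (x $ l) * ddiff i j g x)"
    by (intro poly_deg_le.poly_deg_le_add poly_deg_le_add.IH poly_deg_le_add.prems)
  then show ?case using ddiff_add[OF poly_deg_le_add.prems smooth_fun_poly_deg_le smooth_fun_poly_deg_le, OF poly_deg_le_add.hyps] by (simp add: distrib_left)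
qed

lemma ddiff_p1: "i \<noteq> j \<Longrightarrow> smooth1 H \<Longrightarrow> ddiff i j (\<lambda>x. H (p1 x)) = (\<lambda>x. 0)"
  by (rule ddiff_symmetric) (auto intro: smooth_fun_p1 simp: bij_transpose)

text \<open>Add up the equations of all coordinates: the difference terms vanish on functions of
  \<open>p1\<close>, and the factors x_i sum to \<open>p1\<close>, which leaves an Euler operator on
  the half line.\<close>

lemma master_functional_euler:
  fixes W :: "(real^'n::finite \<Rightarrow> complex) \<Rightarrow> complex"
  assumes W: "master_functional k \<mu> W" and H: "smooth1 H" "\<And>t. t \<ge> B \<Longrightarrow> H t = 0"
  shows "W (\<lambda>x. of_nat CARD('n) * \<mu> * H (p1 x) + of_real (p1 x) * deriv1 H (p1 x)) = 0"
proof -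
  let ?f = "\<lambda>x::real^'n. H (p1 x)" and ?g = "\<lambda>i (x::real^'n). complex_of_real (x $ i) * deriv1 H (p1 x)"
  have f: "orthant_test ?f" by (rule orthant_test_p1[OF H])
  have pf: "pdiff i ?f = (\<lambda>x. deriv1 H (p1 x))" for i by (rule pdiff_p1[OF H(1)])
  have g: "orthant_test (?g i)" for i
    using orthant_test_mult[OF smooth_fun_coord orthant_test_pdiff[OF f, of i], of i] unfolding pf .
  have lin: "W (\<lambda>x. \<Sum>i\<in>I. ?g i x) = (\<Sum>i\<in>I. W (?g i))" if "finite I" for I
    using that
  proof (induction I)
    case empty
    show ?case using master_functional_cmult[OF W f, of 0] by simp
  next
    case (insert a I)
    then show ?case using master_functional_add[OF W g orthant_test_sum[of I ?g, OF g], of a] by simp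
  qed
  have "\<mu> * W ?f + W (?g i) = 0" for i
  proof -
    have "(\<lambda>x. of_real (x $ i) * pdiff i ?f x + (\<Sum>j\<in>UNIV - {i}. of_real k * of_real (x $ j) * ddiff i j ?f x)) = ?g i"
      unfolding pf by (rule ext) (simp add: ddiff_p1[OF _ H(1)])
    then show ?thesis using master_functional_eq[OF W f, of i] by simp
  qed
  then have "(\<Sum>i\<in>UNIV. \<mu> * W ?f + W (?g i)) = 0" by simp
  then have "of_nat CARD('n) * \<mu> * W ?f + W (\<lambda>x. \<Sum>i\<in>UNIV. ?g i x) = 0"
    by (simp add: lin sum.distrib mult.assoc)
  moreover have "(\<Sum>i\<in>UNIV. ?g i x) = of_real (p1 x) * deriv1 H (p1 x)" for x
    by (simp add: p1_def sum_distrib_right)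
  moreover have "orthant_test (\<lambda>x. \<Sum>i\<in>UNIV. ?g i x)" by (rule orthant_test_sum) (rule g)
  ultimately show ?thesis
    using master_functional_add[OF W orthant_test_cmult[OF f], of "\<lambda>x. \<Sum>i\<in>UNIV. ?g i x" "of_nat CARD('n) * \<mu>"]
      master_functional_cmult[OF W f] by simp
qed

text \<open>On functions of \<open>p1\<close> the functional annihilates the range of the Euler
  operator, which is the kernel of a single linear form. Subtracting a multiple of the given cut-off
  moves \<open>H\<close> into this kernel, and on the cut-off the functional vanishes by
  \<open>W0\<close>.\<close>

lemma master_functional_p1_eq_0:
  fixes W :: "(real^'n::finite \<Rightarrow> complex) \<Rightarrow> complex"
  assumes W: "master_functional k (of_real \<mu>) W" and \<mu>: "0 \<le> \<mu>" and G: "cm_seq G"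
    and W0: "W (\<lambda>x. of_real (G (Suc (Suc m)) (p1 x))) = 0"
    and H: "smooth1 H" "\<And>t. t \<ge> B \<Longrightarrow> H t = 0"
  shows "W (\<lambda>x. H (p1 x)) = 0"
proof -
  let ?l = "real CARD('n) * \<mu>" and ?G0 = "\<lambda>t. complex_of_real (G (Suc (Suc m)) t)"
  define C where "C = max B 2"
  have l: "0 \<le> ?l" using \<mu> by simp
  have sG: "smooth1 (\<lambda>t. complex_of_real (G j t))" for j using G by (simp add: cm_seq_def)
  \<comment> \<open>The linear form whose vanishing is the solvability condition; the upper limit
    \<open>C\<close> covers the supports of both \<open>H\<close> and the cut-off.\<close>
  define \<Lambda> where "\<Lambda> F = integral {0..C} (\<lambda>t. complex_of_real (rpow ?l t) * deriv1 F t)" for F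
  have dG: "deriv1 ?G0 = (\<lambda>t. - complex_of_real (G (Suc m) t))"
    using cm_seq_deriv1[OF G, of 1 "Suc m"] by simp
  have cr: "continuous_on {0..C} (rpow ?l)" using continuous_on_rpow[OF l continuous_on_id, of "{0..C}"] by simp
  have cG: "continuous_on S (\<lambda>t. G j t)" for j S
    using continuous_on_Re[OF continuous_on_subset[OF smooth1_continuous[OF sG]], of S j] by simp
  \<comment> \<open>This is minus the form at the cut-off, whose derivative is
    -\<open>G (Suc m)\<close>. The double successor in \<open>W0\<close> makes this function
    positive on all of t < 2.\<close>
  have "0 < integral {0..C} (\<lambda>t. rpow ?l t * G (Suc m) t)"
  proof -
    have nn: "0 \<le> rpow ?l t * G (Suc m) t" for t using G by (auto simp: rpow_def cm_seq_def)
    have c: "continuous_on {0..C} (\<lambda>t. rpow ?l t * G (Suc m) t)" by (intro continuous_intros cr cG)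
    have "integral {0..C} (\<lambda>t. rpow ?l t * G (Suc m) t) \<noteq> 0"
    proof
      assume "integral {0..C} (\<lambda>t. rpow ?l t * G (Suc m) t) = 0"
      then have "rpow ?l 1 * G (Suc m) 1 = 0"
        using integral_eq_0_iff[OF c] nn by (auto simp: C_def)
      moreover have "0 < G (Suc m) 1" using G by (simp add: cm_seq_def)
      ultimately show False by (simp add: rpow_def split: if_splits)
    qed
    moreover have "0 \<le> integral {0..C} (\<lambda>t. rpow ?l t * G (Suc m) t)"
      by (rule integral_nonneg[OF integrable_continuous_real[OF c]]) (rule nn)
    ultimately show ?thesis by simp
  qed
  moreover have "\<Lambda> ?G0 = of_real (- integral {0..C} (\<lambda>t. rpow ?l t * G (Suc m) t))"
  proof -
    have "((\<lambda>t. rpow ?l t * G (Suc m) t) has_integral integral {0..C} (\<lambda>t. rpow ?l t * G (Suc m) t)) {0..C}"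
      by (intro integrable_integral integrable_continuous_real continuous_intros cr cG)
    from has_integral_neg[OF has_integral_of_real[OF this]] show ?thesis
      unfolding \<Lambda>_def dG by (intro integral_unique) simp
  qed
  ultimately have L0: "\<Lambda> ?G0 \<noteq> 0" by (simp only: of_real_eq_0_iff)
  define c where "c = - (\<Lambda> H / \<Lambda> ?G0)"
  let ?F = "\<lambda>t. H t + c * ?G0 t"
  have scG: "smooth1 (\<lambda>t. c * ?G0 t)" by (intro smooth1_mult smooth1_const sG)
  have sF: "smooth1 ?F" by (intro smooth1_add H(1) scG)
  have dF: "deriv1 ?F = (\<lambda>t. deriv1 H t + c * deriv1 ?G0 t)"
    by (rule deriv1_eqI) (intro has_vector_derivative_add has_vector_derivative_mult_right smooth1_has_deriv H(1) sG)
  have cd: "continuous_on {0..C} (\<lambda>t. complex_of_real (rpow ?l t) * deriv1 E t)" if "smooth1 E" for E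
    by (intro continuous_intros cr continuous_on_subset[OF smooth1_continuous[OF smooth1_deriv1[OF that]]]) auto
  have "\<Lambda> ?F = \<Lambda> H + c * \<Lambda> ?G0"
  proof -
    have "\<Lambda> ?F = integral {0..C} (\<lambda>t. complex_of_real (rpow ?l t) * deriv1 H t + c * (complex_of_real (rpow ?l t) * deriv1 ?G0 t))"
      unfolding \<Lambda>_def dF by (simp add: algebra_simps)
    also have "\<dots> = \<Lambda> H + integral {0..C} (\<lambda>t. c * (complex_of_real (rpow ?l t) * deriv1 ?G0 t))"
      unfolding \<Lambda>_def by (rule integral_add) (intro integrable_continuous_real continuous_on_mult_left cd H(1) sG)+
    also have "\<dots> = \<Lambda> H + c * \<Lambda> ?G0" unfolding \<Lambda>_def by (simp add: integral_mult_right)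
    finally show ?thesis .
  qed
  then have LF: "\<Lambda> ?F = 0" using L0 by (simp add: c_def)
  have HC: "H t = 0" "G j t = 0" if "t \<ge> C" for t j using that H(2) G by (auto simp: C_def cm_seq_def)
  have C0: "0 < C" by (simp add: C_def)
  have F0: "?F t = 0" if "t \<ge> C" for t using HC[OF that] by simp
  obtain E where E: "smooth1 E" "\<And>t. t \<ge> C \<Longrightarrow> E t = 0" "\<And>t. ?F t = of_real ?l * E t + of_real t * deriv1 E t"
    using euler_operator_solvable[OF l C0 sF F0 LF[unfolded \<Lambda>_def]] by blast
  have "(\<lambda>x::real^'n. of_nat CARD('n) * of_real \<mu> * E (p1 x) + of_real (p1 x) * deriv1 E (p1 x)) = (\<lambda>x. ?F (p1 x))"
    by (rule ext) (simp only: E(3), simp)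
  then have "W (\<lambda>x. ?F (p1 x)) = 0" using master_functional_euler[OF W E(1,2)] by simp
  moreover have "W (\<lambda>x. ?F (p1 x)) = W (\<lambda>x. H (p1 x)) + c * W (\<lambda>x. ?G0 (p1 x))"
    using master_functional_add[OF W orthant_test_p1[OF H] orthant_test_cmult[OF orthant_test_cm[OF G, of "Suc (Suc m)"], of c]]
      master_functional_cmult[OF W orthant_test_cm[OF G, of "Suc (Suc m)"], of c] by simp
  ultimately show ?thesis using W0 by simp
qed

text \<open>Induction on the degree. With a primitive K of H, the equation for f K(p1) produces x_i
  f H(p1), of one degree more than f, and otherwise only terms of the degree of f with the radial
  factor K(p1).\<close>

lemma master_functional_pol_eq_0:
  fixes W :: "(real^'n::finite \<Rightarrow> complex) \<Rightarrow> complex"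
  assumes W: "master_functional k \<mu> W"
    and W0: "\<And>H B. smooth1 H \<Longrightarrow> (\<And>t. t \<ge> B \<Longrightarrow> H t = 0) \<Longrightarrow> W (\<lambda>x. H (p1 x)) = 0"
    and H: "smooth1 H" "\<And>t. t \<ge> B \<Longrightarrow> H t = 0"
  shows "poly_deg_le d f \<Longrightarrow> W (\<lambda>x. f x * H (p1 x)) = 0"
  using H
proof (induction d arbitrary: f H B)
  have ot: "orthant_test (\<lambda>x. f x * H (p1 x))" if "poly_deg_le d f" "smooth1 H" "\<And>t. t \<ge> B \<Longrightarrow> H t = 0" for d f H B
    by (rule orthant_test_mult[OF smooth_fun_poly_deg_le[OF that(1)] orthant_test_p1[OF that(2,3)]])
  have add: "W (\<lambda>x. (f x + g x) * H (p1 x)) = W (\<lambda>x. f x * H (p1 x)) + W (\<lambda>x. g x * H (p1 x))"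
    if "poly_deg_le d f" "poly_deg_le d g" "smooth1 H" "\<And>t. t \<ge> B \<Longrightarrow> H t = 0" for d f g H B
    using master_functional_add[OF W ot[OF that(1,3,4)] ot[OF that(2,3,4)]] by (simp add: distrib_right)
  {
    case 0
    have "\<exists>c. f = (\<lambda>x. c)" using 0(1) by (induction "0::nat" f rule: poly_deg_le.induct) auto
    then obtain c where "f = (\<lambda>x. c)" by blast
    then show ?case using master_functional_cmult[OF W orthant_test_p1[OF 0(2,3)], where c=c] W0[OF 0(2,3)] by simp
  next
    case (Suc d)
    obtain K where K: "smooth1 K" "\<And>t. t \<ge> B \<Longrightarrow> K t = 0" "deriv1 K = H"
      using smooth1_right_antiderivative[OF Suc.prems(2,3)] by blast
    have coord: "W (\<lambda>x. (of_real (x $ i) * f x) * H (p1 x)) = 0" if f: "poly_deg_le d f" for f i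
    proof -
      let ?f = "\<lambda>x. f x * K (p1 x)"
      have sf: "smooth_fun f" by (rule smooth_fun_poly_deg_le[OF f])
      have sK: "smooth_fun (\<lambda>x::real^'n. K (p1 x))" by (rule smooth_fun_p1[OF K(1)])
      have o: "orthant_test ?f" by (rule ot[OF f K(1,2)])
      let ?e = "\<lambda>x. of_real (x $ i) * pdiff i f x + (\<Sum>j\<in>UNIV - {i}. of_real k * (of_real (x $ j) * ddiff i j f x))"
      have e: "poly_deg_le d ?e" by (intro poly_deg_le_add poly_deg_le_sum poly_deg_le_cmult poly_deg_le_coord_pdiff poly_deg_le_coord_ddiff f) auto
      have pd: "pdiff i ?f x = pdiff i f x * K (p1 x) + f x * H (p1 x)" for x
        using pdiff_mult[OF sf sK, of i] pdiff_p1[OF K(1), of i] K(3) by simp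
      have dd: "ddiff i j ?f x = ddiff i j f x * K (p1 x)" if "j \<noteq> i" for j x
        using ddiff_mult_symmetric[of i j f "\<lambda>x. K (p1 x)"] that sf sK by (simp add: bij_transpose)
      have "(\<lambda>x. of_real (x $ i) * pdiff i ?f x + (\<Sum>j\<in>UNIV - {i}. of_real k * of_real (x $ j) * ddiff i j ?f x))
        = (\<lambda>x. (of_real (x $ i) * f x) * H (p1 x) + ?e x * K (p1 x))"
        unfolding pd by (rule ext) (simp add: dd sum_distrib_left sum_distrib_right algebra_simps)
      moreover have "W (\<lambda>x. (of_real (x $ i) * f x) * H (p1 x) + ?e x * K (p1 x))
         = W (\<lambda>x. (of_real (x $ i) * f x) * H (p1 x)) + W (\<lambda>x. ?e x * K (p1 x))"
        by (rule master_functional_add[OF W ot[OF poly_deg_le_coord[OF f] Suc.prems(2,3)] ot[OF e K(1,2)]])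
      ultimately show ?thesis
        using master_functional_eq[OF W o, of i] Suc.IH[OF f K(1,2)] Suc.IH[OF e K(1,2)] by simp
    qed
    from Suc.prems(1) show ?case
    proof (induction "Suc d" f rule: poly_deg_le.induct)
      case (poly_deg_le_const c)
      then show ?case using master_functional_cmult[OF W orthant_test_p1[OF Suc.prems(2,3)], where c=c] W0[OF Suc.prems(2,3)] by simp
    next
      case (poly_deg_le_coord f i)
      then show ?case by (intro coord)
    next
      case (poly_deg_le_add f g)
      then show ?case using add[OF poly_deg_le_add(1,3) Suc.prems(2,3)] by simp
    qed
  }
qed

subsection \<open>Continuity with respect to derivatives of finite order\<close>

text \<open>A C^m bound as a relation, with one constant for all orders; only the simplex matters
  for functions that vanish beyond \<open>B\<close>.\<close>

primrec derivs_bounded :: "real \<Rightarrow> nat \<Rightarrow> real \<Rightarrow> (real^'n::finite \<Rightarrow> complex) \<Rightarrow> bool" where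
  "derivs_bounded B 0 S f \<longleftrightarrow> (\<forall>x\<in>simplex_set B. norm (f x) \<le> S)"
| "derivs_bounded B (Suc m) S f \<longleftrightarrow> (\<forall>x\<in>simplex_set B. norm (f x) \<le> S) \<and> (\<forall>i. derivs_bounded B m S (pdiff i f))"

lemma derivs_bounded_norm_le: "derivs_bounded B m S f \<Longrightarrow> x \<in> simplex_set B \<Longrightarrow> norm (f x) \<le> S"
  by (cases m) auto

lemma derivs_bounded_Suc_imp: "derivs_bounded B (Suc m) S f \<Longrightarrow> derivs_bounded B m S f"
  by (induction m arbitrary: f) auto

lemma derivs_bounded_le: "derivs_bounded B n S f \<Longrightarrow> m \<le> n \<Longrightarrow> derivs_bounded B m S f"
  by (induction n) (auto simp: le_Suc_eq simp del: derivs_bounded.simps dest: derivs_bounded_Suc_imp)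

lemma derivs_bounded_mono: "derivs_bounded B m S f \<Longrightarrow> S \<le> T \<Longrightarrow> derivs_bounded B m T f"
  by (induction m arbitrary: f) (auto intro: order_trans)

lemma derivs_bounded_add: "smooth_fun f \<Longrightarrow> smooth_fun g \<Longrightarrow> derivs_bounded B m S f \<Longrightarrow> derivs_bounded B m T g \<Longrightarrow> derivs_bounded B m (S + T) (\<lambda>x. f x + g x)"
proof (induction m arbitrary: f g)
  case 0
  then show ?case by (auto intro: norm_triangle_mono)
next
  case (Suc m)
  have "derivs_bounded B m (S + T) (\<lambda>x. pdiff i f x + pdiff i g x)" for i
    by (rule Suc.IH) (use Suc.prems in \<open>auto intro: smooth_fun_pdiff\<close>)
  then show ?case using Suc.prems by (auto simp: pdiff_add intro: norm_triangle_mono)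
qed

lemma derivs_bounded_cmult: "smooth_fun f \<Longrightarrow> derivs_bounded B m S f \<Longrightarrow> derivs_bounded B m (norm c * S) (\<lambda>x. c * f x)"
proof (induction m arbitrary: f)
  case 0
  then show ?case by (auto simp: norm_mult intro: mult_left_mono)
next
  case (Suc m)
  then show ?case by (auto simp: norm_mult pdiff_cmult intro: mult_left_mono smooth_fun_pdiff)
qed

lemma simplex_set_permv: "bij \<pi> \<Longrightarrow> x \<in> simplex_set B \<Longrightarrow> permv \<pi> x \<in> simplex_set B"
  by (simp add: simplex_set_def)

lemma simplex_set_mixv: "i \<noteq> j \<Longrightarrow> 0 \<le> t \<Longrightarrow> t \<le> 1 \<Longrightarrow> x \<in> simplex_set B \<Longrightarrow> mixv i j t x \<in> simplex_set B"
  by (auto simp: simplex_set_def mixv_def[where x=x] p1_mixv[unfolded mixv_def])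

lemma derivs_bounded_permv: "bij \<pi> \<Longrightarrow> smooth_fun f \<Longrightarrow> derivs_bounded B m S f \<Longrightarrow> derivs_bounded B m S (\<lambda>x. f (permv \<pi> x))"
  by (induction m arbitrary: f) (auto simp: simplex_set_permv pdiff_permv smooth_fun_pdiff)

text \<open>A derivative of an average is a sum of at most two averages whose weights are still
  bounded by 1, hence one factor 2 per order.\<close>

lemma derivs_bounded_mix_avg:
  fixes i j :: "'n::finite"
  assumes "i \<noteq> j" "0 \<le> S"
  shows "continuous_on {0..1} p \<Longrightarrow> (\<And>t. 0 \<le> t \<Longrightarrow> t \<le> 1 \<Longrightarrow> \<bar>p t\<bar> \<le> 1) \<Longrightarrow> smooth_fun f \<Longrightarrow> derivs_bounded B m S f
    \<Longrightarrow> derivs_bounded B m (2 ^ m * S) (mix_avg i j p f)"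
proof (induction m arbitrary: p f)
  have sup: "norm (mix_avg i j p f x) \<le> S"
    if p: "continuous_on {0..1} p" "\<And>t. 0 \<le> t \<Longrightarrow> t \<le> 1 \<Longrightarrow> \<bar>p t\<bar> \<le> 1" and f: "smooth_fun f" "derivs_bounded B m S f"
      and x: "x \<in> simplex_set B" for p f m and x :: "real^'n"
  proof -
    have "norm (integral {0..1} (\<lambda>t. complex_of_real (p t) * f (mixv i j t x))) \<le> S * (1 - 0)"
    proof (rule integral_bound)
      show "continuous_on {0..1} (\<lambda>t. complex_of_real (p t) * f (mixv i j t x))"
        using p f(1) by (intro continuous_intros smooth_fun_compose_continuous) auto
      show "norm (complex_of_real (p t) * f (mixv i j t x)) \<le> S" if "t \<in> {0..1}" for t
      proof -
        have "norm (f (mixv i j t x)) \<le> S" using that x assms by (intro derivs_bounded_norm_le[OF f(2)] simplex_set_mixv) auto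
        then have "\<bar>p t\<bar> * norm (f (mixv i j t x)) \<le> 1 * S" using p(2)[of t] that by (intro mult_mono) auto
        then show ?thesis by (simp add: norm_mult)
      qed
    qed simp
    then show ?thesis by (simp add: mix_avg_def)
  qed
  {
    case 0
    then show ?case using sup[of p f 0] by simp
  next
    case (Suc m)
    have bp: "derivs_bounded B m S (pdiff l f)" for l using Suc.prems by simp
    have sp: "smooth_fun (pdiff l f)" for l using Suc.prems by (intro smooth_fun_pdiff)
    have q: "continuous_on {0..1} (\<lambda>t. p t * t)" "continuous_on {0..1} (\<lambda>t. p t * (1 - t))"
      using Suc.prems(1) by (auto intro!: continuous_intros)
    have qb: "\<bar>p t * t\<bar> \<le> 1" "\<bar>p t * (1 - t)\<bar> \<le> 1" if "0 \<le> t" "t \<le> 1" for t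
      using Suc.prems(2)[OF that] that mult_mono[of "\<bar>p t\<bar>" 1 t 1] mult_mono[of "\<bar>p t\<bar>" 1 "1 - t" 1] by (auto simp: abs_mult)
    have two: "derivs_bounded B m (2 ^ Suc m * S) (\<lambda>x. mix_avg i j a g x + mix_avg i j b h x)"
      if "a \<in> {\<lambda>t. p t * t, \<lambda>t. p t * (1 - t)}" "b \<in> {\<lambda>t. p t * t, \<lambda>t. p t * (1 - t)}"
        and g: "smooth_fun g" "derivs_bounded B m S g" and h: "smooth_fun h" "derivs_bounded B m S h" for a b g h
    proof -
      have a: "continuous_on {0..1} a" "\<And>t. 0 \<le> t \<Longrightarrow> t \<le> 1 \<Longrightarrow> \<bar>a t\<bar> \<le> 1"
        and b: "continuous_on {0..1} b" "\<And>t. 0 \<le> t \<Longrightarrow> t \<le> 1 \<Longrightarrow> \<bar>b t\<bar> \<le> 1"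
        using that(1,2) q qb by auto
      have "derivs_bounded B m (2 ^ m * S + 2 ^ m * S) (\<lambda>x. mix_avg i j a g x + mix_avg i j b h x)"
        by (intro derivs_bounded_add smooth_fun_mix_avg assms(1) a b g h Suc.IH)
      then show ?thesis by (simp only: power_Suc mult_2 distrib_right)
    qed
    have "derivs_bounded B m (2 ^ Suc m * S) (pdiff l (mix_avg i j p f))" for l
    proof -
      have "derivs_bounded B m (2 ^ m * S) (mix_avg i j p (pdiff l f))"
        by (rule Suc.IH[OF Suc.prems(1,2) sp bp])
      then have "derivs_bounded B m (2 ^ Suc m * S) (mix_avg i j p (pdiff l f))"
        using assms(2) by (rule_tac derivs_bounded_mono) auto
      moreover have "pdiff l (mix_avg i j p f) = mix_avg_pd l i j p f"
        by (rule has_pd_pdiff[OF has_pd_mix_avg[OF assms(1) Suc.prems(1,3)]])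
      ultimately show ?thesis
        unfolding mix_avg_pd_def using two[OF _ _ sp bp sp bp] by simp
    qed
    moreover have "norm (mix_avg i j p f x) \<le> 2 ^ Suc m * S" if "x \<in> simplex_set B" for x
    proof -
      have "S \<le> 2 ^ Suc m * S" using assms(2) by (simp add: mult_le_cancel_right1 del: power_Suc)
      then show ?thesis using sup[OF Suc.prems that] by linarith
    qed
    ultimately show ?case by (simp del: power_Suc)
  }
qed

section \<open>Operators and functionals of finite order\<close>

text \<open>A loss of \<open>e\<close> derivatives, with a constant for each target order;
  quantifying over all target orders makes the notion stable under composition, where the losses
  add.\<close>

definition bounded_op :: "real \<Rightarrow> nat \<Rightarrow> ((real^'n::finite \<Rightarrow> complex) \<Rightarrow> real^'n \<Rightarrow> complex) \<Rightarrow> bool" where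
  "bounded_op B e L \<longleftrightarrow> (\<forall>f. smooth_fun f \<longrightarrow> smooth_fun (L f)) \<and>
     (\<forall>m. \<exists>c\<ge>0. \<forall>f S. smooth_fun f \<longrightarrow> 0 \<le> S \<longrightarrow> derivs_bounded B (m + e) S f \<longrightarrow> derivs_bounded B m (c * S) (L f))"

lemma bounded_opI:
  assumes "\<And>f. smooth_fun f \<Longrightarrow> smooth_fun (L f)"
    and "\<And>m. \<exists>c\<ge>0. \<forall>f S. smooth_fun f \<longrightarrow> 0 \<le> S \<longrightarrow> derivs_bounded B (m + e) S f \<longrightarrow> derivs_bounded B m (c * S) (L f)"
  shows "bounded_op B e L"
  using assms by (simp add: bounded_op_def)

lemma bounded_op_smooth: "bounded_op B e L \<Longrightarrow> smooth_fun f \<Longrightarrow> smooth_fun (L f)"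
  by (simp add: bounded_op_def)

lemma bounded_opD:
  assumes "bounded_op B e L"
  shows "\<exists>c. 0 \<le> c \<and> (\<forall>f S. smooth_fun f \<longrightarrow> 0 \<le> S \<longrightarrow> derivs_bounded B (m + e) S f \<longrightarrow> derivs_bounded B m (c * S) (L f))"
  using assms unfolding bounded_op_def by blast

lemma bounded_op_add:
  fixes L M :: "(real^'n::finite \<Rightarrow> complex) \<Rightarrow> real^'n \<Rightarrow> complex"
  assumes "bounded_op B e L" "bounded_op B e M" shows "bounded_op B e (\<lambda>f x. L f x + M f x)"
proof (rule bounded_opI)
  show "smooth_fun (\<lambda>x. L f x + M f x)" if "smooth_fun f" for f
    by (intro smooth_fun_add bounded_op_smooth[OF assms(1)] bounded_op_smooth[OF assms(2)] that)
  fix m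
  obtain c where c: "0 \<le> c" "\<And>f S. smooth_fun f \<Longrightarrow> 0 \<le> S \<Longrightarrow> derivs_bounded B (m + e) S f \<Longrightarrow> derivs_bounded B m (c * S) (L f)"
    using bounded_opD[OF assms(1)] by blast
  obtain d where d: "0 \<le> d" "\<And>f S. smooth_fun f \<Longrightarrow> 0 \<le> S \<Longrightarrow> derivs_bounded B (m + e) S f \<Longrightarrow> derivs_bounded B m (d * S) (M f)"
    using bounded_opD[OF assms(2)] by blast
  show "\<exists>c\<ge>0. \<forall>f S. smooth_fun f \<longrightarrow> 0 \<le> S \<longrightarrow> derivs_bounded B (m + e) S f \<longrightarrow> derivs_bounded B m (c * S) (\<lambda>x. L f x + M f x)"
  proof (intro exI[of _ "c + d"] conjI allI impI)
    fix f :: "real^'n \<Rightarrow> complex" and S :: real assume f: "smooth_fun f" "0 \<le> S" "derivs_bounded B (m + e) S f"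
    show "derivs_bounded B m ((c + d) * S) (\<lambda>x. L f x + M f x)"
      unfolding distrib_right by (intro derivs_bounded_add bounded_op_smooth[OF assms(1)] bounded_op_smooth[OF assms(2)] c d f)
  qed (use c d in simp)
qed

lemma bounded_op_comp:
  fixes L M :: "(real^'n::finite \<Rightarrow> complex) \<Rightarrow> real^'n \<Rightarrow> complex"
  assumes "bounded_op B e L" "bounded_op B e' M" shows "bounded_op B (e + e') (\<lambda>f. L (M f))"
proof (rule bounded_opI)
  show "smooth_fun (L (M f))" if "smooth_fun f" for f
    by (intro bounded_op_smooth[OF assms(1)] bounded_op_smooth[OF assms(2)] that)
  fix m
  obtain c where c: "0 \<le> c" "\<And>f S. smooth_fun f \<Longrightarrow> 0 \<le> S \<Longrightarrow> derivs_bounded B (m + e) S f \<Longrightarrow> derivs_bounded B m (c * S) (L f)"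
    using bounded_opD[OF assms(1)] by blast
  obtain d where d: "0 \<le> d" "\<And>f S. smooth_fun f \<Longrightarrow> 0 \<le> S \<Longrightarrow> derivs_bounded B (m + e + e') S f \<Longrightarrow> derivs_bounded B (m + e) (d * S) (M f)"
    using bounded_opD[OF assms(2)] by blast
  show "\<exists>c\<ge>0. \<forall>f S. smooth_fun f \<longrightarrow> 0 \<le> S \<longrightarrow> derivs_bounded B (m + (e + e')) S f \<longrightarrow> derivs_bounded B m (c * S) (L (M f))"
  proof (intro exI[of _ "c * d"] conjI allI impI)
    fix f :: "real^'n \<Rightarrow> complex" and S :: real assume f: "smooth_fun f" "0 \<le> S" "derivs_bounded B (m + (e + e')) S f"
    then have "derivs_bounded B (m + e) (d * S) (M f)" by (intro d) (simp_all add: add.assoc)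
    then show "derivs_bounded B m (c * d * S) (L (M f))"
      unfolding mult.assoc using f d(1) by (intro c bounded_op_smooth[OF assms(2)]) auto
  qed (use c d in simp)
qed

lemma bounded_op_cmult: "bounded_op B 0 (\<lambda>f x. c * f x)"
proof (rule bounded_opI)
  show "smooth_fun (\<lambda>x. c * f x)" if "smooth_fun f" for f :: "real^'a \<Rightarrow> complex"
    using that by (intro smooth_fun_mult smooth_fun_const)
qed (auto intro!: exI[of _ "norm c"] derivs_bounded_cmult)

lemma bounded_op_sum:
  fixes L :: "'b \<Rightarrow> (real^'n::finite \<Rightarrow> complex) \<Rightarrow> real^'n \<Rightarrow> complex"
  shows "finite A \<Longrightarrow> (\<And>a. a \<in> A \<Longrightarrow> bounded_op B e (L a)) \<Longrightarrow> bounded_op B e (\<lambda>f x. \<Sum>a\<in>A. L a f x)"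
proof (induction A rule: finite_induct)
  case empty
  have "derivs_bounded B m 0 (\<lambda>x::real^'n. 0)" for m
  proof (induction m)
    case (Suc m)
    have "pdiff i (\<lambda>x::real^'n. 0) = (\<lambda>x. 0)" for i by (rule has_pd_pdiff[OF has_pd_const])
    then show ?case using Suc by simp
  qed simp
  then have "bounded_op B e (\<lambda>(f::real^'n \<Rightarrow> complex) (x::real^'n). 0)" by (intro bounded_opI) (auto intro!: smooth_fun_const exI[of _ 0])
  then show ?case by simp
next
  case (insert a A)
  then show ?case by (simp add: bounded_op_add)
qed

lemma bounded_op_pdiff: "bounded_op B 1 (pdiff i)"
  by (rule bounded_opI) (auto intro!: smooth_fun_pdiff exI[of _ 1])

lemma bounded_op_permv: "bij \<pi> \<Longrightarrow> bounded_op B 0 (\<lambda>f x. f (permv \<pi> x))"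
  by (rule bounded_opI) (auto intro!: smooth_fun_permv exI[of _ 1] derivs_bounded_permv)

lemma bounded_op_mix_avg: "i \<noteq> j \<Longrightarrow> bounded_op B 0 (mix_avg i j (\<lambda>_. 1))"
proof (rule bounded_opI)
  fix m
  assume "i \<noteq> j"
  then show "\<exists>c\<ge>0. \<forall>f S. smooth_fun f \<longrightarrow> 0 \<le> S \<longrightarrow> derivs_bounded B (m + 0) S f \<longrightarrow> derivs_bounded B m (c * S) (mix_avg i j (\<lambda>_. 1) f)"
    by (intro exI[of _ "2 ^ m"] conjI allI impI derivs_bounded_mix_avg) auto
qed (auto intro: smooth_fun_mix_avg)

lemma bounded_op_ddiff: "i \<noteq> j \<Longrightarrow> bounded_op B 1 (ddiff i j)"
proof -
  assume ij: "i \<noteq> j"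
  have "bounded_op B (0 + 1) (\<lambda>f x. (-1) * pdiff j f x)" by (rule bounded_op_comp[OF bounded_op_cmult bounded_op_pdiff])
  then have "bounded_op B 1 (\<lambda>f x. pdiff i f x + (-1) * pdiff j f x)" by (intro bounded_op_add bounded_op_pdiff) simp
  from bounded_op_comp[OF bounded_op_mix_avg[OF ij] this] show ?thesis by (simp add: ddiff_def[abs_def])
qed

lemma bounded_op_dunkl_step:
  assumes "i \<notin> A" shows "bounded_op B 1 (dunkl_step k i A)"
proof -
  have "bounded_op B 1 (\<lambda>f x. of_real k * ddiff i j f x)" if "j \<in> A" for j
    using bounded_op_comp[OF bounded_op_cmult bounded_op_ddiff, of i j B "of_real k"] that assms by fastforce
  then have "bounded_op B 1 (\<lambda>f x. pdiff i f x + (\<Sum>j\<in>A. of_real k * ddiff i j f x))"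
    by (intro bounded_op_add bounded_op_pdiff bounded_op_sum) auto
  then show ?thesis by (simp add: dunkl_step_def[abs_def])
qed

lemma bounded_op_dunkl_chain:
  "distinct is \<Longrightarrow> set is \<inter> A = {} \<Longrightarrow> bounded_op B (length is) (dunkl_chain k is A)"
proof (induction "is" arbitrary: A)
  case Nil
  have "bounded_op B 0 (\<lambda>f. f)" by (rule bounded_opI) (auto intro!: exI[of _ 1])
  then show ?case by simp
next
  case (Cons i xs)
  have "bounded_op B (length xs + 1) (\<lambda>f. dunkl_chain k xs (insert i A) (dunkl_step k i A f))"
    using Cons by (intro bounded_op_comp Cons.IH bounded_op_dunkl_step) auto
  then show ?case by simp
qed

lemma bounded_op_symmetrize: "bounded_op B 0 symmetrize"
proof -
  let ?c = "1 / of_nat (card {\<pi>::'a \<Rightarrow> 'a. bij \<pi>}) :: complex"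
  have "bounded_op B 0 (\<lambda>f x. \<Sum>\<pi>\<in>{\<pi>::'a \<Rightarrow> 'a. bij \<pi>}. f (permv \<pi> x))"
    by (intro bounded_op_sum bounded_op_permv) auto
  from bounded_op_comp[OF bounded_op_cmult[of B ?c] this] show ?thesis by (simp add: symmetrize_def[abs_def])
qed

lemma bounded_op_dunkl_prod_pow: "\<exists>e. bounded_op B e (dunkl_prod k ^^ N :: (real^'n::finite \<Rightarrow> complex) \<Rightarrow> _)"
proof (induction N)
  case 0
  have "bounded_op B 0 (\<lambda>f. f)" by (rule bounded_opI) (auto intro!: exI[of _ 1])
  then show ?case by (auto simp: id_def)
next
  case (Suc N)
  then obtain e where e: "bounded_op B e (dunkl_prod k ^^ N :: (real^'n \<Rightarrow> complex) \<Rightarrow> _)" by blast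
  have cl: "distinct (coord_list :: 'n list)" "set (coord_list :: 'n list) \<inter> {} = {}"
    using coord_list by auto
  have "bounded_op B (length (coord_list :: 'n list) + 0) (dunkl_prod k :: (real^'n \<Rightarrow> complex) \<Rightarrow> _)"
    using bounded_op_comp[OF bounded_op_dunkl_chain[OF cl] bounded_op_symmetrize] by (simp add: dunkl_prod_def[abs_def])
  from bounded_op_comp[OF this e] show ?case by (auto simp: comp_def)
qed

text \<open>Leibniz rule by induction on the order; the constant also collects those of the finitely
  many partial derivatives of \<open>g\<close>.\<close>

lemma bounded_op_mult:
  fixes g :: "real^'n::finite \<Rightarrow> complex"
  assumes "smooth_fun g" shows "bounded_op B 0 (\<lambda>f x. g x * f x)"
proof (rule bounded_opI)
  show "smooth_fun (\<lambda>x. g x * f x)" if "smooth_fun f" for f using assms that by (rule smooth_fun_mult)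
  fix m
  show "\<exists>c\<ge>0. \<forall>f S. smooth_fun f \<longrightarrow> 0 \<le> S \<longrightarrow> derivs_bounded B (m + 0) S f \<longrightarrow> derivs_bounded B m (c * S) (\<lambda>x. g x * f x)"
    using assms
  proof (induction m arbitrary: g)
    case 0
    obtain c where "0 \<le> c" "\<And>x. x \<in> simplex_set B \<Longrightarrow> norm (g x) \<le> c"
      using bounded_on_simplex[OF smooth_fun_continuous[OF 0]] by metis
    then show ?case by (intro exI[of _ c]) (auto simp: norm_mult intro!: mult_mono)
  next
    case (Suc m)
    obtain c0 where c0: "0 \<le> c0" "\<And>x. x \<in> simplex_set B \<Longrightarrow> norm (g x) \<le> c0"
      using bounded_on_simplex[OF smooth_fun_continuous[OF Suc.prems]] by metis
    obtain c1 where c1: "0 \<le> c1" "\<And>f S. smooth_fun f \<Longrightarrow> 0 \<le> S \<Longrightarrow> derivs_bounded B m S f \<Longrightarrow> derivs_bounded B m (c1 * S) (\<lambda>x. g x * f x)"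
      using Suc.IH[OF Suc.prems] by auto
    have "\<exists>c. \<forall>i. 0 \<le> c i \<and> (\<forall>f S. smooth_fun f \<longrightarrow> 0 \<le> S \<longrightarrow> derivs_bounded B m S f \<longrightarrow> derivs_bounded B m (c i * S) (\<lambda>x. pdiff i g x * f x))"
      by (rule choice) (use Suc.IH[OF smooth_fun_pdiff[OF Suc.prems]] in auto)
    then obtain c2 where c2: "\<And>i. 0 \<le> c2 i" "\<And>i f S. smooth_fun f \<Longrightarrow> 0 \<le> S \<Longrightarrow> derivs_bounded B m S f \<Longrightarrow> derivs_bounded B m (c2 i * S) (\<lambda>x. pdiff i g x * f x)"
      by blast
    let ?c = "c0 + c1 + (\<Sum>i\<in>UNIV. c2 i)"
    have s: "c2 i \<le> (\<Sum>i\<in>UNIV. c2 i)" "0 \<le> (\<Sum>i\<in>UNIV. c2 i)" for i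
      using c2(1) by (auto intro: member_le_sum sum_nonneg)
    show ?case
    proof (intro exI[of _ ?c] conjI allI impI)
      show "0 \<le> ?c" using c0 c1 s by simp
      fix f :: "real^'n \<Rightarrow> complex" and S :: real assume f: "smooth_fun f" "0 \<le> S" "derivs_bounded B (Suc m + 0) S f"
      have "norm (g x * f x) \<le> ?c * S" if x: "x \<in> simplex_set B" for x
      proof -
        have "norm (g x) * norm (f x) \<le> ?c * S"
        proof (rule mult_mono)
          show "norm (g x) \<le> ?c" using c0(2)[OF x] c1(1) s(2) by linarith
          show "0 \<le> ?c" using c0 c1 s by simp
        qed (use derivs_bounded_norm_le[of B _ S f x] f(3) x in auto)
        then show ?thesis by (simp add: norm_mult)
      qed
      moreover have "derivs_bounded B m (?c * S) (pdiff i (\<lambda>x. g x * f x))" for i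
      proof -
        have "derivs_bounded B m (c1 * S + c2 i * S) (\<lambda>x. g x * pdiff i f x + pdiff i g x * f x)"
          using f derivs_bounded_Suc_imp[where B=B and m=m and S=S and f=f] by (intro derivs_bounded_add c1 c2 smooth_fun_mult smooth_fun_pdiff Suc.prems) auto
        moreover have "c1 * S + c2 i * S \<le> ?c * S"
          unfolding distrib_right[symmetric] using f(2) s(1)[of i] c0(1) by (intro mult_right_mono) auto
        ultimately show ?thesis unfolding pdiff_mult[OF Suc.prems f(1)] by (rule derivs_bounded_mono)
      qed
      ultimately show "derivs_bounded B (Suc m) (?c * S) (\<lambda>x. g x * f x)" by simp
    qed
  qed
qed

lemma fint_bound:
  assumes k: "0 < k" and b: "0 < Re b"
  obtains C where "0 \<le> C" "\<And>f S. orthant_test (f :: real^'n::finite \<Rightarrow> complex) \<Longrightarrow> vanishes_beyond B f \<Longrightarrow> 0 \<le> S \<Longrightarrow> derivs_bounded B 0 S f \<Longrightarrow> norm (fint A k b f) \<le> C * S"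
proof -
  obtain C where C: "0 \<le> C" "\<And>f S. \<lbrakk>continuous_on UNIV f; vanishes_beyond B f; \<And>y. y \<in> simplex_set B \<Longrightarrow> norm (f y) \<le> S; 0 \<le> S\<rbrakk>
       \<Longrightarrow> norm (gint A b f) \<le> S * C"
    using gint_bound[OF b, of B A] by blast
  obtain T where T: "0 \<le> T" "\<And>y. y \<in> simplex_set B \<Longrightarrow> norm (complex_of_real (vand A k 0 y)) \<le> T"
    using bounded_on_simplex[OF continuous_on_of_real_vand[OF k order_refl], of B] by metis
  show ?thesis
  proof (rule that[of "T * C"])
    fix f S assume f: "orthant_test (f :: real^'n \<Rightarrow> complex)" "vanishes_beyond B f" "(0::real) \<le> S" "derivs_bounded B 0 S f"
    have "norm (gint A b (\<lambda>x. f x * complex_of_real (vand A k 0 x))) \<le> (S * T) * C"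
    proof (rule C(2))
      show "continuous_on UNIV (\<lambda>x. f x * complex_of_real (vand A k 0 x))"
        by (intro continuous_on_mult smooth_fun_continuous orthant_test_smooth f continuous_on_of_real_vand k) simp
      show "vanishes_beyond B (\<lambda>x. f x * complex_of_real (vand A k 0 x))" by (rule vanishes_beyond_mult'[OF f(2)])
      show "norm (f y * complex_of_real (vand A k 0 y)) \<le> S * T" if "y \<in> simplex_set B" for y
        unfolding norm_mult using f(3) T(2) that derivs_bounded_norm_le[OF f(4)] by (intro mult_mono) auto
      show "0 \<le> S * T" using f(3) T(1) by simp
    qed
    then show "norm (fint A k b f) \<le> T * C * S" by (simp add: fint_def mult_ac)
  qed (use C T in simp)
qed

text \<open>The bound \<open>B\<close> itself is preserved, so the estimates before and after
  applying the operator refer to the same simplex.\<close>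

lemma vanishes_beyond_dunkl_prod_pow:
  "orthant_test f \<Longrightarrow> vanishes_beyond B f \<Longrightarrow> vanishes_beyond B ((dunkl_prod k ^^ N) f)"
proof (induction N)
  case (Suc N)
  let ?g = "(dunkl_prod k ^^ N) f"
  have chain: "orthant_test h \<Longrightarrow> vanishes_beyond B h \<Longrightarrow> distinct is \<Longrightarrow> set is \<inter> A = {} \<Longrightarrow> vanishes_beyond B (dunkl_chain k is A h)" for h "is" A
  proof (induction "is" arbitrary: h A)
    case (Cons i xs)
    have "vanishes_beyond B (\<lambda>x. \<Sum>j\<in>A. of_real k * ddiff i j h x)"
      using Cons.prems by (intro vanishes_beyond_sum vanishes_beyond_mult vanishes_beyond_ddiff orthant_test_smooth) auto
    then have "vanishes_beyond B (dunkl_step k i A h)"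
      unfolding dunkl_step_def[abs_def] using Cons.prems
      by (intro vanishes_beyond_add vanishes_beyond_pdiff orthant_test_smooth)
    then show ?case
      using Cons.IH[of "dunkl_step k i A h" "insert i A"] orthant_test_dunkl_step[of i A h k] Cons.prems by simp
  qed simp
  have "vanishes_beyond B (symmetrize ?g)"
    unfolding symmetrize_def[abs_def] using Suc
    by (intro vanishes_beyond_mult vanishes_beyond_sum vanishes_beyond_permv) auto
  then have "vanishes_beyond B (dunkl_chain k coord_list {} (symmetrize ?g))"
    using coord_list Suc.prems by (intro chain orthant_test_symmetrize orthant_test_dunkl_prod_pow) auto
  then show ?case by (simp add: dunkl_prod_def[of k ?g])
qed simp

text \<open>After a shift into the domain of convergence the value is bounded by the sup norm of the
  iterated operator applied to f, so the order of the functional is at most that of the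
  operator.\<close>

lemma riesz_bound:
  assumes k: "0 < k"
  obtains C e where "0 \<le> C" "\<And>f S. orthant_test (f :: real^'n::finite \<Rightarrow> complex) \<Longrightarrow> vanishes_beyond B f \<Longrightarrow> 0 \<le> S \<Longrightarrow> derivs_bounded B e S f \<Longrightarrow> norm (riesz k \<mu> f) \<le> C * S"
proof -
  define N where "N = nat (\<lceil>mu0 CARD('n) k - Re \<mu>\<rceil> + 1)"
  have N: "mu0 CARD('n) k < Re \<mu> + real N" unfolding N_def by linarith
  obtain e where e: "bounded_op B e (dunkl_prod k ^^ N :: (real^'n \<Rightarrow> complex) \<Rightarrow> _)" using bounded_op_dunkl_prod_pow by blast
  obtain c where c: "0 \<le> c" "\<And>f S. smooth_fun f \<Longrightarrow> 0 \<le> S \<Longrightarrow> derivs_bounded B (0 + e) S f \<Longrightarrow> derivs_bounded B 0 (c * S) ((dunkl_prod k ^^ N) (f :: real^'n \<Rightarrow> complex))"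
    using bounded_opD[OF e, of 0] by blast
  let ?b = "\<mu> + of_nat N - of_real (mu0 CARD('n) k)"
  have b: "0 < Re ?b" using N by simp
  obtain C where C: "0 \<le> C" "\<And>f S. orthant_test (f :: real^'n \<Rightarrow> complex) \<Longrightarrow> vanishes_beyond B f \<Longrightarrow> 0 \<le> S \<Longrightarrow> derivs_bounded B 0 S f \<Longrightarrow> norm (fint UNIV k ?b f) \<le> C * S"
    using fint_bound[OF k b, of B UNIV] by blast
  let ?r = "norm (rcoef CARD('n) k (\<mu> + of_nat N))"
  show ?thesis
  proof (rule that[of "?r * (C * c)" e])
    fix f S assume f: "orthant_test (f :: real^'n \<Rightarrow> complex)" "vanishes_beyond B f" "(0::real) \<le> S" "derivs_bounded B e S f"
    have "norm (fint UNIV k ?b ((dunkl_prod k ^^ N) f)) \<le> C * (c * S)"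
      using f c by (intro C orthant_test_dunkl_prod_pow vanishes_beyond_dunkl_prod_pow) (auto intro: orthant_test_smooth)
    then have "?r * norm (fint UNIV k ?b ((dunkl_prod k ^^ N) f)) \<le> ?r * (C * (c * S))" by (rule mult_left_mono) simp
    then show "norm (riesz k \<mu> f) \<le> ?r * (C * c) * S"
      using riesz_eq_shift[OF k f(1) N] by (simp add: riesz_shift_def riesz_integral_eq norm_mult norm_power mult.assoc)
  qed (use C c in simp)
qed

lemma face_functional_bound:
  assumes k: "0 < k" and r: "r < CARD('n)"
  obtains C where "0 \<le> C" "\<And>f S. orthant_test (f :: real^'n::finite \<Rightarrow> complex) \<Longrightarrow> vanishes_beyond B f \<Longrightarrow> 0 \<le> S \<Longrightarrow> derivs_bounded B e S f \<Longrightarrow> norm (face_functional k r f) \<le> C * S"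
proof -
  let ?b = "of_real (k * (real CARD('n) - real r + 1)) :: complex"
  have b: "0 < Re ?b" using k r by simp
  have "\<forall>A. \<exists>C. 0 \<le> C \<and> (\<forall>f S. orthant_test (f :: real^'n \<Rightarrow> complex) \<longrightarrow> vanishes_beyond B f \<longrightarrow> 0 \<le> S \<longrightarrow> derivs_bounded B 0 S f \<longrightarrow> norm (fint A k ?b f) \<le> C * S)"
    using fint_bound[OF k b, of B] by metis
  then obtain C where C: "\<And>A. 0 \<le> C A" "\<And>A f S. orthant_test (f :: real^'n \<Rightarrow> complex) \<Longrightarrow> vanishes_beyond B f \<Longrightarrow> 0 \<le> S \<Longrightarrow> derivs_bounded B 0 S f \<Longrightarrow> norm (fint A k ?b f) \<le> C A * S"
    by metis
  show ?thesis
  proof (rule that[of "\<Sum>A | card A = r. C A"])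
    fix f S assume f: "orthant_test (f :: real^'n \<Rightarrow> complex)" "vanishes_beyond B f" "(0::real) \<le> S" "derivs_bounded B e S f"
    then show "norm (face_functional k r f) \<le> (\<Sum>A | card A = r. C A) * S"
      unfolding face_functional_def sum_distrib_right
      by (intro sum_norm_le C(2) derivs_bounded_le[OF f(4)]) auto
  qed (use C in \<open>simp add: sum_nonneg\<close>)
qed

subsection \<open>Polynomial approximation by Landau kernels\<close>

lemma supp_integrable:
  fixes g :: "real^'n::finite \<Rightarrow> complex"
  assumes "continuous_on UNIV g" "\<forall>y. r < norm y \<longrightarrow> g y = 0"
  shows "integrable lborel g"
proof -
  have "integrable lborel (\<lambda>x. indicator (cball 0 r) x *\<^sub>R g x)"
    by (intro borel_integrable_compact continuous_on_subset[OF assms(1)]) auto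
  also have "(\<lambda>x. indicator (cball 0 r) x *\<^sub>R g x) = g"
    using assms(2) by (auto simp: indicator_def fun_eq_iff)
  finally show ?thesis .
qed

lemma supp_integral_eq:
  fixes g :: "real^'n::finite \<Rightarrow> complex"
  assumes "continuous_on UNIV g" "\<forall>y. r < norm y \<longrightarrow> g y = 0" "cball 0 r \<subseteq> cbox a b"
  shows "(\<integral>y. g y \<partial>lborel) = integral (cbox a b) g"
proof -
  have "(\<integral>y. g y \<partial>lborel) = integral UNIV g"
    by (rule integral_lborel[symmetric], rule supp_integrable[OF assms(1,2)])
  also have "\<dots> = integral UNIV (\<lambda>y. if y \<in> cbox a b then g y else 0)"
  proof (rule arg_cong[of _ _ "integral UNIV"], rule ext)
    fix y
    have "r < norm y" if "y \<notin> cbox a b" using assms(3) that by (auto simp: not_le[symmetric])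
    then show "g y = (if y \<in> cbox a b then g y else 0)" using assms(2) by auto
  qed
  finally show ?thesis unfolding integral_restrict_UNIV .
qed

text \<open>Not cut off at radius c, so that integrating against it produces polynomials; the
  estimates use it only for |z| <= c, where it lies between 0 and 1.\<close>

definition landau_kernel :: "real \<Rightarrow> nat \<Rightarrow> real^'n::finite \<Rightarrow> real" where
  "landau_kernel c j z = (1 - (norm z)\<^sup>2 / c\<^sup>2) ^ j"

definition landau_integral :: "real \<Rightarrow> nat \<Rightarrow> (real^'n::finite \<Rightarrow> complex) \<Rightarrow> real^'n \<Rightarrow> complex" where
  "landau_integral c j \<psi> x = (\<integral>y. \<psi> y * of_real (landau_kernel c j (x - y)) \<partial>lborel)"

definition landau_mass :: "'n::finite itself \<Rightarrow> real \<Rightarrow> nat \<Rightarrow> real" where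
  "landau_mass _ c j = (\<integral>z. indicator (cball 0 c) (z :: real^'n) * landau_kernel c j z \<partial>lborel)"

lemma continuous_on_landau_kernel [continuous_intros]: "continuous_on S f \<Longrightarrow> continuous_on S (\<lambda>x. landau_kernel c j (f x))"
  unfolding landau_kernel_def by (cases "c = 0") (auto intro!: continuous_intros)

lemma landau_integral_integrable:
  fixes \<psi> :: "real^'n::finite \<Rightarrow> complex"
  assumes "continuous_on UNIV \<psi>" "\<forall>y. r < norm y \<longrightarrow> \<psi> y = 0"
  shows "integrable lborel (\<lambda>y. \<psi> y * of_real (landau_kernel c j (x - y)))"
  by (rule supp_integrable[where r=r]) (use assms in \<open>auto intro!: continuous_intros\<close>)

text \<open>Expanding one factor 1 - |x - y|^2 / c^2 in the coordinates of x leaves coefficients in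
  y, which are absorbed into \<psi>; each factor raises the degree by two. Hence the induction
  generalises over \<psi>.\<close>

lemma poly_deg_le_landau_integral:
  fixes \<psi> :: "real^'n::finite \<Rightarrow> complex"
  assumes "continuous_on UNIV \<psi>" "\<forall>y. r < norm y \<longrightarrow> \<psi> y = 0"
  shows "poly_deg_le (2 * j) (landau_integral c j \<psi>)"
  using assms
proof (induction j arbitrary: \<psi>)
  case 0
  show ?case unfolding landau_integral_def[abs_def] landau_kernel_def by (simp add: poly_deg_le_const)
next
  case (Suc j)
  \<comment> \<open>\<open>?a\<close>, \<open>?b l\<close> and \<open>?d\<close> are \<psi> times
    the coefficients of 1, x_l and x_l^2 in the expanded factor.\<close>
  let ?q = "1 / complex_of_real (c\<^sup>2)"
  let ?a = "\<lambda>y. \<psi> y * of_real (1 - (norm y)\<^sup>2 / c\<^sup>2)"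
  let ?b = "\<lambda>l y. \<psi> y * (2 * ?q * of_real (y $ l))"
  let ?d = "\<lambda>y. \<psi> y * (- ?q)"
  have ca: "continuous_on UNIV ?a" and cb: "\<And>l. continuous_on UNIV (?b l)" and cd: "continuous_on UNIV ?d"
    using Suc.prems(1) by (auto intro!: continuous_intros simp: divide_inverse)
  have za: "\<forall>y. r < norm y \<longrightarrow> ?a y = 0" and zb: "\<And>l. \<forall>y. r < norm y \<longrightarrow> ?b l y = 0" and zd: "\<forall>y. r < norm y \<longrightarrow> ?d y = 0"
    using Suc.prems(2) by auto
  have eq: "landau_integral c (Suc j) \<psi> x = landau_integral c j ?a x + (\<Sum>l\<in>UNIV. of_real (x $ l) * landau_integral c j (?b l) x)
     + (\<Sum>l\<in>UNIV. of_real (x $ l) * (of_real (x $ l) * landau_integral c j ?d x))" for x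
  proof -
    have ns: "(norm v)\<^sup>2 = (\<Sum>l\<in>UNIV. v $ l * v $ l)" for v :: "real^'n"
      unfolding power2_norm_eq_inner inner_vec_def by simp
    have "\<psi> y * of_real (landau_kernel c (Suc j) (x - y)) = ?a y * of_real (landau_kernel c j (x - y))
       + (\<Sum>l\<in>UNIV. of_real (x $ l) * (?b l y * of_real (landau_kernel c j (x - y))))
       + (\<Sum>l\<in>UNIV. of_real (x $ l) * (of_real (x $ l) * (?d y * of_real (landau_kernel c j (x - y)))))" for y
    proof -
      have "landau_kernel c (Suc j) (x - y) = (1 - (norm y)\<^sup>2 / c\<^sup>2 + (\<Sum>l\<in>UNIV. x $ l * (2 * (1 / c\<^sup>2) * y $ l))
          + (\<Sum>l\<in>UNIV. x $ l * (x $ l * (- (1 / c\<^sup>2))))) * landau_kernel c j (x - y)"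
        unfolding landau_kernel_def ns
        by (simp add: algebra_simps sum.distrib sum_subtractf sum_distrib_left[symmetric] sum_divide_distrib[symmetric] diff_divide_distrib add_divide_distrib sum_negf)
      then have "of_real (landau_kernel c (Suc j) (x - y)) = (of_real (1 - (norm y)\<^sup>2 / c\<^sup>2) + (\<Sum>l\<in>UNIV. of_real (x $ l) * (2 * ?q * of_real (y $ l)))
          + (\<Sum>l\<in>UNIV. of_real (x $ l) * (of_real (x $ l) * (- ?q)))) * complex_of_real (landau_kernel c j (x - y))"
        by simp
      then show ?thesis
        by (simp only: distrib_left distrib_right sum_distrib_left sum_distrib_right) (simp add: mult_ac)
    qed
    then have "landau_integral c (Suc j) \<psi> x = (\<integral>y. ?a y * of_real (landau_kernel c j (x - y))
       + (\<Sum>l\<in>UNIV. of_real (x $ l) * (?b l y * of_real (landau_kernel c j (x - y))))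
       + (\<Sum>l\<in>UNIV. of_real (x $ l) * (of_real (x $ l) * (?d y * of_real (landau_kernel c j (x - y))))) \<partial>lborel)"
      unfolding landau_integral_def by (simp only:)
    also have "\<dots> = (\<integral>y. ?a y * of_real (landau_kernel c j (x - y)) \<partial>lborel)
       + (\<Sum>l\<in>UNIV. of_real (x $ l) * (\<integral>y. ?b l y * of_real (landau_kernel c j (x - y)) \<partial>lborel))
       + (\<Sum>l\<in>UNIV. of_real (x $ l) * (of_real (x $ l) * (\<integral>y. ?d y * of_real (landau_kernel c j (x - y)) \<partial>lborel)))"
      using landau_integral_integrable[OF ca za] landau_integral_integrable[OF cb zb] landau_integral_integrable[OF cd zd]
      by (simp only: Bochner_Integration.integral_add Bochner_Integration.integral_sum Bochner_Integration.integrable_add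
          Bochner_Integration.integrable_sum integrable_mult_right integral_mult_right_zero)
    finally show ?thesis unfolding landau_integral_def .
  qed
  have "poly_deg_le (2 * j) (landau_integral c j ?a)" "\<And>l. poly_deg_le (2 * j) (landau_integral c j (?b l))" "poly_deg_le (2 * j) (landau_integral c j ?d)"
    using Suc.IH[OF ca za] Suc.IH[OF cb zb] Suc.IH[OF cd zd] by simp_all
  note p = this
  have "poly_deg_le (Suc (Suc (2 * j))) (\<lambda>x. landau_integral c j ?a x + (\<Sum>l\<in>UNIV. of_real (x $ l) * landau_integral c j (?b l) x)
     + (\<Sum>l\<in>UNIV. of_real (x $ l) * (of_real (x $ l) * landau_integral c j ?d x)))"
  proof (intro poly_deg_le_add[OF poly_deg_le_add] poly_deg_le_sum)
    show "poly_deg_le (Suc (Suc (2 * j))) (landau_integral c j ?a)" by (rule poly_deg_le_Suc[OF poly_deg_le_Suc[OF p(1)]])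
    show "poly_deg_le (Suc (Suc (2 * j))) (\<lambda>x. of_real (x $ l) * landau_integral c j (?b l) x)" for l by (rule poly_deg_le_coord[OF poly_deg_le_Suc[OF p(2)]])
    show "poly_deg_le (Suc (Suc (2 * j))) (\<lambda>x. of_real (x $ l) * (of_real (x $ l) * landau_integral c j ?d x))" for l by (rule poly_deg_le_coord[OF poly_deg_le_coord[OF p(3)]])
  qed
  moreover have "landau_integral c (Suc j) \<psi> = (\<lambda>x. landau_integral c j ?a x + (\<Sum>l\<in>UNIV. of_real (x $ l) * landau_integral c j (?b l) x)
     + (\<Sum>l\<in>UNIV. of_real (x $ l) * (of_real (x $ l) * landau_integral c j ?d x)))"
    using eq by (rule ext)
  ultimately show ?case by simp
qed

lemma landau_integral_translate:
  assumes "continuous_on UNIV \<psi>" "\<forall>y. r < norm y \<longrightarrow> \<psi> y = 0"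
  shows "landau_integral c j \<psi> (x + v) = (\<integral>y. \<psi> (y + v) * of_real (landau_kernel c j (x - y)) \<partial>lborel)"
  unfolding landau_integral_def
  using integral_translate[OF landau_integral_integrable[OF assms, of c j "x + v"], of v] by (simp add: algebra_simps)

text \<open>Translating the variable of integration moves the derivative from the kernel to \<psi>,
  so that approximating \<psi> also approximates its derivatives.\<close>

lemma pdiff_landau_integral:
  fixes \<psi> :: "real^'n::finite \<Rightarrow> complex"
  assumes sm: "smooth_fun \<psi>" and supp: "\<forall>y. r < norm y \<longrightarrow> \<psi> y = 0"
    and supp': "\<forall>y. r < norm y \<longrightarrow> pdiff i \<psi> y = 0"
  shows "pdiff i (landau_integral c j \<psi>) = landau_integral c j (pdiff i \<psi>)"
proof (rule has_pd_pdiff, unfold has_pd_def, intro allI)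
  fix x :: "real^'n"
  let ?e = "axis i 1 :: real^'n" and ?U = "{-1<..<1::real}"
  \<comment> \<open>Radius r + 1 accommodates the supports of all translates with |t| < 1.\<close>
  have "bounded (cball (0::real^'n) (r + 1))" by simp
  then obtain a b :: "real^'n" where ab: "cball 0 (r + 1) \<subseteq> cbox a b" using bounded_subset_cbox_symmetric by metis
  have far: "r < norm (y + t *\<^sub>R ?e)" if "t \<in> ?U" "r + 1 < norm y" for t and y :: "real^'n"
  proof -
    have "norm y \<le> norm (y + t *\<^sub>R ?e) + norm (t *\<^sub>R ?e)" using norm_triangle_ineq4[of "y + t *\<^sub>R ?e" "t *\<^sub>R ?e"] by simp
    moreover have "norm (t *\<^sub>R ?e) < 1" using that by (simp add: norm_axis_1 abs_less_iff)
    ultimately show ?thesis using that(2) by linarith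
  qed
  have cp: "continuous_on UNIV (pdiff i \<psi>)" and c0: "continuous_on UNIV \<psi>"
    using sm by (auto intro: smooth_fun_continuous smooth_fun_pdiff)
  let ?f = "\<lambda>t y. \<psi> (y + t *\<^sub>R ?e) * of_real (landau_kernel c j (x - y))"
  let ?f' = "\<lambda>t y. pdiff i \<psi> (y + t *\<^sub>R ?e) * of_real (landau_kernel c j (x - y))"
  have "((\<lambda>t. integral (cbox a b) (?f t)) has_vector_derivative integral (cbox a b) (?f' 0)) (at 0 within ?U)"
  proof (rule leibniz_rule_vector_derivative)
    fix t y
    have "((\<lambda>t. \<psi> (y + t *\<^sub>R ?e)) has_vector_derivative pdiff i \<psi> (y + t *\<^sub>R ?e)) (at t)"
      by (rule has_pd_at[OF smooth_fun_has_pd[OF sm]])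
    from has_vector_derivative_mult_left[OF has_vector_derivative_at_within[OF this]]
    show "((\<lambda>t. ?f t y) has_vector_derivative ?f' t y) (at t within ?U)" .
  next
    show "?f t integrable_on cbox a b" for t
      by (intro integrable_continuous continuous_intros continuous_on_compose2[OF c0]) auto
    show "continuous_on (?U \<times> cbox a b) (\<lambda>(t, y). ?f' t y)"
      unfolding split_beta by (intro continuous_intros continuous_on_compose2[OF cp]) auto
  qed auto
  then have "((\<lambda>t. integral (cbox a b) (?f t)) has_vector_derivative integral (cbox a b) (?f' 0)) (at 0)"
    by (subst (asm) at_within_open) auto
  moreover have "integral (cbox a b) (?f' 0) = landau_integral c j (pdiff i \<psi>) x"
    unfolding landau_integral_def
    by (subst supp_integral_eq[OF _ _ ab]) (use supp' in \<open>auto intro!: continuous_intros cp\<close>)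
  moreover have "landau_integral c j \<psi> (x + t *\<^sub>R ?e) = integral (cbox a b) (?f t)" if "t \<in> ?U" for t
    unfolding landau_integral_translate[OF c0 supp]
    by (rule supp_integral_eq[OF _ _ ab]) (use supp far[OF that] in \<open>auto intro!: continuous_intros continuous_on_compose2[OF c0]\<close>)
  ultimately show "((\<lambda>t. landau_integral c j \<psi> (x + t *\<^sub>R ?e)) has_vector_derivative landau_integral c j (pdiff i \<psi>) x) (at 0)"
    by (auto intro: has_vector_derivative_transform_within_open[where S="?U"])
qed

lemma landau_kernel_bounds:
  assumes "0 < c" "norm z \<le> c" shows "0 \<le> landau_kernel c j z"
proof -
  have "(norm z)\<^sup>2 \<le> c\<^sup>2" using assms by (intro power_mono) auto
  then show ?thesis using assms(1) by (simp add: landau_kernel_def)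
qed

lemma landau_kernel_antimono:
  assumes "0 < c" "0 \<le> d" "d \<le> norm z" "norm z \<le> c" shows "landau_kernel c j z \<le> (1 - d\<^sup>2 / c\<^sup>2) ^ j"
proof -
  have "d\<^sup>2 \<le> (norm z)\<^sup>2" "(norm z)\<^sup>2 \<le> c\<^sup>2" using assms by (auto intro: power_mono)
  then show ?thesis using assms(1) unfolding landau_kernel_def by (intro power_mono) (auto simp: divide_right_mono)
qed

lemma landau_kernel_ge:
  assumes "0 < c" "norm z \<le> d" "d \<le> c" shows "(1 - d\<^sup>2 / c\<^sup>2) ^ j \<le> landau_kernel c j z"
proof -
  have "(norm z)\<^sup>2 \<le> d\<^sup>2" "d\<^sup>2 \<le> c\<^sup>2" using assms order_trans[OF norm_ge_zero assms(2)] by (auto intro!: power_mono)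
  then show ?thesis using assms(1) unfolding landau_kernel_def by (intro power_mono) (auto simp: divide_right_mono)
qed

lemma indicator_landau_kernel_integrable: "integrable lborel (\<lambda>z::real^'n::finite. indicator (cball 0 c) z * landau_kernel c j z)"
  using borel_integrable_compact[of "cball (0::real^'n) c" "landau_kernel c j"] by (simp add: continuous_on_landau_kernel)

lemma landau_mass_ge:
  assumes "0 < c" "0 < d" "d \<le> c"
  shows "measure lborel (ball (0::real^'n::finite) d) * (1 - d\<^sup>2 / c\<^sup>2) ^ j \<le> landau_mass TYPE('n) c j"
proof -
  have "(\<integral>z. indicator (ball 0 d) (z::real^'n) * (1 - d\<^sup>2 / c\<^sup>2) ^ j \<partial>lborel) \<le> landau_mass TYPE('n) c j"
    unfolding landau_mass_def
  proof (rule integral_mono[OF _ indicator_landau_kernel_integrable])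
    show "integrable lborel (\<lambda>z::real^'n. indicator (ball 0 d) z * (1 - d\<^sup>2 / c\<^sup>2) ^ j)"
      using emeasure_lborel_ball_finite[of "0::real^'n" d] by (intro integrable_mult_left integrable_real_indicator) auto
    show "indicator (ball 0 d) z * (1 - d\<^sup>2 / c\<^sup>2) ^ j \<le> indicator (cball 0 c) z * landau_kernel c j z" for z :: "real^'n"
      using landau_kernel_ge[OF assms(1) _ assms(3), of z j] landau_kernel_bounds[OF assms(1), of z j] assms by (auto simp: indicator_def)
  qed
  then show ?thesis by simp
qed

lemma landau_mass_pos:
  assumes "0 < c" shows "0 < landau_mass TYPE('n::finite) c j"
proof -
  have "(c / 2)\<^sup>2 < c\<^sup>2" using assms by (simp add: power_divide)
  then have "0 < measure lborel (ball (0::real^'n) (c / 2)) * (1 - (c / 2)\<^sup>2 / c\<^sup>2) ^ j"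
    using assms by (intro mult_pos_pos content_ball_pos zero_less_power) auto
  also have "\<dots> \<le> landau_mass TYPE('n) c j" using assms by (intro landau_mass_ge) auto
  finally show ?thesis .
qed

text \<open>Between the radii d and c the kernel is at most (1 - d^2/c^2)^j, while the ball of
  radius d / 2 alone gives a mass of at least a multiple of (1 - d^2/(4 c^2))^j; the ratio decays
  geometrically.\<close>

lemma landau_kernel_tail:
  assumes c: "0 < c" and d: "0 < d" "d \<le> c" and \<epsilon>: "0 < \<epsilon>"
  shows "\<forall>\<^sub>F j in sequentially. measure lborel (cball (0::real^'n::finite) c) * (1 - d\<^sup>2 / c\<^sup>2) ^ j \<le> \<epsilon> * landau_mass TYPE('n) c j"
proof -
  define a where "a = 1 - d\<^sup>2 / c\<^sup>2"
  define b where "b = 1 - (d / 2)\<^sup>2 / c\<^sup>2"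
  let ?v = "measure lborel (ball (0::real^'n) (d / 2))" and ?w = "measure lborel (cball (0::real^'n) c)"
  have v: "0 < ?v" using d by (intro content_ball_pos) simp
  have "d\<^sup>2 \<le> c\<^sup>2" using d by (intro power_mono) auto
  then have a: "0 \<le> a" using c by (simp add: a_def)
  have ab: "a < b" unfolding a_def b_def using c d by (simp add: power_divide divide_strict_left_mono)
  have "(\<lambda>j. ?w * (a / b) ^ j) \<longlonglongrightarrow> ?w * 0"
    using a ab by (intro tendsto_mult_left LIMSEQ_power_zero) auto
  then have "\<forall>\<^sub>F j in sequentially. ?w * (a / b) ^ j < \<epsilon> * ?v"
    using v \<epsilon> by (intro order_tendstoD(2)[where y="?w * 0"]) auto
  then show ?thesis
  proof eventually_elim
    case (elim j)
    have "?w * a ^ j = (?w * (a / b) ^ j) * b ^ j" using a ab by (simp add: power_divide)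
    also have "\<dots> \<le> (\<epsilon> * ?v) * b ^ j" using elim a ab by (intro mult_right_mono) auto
    also have "\<dots> \<le> \<epsilon> * landau_mass TYPE('n) c j"
      using landau_mass_ge[of c "d / 2" j, where 'n='n] c d \<epsilon> unfolding b_def by (simp add: mult.assoc)
    finally show ?case unfolding a_def .
  qed
qed

definition landau :: "real \<Rightarrow> nat \<Rightarrow> (real^'n::finite \<Rightarrow> complex) \<Rightarrow> real^'n \<Rightarrow> complex" where
  "landau c j \<psi> x = of_real (1 / landau_mass TYPE('n) c j) * landau_integral c j \<psi> x"

text \<open>The splitting of an approximate identity: uniform continuity near the centre, the
  negligible tail elsewhere.\<close>

lemma landau_uniform:
  fixes \<psi> :: "real^'n::finite \<Rightarrow> complex"
  assumes cont: "continuous_on UNIV \<psi>" and supp: "\<forall>y. r < norm y \<longrightarrow> \<psi> y = 0" and r: "0 < r" "0 < s" and \<epsilon>: "0 < \<epsilon>"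
  shows "\<forall>\<^sub>F j in sequentially. \<forall>x. norm x \<le> s \<longrightarrow> norm (\<psi> x + (-1) * landau (r + s) j \<psi> x) \<le> \<epsilon>"
proof -
  \<comment> \<open>For |x| <= s and y in the support, |x - y| is at most c, the range in which the
    kernel is nonnegative.\<close>
  define c where "c = r + s"
  let ?D = "cball (0::real^'n) c"
  have c: "0 < c" using r by (simp add: c_def)
  have "compact (\<psi> ` cball 0 r)" by (intro compact_continuous_image continuous_on_subset[OF cont]) auto
  then obtain S0 where S0: "\<And>y. y \<in> \<psi> ` cball 0 r \<Longrightarrow> norm y \<le> S0" using compact_imp_bounded bounded_iff by metis
  define S where "S = max S0 1"
  have S: "0 < S" "norm (\<psi> y) \<le> S" for y
  proof -
    show "0 < S" by (simp add: S_def)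
    show "norm (\<psi> y) \<le> S"
    proof (cases "norm y \<le> r")
      case True
      then have "norm (\<psi> y) \<le> S0" by (intro S0) auto
      then show ?thesis by (simp add: S_def)
    qed (simp add: supp S_def)
  qed
  have "uniformly_continuous_on (cball 0 (s + c)) \<psi>"
    by (intro compact_uniformly_continuous continuous_on_subset[OF cont]) auto
  then obtain d0 where d0: "0 < d0" "\<And>x y. x \<in> cball 0 (s + c) \<Longrightarrow> y \<in> cball 0 (s + c) \<Longrightarrow> dist y x < d0 \<Longrightarrow> dist (\<psi> y) (\<psi> x) < \<epsilon> / 2"
    unfolding uniformly_continuous_on_def using \<epsilon> by (metis half_gt_zero)
  define d where "d = min d0 c"
  have d: "0 < d" "d \<le> c" using d0 c by (auto simp: d_def)
  \<comment> \<open>The tail enters with the factor 2 S, so this share contributes \<epsilon> /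
    2.\<close>
  have e4: "0 < \<epsilon> / (4 * S)" using \<epsilon> S by simp
  from landau_kernel_tail[OF c d e4, where 'n='n] show ?thesis unfolding c_def[symmetric]
  proof eventually_elim
    case (elim j)
    let ?N = "landau_mass TYPE('n) c j" and ?w = "measure lborel ?D"
    have N: "0 < ?N" by (rule landau_mass_pos[OF c])
    show ?case
    proof (intro allI impI)
      fix x :: "real^'n" assume x: "norm x \<le> s"
      let ?h = "\<lambda>z. complex_of_real (indicator ?D z * landau_kernel c j z)"
      have ih: "integrable lborel ?h" using indicator_landau_kernel_integrable by (simp only: complex_of_real_integrable_eq)
      have "landau_integral c j \<psi> x = (\<integral>y. \<psi> (y + x) * of_real (landau_kernel c j (0 - y)) \<partial>lborel)"
        using landau_integral_translate[OF cont supp, of c j 0 x] by simp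
      also have "\<dots> = (\<integral>z. \<psi> (x + z) * of_real (landau_kernel c j z) \<partial>lborel)"
        by (simp add: landau_kernel_def add.commute)
      also have "\<dots> = (\<integral>z. \<psi> (x + z) * ?h z \<partial>lborel)"
      proof (intro Bochner_Integration.integral_cong refl)
        fix z :: "real^'n"
        have "\<psi> (x + z) = 0" if "z \<notin> ?D"
        proof -
          have "norm z \<le> norm (x + z) + norm x" using norm_triangle_ineq4[of "x + z" x] by simp
          then have "r < norm (x + z)" using that x by (simp add: c_def)
          then show ?thesis using supp by simp
        qed
        then show "\<psi> (x + z) * of_real (landau_kernel c j z) = \<psi> (x + z) * ?h z" by (cases "z \<in> ?D") auto
      qed
      finally have L: "landau_integral c j \<psi> x = (\<integral>z. \<psi> (x + z) * ?h z \<partial>lborel)" .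
      have cx: "continuous_on UNIV (\<lambda>z. \<psi> (x + z))" by (intro continuous_on_compose2[OF cont] continuous_intros) auto
      have i1: "integrable lborel (\<lambda>z. \<psi> (x + z) * ?h z)"
      proof (rule Bochner_Integration.integrable_bound)
        show "integrable lborel (\<lambda>z. S * norm (?h z))" using ih by simp
        show "(\<lambda>z. \<psi> (x + z) * ?h z) \<in> borel_measurable lborel"
          using borel_measurable_continuous_onI[OF cx] borel_measurable_integrable[OF ih] by (intro borel_measurable_times) auto
        show "AE z in lborel. norm (\<psi> (x + z) * ?h z) \<le> norm (S * norm (?h z))"
        proof (intro AE_I2)
          fix z
          have "norm (\<psi> (x + z)) * norm (?h z) \<le> S * norm (?h z)" by (intro mult_right_mono S(2) norm_ge_zero)
          then show "norm (\<psi> (x + z) * ?h z) \<le> norm (S * norm (?h z))" using S(1) by (simp only: norm_mult real_norm_def abs_mult abs_norm_cancel)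
        qed
      qed
      have "of_real ?N * \<psi> x - landau_integral c j \<psi> x = (\<integral>z. \<psi> x * ?h z - \<psi> (x + z) * ?h z \<partial>lborel)"
        unfolding L using i1 ih by (subst Bochner_Integration.integral_diff) (auto simp: landau_mass_def simp del: of_real_mult)
      also have "norm \<dots> \<le> (\<integral>z. norm (\<psi> x * ?h z - \<psi> (x + z) * ?h z) \<partial>lborel)" by (rule integral_norm_bound)
      also have "\<dots> \<le> (\<integral>z. \<epsilon> / 2 * (indicator ?D z * landau_kernel c j z) + 2 * S * ((1 - d\<^sup>2 / c\<^sup>2) ^ j * indicator ?D z) \<partial>lborel)"
      proof (rule integral_mono)
        show "integrable lborel (\<lambda>z. norm (\<psi> x * ?h z - \<psi> (x + z) * ?h z))"
          using i1 ih by (intro integrable_norm Bochner_Integration.integrable_diff integrable_mult_right) auto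
        show "integrable lborel (\<lambda>z. \<epsilon> / 2 * (indicator ?D z * landau_kernel c j z) + 2 * S * ((1 - d\<^sup>2 / c\<^sup>2) ^ j * indicator ?D z))"
          using emeasure_lborel_cball_finite[of "0::real^'n" c] by (intro Bochner_Integration.integrable_add integrable_mult_right indicator_landau_kernel_integrable integrable_real_indicator) auto
        fix z :: "real^'n"
        show "norm (\<psi> x * ?h z - \<psi> (x + z) * ?h z) \<le> \<epsilon> / 2 * (indicator ?D z * landau_kernel c j z) + 2 * S * ((1 - d\<^sup>2 / c\<^sup>2) ^ j * indicator ?D z)"
        proof (cases "z \<in> ?D")
          case True
          then have z: "norm z \<le> c" by simp
          have p: "0 \<le> landau_kernel c j z" by (rule landau_kernel_bounds[OF c z])
          have q: "0 \<le> (1 - d\<^sup>2 / c\<^sup>2) ^ j" using d by (intro zero_le_power) (simp add: power_mono)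
          have eq: "norm (\<psi> x * ?h z - \<psi> (x + z) * ?h z) = norm (\<psi> x - \<psi> (x + z)) * landau_kernel c j z"
            unfolding left_diff_distrib[symmetric] norm_mult using True p by simp
          show ?thesis
          proof (cases "norm z < d")
            case True
            have "dist (\<psi> x) (\<psi> (x + z)) < \<epsilon> / 2"
            proof (rule d0(2))
              show "x + z \<in> cball 0 (s + c)" using x z norm_triangle_ineq[of x z] by simp
              show "x \<in> cball 0 (s + c)" using x c by simp
              show "dist x (x + z) < d0" using True by (simp add: dist_norm d_def)
            qed
            then have "norm (\<psi> x - \<psi> (x + z)) * landau_kernel c j z \<le> \<epsilon> / 2 * landau_kernel c j z"
              using p by (intro mult_right_mono) (auto simp: dist_norm)
            moreover have "0 \<le> 2 * S * (1 - d\<^sup>2 / c\<^sup>2) ^ j" using S(1) q by simp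
            ultimately show ?thesis unfolding eq using z by simp
          next
            case False
            have "norm (\<psi> x - \<psi> (x + z)) \<le> 2 * S" using norm_triangle_ineq4[of "\<psi> x" "\<psi> (x + z)"] S(2)[of x] S(2)[of "x + z"] by linarith
            moreover have "landau_kernel c j z \<le> (1 - d\<^sup>2 / c\<^sup>2) ^ j" using False d z by (intro landau_kernel_antimono c) auto
            ultimately have "norm (\<psi> x - \<psi> (x + z)) * landau_kernel c j z \<le> 2 * S * (1 - d\<^sup>2 / c\<^sup>2) ^ j"
              using p S(1) by (intro mult_mono) auto
            moreover have "0 \<le> \<epsilon> / 2 * landau_kernel c j z" using \<epsilon> p by simp
            ultimately show ?thesis unfolding eq using z by simp
          qed
        qed simp
      qed
      also have "\<dots> = \<epsilon> / 2 * ?N + 2 * S * ((1 - d\<^sup>2 / c\<^sup>2) ^ j * ?w)"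
      proof -
        have "integrable lborel (\<lambda>z::real^'n. indicat_real ?D z)"
          using emeasure_lborel_cball_finite[of "0::real^'n" c] by (intro integrable_real_indicator) auto
        then show ?thesis
          using indicator_landau_kernel_integrable[of c j, where 'n='n] by (simp add: landau_mass_def)
      qed
      also have "\<dots> \<le> \<epsilon> / 2 * ?N + 2 * S * (\<epsilon> / (4 * S) * ?N)"
        using elim S(1) by (intro add_left_mono mult_left_mono) (auto simp: mult.commute)
      also have "\<dots> = \<epsilon> * ?N" using S(1) by (simp add: field_simps)
      finally have main: "norm (of_real ?N * \<psi> x - landau_integral c j \<psi> x) \<le> \<epsilon> * ?N" .
      have "\<psi> x + (-1) * landau c j \<psi> x = of_real (1 / ?N) * (of_real ?N * \<psi> x - landau_integral c j \<psi> x)"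
        using N by (simp add: landau_def field_simps)
      then have "norm (\<psi> x + (-1) * landau c j \<psi> x) = (1 / ?N) * norm (of_real ?N * \<psi> x - landau_integral c j \<psi> x)"
        using N by (simp add: norm_mult norm_divide)
      also have "\<dots> \<le> (1 / ?N) * (\<epsilon> * ?N)" using main N by (intro mult_left_mono) auto
      finally show "norm (\<psi> x + (-1) * landau c j \<psi> x) \<le> \<epsilon>" using N by simp
    qed
  qed
qed

lemma poly_deg_le_landau:
  fixes \<psi> :: "real^'n::finite \<Rightarrow> complex"
  assumes "continuous_on UNIV \<psi>" "\<forall>y. r < norm y \<longrightarrow> \<psi> y = 0"
  shows "poly_deg_le (2 * j) (landau c j \<psi>)"
  unfolding landau_def[abs_def] by (intro poly_deg_le_cmult poly_deg_le_landau_integral[OF assms])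

lemma pdiff_vanishing:
  fixes \<psi> :: "real^'n::finite \<Rightarrow> complex"
  assumes "\<forall>y. r < norm y \<longrightarrow> \<psi> y = 0" shows "\<forall>y. r < norm y \<longrightarrow> pdiff i \<psi> y = 0"
proof (intro allI impI)
  fix y :: "real^'n" assume "r < norm y"
  then have "pdiff i \<psi> y = pdiff i (\<lambda>x. 0) y"
    by (intro pdiff_cong_open[of "- cball 0 r"]) (use assms in auto)
  moreover have "pdiff i (\<lambda>x::real^'n. 0) = (\<lambda>x. 0)" by (rule has_pd_pdiff[OF has_pd_const])
  ultimately show "pdiff i \<psi> y = 0" by simp
qed

lemma simplex_set_norm_le: "x \<in> simplex_set B \<Longrightarrow> norm (x :: real^'n::finite) \<le> B"
  using norm_le_l1_cart[of x] by (auto simp: simplex_set_def p1_def)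

text \<open>Differentiation commutes with the approximation, so the uniform estimate applies to each
  of the finitely many derivatives up to order m, and eventually one index j serves them
  all.\<close>

lemma landau_approximation:
  fixes \<psi> :: "real^'n::finite \<Rightarrow> complex"
  assumes "smooth_fun \<psi>" "\<forall>y. r < norm y \<longrightarrow> \<psi> y = 0" and r: "0 < r" "0 < B" and \<epsilon>: "0 < \<epsilon>"
  shows "\<forall>\<^sub>F j in sequentially. derivs_bounded B m \<epsilon> (\<lambda>x. \<psi> x + (-1) * landau (r + B) j \<psi> x)"
  using assms(1,2)
proof (induction m arbitrary: \<psi>)
  case 0
  show ?case
    using landau_uniform[OF smooth_fun_continuous[OF 0(1)] 0(2) r \<epsilon>]
    by (rule eventually_mono) (auto dest: simplex_set_norm_le)
next
  case (Suc m)
  have "\<forall>\<^sub>F j in sequentially. derivs_bounded B m \<epsilon> (\<lambda>x. pdiff i \<psi> x + (-1) * landau (r + B) j (pdiff i \<psi>) x)" for i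
    by (rule Suc.IH[OF smooth_fun_pdiff[OF Suc.prems(1)] pdiff_vanishing[OF Suc.prems(2)]])
  then have "\<forall>\<^sub>F j in sequentially. \<forall>i. derivs_bounded B m \<epsilon> (\<lambda>x. pdiff i \<psi> x + (-1) * landau (r + B) j (pdiff i \<psi>) x)"
    by (rule eventually_all_finite)
  with landau_uniform[OF smooth_fun_continuous[OF Suc.prems(1)] Suc.prems(2) r \<epsilon>]
  show ?case
  proof eventually_elim
    case (elim j)
    have sl: "smooth_fun (landau_integral (r + B) j \<psi>)"
      by (rule smooth_fun_poly_deg_le[OF poly_deg_le_landau_integral[OF smooth_fun_continuous[OF Suc.prems(1)] Suc.prems(2)]])
    then have sm2: "smooth_fun (landau (r + B) j \<psi>)"
      unfolding landau_def[abs_def] by (intro smooth_fun_mult smooth_fun_const)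
    have sm: "smooth_fun (\<lambda>x. (-1) * landau (r + B) j \<psi> x)" "smooth_fun (landau (r + B) j \<psi>)"
      by (intro smooth_fun_mult smooth_fun_const sm2, rule sm2)
    have "pdiff i (landau (r + B) j \<psi>) = landau (r + B) j (pdiff i \<psi>)" for i
      unfolding landau_def[abs_def] pdiff_cmult[OF sl]
      using pdiff_landau_integral[OF Suc.prems(1,2) pdiff_vanishing[OF Suc.prems(2)]] by simp
    then have "pdiff i (\<lambda>x. \<psi> x + (-1) * landau (r + B) j \<psi> x) = (\<lambda>x. pdiff i \<psi> x + (-1) * landau (r + B) j (pdiff i \<psi>) x)" for i
      unfolding pdiff_add[OF Suc.prems(1) sm(1)] pdiff_cmult[OF sm(2)] by simp
    then show ?case using elim unfolding derivs_bounded.simps by (auto dest: simplex_set_norm_le simp del: mult_minus1)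
  qed
qed

subsection \<open>Riesz distributions at the discrete Wallach points\<close>

lemma master_functional_combination:
  assumes V: "master_functional k \<mu> V" and R: "master_functional k \<mu> R"
  shows "master_functional k \<mu> (\<lambda>f. a * V f + b * R f)"
  unfolding master_functional_def
proof (intro conjI allI impI)
  fix f g :: "real^'a \<Rightarrow> complex" assume f: "orthant_test f"
  show "a * V (\<lambda>x. f x + g x) + b * R (\<lambda>x. f x + g x) = a * V f + b * R f + (a * V g + b * R g)" if g: "orthant_test g"
    by (simp only: master_functional_add[OF V f g] master_functional_add[OF R f g]) (simp add: algebra_simps)
  show "a * V (\<lambda>x. c * f x) + b * R (\<lambda>x. c * f x) = c * (a * V f + b * R f)" for c
    by (simp only: master_functional_cmult[OF V f] master_functional_cmult[OF R f]) (simp add: algebra_simps)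
  fix i
  let ?g = "\<lambda>x. of_real (x $ i) * pdiff i f x + (\<Sum>j\<in>UNIV - {i}. of_real k * of_real (x $ j) * ddiff i j f x)"
  have "\<mu> * (a * V f + b * R f) + (a * V ?g + b * R ?g) = a * (\<mu> * V f + V ?g) + b * (\<mu> * R f + R ?g)"
    by (simp add: algebra_simps)
  then show "\<mu> * (a * V f + b * R f) + (a * V ?g + b * R ?g) = 0"
    by (simp only: master_functional_eq[OF V f] master_functional_eq[OF R f]) simp
qed

text \<open>A solution of the master equation of finite order that vanishes on one radial function vanishes:
  it vanishes on polynomials times a radial cutoff, and these are dense.\<close>

lemma master_functional_eq_0:
  fixes W :: "(real^'n::finite \<Rightarrow> complex) \<Rightarrow> complex"
  assumes W: "master_functional k (of_real \<mu>) W" and \<mu>: "0 \<le> \<mu>" and G: "cm_seq G"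
    and W0: "W (\<lambda>x. of_real (G (Suc (Suc m)) (p1 x))) = 0"
    and cong: "\<And>f g. (\<And>x::real^'n. (\<forall>i. 0 \<le> x $ i) \<Longrightarrow> f x = g x) \<Longrightarrow> W f = W g"
    and bound: "\<And>B. \<exists>C e. 0 \<le> C \<and> (\<forall>f S. orthant_test f \<longrightarrow> vanishes_beyond B f \<longrightarrow> 0 \<le> S \<longrightarrow> derivs_bounded B e S f \<longrightarrow> norm (W f) \<le> C * S)"
    and \<phi>: "test_function \<phi>"
  shows "W \<phi> = 0"
proof -
  have ot: "orthant_test \<phi>" by (rule test_function_imp_orthant_test[OF \<phi>])
  then have sm: "smooth_fun \<phi>" by (rule orthant_test_smooth)
  obtain B0 where B0: "vanishes_beyond B0 \<phi>" using ot by (auto simp: orthant_test_def)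
  \<comment> \<open>Leaves one unit of room beyond the bound for \<phi>, in which the cut-off
    \<open>H\<close> descends from 1 to 0.\<close>
  define B where "B = max B0 0 + 1"
  have B: "0 < B" "B0 + 1 \<le> B" by (auto simp: B_def)
  obtain K where K: "compact K" "\<And>x. x \<notin> K \<Longrightarrow> \<phi> x = 0" using \<phi> by (auto simp: test_function_def)
  obtain r0 where r0: "\<And>x. x \<in> K \<Longrightarrow> norm x \<le> r0" using compact_imp_bounded[OF K(1)] bounded_iff by metis
  define r where "r = max r0 1"
  have r: "0 < r" by (simp add: r_def)
  have supp: "\<forall>y. r < norm y \<longrightarrow> \<phi> y = 0"
  proof (intro allI impI)
    fix y :: "real^'n" assume "r < norm y"
    then have "y \<notin> K" using r0[of y] by (auto simp: r_def)
    then show "\<phi> y = 0" by (rule K(2))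
  qed
  obtain \<eta> :: "real \<Rightarrow> real" where \<eta>: "smooth1 (\<lambda>t. complex_of_real (\<eta> t))" "\<And>t. 0 \<le> t \<Longrightarrow> \<eta> t = 1" "\<And>t. t \<le> -1 \<Longrightarrow> \<eta> t = 0"
    using smooth_step by metis
  define H where "H t = complex_of_real (\<eta> ((-1) * t + (B - 1)))" for t
  have sH: "smooth1 H" using smooth1_affine[OF \<eta>(1), of "-1" "B - 1"] unfolding H_def[abs_def] .
  have H0: "H t = 0" if "t \<ge> B" for t using \<eta>(3) that by (simp add: H_def)
  have H1: "H t = 1" if "t \<le> B - 1" for t using \<eta>(2) that by (simp add: H_def)
  have oH: "orthant_test (\<lambda>x::real^'n. H (p1 x))" by (rule orthant_test_p1[OF sH H0])
  have vH: "vanishes_beyond B (\<lambda>x::real^'n. H (p1 x) * f x)" for f using H0 by (simp add: vanishes_beyond_def)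
  have oHf: "orthant_test (\<lambda>x::real^'n. H (p1 x) * f x)" if "smooth_fun f" for f
    unfolding orthant_test_def using vH smooth_fun_mult[OF orthant_test_smooth[OF oH] that] by blast
  \<comment> \<open>Wherever \<open>H (p1 x)\<close> differs from 1 on the closed orthant, \<phi>
    already vanishes.\<close>
  have W\<phi>: "W \<phi> = W (\<lambda>x. H (p1 x) * \<phi> x)"
  proof (rule cong)
    fix x :: "real^'n" assume x: "\<forall>i. 0 \<le> x $ i"
    show "\<phi> x = H (p1 x) * \<phi> x"
    proof (cases "B0 \<le> p1 x")
      case True
      then have "\<phi> x = 0" using B0 x by (simp add: vanishes_beyond_def)
      then show ?thesis by simp
    next
      case False
      then have "H (p1 x) = 1" using B(2) by (intro H1) linarith
      then show ?thesis by simp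
    qed
  qed
  have pol0: "W (\<lambda>x. H (p1 x) * f x) = 0" if "poly_deg_le d f" for d f
  proof -
    have "W (\<lambda>x. f x * H (p1 x)) = 0"
    proof (rule master_functional_pol_eq_0[OF W _ sH _ that])
      show "W (\<lambda>x. E (p1 x)) = 0" if "smooth1 E" "\<And>t. t \<ge> D \<Longrightarrow> E t = 0" for E D
        by (rule master_functional_p1_eq_0[OF W \<mu> G W0 that])
    qed (rule H0)
    then show ?thesis by (simp add: mult.commute)
  qed
  obtain C e where C: "0 \<le> C" "\<And>f S. orthant_test f \<Longrightarrow> vanishes_beyond B f \<Longrightarrow> 0 \<le> S \<Longrightarrow> derivs_bounded B e S f \<Longrightarrow> norm (W f) \<le> C * S"
    using bound[of B] by blast
  have "bounded_op B 0 (\<lambda>f x. H (p1 (x::real^'n)) * f x)" by (rule bounded_op_mult[OF orthant_test_smooth[OF oH]])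
  from bounded_opD[OF this, of e] obtain c where c: "0 \<le> c" "\<And>f S. smooth_fun f \<Longrightarrow> 0 \<le> S \<Longrightarrow> derivs_bounded B e S f \<Longrightarrow> derivs_bounded B e (c * S) (\<lambda>x::real^'n. H (p1 x) * f x)"
    by auto
  \<comment> \<open>Approximate \<phi> by a polynomial. Times the cut-off the polynomial is
    annihilated, and the error is controlled because W has finite order.\<close>
  have small: "norm (W \<phi>) \<le> C * (c * \<epsilon>)" if \<epsilon>: "0 < \<epsilon>" for \<epsilon>
  proof -
    obtain j where j: "derivs_bounded B e \<epsilon> (\<lambda>x. \<phi> x + (-1) * landau (r + B) j \<phi> x)"
      using eventually_happens'[OF sequentially_bot landau_approximation[OF sm supp r B(1) \<epsilon>, of e]] by blast
    let ?L = "landau (r + B) j \<phi>" and ?u = "\<lambda>x. \<phi> x + (-1) * landau (r + B) j \<phi> x"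
    have pL: "poly_deg_le (2 * j) ?L" by (rule poly_deg_le_landau[OF smooth_fun_continuous[OF sm] supp])
    have su: "smooth_fun ?u" by (intro smooth_fun_add smooth_fun_mult smooth_fun_const smooth_fun_poly_deg_le[OF pL] sm)
    have "(\<lambda>x. H (p1 x) * \<phi> x) = (\<lambda>x. H (p1 x) * ?u x + H (p1 x) * ?L x)" by (simp add: algebra_simps)
    then have "W (\<lambda>x. H (p1 x) * \<phi> x) = W (\<lambda>x. H (p1 x) * ?u x) + W (\<lambda>x. H (p1 x) * ?L x)"
      using master_functional_add[OF W oHf[OF su] oHf[OF smooth_fun_poly_deg_le[OF pL]]] by (simp only:)
    then have "W \<phi> = W (\<lambda>x. H (p1 x) * ?u x)" using pol0[OF pL] W\<phi> by (simp only: add_0_right)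
    moreover have "norm (W (\<lambda>x. H (p1 x) * ?u x)) \<le> C * (c * \<epsilon>)"
      by (rule C(2)[OF oHf[OF su] vH _ c(2)[OF su _ j]]) (use c(1) \<epsilon> in auto)
    ultimately show ?thesis by (simp only:)
  qed
  have "norm (W \<phi>) \<le> 0 + \<epsilon>" if \<epsilon>: "0 < \<epsilon>" for \<epsilon>
  proof -
    have Cc: "0 \<le> C * c" using C(1) c(1) by simp
    \<comment> \<open>The added 1 keeps the denominator positive also when C c = 0.\<close>
    have "norm (W \<phi>) \<le> C * (c * (\<epsilon> / (C * c + 1)))" using \<epsilon> Cc by (intro small) simp
    also have "\<dots> = \<epsilon> * ((C * c) / (C * c + 1))" by simp
    also have "\<dots> \<le> \<epsilon> * 1" using \<epsilon> Cc by (intro mult_left_mono) auto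
    finally show ?thesis by simp
  qed
  then have "norm (W \<phi>) \<le> 0" by (rule field_le_epsilon)
  then show ?thesis by simp
qed

text \<open>Both functionals solve the same equation and take positive values s and t on one
  cut-off. The combination that vanishes there is zero by uniqueness, so R is s / t times the sum
  over the faces.\<close>

lemma riesz_discrete_positive:
  assumes k: "0 < k" and r: "r < CARD('n)"
  shows "is_positive_measure_dist (riesz k (of_real (k * real r)) :: (real^'n::finite \<Rightarrow> complex) \<Rightarrow> complex)"
proof -
  let ?R = "riesz k (of_real (k * real r)) :: (real^'n \<Rightarrow> complex) \<Rightarrow> complex"
  let ?V = "face_functional k r :: (real^'n \<Rightarrow> complex) \<Rightarrow> complex"
  let ?b = "k * (real CARD('n) - real r + 1)"
  have b: "0 < ?b" using k r by simp
  obtain G where G: "cm_seq G" using cm_seq_exists by blast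
  obtain J where J: "\<And>j. J \<le> j \<Longrightarrow> \<exists>s>0. ?R (\<lambda>x. complex_of_real (G j (p1 x))) = complex_of_real s"
    using riesz_cm_pos[OF k G, of "k * real r"] by blast
  let ?G = "\<lambda>x::real^'n. complex_of_real (G (Suc (Suc J)) (p1 x))"
  obtain s where s: "0 < s" "?R ?G = complex_of_real s" using J[of "Suc (Suc J)"] by auto
  have "\<exists>v>0. fint A k (of_real ?b) ?G = complex_of_real v" for A :: "'n set"
    using fint_cm_pos[OF k b G, of A "Suc J"] by blast
  then obtain v where v: "\<And>A::'n set. 0 < v A" "\<And>A. fint A k (of_real ?b) ?G = complex_of_real (v A)" by metis
  define t where "t = (\<Sum>A | card (A::'n set) = r. v A)"
  have VG: "?V ?G = complex_of_real t" unfolding face_functional_def v(2) t_def by simp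
  obtain A0 :: "'n set" where "card A0 = r" using obtain_subset_with_card_n[of r "UNIV :: 'n set"] r by auto
  then have t: "0 < t" unfolding t_def using v(1) by (intro sum_pos) auto
  note mR = riesz_master_functional[OF k, of "of_real (k * real r)", where 'n='n] and mV = face_functional_master[OF k r]
  let ?W = "\<lambda>f::real^'n \<Rightarrow> complex. of_real t * ?R f + of_real (- s) * ?V f"
  have "?W \<phi> = 0" if \<phi>: "test_function \<phi>" for \<phi>
  proof (rule master_functional_eq_0[OF master_functional_combination[OF mR mV] _ G _ _ _ \<phi>])
    show "0 \<le> k * real r" using k by simp
    show "?W ?G = 0" unfolding s VG by simp
    show "?W f = ?W g" if "\<And>x::real^'n. (\<forall>i. 0 \<le> x $ i) \<Longrightarrow> f x = g x" for f g
    proof -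
      have "?R f = ?R g" by (rule riesz_cong, rule that) (auto simp: positive_orthant_def less_imp_le)
      moreover have "fint A k b f = fint A k b g" for A b
        by (rule fint_cong, rule that) (auto simp: positive_orthant_def face_def less_imp_le)
      ultimately show ?thesis unfolding face_functional_def by simp
    qed
    fix B
    obtain C e where C: "0 \<le> C" "\<And>f S. orthant_test f \<Longrightarrow> vanishes_beyond B f \<Longrightarrow> 0 \<le> S \<Longrightarrow> derivs_bounded B e S f \<Longrightarrow> norm (?R f) \<le> C * S"
      using riesz_bound[OF k, where 'n='n and \<mu>="of_real (k * real r)" and B=B] by blast
    obtain D where D: "0 \<le> D" "\<And>f S. orthant_test f \<Longrightarrow> vanishes_beyond B f \<Longrightarrow> 0 \<le> S \<Longrightarrow> derivs_bounded B e S f \<Longrightarrow> norm (?V f) \<le> D * S"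
      using face_functional_bound[OF k r, where B=B and e=e] by blast
    show "\<exists>C e. 0 \<le> C \<and> (\<forall>f S. orthant_test f \<longrightarrow> vanishes_beyond B f \<longrightarrow> 0 \<le> S \<longrightarrow> derivs_bounded B e S f \<longrightarrow> norm (?W f) \<le> C * S)"
    proof (intro exI[of _ "t * C + s * D"] exI[of _ e] conjI allI impI)
      show "0 \<le> t * C + s * D" using C(1) D(1) s t by simp
      fix f :: "real^'n \<Rightarrow> complex" and S :: real
      assume f: "orthant_test f" "vanishes_beyond B f" "0 \<le> S" "derivs_bounded B e S f"
      have "norm (?W f) \<le> t * norm (?R f) + s * norm (?V f)"
        using norm_triangle_ineq[of "of_real t * ?R f" "of_real (- s) * ?V f"] s t by (simp add: norm_mult)
      also have "\<dots> \<le> t * (C * S) + s * (D * S)" using C(2)[OF f] D(2)[OF f] s t by (intro add_mono mult_left_mono) auto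
      finally show "norm (?W f) \<le> (t * C + s * D) * S" by (simp add: algebra_simps)
    qed
  qed
  then have "?R \<phi> = complex_of_real (s / t) * (\<Sum>A | card A = r. fint A k (of_real ?b) \<phi>)" if "test_function \<phi>" for \<phi>
    using that t unfolding face_functional_def by (simp add: field_simps)
  moreover have "0 \<le> s / t" using s(1) t by (intro divide_nonneg_pos) simp_all
  ultimately show ?thesis by (intro finite_sum_of_faces_positive[OF k b, where c="s / t" and \<A>="{A. card A = r}"])
qed

text \<open>Above mu0 the Riesz integral is itself the integral over the full face, with a positive
  normalising factor.\<close>

lemma riesz_continuous_positive:
  assumes k: "0 < k" and \<mu>: "mu0 CARD('n) k < \<mu>"
  shows "is_positive_measure_dist (riesz k (of_real \<mu>) :: (real^'n::finite \<Rightarrow> complex) \<Rightarrow> complex)"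
proof -
  obtain s where s: "0 < s" "rcoef CARD('n) k (of_real \<mu>) = complex_of_real s" using rcoef_pos[OF k \<mu>] by blast
  have "riesz k (of_real \<mu>) \<phi> = complex_of_real s * (\<Sum>A\<in>{UNIV}. fint A k (of_real (\<mu> - mu0 CARD('n) k)) \<phi>)"
    if "test_function \<phi>" for \<phi> :: "real^'n \<Rightarrow> complex"
    using riesz_eq_integral[OF k test_function_imp_orthant_test[OF that], of "of_real \<mu>"] \<mu> s
    by (simp add: riesz_integral_eq)
  then show ?thesis using \<mu> s by (intro finite_sum_of_faces_positive[OF k, where b="\<mu> - mu0 CARD('n) k" and c=s and \<A>="{UNIV}"]) auto
qed

theorem theorem5p15:
  fixes k :: real and \<mu> :: complex
  assumes "0 < k"
  shows "(is_complex_measure_dist (riesz k \<mu> :: (real^'n::finite \<Rightarrow> complex) \<Rightarrow> complex) \<longrightarrow>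
            mu0 CARD('n) k < Re \<mu> \<or> \<mu> \<in> complex_of_real ` exceptional_set CARD('n) k)
       \<and> (is_positive_measure_dist (riesz k \<mu> :: (real^'n::finite \<Rightarrow> complex) \<Rightarrow> complex) \<longleftrightarrow>
            \<mu> \<in> complex_of_real ` wallach_set CARD('n) k)"
proof (intro conjI impI iffI)
  assume "\<mu> \<in> complex_of_real ` wallach_set CARD('n) k"
  then consider j where "j < CARD('n)" "\<mu> = of_real (k * real j)" | t where "mu0 CARD('n) k < t" "\<mu> = of_real t"
    by (auto simp: wallach_set_def mu0_def)
  then show "is_positive_measure_dist (riesz k \<mu> :: (real^'n \<Rightarrow> complex) \<Rightarrow> complex)"
    by cases (use riesz_discrete_positive[OF assms] riesz_continuous_positive[OF assms] in auto)
qed (use complex_measure_imp_exceptional[OF assms] positive_imp_wallach[OF assms] in blast)+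

end
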